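(* Let $\mu$ be a doubling Borel measure on $\mathbb{R}^n$ with doubling order $D$, let $1\le p_0<q_0\le\infty$, $b\in\mathrm{BMO}(\mu)$ and $k\in\mathbb{N}$, $k\ge1$. Suppose that $T$ is a sublinear operator and that $T$ and $T_b^m$ for $m=1,\dots,k$ are of weak-type $(q_0,q_0)$ (with respect to $\mu$). Let $\{\mathcal{A}_r\}_{r>0}$ be a family of operators acting from $L^\infty_c(\mu)$ into $L^{q_0}(\mu)$. Assume that, for some numbers $\alpha_j\ge0$ and some exponent $r>1$, for every ball $B$ with radius $r(B)$ and every $f\in L^\infty_c(\mu)$ supported in $B$, $$\Big(\frac1{\mu(2^{j+1}B)}\int_{C_j(B)}|\mathcal{A}_{r(B)}f|^{q_0}\,d\mu\Big)^{1/q_0}\le\alpha_j\Big(\frac1{\mu(B)}\int_B|f|^{p_0}\,d\mu\Big)^{1/p_0}\qquad\text{for all }j\ge1,$$ and $$\Big(\frac1{\mu(2^{j+1}B)}\int_{C_j(B)}|T(I-\mathcal{A}_{r(B)})f|^{r}\,d\mu\Big)^{1/r}\le\alpha_j\Big(\frac1{\mu(B)}\int_B|f|^{p_0}\,d\mu\Big)^{1/p_0}\qquad\text{for all }j\ge2.$$ If $\sum_j\alpha_j\,2^{Dj}\,j^k<\infty$, then for all $p_0<p<q_0$ there exists a constant $C$ (independent of $b$) such that for all $f\in L^\infty_c(\mu)$, $$\|T_b^kf\|_{L^p(\mu)}\le C\,\|b\|_{\mathrm{BMO}(\mu)}^k\,\|f\|_{L^p(\mu)}.$$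
   Context: $\mu$ doubling: there is $C$ with $\mu(2B)\le C\mu(B)<\infty$ for all balls $B$, where $\lambda B$ is the ball concentric with $B$ of radius $\lambda r(B)$. $\mu$ has doubling order $D>0$ if $\mu(\lambda B)\le C_\mu\lambda^D\mu(B)$ for every ball $B$ and every $\lambda\ge1$. $C_1(B)=4B$ and $C_j(B)=2^{j+1}B\setminus2^jB$ for $j\ge2$. $L^\infty_c(\mu)$: bounded compactly supported functions. $T$ is sublinear if $|T(f+g)|\le|Tf|+|Tg|$ and $|T(\lambda f)|=|\lambda||Tf|$. Weak-type $(q_0,q_0)$ means boundedness from $L^{q_0}(\mu)$ to $L^{q_0,\infty}(\mu)$ (and $L^\infty\to L^\infty$ if $q_0=\infty$); for $q_0=\infty$ the $L^{q_0}$-average is an essential supremum. $\mathrm{BMO}(\mu)$: $\|b\|_{\mathrm{BMO}(\mu)}=\sup_B\frac1{\mu(B)}\int_B|b-b_B|\,d\mu<\infty$ with $b_B=\frac1{\mu(B)}\int_Bb\,d\mu$. The $m$-th order commutator is $T_b^mf(x)=T\big((b(x)-b)^mf\big)(x)$ for $f\in L^\infty_c(\mu)$ (so $T_b^0=T$).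
   Formalization: For q_0=∞, T is also assumed countably sublinear (|T(Σg_i)| ≤ Σ|Tg_i| a.e. for absolutely convergent series; false otherwise) and T_b^m f defined; sublinearity holds at every point; C depends on b only via weak-type bounds of T_b^m divided by ‖b‖^m. *)

theory Defs
  imports "HOL-Probability.Essential_Supremum"
begin

section \<open>Lebesgue and weak Lebesgue (quasi-)norms\<close>

text \<open>
  Exponents range over \<^typ>\<open>ereal\<close>; only \<open>0 < q \<le> \<infinity>\<close> is meaningful.  All norms depend on the
  modulus of the function only and take the value \<open>\<infinity>\<close> outside the respective space.
\<close>

definition eroot :: "real \<Rightarrow> ennreal \<Rightarrow> ennreal" where
  "eroot q a = (if a = \<infinity> then \<infinity> else ennreal (enn2real a powr (1 / q)))"

definition Lnorm :: "'a measure \<Rightarrow> ereal \<Rightarrow> ('a \<Rightarrow> 'k::real_normed_vector) \<Rightarrow> ennreal" where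
  "Lnorm M q f =
     (if q = \<infinity> then esssup M (\<lambda>x. ennreal (norm (f x)))
      else eroot (real_of_ereal q) (\<integral>\<^sup>+x. ennreal (norm (f x) powr real_of_ereal q) \<partial>M))"

definition Lspace :: "'a measure \<Rightarrow> ereal \<Rightarrow> ('a \<Rightarrow> 'k::real_normed_vector) set" where
  "Lspace M q = {f \<in> borel_measurable M. Lnorm M q f < \<infinity>}"

definition weak_Lnorm :: "'a measure \<Rightarrow> ereal \<Rightarrow> ('a \<Rightarrow> 'k::real_normed_vector) \<Rightarrow> ennreal" where
  "weak_Lnorm M q f =
     (if q = \<infinity> then Lnorm M \<infinity> f
      else (SUP t\<in>{0<..}. ennreal t *
              eroot (real_of_ereal q) (emeasure M {x \<in> space M. t < norm (f x)})))"

text \<open>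
  The average \<open>(1/\<mu>(N) \<integral>\<^bsub>S\<^esub> |f|\<^sup>q d\<mu>)\<^bsup>1/q\<^esup>\<close>, read as the essential supremum over \<open>S\<close> when
  \<open>q = \<infinity>\<close>.  The normalising set \<open>N\<close> is in general larger than \<open>S\<close>.
\<close>
definition avg_norm ::
    "'a measure \<Rightarrow> ereal \<Rightarrow> 'a set \<Rightarrow> 'a set \<Rightarrow> ('a \<Rightarrow> 'k::real_normed_vector) \<Rightarrow> ennreal" where
  "avg_norm M q N S f =
     (if q = \<infinity> then esssup (restrict_space M S) (\<lambda>x. ennreal (norm (f x)))
      else eroot (real_of_ereal q)
             ((\<integral>\<^sup>+x\<in>S. ennreal (norm (f x) powr real_of_ereal q) \<partial>M) / emeasure M N))"

definition Linf_c :: "'a::euclidean_space measure \<Rightarrow> ('a \<Rightarrow> 'k::real_normed_vector) set" where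
  "Linf_c M = {f \<in> borel_measurable M. bounded (range f) \<and> compact (closure {x. f x \<noteq> 0})}"


section \<open>Doubling measures, annuli, BMO\<close>

definition doubling :: "'a::euclidean_space measure \<Rightarrow> bool" where
  "doubling M \<longleftrightarrow> sets M = sets borel \<and>
     (\<exists>C::real. \<forall>x r. 0 < r \<longrightarrow>
        emeasure M (ball x (2 * r)) \<le> ennreal C * emeasure M (ball x r) \<and>
        emeasure M (ball x r) < \<infinity>)"

definition doubling_order :: "'a::euclidean_space measure \<Rightarrow> real \<Rightarrow> bool" where
  "doubling_order M D \<longleftrightarrow> 0 < D \<and>
     (\<exists>C::real. \<forall>x r l. 0 < r \<longrightarrow> 1 \<le> l \<longrightarrow>
        emeasure M (ball x (l * r)) \<le> ennreal (C * l powr D) * emeasure M (ball x r))"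

text \<open>The sets \<open>C\<^sub>j(B)\<close> for \<open>B = ball x r\<close>; the index runs over \<open>j \<ge> 1\<close>.\<close>
definition annulus :: "'a::euclidean_space \<Rightarrow> real \<Rightarrow> nat \<Rightarrow> 'a set" where
  "annulus x r j =
     (if j \<le> 1 then ball x (4 * r) else ball x (2 ^ (j + 1) * r) - ball x (2 ^ j * r))"

definition mean ::
    "'a measure \<Rightarrow> 'a set \<Rightarrow> ('a \<Rightarrow> 'k::{banach, second_countable_topology}) \<Rightarrow> 'k" where
  "mean M B b = (1 / measure M B) *\<^sub>R (LINT x:B|M. b x)"

definition BMO_norm ::
    "'a::euclidean_space measure \<Rightarrow> ('a \<Rightarrow> 'k::{banach, second_countable_topology}) \<Rightarrow> ennreal" where
  "BMO_norm M b =
     (SUP (x, r)\<in>UNIV \<times> {0<..}.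
        (\<integral>\<^sup>+y\<in>ball x r. ennreal (norm (b y - mean M (ball x r) b)) \<partial>M) / emeasure M (ball x r))"

definition BMO ::
    "'a::euclidean_space measure \<Rightarrow> ('a \<Rightarrow> 'k::{banach, second_countable_topology}) set" where
  "BMO M = {b \<in> borel_measurable M.
     (\<forall>x r. 0 < r \<longrightarrow> set_integrable M (ball x r) b) \<and> BMO_norm M b < \<infinity>}"


section \<open>Sublinear operators and commutators\<close>

text \<open>
  An operator acts on functions, not on classes modulo null sets, and \<open>\<D>\<close> is its domain: the
  commutator below evaluates at \<open>x\<close> the image of a function that itself depends on \<open>x\<close>, so it
  involves \<open>T\<close> on uncountably many functions, and a separate exceptional null set for each
  of them would make it meaningless.  For the same reason the two relations hold at every point.
\<close>
definition sublinear_on ::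
    "('a \<Rightarrow> 'k::real_normed_field) set \<Rightarrow> (('a \<Rightarrow> 'k) \<Rightarrow> 'a \<Rightarrow> 'k) \<Rightarrow> bool" where
  "sublinear_on \<D> T \<longleftrightarrow>
     (\<lambda>x. 0) \<in> \<D> \<and>
     (\<forall>f\<in>\<D>. \<forall>g\<in>\<D>. (\<lambda>x. f x + g x) \<in> \<D> \<and>
        (\<forall>x. norm (T (\<lambda>y. f y + g y) x) \<le> norm (T f x) + norm (T g x))) \<and>
     (\<forall>f\<in>\<D>. \<forall>c. (\<lambda>x. c * f x) \<in> \<D> \<and>
        (\<forall>x. norm (T (\<lambda>y. c * f y) x) = norm c * norm (T f x)))"

text \<open>
  Sublinearity for absolutely convergent series.  If \<open>T\<close> is of weak type \<open>(q, q)\<close> with \<open>q < \<infinity>\<close>,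
  finite sublinearity implies it on \<open>L\<^sup>q\<close> (for such series the partial sums converge in \<open>L\<^sup>q\<close>).
  Boundedness on \<open>L\<^sup>\<infinity>\<close> does not imply it: in the plane let \<open>T f(x)\<close> be the limit superior of the
  averages of \<open>|f|\<close> over rectangles, of any orientation, that contain \<open>x\<close> and shrink to it.
\<close>
definition countably_sublinear_on ::
    "'a measure \<Rightarrow> ('a \<Rightarrow> 'k::{real_normed_field, banach}) set \<Rightarrow>
     (('a \<Rightarrow> 'k) \<Rightarrow> 'a \<Rightarrow> 'k) \<Rightarrow> bool" where
  "countably_sublinear_on M \<D> T \<longleftrightarrow>
     (\<forall>g :: nat \<Rightarrow> 'a \<Rightarrow> 'k.
        (\<forall>i. g i \<in> \<D>) \<longrightarrow>
        (\<forall>x. summable (\<lambda>i. norm (g i x))) \<longrightarrow>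
        (\<lambda>x. of_real (\<Sum>i. norm (g i x))) \<in> \<D> \<longrightarrow>
        (\<lambda>x. \<Sum>i. g i x) \<in> \<D> \<longrightarrow>
        (AE x in M. ennreal (norm (T (\<lambda>y. \<Sum>i. g i y) x)) \<le> (\<Sum>i. ennreal (norm (T (g i) x)))))"

text \<open>
  \<open>S\<close> is bounded, with constant \<open>K\<close>, from \<open>L\<^sup>q\<close> to weak \<open>L\<^sup>q\<close> on the class \<open>X\<close>.  Only moduli
  enter, so only \<open>|S f|\<close> is asked to be measurable.  The constant is explicit so that the bounds
  for the commutators of different \<open>b\<close> can be compared: since \<open>T\<^sub>b\<^sup>m\<close> is homogeneous of degree \<open>m\<close>
  in \<open>b\<close>, a bound uniform in \<open>b\<close> has the form \<open>W * BMO_norm M b ^ m\<close>.  A single \<open>b\<close> in BMO whose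
  commutators are of weak type always admits such a \<open>W\<close>: if the BMO norm vanishes, \<open>b\<close> is a.e. constant
  and \<open>T\<^sub>b\<^sup>m f\<close> is zero almost everywhere for \<open>m \<ge> 1\<close>.
\<close>
definition weak_type_bound ::
    "'a measure \<Rightarrow> ereal \<Rightarrow> ('a \<Rightarrow> 'k::real_normed_vector) set \<Rightarrow>
     (('a \<Rightarrow> 'k) \<Rightarrow> 'a \<Rightarrow> 'k) \<Rightarrow> ennreal \<Rightarrow> bool" where
  "weak_type_bound M q X S K \<longleftrightarrow>
     (\<forall>f\<in>X. (\<lambda>x. norm (S f x)) \<in> borel_measurable M \<and> weak_Lnorm M q (S f) \<le> K * Lnorm M q f)"

definition commutator ::
    "(('a \<Rightarrow> 'k::real_normed_field) \<Rightarrow> 'a \<Rightarrow> 'k) \<Rightarrow> ('a \<Rightarrow> 'k) \<Rightarrow> nat \<Rightarrow>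
     ('a \<Rightarrow> 'k) \<Rightarrow> 'a \<Rightarrow> 'k" where
  "commutator T b m f x = T (\<lambda>y. (b x - b y) ^ m * f y) x"

text \<open>
  Every \<open>T\<^sub>b\<^sup>m f\<close> with \<open>m \<le> k\<close> and \<open>f\<close> bounded with compact support is defined.  When \<open>\<D>\<close>
  contains \<open>L\<^sup>q\<close> for a finite \<open>q\<close> this is automatic for \<open>b\<close> in BMO, by the John-Nirenberg
  inequality.
\<close>
definition commutators_defined ::
    "'a::euclidean_space measure \<Rightarrow> ('a \<Rightarrow> 'k::real_normed_field) set \<Rightarrow> ('a \<Rightarrow> 'k) \<Rightarrow> nat \<Rightarrow> bool" where
  "commutators_defined M \<D> b k \<longleftrightarrow>
     (\<forall>f\<in>Linf_c M. \<forall>m\<le>k. \<forall>c. (\<lambda>y. (c - b y) ^ m * f y) \<in> \<D>)"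

end

theory Submission
  imports Defs
begin

text \<open>
  Decompose \<open>f\<close> at height \<open>\<lambda>\<close> into a bounded part and pieces \<open>h\<^sub>i\<close> supported in balls \<open>B\<^sub>i\<close>.  In
  addition to the usual Calderon-Zygmund properties one arranges that
  \<open>\<Sum>\<^sub>i \<lambda>\<^sub>i \<Sum>\<^sub>j \<alpha>\<^sub>j (1 + j)\<^sup>k 1\<^bsub>2\<^bsup>j+1\<^esup>B\<^sub>i\<^esub> \<le> C \<lambda>\<close> everywhere, where \<open>\<lambda>\<^sub>i\<close> is the height at which \<open>h\<^sub>i\<close>
  was selected: balls in the region of large overlap are thrown away and the small part of \<open>f\<close> that
  is lost is decomposed again at half the height.  By Jensen's inequality, functions with decay
  \<open>\<lambda>\<^sub>i \<alpha>\<^sub>j (1 + j)\<^sup>k\<close> on the annuli of \<open>B\<^sub>i\<close>, such as \<open>(b - b\<^bsub>B\<^sub>i\<^esub>)\<^sup>s A h\<^sub>i\<close>, then have a sum under control in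
  \<open>L\<^bsup>q\<^esup>\<close> for every \<open>q \<le> q\<^sub>0\<close>; the factor \<open>(1 + j)\<^sup>k\<close> pays for the John-Nirenberg inequality on
  \<open>2\<^bsup>j+1\<^esup>B\<^sub>i\<close>.

  Expanding \<open>(b x - b y)\<^sup>m\<close> around \<open>b\<^bsub>B\<^sub>i\<^esub>\<close> reduces \<open>T\<^sub>b\<^sup>m h\<^sub>i\<close> to the functions \<open>T (I - A)\<close>, which are small off
  \<open>4 B\<^sub>i\<close>, and to commutators of order at most \<open>m\<close> applied to the sum of the \<open>A\<close>-parts.  The commutator
  of order \<open>m\<close> is estimated with the weak type \<open>(q\<^sub>0, q\<^sub>0)\<close> and those of lower order with weak type
  \<open>(q, q)\<close>, \<open>p < q < q\<^sub>0\<close>, known by induction.  Hence \<open>T\<^sub>b\<^sup>m\<close> is of weak type \<open>(p, p)\<close> for all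
  \<open>p\<^sub>0 < p < q\<^sub>0\<close>, uniformly in \<open>b\<close> of norm at most one, and Marcinkiewicz interpolation gives the strong
  type.
\<close>

section \<open>Dyadic cubes and the Calderon-Zygmund stopping time\<close>

text \<open>Two obstacles shape the argument. First, multiplication by a power of \<open>b\<close>
  costs integrability: an A-part controlled in \<open>L^q\<^sub>0\<close> stays, once multiplied by
  powers of \<open>b - c i\<close>, under control only in \<open>L^q\<close> with
  \<open>q < q\<^sub>0\<close>. In the expansion the term that carries the full order
  \<open>m\<close> has no such power, so the assumed weak type at \<open>q\<^sub>0\<close> applies
  to it; the others carry a lower order and are fed to the induction at an intermediate
  \<open>q\<close>. Secondly, \<open>commutator T b m f x\<close> applies \<open>T\<close> to a
  function that depends on \<open>x\<close>, so statements that hold almost everywhere for each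
  fixed function, such as countable sublinearity, do not pass to commutators, whose weak type is
  moreover given only on \<open>Linf_c M\<close>. Hence \<open>T\<close> itself is treated with all
  pieces at once, while for \<open>m \<ge> 1\<close> only finitely many truncated pieces are kept.
  What is cut off is expanded into finitely many functions independent of \<open>x\<close>, on which
  \<open>T\<close> is small in measure by its own weak type \<open>(p, p)\<close>; the coefficients
  are powers of \<open>b x\<close> and of \<open>b x - c i\<close>, and this is why order 0 comes
  first and why \<open>norm (b y) \<le> R\<close> is imposed for a while.\<close>

definition cube :: "'a::euclidean_space \<Rightarrow> real \<Rightarrow> 'a \<Rightarrow> 'a set" where
  "cube a h y = {z. \<forall>i\<in>Basis. \<lfloor>((z - a) \<bullet> i) / h\<rfloor> = \<lfloor>((y - a) \<bullet> i) / h\<rfloor>}"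

definition cube_center :: "'a::euclidean_space \<Rightarrow> real \<Rightarrow> 'a \<Rightarrow> 'a" where
  "cube_center a h y = a + (\<Sum>i\<in>Basis. ((of_int \<lfloor>((y - a) \<bullet> i) / h\<rfloor> + 1/2) * h) *\<^sub>R i)"

lemma cube_self: "y \<in> cube a h y"
  by (simp add: cube_def)

lemma cube_eq: "z \<in> cube a h y \<Longrightarrow> cube a h z = cube a h y"
  by (auto simp: cube_def)

text \<open>Since \<open>floor t = floor (2 * t) div 2\<close>, grids with a common anchor
  \<open>a\<close> and meshes \<open>s / 2 ^ j\<close> are nested; this is what makes the cells a
  dyadic system.\<close>

lemma cube_half_subset: "cube a (h / 2) y \<subseteq> cube a h y"
proof
  fix z assume z: "z \<in> cube a (h / 2) y"
  have half: "\<lfloor>t\<rfloor> = \<lfloor>2 * t\<rfloor> div 2" for t :: real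
    using floor_divide_real_eq_div[of 2 "2 * t"] by simp
  show "z \<in> cube a h y"
    using z unfolding cube_def
    by (auto simp: half[of "((z - a) \<bullet> i) / h" for i] half[of "((y - a) \<bullet> i) / h" for i] mult.commute)
qed

lemma cube_levels_mono:
  assumes "j \<le> k" shows "cube a (s / 2 ^ k) y \<subseteq> cube a (s / 2 ^ j) y"
  using assms
proof (induction k rule: dec_induct)
  case (step k)
  then show ?case
    using cube_half_subset[of a "s / 2 ^ k" y] by (simp add: mult.commute)
qed simp

lemma cube_borel [measurable]: "cube a h y \<in> sets borel"
proof -
  have "cube a h y = (\<Inter>i\<in>Basis. {z. \<lfloor>((z - a) \<bullet> i) / h\<rfloor> = \<lfloor>((y - a) \<bullet> i) / h\<rfloor>})"
    by (auto simp: cube_def)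
  also have "\<dots> \<in> sets borel"
    by (intro sets.finite_INT) auto
  finally show ?thesis .
qed

lemma cube_center_inner:
  assumes "i \<in> Basis"
  shows "(cube_center a h y - a) \<bullet> i = (of_int \<lfloor>((y - a) \<bullet> i) / h\<rfloor> + 1/2) * h"
  using assms by (simp add: cube_center_def inner_sum_left_Basis)

lemma abs_mid_less:
  fixes t m h :: real
  assumes "\<bar>t - (m + 1/2) * h\<bar> < h / 2" shows "m * h < t" "t < (m + 1) * h"
proof -
  have *: "(m + 1/2) * h = m * h + h / 2" "(m + 1) * h = m * h + h" by (simp_all add: field_simps)
  from assms have "t - (m * h + h / 2) < h / 2" "- (t - (m * h + h / 2)) < h / 2"
    unfolding *(1) abs_less_iff by auto
  then show "m * h < t" "t < (m + 1) * h"
    unfolding *(2) by auto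
qed

lemma ball_subset_cube:
  assumes "0 < h" shows "ball (cube_center a h y) (h / 2) \<subseteq> cube a h y"
proof
  fix z assume "z \<in> ball (cube_center a h y) (h / 2)"
  then have n: "norm (z - cube_center a h y) < h / 2"
    by (simp add: dist_norm norm_minus_commute)
  show "z \<in> cube a h y"
    unfolding cube_def
  proof (intro CollectI ballI)
    fix i :: 'a assume i: "i \<in> Basis"
    let ?m = "\<lfloor>((y - a) \<bullet> i) / h\<rfloor>"
    have "\<bar>(z - cube_center a h y) \<bullet> i\<bar> < h / 2"
      using Basis_le_norm[OF i, of "z - cube_center a h y"] n by simp
    moreover have "(z - cube_center a h y) \<bullet> i = (z - a) \<bullet> i - (of_int ?m + 1/2) * h"
      using cube_center_inner[OF i, of a h y] by (simp add: inner_diff_left algebra_simps)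
    ultimately have "\<bar>(z - a) \<bullet> i - (of_int ?m + 1/2) * h\<bar> < h / 2" by simp
    then have "of_int ?m * h < (z - a) \<bullet> i" "(z - a) \<bullet> i < (of_int ?m + 1) * h"
      using abs_mid_less by blast+
    then show "\<lfloor>((z - a) \<bullet> i) / h\<rfloor> = ?m"
      using assms by (intro floor_unique) (auto simp: field_simps)
  qed
qed

lemma cube_coord_bound:
  assumes "0 < h" "z \<in> cube a h y" "i \<in> Basis"
  shows "\<bar>(z - cube_center a h y) \<bullet> i\<bar> \<le> h / 2"
proof -
  let ?m = "\<lfloor>((y - a) \<bullet> i) / h\<rfloor>"
  have "\<lfloor>((z - a) \<bullet> i) / h\<rfloor> = ?m" using assms by (auto simp: cube_def)
  then have "of_int ?m \<le> ((z - a) \<bullet> i) / h" "((z - a) \<bullet> i) / h < of_int ?m + 1"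
    by linarith+
  then have "of_int ?m * h \<le> (z - a) \<bullet> i" "(z - a) \<bullet> i \<le> (of_int ?m + 1) * h"
    using assms(1) by (auto simp: field_simps)
  moreover have "(z - cube_center a h y) \<bullet> i = (z - a) \<bullet> i - (of_int ?m + 1/2) * h"
    using cube_center_inner[OF assms(3), of a h y] by (simp add: inner_diff_left algebra_simps)
  ultimately show ?thesis
    unfolding abs_le_iff by (simp only: distrib_right) linarith
qed

lemma cube_subset_ball:
  fixes a :: "'a::euclidean_space"
  assumes "0 < h" shows "cube a h y \<subseteq> ball (cube_center a h y) (real DIM('a) * h)"
proof
  fix z assume z: "z \<in> cube a h y"
  have "norm (z - cube_center a h y) \<le> (\<Sum>i\<in>Basis. \<bar>(z - cube_center a h y) \<bullet> i\<bar>)"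
    by (rule norm_le_l1)
  also have "\<dots> \<le> (\<Sum>i\<in>(Basis::'a set). h / 2)"
    by (intro sum_mono cube_coord_bound[OF assms z])
  also have "\<dots> = real DIM('a) * h / 2" by simp
  also have "\<dots> < real DIM('a) * h" using assms by simp
  finally show "z \<in> ball (cube_center a h y) (real DIM('a) * h)"
    by (simp add: dist_norm norm_minus_commute)
qed

lemma cube_center_in: "0 < h \<Longrightarrow> cube_center a h y \<in> cube a h y"
  using ball_subset_cube[of h a y] by auto

text \<open>Every cell contains a ball and hence a point of a fixed countable dense set, which
  together with the generation determines the cell.\<close>

lemma countable_cubes:
  fixes a :: "'a::euclidean_space"
  assumes "0 < s" shows "countable {cube a (s / 2 ^ j) y | j y. True}"
proof -
  obtain E :: "'a set" where E: "countable E" "\<And>X. open X \<Longrightarrow> X \<noteq> {} \<Longrightarrow> \<exists>d\<in>E. d \<in> X"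
    using countable_dense_setE by blast
  have "{cube a (s / 2 ^ j) y | j y. True} \<subseteq> (\<lambda>(j, d). cube a (s / 2 ^ j) d) ` (UNIV \<times> E)"
  proof clarify
    fix j :: nat and y
    have h: "0 < s / 2 ^ j" using assms by simp
    obtain d where "d \<in> E" "d \<in> ball (cube_center a (s / 2 ^ j) y) (s / 2 ^ j / 2)"
      using E(2)[of "ball (cube_center a (s / 2 ^ j) y) (s / 2 ^ j / 2)"] h by auto
    then show "cube a (s / 2 ^ j) y \<in> (\<lambda>(j, d). cube a (s / 2 ^ j) d) ` (UNIV \<times> E)"
      using ball_subset_cube[OF h, of a y] cube_eq[of d a "s / 2 ^ j" y] by (intro image_eqI[of _ _ "(j, d)"]) auto
  qed
  then show ?thesis
    using E(1) by (meson countable_SIGMA countable_image countable_subset countableI_type)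
qed

text \<open>\<open>ball_pos\<close> excludes the zero measure: under doubling a single null ball
  forces everything to be null, and that case is settled separately at the end.\<close>

locale doubling_measure =
  fixes M :: "'a::euclidean_space measure" and D Cd :: real
  assumes sets_M [simp]: "sets M = sets borel" and D_pos: "0 < D" and Cd_ge_1: "1 \<le> Cd"
    and ball_finite: "emeasure M (ball x r) < \<infinity>"
    and ball_pos: "0 < r \<Longrightarrow> 0 < emeasure M (ball x r)"
    and ball_dilate: "0 < r \<Longrightarrow> 1 \<le> l \<Longrightarrow>
      emeasure M (ball x (l * r)) \<le> ennreal (Cd * l powr D) * emeasure M (ball x r)"
begin

section \<open>Mass of balls and cubes under doubling; outer regularity\<close>

lemma space_M [simp]: "space M = UNIV"
  using sets_eq_imp_space_eq[OF sets_M] by simp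

lemma bounded_finite: "bounded S \<Longrightarrow> emeasure M S < \<infinity>"
proof -
  assume "bounded S"
  then obtain r where "S \<subseteq> ball 0 r" by (meson bounded_subset_ballD)
  then have "emeasure M S \<le> emeasure M (ball 0 r)"
    by (intro emeasure_mono) auto
  then show ?thesis using ball_finite[of 0 r] by (auto simp: less_top[symmetric] top_unique)
qed

lemma sigma_finite: "sigma_finite_measure M"
proof
  show "\<exists>A. countable A \<and> A \<subseteq> sets M \<and> \<Union> A = space M \<and> (\<forall>a\<in>A. emeasure M a \<noteq> \<infinity>)"
  proof (intro exI[of _ "range (\<lambda>n::nat. ball 0 (real n))"] conjI ballI)
    show "\<Union> (range (\<lambda>n::nat. ball 0 (real n))) = space M"
      by (auto simp: reals_Archimedean2)
    fix a assume "a \<in> range (\<lambda>n::nat. ball (0::'a) (real n))"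
    then obtain n :: nat where "a = ball 0 (real n)" by blast
    then show "emeasure M a \<noteq> \<infinity>" using ball_finite[of 0 "real n"] by simp
  qed auto
qed

lemma emeasure_ball_eq: "emeasure M (ball x r) = ennreal (measure M (ball x r))"
  using ball_finite[of x r] by (simp add: emeasure_eq_ennreal_measure less_top)

lemma measure_ball_pos: "0 < r \<Longrightarrow> 0 < measure M (ball x r)"
  using ball_pos[of r x] by (simp add: emeasure_ball_eq)

lemma measure_ball_dilate:
  "0 < r \<Longrightarrow> 1 \<le> l \<Longrightarrow> measure M (ball x (l * r)) \<le> Cd * l powr D * measure M (ball x r)"
  using ball_dilate[of r l x] Cd_ge_1
  by (simp add: emeasure_ball_eq ennreal_mult[symmetric] ennreal_le_iff)

lemma measure_mono_bounded:
  "A \<subseteq> B \<Longrightarrow> A \<in> sets borel \<Longrightarrow> B \<in> sets borel \<Longrightarrow> bounded B \<Longrightarrow> measure M A \<le> measure M B"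
  using bounded_finite[of B] by (intro measure_mono_fmeasurable) (auto simp: fmeasurable_def)

text \<open>The balls of radius \<open>R\<close> about 0 and about a point at distance
  \<open>4 * R\<close> are disjoint and lie in \<open>ball 0 (5 * R)\<close>. The mass of the second
  is bounded below independently of \<open>R\<close>, because its dilate by 5 contains the unit
  ball.\<close>

lemma measure_ball_step:
  assumes "1 \<le> R"
  shows "measure M (ball 0 R) + measure M (ball 0 1) / (Cd * 5 powr D) \<le> measure M (ball 0 (5 * R))"
proof -
  obtain e :: 'a where e: "e \<in> Basis" using nonempty_Basis by blast
  let ?x = "(4 * R) *\<^sub>R e"
  have ne: "norm ?x = 4 * R" using e assms by simp
  have "measure M (ball 0 1) \<le> measure M (ball ?x (5 * R))"
  proof (rule measure_mono_bounded)
    show "ball 0 1 \<subseteq> ball ?x (5 * R)"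
    proof
      fix z :: 'a assume "z \<in> ball 0 1"
      then have "norm z < 1" by simp
      then have "dist ?x z < 5 * R"
        using norm_triangle_ineq4[of ?x z] ne assms unfolding dist_norm by linarith
      then show "z \<in> ball ?x (5 * R)" by simp
    qed
  qed auto
  also have "\<dots> \<le> Cd * 5 powr D * measure M (ball ?x R)"
    using measure_ball_dilate[of R 5 ?x] assms by simp
  finally have 1: "measure M (ball 0 1) / (Cd * 5 powr D) \<le> measure M (ball ?x R)"
    using Cd_ge_1 by (simp add: field_simps)
  have "measure M (ball 0 R) + measure M (ball ?x R) = measure M (ball 0 R \<union> ball ?x R)"
  proof (rule measure_Union[symmetric])
    show "ball 0 R \<inter> ball ?x R = {}"
    proof -
      have False if "norm z < R" "norm (?x - z) < R" for z
        using norm_triangle_ineq[of "?x - z" z] that ne assms by simp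
      then show ?thesis by (auto simp: dist_norm)
    qed
  qed (use ball_finite in \<open>auto simp: less_top\<close>)
  also have "\<dots> \<le> measure M (ball 0 (5 * R))"
  proof (rule measure_mono_bounded)
    have "norm z < 5 * R" if "norm (?x - z) < R" for z
      using norm_triangle_ineq3[of ?x z] that ne by linarith
    then show "ball 0 R \<union> ball ?x R \<subseteq> ball 0 (5 * R)"
      using assms by (auto simp: dist_norm)
  qed auto
  finally show ?thesis using 1 by linarith
qed

text \<open>Infinite total mass is what makes a global decomposition possible: for a function of
  finite integral and any height there is a starting cube over which the average stays below that
  height.\<close>

lemma measure_ball_unbounded: "\<exists>R\<ge>1. K \<le> measure M (ball 0 R)"
proof -
  define c where "c = measure M (ball 0 1) / (Cd * 5 powr D)"
  have c: "0 < c" using measure_ball_pos[of 1 0] Cd_ge_1 by (auto simp: c_def)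
  have "real j * c \<le> measure M (ball 0 (5 ^ j))" for j
  proof (induction j)
    case (Suc j)
    then show ?case using measure_ball_step[of "5 ^ j"] by (simp add: c_def[symmetric] algebra_simps)
  qed simp
  moreover obtain j where "K / c < real j" using reals_Archimedean2 by blast
  ultimately have "K \<le> measure M (ball 0 (5 ^ j))"
    using c by (smt (verit) divide_less_eq mult.commute)
  then show ?thesis by (intro exI[of _ "5 ^ j"]) auto
qed

text \<open>A cell of side \<open>h\<close> contains a ball of radius \<open>h / 2\<close>, and the
  largest ball ever compared with it has radius \<open>4 * DIM('a) * h\<close> (the one about a
  child that contains the parent). The ratio of these radii is \<open>8 * DIM('a)\<close>.\<close>

definition Kc :: real where "Kc = Cd * (8 * real DIM('a)) powr D"

lemma Kc_ge_1: "1 \<le> Kc"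
proof -
  have "1 \<le> DIM('a)" using DIM_positive[where 'a='a] by linarith
  then have "1 \<le> 8 * real DIM('a)" by linarith
  then have "1 \<le> (8 * real DIM('a)) powr D" using D_pos by (intro ge_one_powr_ge_zero) auto
  then show ?thesis unfolding Kc_def using Cd_ge_1 by (metis mult_mono' mult_1 zero_le_one)
qed

lemma Kc_pos: "0 < Kc" using Kc_ge_1 by simp

lemma bounded_cube: "0 < h \<Longrightarrow> bounded (cube a h y)"
  using cube_subset_ball[of h a y] bounded_ball bounded_subset by blast

lemma cube_finite: "0 < h \<Longrightarrow> emeasure M (cube a h y) < \<infinity>"
  using bounded_finite[OF bounded_cube] by auto

lemma emeasure_cube_pos: "0 < h \<Longrightarrow> 0 < emeasure M (cube a h y)"
  using emeasure_mono[OF ball_subset_cube[of h a y], of M] ball_pos[of "h/2" "cube_center a h y"]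
  by auto

lemma emeasure_dilated_cube:
  assumes "0 < h" "0 < l" "l \<le> 4"
  shows "emeasure M (ball (cube_center a h y) (l * real DIM('a) * h)) \<le> ennreal Kc * emeasure M (cube a h y)"
proof -
  have "emeasure M (ball (cube_center a h y) (l * real DIM('a) * h)) \<le>
    emeasure M (ball (cube_center a h y) ((8 * real DIM('a)) * (h / 2)))"
    using assms by (intro emeasure_mono subset_ball) auto
  also have "\<dots> \<le> ennreal Kc * emeasure M (ball (cube_center a h y) (h / 2))"
    unfolding Kc_def using assms DIM_positive[where 'a='a] by (intro ball_dilate) linarith+
  also have "\<dots> \<le> ennreal Kc * emeasure M (cube a h y)"
    by (intro mult_left_mono emeasure_mono ball_subset_cube assms) auto
  finally show ?thesis .
qed

lemma emeasure_cube_parent: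
  assumes "0 < h"
  shows "emeasure M (cube a h y) \<le> ennreal Kc * emeasure M (cube a (h / 2) y)"
proof -
  let ?c = "cube_center a h y" and ?d = "cube_center a (h / 2) y"
  have "?d \<in> cube a h y"
    using cube_center_in[of "h/2" a y] cube_half_subset[of a h y] assms by auto
  then have d: "dist ?c ?d < real DIM('a) * h"
    using cube_subset_ball[OF assms, of a y] by auto
  have "cube a h y \<subseteq> ball ?d (4 * real DIM('a) * (h / 2))"
  proof
    fix z assume "z \<in> cube a h y"
    then have "dist ?c z < real DIM('a) * h" using cube_subset_ball[OF assms, of a y] by auto
    then show "z \<in> ball ?d (4 * real DIM('a) * (h / 2))"
      using d dist_triangle3[of ?d z ?c] unfolding mem_ball by linarith
  qed
  then have "emeasure M (cube a h y) \<le> emeasure M (ball ?d (4 * real DIM('a) * (h / 2)))"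
    by (intro emeasure_mono) auto
  also have "\<dots> \<le> ennreal Kc * emeasure M (cube a (h / 2) y)"
    using assms by (intro emeasure_dilated_cube) auto
  finally show ?thesis .
qed

text \<open>Outer regularity is available for finite measures, so it is applied to the restriction
  \<open>N\<close> of \<open>M\<close> to a ball that contains \<open>E\<close>, and the open set
  found there is intersected with that ball.\<close>

lemma outer_open:
  assumes "E \<in> sets borel" "bounded E" "0 < \<delta>"
  shows "\<exists>U. open U \<and> E \<subseteq> U \<and> emeasure M U \<le> emeasure M E + ennreal \<delta>"
proof -
  obtain R where R: "E \<subseteq> ball 0 R" using assms(2) by (meson bounded_subset_ballD)
  have im: "indicator (ball 0 R) \<in> borel_measurable M" by (intro borel_measurable_indicator) auto
  define N where "N = density M (indicator (ball 0 R) :: 'a \<Rightarrow> ennreal)"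
  have N: "emeasure N X = emeasure M (ball 0 R \<inter> X)" if "X \<in> sets borel" for X
    unfolding N_def using that
    by (subst emeasure_density[OF im]) (simp_all add: indicator_inter_arith[symmetric])
  have sN: "sets N = sets borel" unfolding N_def sets_density by (rule sets_M)
  have fN: "emeasure N (space N) \<noteq> \<infinity>"
  proof -
    have "space N = UNIV" using sets_eq_imp_space_eq[OF sN] by (metis space_borel)
    then show ?thesis using N[of UNIV] ball_finite[of 0 R] by simp
  qed
  have "emeasure N E = (INF U\<in>{U. E \<subseteq> U \<and> open U}. emeasure N U)"
    using outer_regular[OF sN fN assms(1)] by simp
  moreover have "emeasure N E \<noteq> \<infinity>"
    using N[OF assms(1)] bounded_finite[OF assms(2)] R by (simp add: Int_absorb1)
  ultimately have "(INF U\<in>{U. E \<subseteq> U \<and> open U}. emeasure N U) < emeasure N E + ennreal \<delta>"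
    using assms(3) ennreal_add_left_cancel_less[of "emeasure N E" 0 "ennreal \<delta>"] by simp
  then obtain U where U: "E \<subseteq> U" "open U" "emeasure N U < emeasure N E + ennreal \<delta>"
    by (auto simp: INF_less_iff)
  show ?thesis
  proof (intro exI conjI)
    show "open (ball 0 R \<inter> U)" "E \<subseteq> ball 0 R \<inter> U" using U R by auto
    show "emeasure M (ball 0 R \<inter> U) \<le> emeasure M E + ennreal \<delta>"
      using U(2,3) N[of U] N[OF assms(1)] R by (simp add: Int_absorb1)
  qed
qed


text \<open>
  The last property replaces the differentiation theorem: it is applied to an open neighbourhood
  \<open>U\<close> of a level set, provided by outer regularity, on which \<open>v\<close> has been raised artificially.
\<close>
lemma calderon_zygmund:
  fixes v :: "'a \<Rightarrow> ennreal"
  assumes s: "0 < s" and v [measurable]: "v \<in> borel_measurable M" and \<tau>: "0 < \<tau>"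
    and base: "(\<integral>\<^sup>+x\<in>cube a s y\<^sub>0. v x \<partial>M) \<le> ennreal \<tau> * emeasure M (cube a s y\<^sub>0)"
  obtains Q :: "nat \<Rightarrow> 'a set" where
    "disjoint_family Q" "\<And>i. Q i \<in> sets borel" "\<And>i. Q i \<subseteq> cube a s y\<^sub>0"
    "\<And>i. Q i \<noteq> {} \<Longrightarrow> \<exists>j y. Q i = cube a (s / 2 ^ j) y"
    "\<And>i. ennreal \<tau> * emeasure M (Q i) \<le> (\<integral>\<^sup>+x\<in>Q i. v x \<partial>M)"
    "\<And>i. (\<integral>\<^sup>+x\<in>Q i. v x \<partial>M) \<le> ennreal (Kc * \<tau>) * emeasure M (Q i)"
    "\<And>U. open U \<Longrightarrow> (\<And>y. y \<in> U \<Longrightarrow> ennreal (2 * \<tau>) \<le> v y) \<Longrightarrow> U \<inter> cube a s y\<^sub>0 \<subseteq> (\<Union>i. Q i)"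
proof -
  let ?C = "\<lambda>j y. cube a (s / 2 ^ j) y"
  define I where "I X = (\<integral>\<^sup>+x\<in>X. v x \<partial>M)" for X
  define big where "big X \<longleftrightarrow> ennreal \<tau> * emeasure M X < I X" for X
  \<comment> \<open>The maximal cells whose average exceeds \<tau>. By \<open>base\<close> the
    starting cell is not big, so a selected cell always has a parent that is not big, and the parent
    bounds its average by \<open>Kc * \<tau>\<close>.\<close>
  define sel where "sel = {?C j y | j y. y \<in> cube a s y\<^sub>0 \<and> big (?C j y) \<and> (\<forall>i<j. \<not> big (?C i y))}"
  have h: "0 < s / 2 ^ j" for j using s by simp
  have C0: "?C 0 y = cube a s y\<^sub>0" if "y \<in> cube a s y\<^sub>0" for y
    using cube_eq[OF that] by simp
  have nb0: "\<not> big (cube a s y\<^sub>0)"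
    using base by (simp add: big_def I_def not_less)
  have sub0: "?C j y \<subseteq> cube a s y\<^sub>0" if "y \<in> cube a s y\<^sub>0" for j y
    using cube_levels_mono[of 0 j a s y] C0[OF that] by simp
  have parent: "I (?C j y) \<le> ennreal (Kc * \<tau>) * emeasure M (?C j y)"
    if y: "y \<in> cube a s y\<^sub>0" and b: "big (?C j y)" "\<forall>i<j. \<not> big (?C i y)" for j y
  proof (cases j)
    case 0
    then show ?thesis using b(1) C0[OF y] nb0 by simp
  next
    case (Suc i)
    have "I (?C j y) \<le> I (?C i y)"
      unfolding I_def using cube_levels_mono[of i j a s y] Suc
      by (intro nn_integral_mono) (auto split: split_indicator)
    also have "\<dots> \<le> ennreal \<tau> * emeasure M (?C i y)"
      using b(2) Suc by (simp add: big_def not_less)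
    also have "\<dots> \<le> ennreal \<tau> * (ennreal Kc * emeasure M (cube a (s / 2 ^ i / 2) y))"
      by (intro mult_left_mono emeasure_cube_parent h) auto
    also have "\<dots> = ennreal (Kc * \<tau>) * emeasure M (?C j y)"
      using Suc Kc_pos \<tau> by (simp add: ennreal_mult mult_ac)
    finally show ?thesis .
  qed
  \<comment> \<open>Two selected cells with a common point lie on one chain of cells about that
    point; the smaller one would have a big ancestor.\<close>
  have disj: "X = Y" if X: "X \<in> sel" and Y: "Y \<in> sel" and z: "z \<in> X" "z \<in> Y" for X Y z
  proof -
    obtain j y where 1: "X = ?C j y" "big (?C j y)" "\<forall>i<j. \<not> big (?C i y)"
      using X by (auto simp: sel_def)
    obtain k w where 2: "Y = ?C k w" "big (?C k w)" "\<forall>i<k. \<not> big (?C i w)"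
      using Y by (auto simp: sel_def)
    have "?C j z = ?C j y" "?C k z = ?C k w"
      using z 1(1) 2(1) cube_eq by blast+
    moreover have "?C i z = ?C i y" if "i \<le> j" for i
      using z 1(1) cube_levels_mono[OF that, of a s y] cube_eq by blast
    moreover have "?C i z = ?C i w" if "i \<le> k" for i
      using z 2(1) cube_levels_mono[OF that, of a s w] cube_eq by blast
    ultimately have "\<not> j < k" "\<not> k < j" using 1 2 by auto
    then have "j = k" by simp
    then show ?thesis using \<open>?C j z = ?C j y\<close> \<open>?C k z = ?C k w\<close> 1 2 by simp
  qed
  have sel_prop: "X \<subseteq> cube a s y\<^sub>0" "\<exists>j y. X = ?C j y" "ennreal \<tau> * emeasure M X \<le> I X"
    "I X \<le> ennreal (Kc * \<tau>) * emeasure M X" if "X \<in> sel" for X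
    using that sub0 parent by (auto simp: sel_def big_def intro: less_imp_le)
  have cnt: "countable sel"
    by (rule countable_subset[OF _ countable_cubes[OF s, of a]]) (auto simp: sel_def)
  \<comment> \<open>The family is indexed by all naturals and empty outside \<open>J\<close>, so
    that finite and infinite selections are treated alike.\<close>
  define J where "J = to_nat_on sel ` sel"
  define Q where "Q i = (if i \<in> J then from_nat_into sel i else {})" for i
  have fromto: "from_nat_into sel (to_nat_on sel X) = X" if "X \<in> sel" for X
    by (rule from_nat_into_to_nat_on[OF cnt that])
  have Qsel: "Q i \<in> sel" if "Q i \<noteq> {}" for i
  proof -
    have "i \<in> J" using that by (meson Q_def)
    then obtain X where "X \<in> sel" "i = to_nat_on sel X" unfolding J_def by blast
    then show ?thesis using fromto \<open>i \<in> J\<close> by (simp add: Q_def)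
  qed
  have UQ: "\<Union>(range Q) = \<Union>sel"
  proof
    show "\<Union>(range Q) \<subseteq> \<Union>sel" using Qsel by blast
    show "\<Union>sel \<subseteq> \<Union>(range Q)"
    proof
      fix x assume "x \<in> \<Union>sel"
      then obtain X where X: "X \<in> sel" "x \<in> X" by blast
      then have "Q (to_nat_on sel X) = X" using fromto by (simp add: Q_def J_def)
      then show "x \<in> \<Union>(range Q)" using X by blast
    qed
  qed
  show ?thesis
  proof (rule that[of Q])
    show "disjoint_family Q"
      unfolding disjoint_family_on_def
    proof (intro ballI impI)
      fix m n :: nat assume mn: "m \<noteq> n"
      show "Q m \<inter> Q n = {}"
      proof (rule ccontr)
        assume "Q m \<inter> Q n \<noteq> {}"
        then obtain z where z: "z \<in> Q m" "z \<in> Q n" by blast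
        then have "m \<in> J" "n \<in> J" by (auto simp: Q_def split: if_splits)
        moreover have "Q m = Q n" using disj[of "Q m" "Q n" z] z Qsel by blast
        ultimately have "from_nat_into sel m = from_nat_into sel n"
          by (simp add: Q_def)
        moreover have "to_nat_on sel (from_nat_into sel i) = i" if "i \<in> J" for i
          using that fromto unfolding J_def by force
        ultimately have "m = n" using \<open>m \<in> J\<close> \<open>n \<in> J\<close> by metis
        then show False using mn by simp
      qed
    qed
    show "Q i \<in> sets borel" for i
      using Qsel[of i] sel_prop(2)[of "Q i"] by (cases "Q i = {}") auto
    show "Q i \<subseteq> cube a s y\<^sub>0" for i
      using Qsel[of i] sel_prop(1)[of "Q i"] by (cases "Q i = {}") auto
    show "\<exists>j y. Q i = ?C j y" if "Q i \<noteq> {}" for i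
      using Qsel[OF that] sel_prop(2) by blast
    show "ennreal \<tau> * emeasure M (Q i) \<le> (\<integral>\<^sup>+x\<in>Q i. v x \<partial>M)" for i
      using Qsel[of i] sel_prop(3)[of "Q i"] by (cases "Q i = {}") (auto simp: I_def)
    show "(\<integral>\<^sup>+x\<in>Q i. v x \<partial>M) \<le> ennreal (Kc * \<tau>) * emeasure M (Q i)" for i
      using Qsel[of i] sel_prop(4)[of "Q i"] by (cases "Q i = {}") (auto simp: I_def)
    fix U assume U: "open U" "\<And>y. y \<in> U \<Longrightarrow> ennreal (2 * \<tau>) \<le> v y"
    show "U \<inter> cube a s y\<^sub>0 \<subseteq> (\<Union>i. Q i)"
    proof
      fix x assume x: "x \<in> U \<inter> cube a s y\<^sub>0"
      then obtain e where e: "0 < e" "ball x e \<subseteq> U" using U(1) by (auto simp: open_contains_ball)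
      obtain j :: nat where j: "2 * real DIM('a) * s / e < 2 ^ j"
        using real_arch_pow[of 2] by auto
      have "?C j x \<subseteq> ball x e"
      proof
        fix z assume z: "z \<in> ?C j x"
        let ?c = "cube_center a (s / 2 ^ j) x"
        define w where "w = real DIM('a) * (s / 2 ^ j)"
        have "dist ?c x < w" "dist ?c z < w"
          using cube_subset_ball[OF h[of j], of a x] z cube_self[of x a "s / 2 ^ j"] by (auto simp: w_def)
        then have "dist x z < 2 * w"
          using dist_triangle3[of x z ?c] by linarith
        also have "\<dots> \<le> e"
          using j e(1) s by (simp add: w_def field_simps less_imp_le)
        finally show "z \<in> ball x e" by simp
      qed
      then have "?C j x \<subseteq> U" using e by blast
      \<comment> \<open>The factor 2 in the lower bound for \<open>v\<close> on \<open>U\<close>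
        yields the strict inequality in \<open>big\<close> for every cell inside
        \<open>U\<close>.\<close>
      have "ennreal \<tau> * emeasure M (?C j x) < ennreal (2 * \<tau>) * emeasure M (?C j x)"
        using emeasure_cube_pos[OF h, of a j x] cube_finite[OF h, of a j x] \<tau>
        by (subst mult.commute, subst (2) mult.commute, intro ennreal_mult_strict_left_mono) (auto simp: ennreal_less_iff)
      also have "\<dots> = (\<integral>\<^sup>+y. ennreal (2 * \<tau>) * indicator (?C j x) y \<partial>M)"
        by (subst nn_integral_cmult_indicator) auto
      also have "\<dots> \<le> I (?C j x)"
        unfolding I_def using U(2) \<open>?C j x \<subseteq> U\<close>
        by (intro nn_integral_mono) (auto split: split_indicator)
      finally have "big (?C j x)" by (simp add: big_def)
      define k where "k = (LEAST k. big (?C k x))"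
      have "big (?C k x)" unfolding k_def by (rule LeastI[of _ j]) fact
      moreover have "\<forall>i<k. \<not> big (?C i x)" unfolding k_def using not_less_Least by blast
      ultimately have "?C k x \<in> sel" using x by (auto simp: sel_def)
      then have "x \<in> \<Union>sel" using cube_self by blast
      then show "x \<in> (\<Union>i. Q i)" using UQ by simp
    qed
  qed
qed

end

section \<open>The John-Nirenberg inequality\<close>

lemma powr_add_le:
  fixes u d q :: real
  assumes "0 \<le> u" "0 \<le> d" "0 \<le> q"
  shows "(u + d) powr q \<le> 2 powr q * (u powr q + d powr q)"
proof -
  have "(u + d) powr q \<le> (2 * max u d) powr q"
    using assms by (intro powr_mono2) auto
  also have "\<dots> = 2 powr q * max u d powr q"
    using assms by (simp add: powr_mult)
  also have "\<dots> \<le> 2 powr q * (u powr q + d powr q)"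
    by (intro mult_left_mono) (auto simp: max_def)
  finally show ?thesis .
qed

lemma nn_set_integral_const:
  "A \<in> sets M \<Longrightarrow> (\<integral>\<^sup>+x\<in>A. c \<partial>M) = c * emeasure M A"
  by (rule nn_integral_cmult_indicator)

lemma nn_set_integral_le:
  "(\<And>x. x \<in> A \<Longrightarrow> f x \<le> g x) \<Longrightarrow> (\<integral>\<^sup>+x\<in>A. f x \<partial>M) \<le> (\<integral>\<^sup>+x\<in>A. g x \<partial>M)"
  for f g :: "'a \<Rightarrow> ennreal"
  by (intro nn_integral_mono) (auto split: split_indicator)

lemma nn_set_integral_subset:
  "A \<subseteq> B \<Longrightarrow> (\<integral>\<^sup>+x\<in>A. f x \<partial>M) \<le> (\<integral>\<^sup>+x\<in>B. f x \<partial>M)"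
  for f :: "'a \<Rightarrow> ennreal"
  by (intro nn_integral_mono) (auto split: split_indicator)

lemma set_markov:
  fixes u :: "'a \<Rightarrow> real"
  assumes [measurable]: "u \<in> borel_measurable M" "A \<in> sets M" and t: "0 < t"
  shows "emeasure M {x\<in>A. t < u x} \<le> ennreal (1 / t) * (\<integral>\<^sup>+x\<in>A. ennreal (u x) \<partial>M)"
proof -
  have *: "{x\<in>A. t < u x} \<in> sets M"
  proof -
    have "{x\<in>A. t < u x} = {x\<in>space M. t < u x} \<inter> A"
      using sets.sets_into_space[OF assms(2)] by blast
    also have "\<dots> \<in> sets M" by measurable
    finally show ?thesis .
  qed
  have "emeasure M {x\<in>A. t < u x} = (\<integral>\<^sup>+x. indicator {x\<in>A. t < u x} x \<partial>M)"
    using * by simp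
  also have "\<dots> \<le> (\<integral>\<^sup>+x. ennreal (1 / t) * (ennreal (u x) * indicator A x) \<partial>M)"
    using t by (intro nn_integral_mono) (auto simp: ennreal_mult'[symmetric] field_simps split: split_indicator)
  also have "\<dots> = ennreal (1 / t) * (\<integral>\<^sup>+x\<in>A. ennreal (u x) \<partial>M)"
    by (rule nn_integral_cmult) measurable
  finally show ?thesis .
qed

text \<open>The triangle inequality is averaged over \<open>S\<close>. Neither constant has to be
  the mean of \<open>b\<close> over \<open>S\<close>; it is enough that both approximate
  \<open>b\<close> there in the mean, so that means over different balls can be compared.\<close>

lemma norm_diff_le_of_oscillations:
  fixes b :: "'a \<Rightarrow> 'k::{real_normed_vector, second_countable_topology}"
  assumes [measurable]: "b \<in> borel_measurable M" "S \<in> sets M"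
    and S: "0 < emeasure M S" "emeasure M S < \<infinity>" and K: "0 \<le> K" "0 \<le> K'"
    and c: "(\<integral>\<^sup>+y\<in>S. ennreal (norm (b y - c)) \<partial>M) \<le> ennreal K * emeasure M S"
    and c': "(\<integral>\<^sup>+y\<in>S. ennreal (norm (b y - c')) \<partial>M) \<le> ennreal K' * emeasure M S"
  shows "norm (c - c') \<le> K + K'"
proof -
  have "ennreal (norm (c - c')) * emeasure M S = (\<integral>\<^sup>+y\<in>S. ennreal (norm (c - c')) \<partial>M)"
    by (simp add: nn_set_integral_const)
  also have "\<dots> \<le> (\<integral>\<^sup>+y\<in>S. ennreal (norm (b y - c)) + ennreal (norm (b y - c')) \<partial>M)"
  proof (rule nn_set_integral_le)
    fix y show "ennreal (norm (c - c')) \<le> ennreal (norm (b y - c)) + ennreal (norm (b y - c'))"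
      using norm_triangle_ineq4[of "b y - c'" "b y - c"]
      by (simp add: ennreal_plus[symmetric] ac_simps del: ennreal_plus)
  qed
  also have "\<dots> = (\<integral>\<^sup>+y\<in>S. ennreal (norm (b y - c)) \<partial>M) + (\<integral>\<^sup>+y\<in>S. ennreal (norm (b y - c')) \<partial>M)"
    by (rule nn_set_integral_add) measurable
  also have "\<dots> \<le> ennreal (K + K') * emeasure M S"
    using add_mono[OF c c'] K by (simp add: distrib_right)
  finally have "emeasure M S * ennreal (norm (c - c')) \<le> emeasure M S * ennreal (K + K')"
    by (simp add: mult.commute)
  then have "ennreal (norm (c - c')) \<le> ennreal (K + K')"
    using S by (subst (asm) ennreal_mult_le_mult_iff) auto
  then show ?thesis using K by (subst (asm) ennreal_le_iff) auto
qed

lemma cube_center_centered: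
  assumes r: "0 < r" shows "cube_center (x - r *\<^sub>R One) (2 * r) x = x"
proof -
  have "(x - (x - r *\<^sub>R One)) \<bullet> i = r" if "i \<in> Basis" for i
    using that by (simp add: inner_sum_left_Basis)
  then show ?thesis
    using r by (simp add: cube_center_def scaleR_sum_right)
qed

lemma ball_subset_centered_cube: "0 < r \<Longrightarrow> ball x r \<subseteq> cube (x - r *\<^sub>R One) (2 * r) x"
  using ball_subset_cube[of "2 * r" "x - r *\<^sub>R One" x] by (simp add: cube_center_centered)

context doubling_measure
begin

lemma cube_sets_M [measurable]: "cube a h y \<in> sets M"
  by simp

lemma ball_sets_M [measurable]: "ball x r \<in> sets M"
  by simp

text \<open>BMO norm at most one, written without division. A general \<open>b\<close> is reduced to
  this by dividing it by a number above its norm, which is how all later constants become uniform in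
  \<open>b\<close>.\<close>

definition BMO1 :: "('a \<Rightarrow> 'k::{banach, second_countable_topology}) \<Rightarrow> bool" where
  "BMO1 b \<longleftrightarrow> b \<in> borel_measurable M \<and>
     (\<forall>x r. 0 < r \<longrightarrow>
       (\<integral>\<^sup>+y\<in>ball x r. ennreal (norm (b y - mean M (ball x r) b)) \<partial>M) \<le> emeasure M (ball x r))"

text \<open>The mean is taken over the circumscribed ball rather than over the cell, because BMO is
  defined with balls; the price is the factor \<open>Kc\<close> in \<open>BMO1_cube\<close>.\<close>

abbreviation cube_mean :: "('a \<Rightarrow> 'k::{banach, second_countable_topology}) \<Rightarrow> 'a \<Rightarrow> real \<Rightarrow> 'a \<Rightarrow> 'k" where
  "cube_mean b a h y \<equiv> mean M (ball (cube_center a h y) (real DIM('a) * h)) b"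

lemma BMO1_cube:
  assumes "BMO1 b" "0 < h"
  shows "(\<integral>\<^sup>+x\<in>cube a h y. ennreal (norm (b x - cube_mean b a h y)) \<partial>M) \<le> ennreal Kc * emeasure M (cube a h y)"
proof -
  let ?B = "ball (cube_center a h y) (real DIM('a) * h)"
  have "(\<integral>\<^sup>+x\<in>cube a h y. ennreal (norm (b x - mean M ?B b)) \<partial>M) \<le>
    (\<integral>\<^sup>+x\<in>?B. ennreal (norm (b x - mean M ?B b)) \<partial>M)"
    by (rule nn_set_integral_subset[OF cube_subset_ball[OF assms(2)]])
  also have "\<dots> \<le> emeasure M ?B"
    using assms DIM_positive[where 'a='a] by (simp add: BMO1_def)
  also have "\<dots> \<le> ennreal Kc * emeasure M (cube a h y)"
    using emeasure_dilated_cube[OF assms(2), of 1 a y] by simp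
  finally show ?thesis .
qed

text \<open>One stopping-time step at height \<tau> for the oscillation of \<open>b\<close>. Outside
  the selected cells the oscillation is at most \<tau>. On a selected cell the constant is replaced
  by the cell's own one at the cost \<open>Kc + Kc * \<tau>\<close>, and the bound \<open>X\<close>
  is applied there. With this \<tau> the selected cells are so small in total that \<open>X\<close>
  comes back halved. The truncation at \<open>N\<close> ensures that some finite \<open>X\<close>
  exists to begin with.\<close>

lemma john_nirenberg_step:
  fixes q N X :: real and b :: "'a \<Rightarrow> 'k::{banach, second_countable_topology}"
  defines "\<tau> \<equiv> 10 * 2 powr q * Kc"
  assumes b: "BMO1 b" and q: "0 \<le> q" and X: "0 \<le> X" and N: "0 \<le> N"
    and IH: "\<And>a h y. 0 < h \<Longrightarrow>
      (\<integral>\<^sup>+x\<in>cube a h y. ennreal (min (norm (b x - cube_mean b a h y)) N powr q) \<partial>M) \<le>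
      ennreal X * emeasure M (cube a h y)"
    and h: "0 < h"
  shows "(\<integral>\<^sup>+x\<in>cube a h y. ennreal (min (norm (b x - cube_mean b a h y)) N powr q) \<partial>M) \<le>
      ennreal (\<tau> powr q + (Kc + Kc * \<tau>) powr q + X / 2) * emeasure M (cube a h y)"
proof -
  let ?Q = "cube a h y" and ?c = "cube_mean b a h y"
  let ?f = "\<lambda>x. norm (b x - ?c)"
  let ?m = "emeasure M ?Q"
  have [measurable]: "b \<in> borel_measurable M" using b by (simp add: BMO1_def)
  have q1: "1 \<le> 2 powr q" using q by (simp add: ge_one_powr_ge_zero)
  have \<tau>: "0 < \<tau>" using Kc_pos q1 by (simp add: \<tau>_def)
  have Qm: "?Q \<in> sets M" by simp
  have m: "0 < ?m" "?m < \<infinity>" using emeasure_cube_pos[OF h] cube_finite[OF h] by auto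
  obtain m' where m': "?m = ennreal m'" "0 < m'"
    using m emeasure_eq_ennreal_measure[of M ?Q] by (auto simp: less_top zero_less_measure_iff)
  define E where "E = {x\<in>?Q. \<tau> < ?f x}"
  have Emeas: "E \<in> sets borel" 
  proof -
    have "{x\<in>space M. \<tau> < ?f x} \<in> sets M" by measurable
    then have "{x. \<tau> < ?f x} \<in> sets borel" by simp
    then have "?Q \<inter> {x. \<tau> < ?f x} \<in> sets borel" by (intro sets.Int) auto
    then show ?thesis by (simp add: E_def Int_def)
  qed
  have "emeasure M E \<le> ennreal (1 / \<tau>) * (\<integral>\<^sup>+x\<in>?Q. ennreal (?f x) \<partial>M)"
    unfolding E_def using \<tau> by (intro set_markov) auto
  also have "\<dots> \<le> ennreal (1 / \<tau>) * (ennreal Kc * ?m)"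
    by (intro mult_left_mono BMO1_cube b h) auto
  also have "\<dots> = ennreal (Kc * m' / \<tau>)"
    using m' \<tau> Kc_pos by (simp add: ennreal_mult'[symmetric])
  finally have Em: "emeasure M E \<le> ennreal (Kc * m' / \<tau>)" .
  have "bounded E" by (rule bounded_subset[OF bounded_cube[OF h]]) (auto simp: E_def)
  moreover have "0 < Kc * m' / \<tau>" using m' \<tau> Kc_pos by simp
  ultimately obtain U where U: "open U" "E \<subseteq> U" "emeasure M U \<le> emeasure M E + ennreal (Kc * m' / \<tau>)"
    using outer_open[OF Emeas, of "Kc * m' / \<tau>"] by blast
  have Um: "emeasure M U \<le> ennreal (2 * Kc * m' / \<tau>)"
  proof -
    have "emeasure M U \<le> ennreal (Kc * m' / \<tau>) + ennreal (Kc * m' / \<tau>)"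
      by (rule order_trans[OF U(3) add_right_mono[OF Em]])
    also have "\<dots> = ennreal (2 * Kc * m' / \<tau>)"
      using m' \<tau> Kc_pos by (subst ennreal_plus[symmetric]) auto
    finally show ?thesis .
  qed
  have [measurable]: "U \<in> sets M" using U by simp
  define v where "v x = ennreal (?f x) + ennreal (2 * \<tau>) * indicator U x" for x
  have [measurable]: "v \<in> borel_measurable M" unfolding v_def by measurable
  have "(\<integral>\<^sup>+x\<in>?Q. v x \<partial>M) = (\<integral>\<^sup>+x\<in>?Q. ennreal (?f x) \<partial>M) + (\<integral>\<^sup>+x\<in>?Q. ennreal (2 * \<tau>) * indicator U x \<partial>M)"
    unfolding v_def by (rule nn_set_integral_add) measurable
  also have "\<dots> \<le> ennreal Kc * ?m + (\<integral>\<^sup>+x. ennreal (2 * \<tau>) * indicator U x \<partial>M)"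
    by (intro add_mono BMO1_cube b h nn_integral_mono) (auto split: split_indicator)
  also have "\<dots> = ennreal Kc * ?m + ennreal (2 * \<tau>) * emeasure M U"
    by (subst nn_integral_cmult_indicator) measurable
  also have "\<dots> \<le> ennreal Kc * ?m + ennreal (2 * \<tau>) * ennreal (2 * Kc * m' / \<tau>)"
    by (intro add_left_mono mult_left_mono Um) auto
  also have "\<dots> = ennreal (5 * Kc) * ?m"
    using m' \<tau> Kc_pos by (simp add: ennreal_mult'[symmetric] ennreal_plus[symmetric] field_simps del: ennreal_plus)
  \<comment> \<open>\<open>Kc\<close> comes from the oscillation of \<open>b\<close> and
    \<open>4 * Kc\<close> from the height \<open>2 * \<tau>\<close> on \<open>U\<close>, whose
    measure is at most twice the Markov bound for \<open>E\<close>.\<close>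
  finally have v5: "(\<integral>\<^sup>+x\<in>?Q. v x \<partial>M) \<le> ennreal (5 * Kc) * ?m" .
  also have "\<dots> \<le> ennreal \<tau> * ?m"
    using q1 Kc_pos by (intro mult_right_mono ennreal_leI) (auto simp: \<tau>_def)
  finally have base: "(\<integral>\<^sup>+x\<in>?Q. v x \<partial>M) \<le> ennreal \<tau> * ?m" .
  obtain Q :: "nat \<Rightarrow> 'a set" where Q: "disjoint_family Q" "\<And>i. Q i \<in> sets borel" "\<And>i. Q i \<subseteq> ?Q"
    "\<And>i. Q i \<noteq> {} \<Longrightarrow> \<exists>j y. Q i = cube a (h / 2 ^ j) y"
    "\<And>i. ennreal \<tau> * emeasure M (Q i) \<le> (\<integral>\<^sup>+x\<in>Q i. v x \<partial>M)"
    "\<And>i. (\<integral>\<^sup>+x\<in>Q i. v x \<partial>M) \<le> ennreal (Kc * \<tau>) * emeasure M (Q i)"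
    "\<And>U. open U \<Longrightarrow> (\<And>y. y \<in> U \<Longrightarrow> ennreal (2 * \<tau>) \<le> v y) \<Longrightarrow> U \<inter> ?Q \<subseteq> (\<Union>i. Q i)"
    by (rule calderon_zygmund[OF h \<open>v \<in> borel_measurable M\<close> \<tau> base]) blast
  have Qm[measurable]: "Q i \<in> sets M" for i using Q(2) by simp
  let ?V = "\<Union>i. Q i"
  have V[measurable]: "?V \<in> sets M" using Qm by blast
  have "E \<subseteq> ?V" using Q(7)[OF U(1)] U(2) by (force simp: v_def E_def)
  let ?g = "\<lambda>x. ennreal (min (?f x) N powr q)"
  have piece: "(\<integral>\<^sup>+x\<in>Q i. ?g x \<partial>M) \<le> ennreal (2 powr q * (X + (Kc + Kc * \<tau>) powr q)) * emeasure M (Q i)" for i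
  proof (cases "Q i = {}")
    case False
    then obtain j y' where Qi: "Q i = cube a (h / 2 ^ j) y'" using Q(4) by blast
    have h': "0 < h / 2 ^ j" using h by simp
    let ?c' = "cube_mean b a (h / 2 ^ j) y'"
    \<comment> \<open>On \<open>Q i\<close> the cell's own constant is good by
      \<open>BMO1_cube\<close>, and the constant of the large cell is good with
      \<open>Kc * \<tau>\<close> because \<open>v\<close> dominates the oscillation and the stopping
      rule bounds the average of \<open>v\<close> from above.\<close>
    have "norm (?c' - ?c) \<le> Kc + Kc * \<tau>"
    proof (rule norm_diff_le_of_oscillations[of b M "Q i"])
      show "0 < emeasure M (Q i)" "emeasure M (Q i) < \<infinity>"
        unfolding Qi using emeasure_cube_pos[OF h'] cube_finite[OF h'] by auto
      show "(\<integral>\<^sup>+y\<in>Q i. ennreal (norm (b y - ?c')) \<partial>M) \<le> ennreal Kc * emeasure M (Q i)"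
        unfolding Qi by (rule BMO1_cube[OF b h'])
      have "(\<integral>\<^sup>+y\<in>Q i. ennreal (?f y) \<partial>M) \<le> (\<integral>\<^sup>+y\<in>Q i. v y \<partial>M)"
        by (rule nn_set_integral_le) (simp add: v_def)
      also note Q(6)[of i]
      finally show "(\<integral>\<^sup>+y\<in>Q i. ennreal (?f y) \<partial>M) \<le> ennreal (Kc * \<tau>) * emeasure M (Q i)" .
    qed (use Qm Kc_pos \<tau> in auto)
    then have d: "?f x \<le> norm (b x - ?c') + (Kc + Kc * \<tau>)" for x
      using norm_triangle_ineq[of "b x - ?c'" "?c' - ?c"] by simp
    have KK: "0 < Kc + Kc * \<tau>" using Kc_pos \<tau> by (simp add: add_pos_pos)
    have "(\<integral>\<^sup>+x\<in>Q i. ?g x \<partial>M) \<le>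
      (\<integral>\<^sup>+x\<in>Q i. ennreal (2 powr q) * ennreal (min (norm (b x - ?c')) N powr q) + ennreal (2 powr q * (Kc + Kc * \<tau>) powr q) \<partial>M)"
    proof (rule nn_set_integral_le)
      fix x
      have "min (?f x) N powr q \<le> (min (norm (b x - ?c')) N + (Kc + Kc * \<tau>)) powr q"
        using d[of x] N KK q by (intro powr_mono2) (auto simp: min_def)
      also have "\<dots> \<le> 2 powr q * (min (norm (b x - ?c')) N powr q + (Kc + Kc * \<tau>) powr q)"
        using N Kc_pos \<tau> q by (intro powr_add_le) auto
      finally show "?g x \<le> ennreal (2 powr q) * ennreal (min (norm (b x - ?c')) N powr q) + ennreal (2 powr q * (Kc + Kc * \<tau>) powr q)"
        by (simp add: ennreal_mult'[symmetric] ennreal_plus[symmetric] distrib_left del: ennreal_plus)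
    qed
    also have "\<dots> = ennreal (2 powr q) * (\<integral>\<^sup>+x\<in>Q i. ennreal (min (norm (b x - ?c')) N powr q) \<partial>M)
      + ennreal (2 powr q * (Kc + Kc * \<tau>) powr q) * emeasure M (Q i)"
      by (subst nn_set_integral_add) (measurable, auto simp: nn_set_integral_const mult.assoc nn_integral_cmult Q(2))
    also have "\<dots> \<le> ennreal (2 powr q) * (ennreal X * emeasure M (Q i))
      + ennreal (2 powr q * (Kc + Kc * \<tau>) powr q) * emeasure M (Q i)"
      unfolding Qi by (intro add_right_mono mult_left_mono IH h') auto
    also have "\<dots> = ennreal (2 powr q * (X + (Kc + Kc * \<tau>) powr q)) * emeasure M (Q i)"
      using X by (simp add: distrib_left distrib_right ennreal_mult mult_ac)
    finally show ?thesis .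
  qed simp
  have sumQ: "ennreal \<tau> * (\<Sum>i. emeasure M (Q i)) \<le> ennreal (5 * Kc) * ?m"
  proof -
    have "ennreal \<tau> * (\<Sum>i. emeasure M (Q i)) = (\<Sum>i. ennreal \<tau> * emeasure M (Q i))" by simp
    also have "\<dots> \<le> (\<Sum>i. \<integral>\<^sup>+x\<in>Q i. v x \<partial>M)" by (intro suminf_le Q(5)) auto
    also have "\<dots> = (\<integral>\<^sup>+x\<in>?V. v x \<partial>M)"
      by (rule nn_integral_disjoint_family[symmetric]) (use Qm Q(1) \<open>v \<in> borel_measurable M\<close> in blast)+
    also have "\<dots> \<le> (\<integral>\<^sup>+x\<in>?Q. v x \<partial>M)" by (rule nn_set_integral_subset) (use Q(3) in auto)
    finally show ?thesis using v5 by simp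
  qed
  then have "ennreal (1 / \<tau>) * (ennreal \<tau> * (\<Sum>i. emeasure M (Q i))) \<le> ennreal (1 / \<tau>) * (ennreal (5 * Kc) * ?m)"
    by (rule mult_left_mono) simp
  \<comment> \<open>\<open>5 * Kc / \<tau> = 1 / (2 * 2 powr q)\<close>: the factor
    \<open>2 powr q\<close> lost in \<open>powr_add_le\<close> is cancelled and one half is left
    over.\<close>
  then have sumQ': "(\<Sum>i. emeasure M (Q i)) \<le> ennreal (1 / (2 * 2 powr q)) * ?m"
    using \<tau> Kc_pos by (simp add: mult.assoc[symmetric] ennreal_mult'[symmetric]) (simp add: \<tau>_def)
  have QV: "?Q - ?V \<in> sets M" by measurable
  have "(\<integral>\<^sup>+x\<in>?Q. ?g x \<partial>M) \<le> (\<integral>\<^sup>+x. ?g x * indicator (?Q - ?V) x + ?g x * indicator ?V x \<partial>M)"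
    by (intro nn_integral_mono) (auto split: split_indicator)
  also have "\<dots> = (\<integral>\<^sup>+x\<in>?Q - ?V. ?g x \<partial>M) + (\<integral>\<^sup>+x\<in>?V. ?g x \<partial>M)"
    by (rule nn_integral_add) measurable
  also have "\<dots> \<le> (\<integral>\<^sup>+x\<in>?Q - ?V. ennreal (\<tau> powr q) \<partial>M) + (\<Sum>i. \<integral>\<^sup>+x\<in>Q i. ?g x \<partial>M)"
  proof (rule add_mono)
    show "(\<integral>\<^sup>+x\<in>?Q - ?V. ?g x \<partial>M) \<le> (\<integral>\<^sup>+x\<in>?Q - ?V. ennreal (\<tau> powr q) \<partial>M)"
    proof (intro nn_set_integral_le ennreal_leI powr_mono2 q)
      fix x assume "x \<in> ?Q - ?V"
      then show "min (?f x) N \<le> \<tau>" using \<open>E \<subseteq> ?V\<close> by (force simp: E_def)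
    qed (use N in auto)
    show "(\<integral>\<^sup>+x\<in>?V. ?g x \<partial>M) \<le> (\<Sum>i. \<integral>\<^sup>+x\<in>Q i. ?g x \<partial>M)"
      using Qm Q(1) by (subst nn_integral_disjoint_family) measurable
  qed
  also have "\<dots> \<le> ennreal (\<tau> powr q) * ?m + (\<Sum>i. ennreal (2 powr q * (X + (Kc + Kc * \<tau>) powr q)) * emeasure M (Q i))"
  proof (intro add_mono suminf_le piece)
    show "(\<integral>\<^sup>+x\<in>?Q - ?V. ennreal (\<tau> powr q) \<partial>M) \<le> ennreal (\<tau> powr q) * ?m"
    proof -
      have "(\<integral>\<^sup>+x\<in>?Q - ?V. ennreal (\<tau> powr q) \<partial>M) = ennreal (\<tau> powr q) * emeasure M (?Q - ?V)"
        by (rule nn_set_integral_const[OF QV])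
      also have "\<dots> \<le> ennreal (\<tau> powr q) * ?m" by (intro mult_left_mono emeasure_mono) auto
      finally show ?thesis .
    qed
  qed auto
  also have "\<dots> = ennreal (\<tau> powr q) * ?m + ennreal (2 powr q * (X + (Kc + Kc * \<tau>) powr q)) * (\<Sum>i. emeasure M (Q i))"
    by simp
  also have "\<dots> \<le> ennreal (\<tau> powr q) * ?m + ennreal (2 powr q * (X + (Kc + Kc * \<tau>) powr q)) * (ennreal (1 / (2 * 2 powr q)) * ?m)"
    by (intro add_left_mono mult_left_mono sumQ') auto
  also have "\<dots> = ennreal (\<tau> powr q + (X + (Kc + Kc * \<tau>) powr q) / 2) * ?m"
  proof -
    have "2 powr q * (X + (Kc + Kc * \<tau>) powr q) * (1 / (2 * 2 powr q)) = (X + (Kc + Kc * \<tau>) powr q) / 2"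
      using q1 by simp
    then have "ennreal (2 powr q * (X + (Kc + Kc * \<tau>) powr q)) * (ennreal (1 / (2 * 2 powr q)) * ?m) =
      ennreal ((X + (Kc + Kc * \<tau>) powr q) / 2) * ?m"
      using X by (simp only: mult.assoc[symmetric]) (subst ennreal_mult[symmetric], auto)
    moreover have "ennreal (\<tau> powr q + (X + (Kc + Kc * \<tau>) powr q) / 2) =
      ennreal (\<tau> powr q) + ennreal ((X + (Kc + Kc * \<tau>) powr q) / 2)"
      using X by (intro ennreal_plus) auto
    ultimately show ?thesis by (simp only: distrib_right)
  qed
  also have "\<dots> \<le> ennreal (\<tau> powr q + (Kc + Kc * \<tau>) powr q + X / 2) * ?m"
    using X by (intro mult_right_mono ennreal_leI) (auto simp: field_simps)
  finally show ?thesis .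
qed

text \<open>The map \<open>X\<close> to \<open>A + X / 2\<close> of the preceding step has the fixed
  point \<open>2 * A\<close>. Started from the trivial bound \<open>N powr q\<close>,
  \<open>n\<close> iterations give \<open>2 * A + N powr q / 2 ^ n\<close>. Letting \<open>n\<close>
  tend to infinity removes the dependence on \<open>N\<close>, after which the truncation is removed
  by monotone convergence.\<close>

lemma john_nirenberg_cube:
  assumes q: "0 \<le> q"
  shows "\<exists>C\<ge>0. \<forall>b::'a \<Rightarrow> 'k::{banach, second_countable_topology}. BMO1 b \<longrightarrow> (\<forall>a h y. 0 < h \<longrightarrow>
    (\<integral>\<^sup>+x\<in>cube a h y. ennreal (norm (b x - cube_mean b a h y) powr q) \<partial>M) \<le> ennreal C * emeasure M (cube a h y))"
proof -
  let ?\<tau> = "10 * 2 powr q * Kc"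
  define A where "A = ?\<tau> powr q + (Kc + Kc * ?\<tau>) powr q"
  have A: "0 \<le> A" by (simp add: A_def)
  show ?thesis
  proof (intro exI[of _ "2 * A"] conjI allI impI)
    show "0 \<le> 2 * A" using A by simp
    fix b :: "'a \<Rightarrow> 'k" and a :: 'a and h :: real and y :: 'a
    assume b: "BMO1 b" and h: "0 < h"
    have [measurable]: "b \<in> borel_measurable M" using b by (simp add: BMO1_def)
    have step: "(\<integral>\<^sup>+x\<in>cube a h y. ennreal (min (norm (b x - cube_mean b a h y)) N powr q) \<partial>M) \<le>
      ennreal (2 * A + N powr q / 2 ^ n) * emeasure M (cube a h y)" if N: "0 \<le> N" and "0 < h" for n N a h y
      using \<open>0 < h\<close>
    proof (induction n arbitrary: a h y)
      case 0
      have "(\<integral>\<^sup>+x\<in>cube a h y. ennreal (min (norm (b x - cube_mean b a h y)) N powr q) \<partial>M) \<le>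
        (\<integral>\<^sup>+x\<in>cube a h y. ennreal (N powr q) \<partial>M)"
        using q N by (intro nn_set_integral_le ennreal_leI powr_mono2) auto
      also have "\<dots> = ennreal (N powr q) * emeasure M (cube a h y)" by (simp add: nn_set_integral_const)
      also have "\<dots> \<le> ennreal (2 * A + N powr q / 2 ^ 0) * emeasure M (cube a h y)"
        using A by (intro mult_right_mono ennreal_leI) auto
      finally show ?case .
    next
      case (Suc n)
      have X: "0 \<le> 2 * A + N powr q / 2 ^ n" using A by simp
      have "2 * A + N powr q / 2 ^ Suc n = ?\<tau> powr q + (Kc + Kc * ?\<tau>) powr q + (2 * A + N powr q / 2 ^ n) / 2"
        by (simp add: A_def field_simps)
      then show ?case
        using john_nirenberg_step[OF b q X N Suc.IH Suc.prems, of a y] by (simp only:)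
    qed
    let ?m = "measure M (cube a h y)"
    have m: "emeasure M (cube a h y) = ennreal ?m"
      using cube_finite[OF h, of a y] by (intro emeasure_eq_ennreal_measure) auto
    have lim: "(\<integral>\<^sup>+x\<in>cube a h y. ennreal (min (norm (b x - cube_mean b a h y)) N powr q) \<partial>M) \<le>
      ennreal (2 * A * ?m)" if N: "0 \<le> N" for N
    proof (rule LIMSEQ_le_const)
      have "(\<lambda>n. (2 * A + N powr q * (1 / 2) ^ n) * ?m) \<longlonglongrightarrow> (2 * A + N powr q * 0) * ?m"
        by (intro tendsto_intros LIMSEQ_power_zero) auto
      then have "(\<lambda>n. (2 * A + N powr q / 2 ^ n) * ?m) \<longlonglongrightarrow> 2 * A * ?m"
        by (simp add: power_divide)
      then show "(\<lambda>n. ennreal ((2 * A + N powr q / 2 ^ n) * ?m)) \<longlonglongrightarrow> ennreal (2 * A * ?m)"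
        by (rule tendsto_ennrealI)
      show "\<exists>k. \<forall>n\<ge>k. (\<integral>\<^sup>+x\<in>cube a h y. ennreal (min (norm (b x - cube_mean b a h y)) N powr q) \<partial>M) \<le> ennreal ((2 * A + N powr q / 2 ^ n) * ?m)"
        using step[OF N h, of a y] A by (simp add: m ennreal_mult'')
    qed
    have "(\<integral>\<^sup>+x\<in>cube a h y. ennreal (norm (b x - cube_mean b a h y) powr q) \<partial>M) \<le>
      (\<integral>\<^sup>+x. (SUP N::nat. ennreal (min (norm (b x - cube_mean b a h y)) (real N) powr q) * indicator (cube a h y) x) \<partial>M)"
    proof (rule nn_integral_mono)
      fix x
      obtain N :: nat where "norm (b x - cube_mean b a h y) \<le> real N" using real_arch_simple by blast
      then show "ennreal (norm (b x - cube_mean b a h y) powr q) * indicator (cube a h y) x \<le>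
        (SUP N::nat. ennreal (min (norm (b x - cube_mean b a h y)) (real N) powr q) * indicator (cube a h y) x)"
        by (intro SUP_upper2[of N]) (auto simp: min_def)
    qed
    also have "\<dots> = (SUP N::nat. \<integral>\<^sup>+x\<in>cube a h y. ennreal (min (norm (b x - cube_mean b a h y)) (real N) powr q) \<partial>M)"
    proof (rule nn_integral_monotone_convergence_SUP)
      show "incseq (\<lambda>N x. ennreal (min (norm (b x - cube_mean b a h y)) (real N) powr q) * indicator (cube a h y) x)"
        using q by (intro incseq_SucI le_funI mult_right_mono ennreal_leI powr_mono2) (auto simp: min_def)
    qed measurable
    also have "\<dots> \<le> ennreal (2 * A * ?m)" by (intro SUP_least lim) auto
    finally show "(\<integral>\<^sup>+x\<in>cube a h y. ennreal (norm (b x - cube_mean b a h y) powr q) \<partial>M) \<le> ennreal (2 * A) * emeasure M (cube a h y)"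
      using A by (simp add: m ennreal_mult'')
  qed
qed

lemma oscillation_change_center:
  fixes b :: "'a \<Rightarrow> 'k::{banach, second_countable_topology}"
  assumes [measurable]: "b \<in> borel_measurable M" "S \<in> sets M" and q: "0 \<le> q" and C: "0 \<le> C"
    and d: "norm (c - c') \<le> d" and m: "emeasure M S \<le> m"
    and S: "(\<integral>\<^sup>+x\<in>S. ennreal (norm (b x - c) powr q) \<partial>M) \<le> ennreal C * m"
  shows "(\<integral>\<^sup>+x\<in>S. ennreal (norm (b x - c') powr q) \<partial>M) \<le> ennreal (2 powr q * (C + d powr q)) * m"
proof -
  have d0: "0 \<le> d" using d norm_ge_zero order_trans by blast
  have "(\<integral>\<^sup>+x\<in>S. ennreal (norm (b x - c') powr q) \<partial>M) \<le>
      (\<integral>\<^sup>+x\<in>S. ennreal (2 powr q) * ennreal (norm (b x - c) powr q) + ennreal (2 powr q * d powr q) \<partial>M)"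
  proof (rule nn_set_integral_le)
    fix x
    have "norm (b x - c') powr q \<le> (norm (b x - c) + d) powr q"
      using d norm_triangle_ineq[of "b x - c" "c - c'"] q by (intro powr_mono2) auto
    also have "\<dots> \<le> 2 powr q * (norm (b x - c) powr q + d powr q)"
      using d0 q by (intro powr_add_le) auto
    finally show "ennreal (norm (b x - c') powr q) \<le> ennreal (2 powr q) * ennreal (norm (b x - c) powr q) + ennreal (2 powr q * d powr q)"
      by (simp add: ennreal_mult'[symmetric] ennreal_plus[symmetric] distrib_left del: ennreal_plus)
  qed
  also have "\<dots> = ennreal (2 powr q) * (\<integral>\<^sup>+x\<in>S. ennreal (norm (b x - c) powr q) \<partial>M) + ennreal (2 powr q * d powr q) * emeasure M S"
    by (subst nn_set_integral_add) (measurable, simp add: nn_set_integral_const[OF assms(2)] mult.assoc nn_integral_cmult)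
  also have "\<dots> \<le> ennreal (2 powr q) * (ennreal C * m) + ennreal (2 powr q * d powr q) * m"
    by (intro add_mono mult_left_mono S m) auto
  also have "\<dots> = ennreal (2 powr q * (C + d powr q)) * m"
    using C by (simp add: distrib_left distrib_right ennreal_mult mult_ac)
  finally show ?thesis .
qed

text \<open>The ball lies in the concentric cell of side \<open>2 * r\<close>, which is at most
  \<open>Kc\<close> times as large, and the two constants differ by at most
  \<open>Kc * Kc + 1\<close>.\<close>

lemma john_nirenberg_ball:
  assumes q: "0 \<le> q"
  shows "\<exists>C\<ge>0. \<forall>b::'a \<Rightarrow> 'k::{banach, second_countable_topology}. BMO1 b \<longrightarrow> (\<forall>x r. 0 < r \<longrightarrow>
    (\<integral>\<^sup>+y\<in>ball x r. ennreal (norm (b y - mean M (ball x r) b) powr q) \<partial>M) \<le> ennreal C * emeasure M (ball x r))"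
proof -
  obtain C where C: "0 \<le> C" "\<And>(b::'a \<Rightarrow> 'k) a h y. BMO1 b \<Longrightarrow> 0 < h \<Longrightarrow>
    (\<integral>\<^sup>+x\<in>cube a h y. ennreal (norm (b x - cube_mean b a h y) powr q) \<partial>M) \<le> ennreal C * emeasure M (cube a h y)"
    using john_nirenberg_cube[OF q, where 'k='k] by blast
  show ?thesis
  proof (intro exI[of _ "2 powr q * (C * Kc + (Kc * Kc + 1) powr q)"] conjI allI impI)
    show "0 \<le> 2 powr q * (C * Kc + (Kc * Kc + 1) powr q)" using C(1) Kc_pos by simp
    fix b :: "'a \<Rightarrow> 'k" and x :: 'a and r :: real
    assume b: "BMO1 b" and r: "0 < r"
    have [measurable]: "b \<in> borel_measurable M" using b by (simp add: BMO1_def)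
    define a where "a = x - r *\<^sub>R One"
    have cc: "cube_center a (2 * r) x = x" unfolding a_def by (rule cube_center_centered[OF r])
    let ?Q = "cube a (2 * r) x" and ?c = "cube_mean b a (2 * r) x" and ?B = "ball x r"
    have h: "0 < 2 * r" using r by simp
    have BQ: "?B \<subseteq> ?Q"
      using ball_subset_cube[OF h, of a x] cc by simp
    have Qm: "emeasure M ?Q \<le> ennreal Kc * emeasure M ?B"
    proof -
      have "emeasure M ?Q \<le> emeasure M (ball x ((8 * real DIM('a)) * r))"
        using cube_subset_ball[OF h, of a x] r unfolding cc
        by (intro emeasure_mono) (auto simp: subset_iff intro: less_le_trans)
      also have "\<dots> \<le> ennreal Kc * emeasure M ?B"
        unfolding Kc_def using r DIM_positive[where 'a='a] by (intro ball_dilate) linarith+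
      finally show ?thesis .
    qed
    have "norm (?c - mean M ?B b) \<le> Kc * Kc + 1"
    proof (rule norm_diff_le_of_oscillations[of b M ?B])
      show "0 < emeasure M ?B" "emeasure M ?B < \<infinity>" using ball_pos[OF r] ball_finite by auto
      have "(\<integral>\<^sup>+y\<in>?B. ennreal (norm (b y - ?c)) \<partial>M) \<le> (\<integral>\<^sup>+y\<in>?Q. ennreal (norm (b y - ?c)) \<partial>M)"
        by (rule nn_set_integral_subset[OF BQ])
      also have "\<dots> \<le> ennreal Kc * emeasure M ?Q" by (rule BMO1_cube[OF b h])
      also have "\<dots> \<le> ennreal Kc * (ennreal Kc * emeasure M ?B)" by (intro mult_left_mono Qm) auto
      finally show "(\<integral>\<^sup>+y\<in>?B. ennreal (norm (b y - ?c)) \<partial>M) \<le> ennreal (Kc * Kc) * emeasure M ?B"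
        using Kc_pos by (simp add: ennreal_mult mult.assoc)
      show "(\<integral>\<^sup>+y\<in>?B. ennreal (norm (b y - mean M ?B b)) \<partial>M) \<le> ennreal 1 * emeasure M ?B"
        using b r by (simp add: BMO1_def)
    qed (use Kc_pos in auto)
    then show "(\<integral>\<^sup>+y\<in>?B. ennreal (norm (b y - mean M ?B b) powr q) \<partial>M) \<le>
      ennreal (2 powr q * (C * Kc + (Kc * Kc + 1) powr q)) * emeasure M ?B"
    proof (rule oscillation_change_center[rotated 4])
      have "(\<integral>\<^sup>+y\<in>?B. ennreal (norm (b y - ?c) powr q) \<partial>M) \<le> (\<integral>\<^sup>+y\<in>?Q. ennreal (norm (b y - ?c) powr q) \<partial>M)"
        by (rule nn_set_integral_subset[OF BQ])
      also have "\<dots> \<le> ennreal C * emeasure M ?Q" by (rule C(2)[OF b h])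
      also have "\<dots> \<le> ennreal C * (ennreal Kc * emeasure M ?B)" by (intro mult_left_mono Qm) auto
      finally show "(\<integral>\<^sup>+y\<in>?B. ennreal (norm (b y - ?c) powr q) \<partial>M) \<le> ennreal (C * Kc) * emeasure M ?B"
        using Kc_pos C by (simp add: ennreal_mult mult.assoc)
    qed (use q C Kc_pos in auto)
  qed
qed

text \<open>Consecutive dyadic dilates have means at bounded distance, and \<open>j\<close> of them
  are telescoped. This linear growth is the origin of the factor \<open>j ^ k\<close> in the
  summability hypothesis.\<close>

lemma BMO1_mean_dilate:
  assumes b: "BMO1 b" and r: "0 < r"
  shows "norm (mean M (ball x (2 ^ j * r)) b - mean M (ball x r) b) \<le> real j * (1 + Cd * 2 powr D)"
proof (induction j)
  case (Suc j)
  let ?R = "2 ^ j * r"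
  have R: "0 < ?R" using r by simp
  have [measurable]: "b \<in> borel_measurable M" using b by (simp add: BMO1_def)
  have "norm (mean M (ball x ?R) b - mean M (ball x (2 * ?R)) b) \<le> 1 + Cd * 2 powr D"
  proof (rule norm_diff_le_of_oscillations[of b M "ball x ?R"])
    show "0 < emeasure M (ball x ?R)" "emeasure M (ball x ?R) < \<infinity>" using ball_pos[OF R] ball_finite by auto
    show "(\<integral>\<^sup>+y\<in>ball x ?R. ennreal (norm (b y - mean M (ball x ?R) b)) \<partial>M) \<le> ennreal 1 * emeasure M (ball x ?R)"
      using b R by (simp add: BMO1_def)
    have "(\<integral>\<^sup>+y\<in>ball x ?R. ennreal (norm (b y - mean M (ball x (2 * ?R)) b)) \<partial>M)
      \<le> (\<integral>\<^sup>+y\<in>ball x (2 * ?R). ennreal (norm (b y - mean M (ball x (2 * ?R)) b)) \<partial>M)"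
      using r by (intro nn_set_integral_subset subset_ball) auto
    also have "\<dots> \<le> emeasure M (ball x (2 * ?R))" using b R by (simp add: BMO1_def)
    also have "\<dots> \<le> ennreal (Cd * 2 powr D) * emeasure M (ball x ?R)"
      using R by (intro ball_dilate) auto
    finally show "(\<integral>\<^sup>+y\<in>ball x ?R. ennreal (norm (b y - mean M (ball x (2 * ?R)) b)) \<partial>M) \<le>
      ennreal (Cd * 2 powr D) * emeasure M (ball x ?R)" .
  qed (use Cd_ge_1 in auto)
  then have "norm (mean M (ball x (2 * ?R)) b - mean M (ball x ?R) b) \<le> 1 + Cd * 2 powr D"
    by (simp add: norm_minus_commute)
  moreover have "norm (mean M (ball x (2 * ?R)) b - mean M (ball x r) b) \<le>
    norm (mean M (ball x (2 * ?R)) b - mean M (ball x ?R) b) + norm (mean M (ball x ?R) b - mean M (ball x r) b)"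
    using norm_triangle_ineq[of "mean M (ball x (2 * ?R)) b - mean M (ball x ?R) b" "mean M (ball x ?R) b - mean M (ball x r) b"] by simp
  ultimately show ?case using Suc.IH by (simp add: distrib_right mult.assoc)
qed simp

lemma john_nirenberg_dilate:
  assumes q: "0 \<le> q"
  shows "\<exists>C\<ge>1. \<forall>b::'a \<Rightarrow> 'k::{banach, second_countable_topology}. BMO1 b \<longrightarrow> (\<forall>x r j. 0 < r \<longrightarrow>
    (\<integral>\<^sup>+y\<in>ball x (2 ^ j * r). ennreal (norm (b y - mean M (ball x r) b) powr q) \<partial>M) \<le>
     ennreal (C * (1 + real j) powr q) * emeasure M (ball x (2 ^ j * r)))"
proof -
  obtain C where C: "0 \<le> C" "\<And>(b::'a \<Rightarrow> 'k) x r. BMO1 b \<Longrightarrow> 0 < r \<Longrightarrow>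
    (\<integral>\<^sup>+y\<in>ball x r. ennreal (norm (b y - mean M (ball x r) b) powr q) \<partial>M) \<le> ennreal C * emeasure M (ball x r)"
    using john_nirenberg_ball[OF q, where 'k='k] by blast
  define E where "E = 1 + Cd * 2 powr D"
  have E: "0 < E" using Cd_ge_1 by (simp add: E_def add_pos_nonneg)
  define C' where "C' = 2 powr q * (C + E powr q) + 1"
  show ?thesis
  proof (intro exI[of _ C'] conjI allI impI)
    show "1 \<le> C'" using C(1) by (simp add: C'_def)
    fix b :: "'a \<Rightarrow> 'k" and x :: 'a and r :: real and j :: nat
    assume b: "BMO1 b" and r: "0 < r"
    let ?R = "2 ^ j * r"
    have R: "0 < ?R" using r by simp
    have "(\<integral>\<^sup>+y\<in>ball x ?R. ennreal (norm (b y - mean M (ball x r) b) powr q) \<partial>M) \<le>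
     ennreal (2 powr q * (C + (real j * E) powr q)) * emeasure M (ball x ?R)"
      using BMO1_mean_dilate[OF b r, of x j] C(2)[OF b R, of x] C(1) b
      by (intro oscillation_change_center[OF _ _ q]) (auto simp: E_def BMO1_def)
    also have "\<dots> \<le> ennreal (C' * (1 + real j) powr q) * emeasure M (ball x ?R)"
    proof (intro mult_right_mono ennreal_leI)
      have "1 \<le> (1 + real j) powr q" using q by (intro ge_one_powr_ge_zero) auto
      moreover have "(real j) powr q \<le> (1 + real j) powr q" using q by (intro powr_mono2) auto
      ultimately have "C + (real j * E) powr q \<le> C * (1 + real j) powr q + (1 + real j) powr q * E powr q"
        using C(1) E by (intro add_mono) (auto simp: powr_mult mult_le_cancel_left1 intro: mult_right_mono)
      then have "2 powr q * (C + (real j * E) powr q) \<le> 2 powr q * ((C + E powr q) * (1 + real j) powr q)"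
        by (intro mult_left_mono) (auto simp: algebra_simps)
      also have "\<dots> \<le> C' * (1 + real j) powr q"
        by (simp add: C'_def algebra_simps)
      finally show "2 powr q * (C + (real j * E) powr q) \<le> C' * (1 + real j) powr q" .
    qed simp
    finally show "(\<integral>\<^sup>+y\<in>ball x ?R. ennreal (norm (b y - mean M (ball x r) b) powr q) \<partial>M) \<le>
     ennreal (C' * (1 + real j) powr q) * emeasure M (ball x ?R)" .
  qed
qed

end

section \<open>Calderon-Zygmund pieces with bounded weighted overlap\<close>

text \<open>The \<open>p\<close>-th power of the norm of \<open>L^p\<close>; without the root it is
  additive over disjoint parts of \<open>f\<close>.\<close>

definition pmass :: "'a measure \<Rightarrow> real \<Rightarrow> ('a \<Rightarrow> 'k::real_normed_vector) \<Rightarrow> ennreal" where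
  "pmass M p f = (\<integral>\<^sup>+x. ennreal (norm (f x) powr p) \<partial>M)"

lemma ennreal_suminf_tail:
  fixes f :: "nat \<Rightarrow> ennreal"
  assumes fin: "(\<Sum>i. f i) < \<infinity>" and e: "0 < e"
  shows "\<exists>n. (\<Sum>i. f (i + n)) \<le> ennreal e"
proof -
  have ft: "f i < top" for i
  proof -
    have "f i \<le> (\<Sum>i. f i)" using sum_le_suminf[of f "{i}"] by simp
    then show ?thesis using fin by (simp add: le_less_trans)
  qed
  define g where "g i = enn2real (f i)" for i
  have fg: "f i = ennreal (g i)" for i using ft[of i] by (simp add: g_def)
  have g0: "0 \<le> g i" for i by (simp add: g_def)
  have sg: "summable g"
    using fin fg g0 by (intro summable_suminf_not_top) (auto simp: less_top)
  obtain n where "norm (\<Sum>i. g (i + n)) < e"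
    using suminf_exist_split[OF e sg] by blast
  then have "(\<Sum>i. g (i + n)) \<le> e" by simp
  moreover have "(\<Sum>i. f (i + n)) = ennreal (\<Sum>i. g (i + n))"
    using fg g0 sg by (simp add: suminf_ennreal2 summable_iff_shift)
  ultimately show ?thesis by (intro exI[of _ n]) (simp add: ennreal_leI)
qed

lemma one_le_two_power: "(1::real) \<le> 2 * 2 ^ j"
  using one_le_power[of "2::real" "Suc j"] by simp

text \<open>Up to a factor, the pointwise majorant of a function that is of size
  \<open>\<beta> j\<close> on the \<open>j\<close>-th annulus of the ball. Full dilates are used
  instead of annuli, since inclusions between them survive a change of the point.\<close>

definition tower :: "(nat \<Rightarrow> real) \<Rightarrow> 'a::metric_space \<Rightarrow> real \<Rightarrow> 'a \<Rightarrow> ennreal" where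
  "tower \<beta> x r y = (\<Sum>j. ennreal (\<beta> j) * indicator (ball x (2 ^ (j + 1) * r)) y)"

lemma Linf_c_measurable: "f \<in> Linf_c M \<Longrightarrow> f \<in> borel_measurable M"
  by (simp add: Linf_c_def)

lemma Linf_c_bounded: "f \<in> Linf_c M \<Longrightarrow> \<exists>B>0. \<forall>x. norm (f x) \<le> B"
  by (auto simp: Linf_c_def bounded_pos)

lemma Linf_c_support: "f \<in> Linf_c M \<Longrightarrow> bounded {x. f x \<noteq> 0}"
  using bounded_subset[OF compact_imp_bounded closure_subset] by (auto simp: Linf_c_def)

lemma Linf_cI:
  fixes f :: "'a::euclidean_space \<Rightarrow> 'k::real_normed_vector"
  assumes "f \<in> borel_measurable M" "\<And>x. norm (f x) \<le> B" "\<And>x. x \<notin> S \<Longrightarrow> f x = 0" "bounded S"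
  shows "f \<in> Linf_c M"
proof -
  have "bounded {x. f x \<noteq> 0}" using assms(3) by (intro bounded_subset[OF assms(4)]) auto
  then have "compact (closure {x. f x \<noteq> 0})" by (simp add: compact_closure)
  moreover have "bounded (range f)" using assms(2) by (auto simp: bounded_iff)
  ultimately show ?thesis using assms(1) by (simp add: Linf_c_def)
qed

definition restr :: "'a set \<Rightarrow> ('a \<Rightarrow> 'k::zero) \<Rightarrow> 'a \<Rightarrow> 'k" where
  "restr S f x = (if x \<in> S then f x else 0)"

lemma restr_measurable [measurable]:
  fixes f :: "'a \<Rightarrow> 'k::real_normed_vector"
  assumes [measurable]: "f \<in> borel_measurable M" "S \<in> sets M"
  shows "restr S f \<in> borel_measurable M"
proof -
  have "restr S f = (\<lambda>x. if x \<in> S then f x else 0)" by (auto simp: restr_def fun_eq_iff)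
  also have "\<dots> \<in> borel_measurable M"
    by (rule measurable_If_set) (use assms in auto)
  finally show ?thesis .
qed

lemma norm_restr_le: "norm (restr S f x) \<le> norm (f x)"
  by (simp add: restr_def)

lemma Linf_c_restr:
  assumes f: "f \<in> Linf_c M" and S: "S \<in> sets M"
  shows "restr S f \<in> Linf_c M"
proof -
  obtain B where B: "\<And>x. norm (f x) \<le> B" using Linf_c_bounded[OF f] by blast
  show ?thesis
  proof (rule Linf_cI)
    show "restr S f \<in> borel_measurable M" by (intro restr_measurable Linf_c_measurable f S)
    show "norm (restr S f x) \<le> B" for x using B[of x] norm_restr_le[of S f x] by linarith
    show "restr S f x = 0" if "x \<notin> {x. f x \<noteq> 0}" for x using that by (simp add: restr_def)
  qed (rule Linf_c_support[OF f])
qed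

lemma pmass_restr: "0 < p \<Longrightarrow> pmass M p (restr S f) = (\<integral>\<^sup>+x\<in>S. ennreal (norm (f x) powr p) \<partial>M)"
  unfolding pmass_def by (intro nn_integral_cong) (auto simp: restr_def split: split_indicator)

context doubling_measure
begin

lemma tower_measurable [measurable]: "tower \<beta> x r \<in> borel_measurable M"
  unfolding tower_def[abs_def] by measurable

text \<open>Bound for the integral of a tower divided by the measure of its ball: the dilate by
  \<open>2 ^ (j + 1)\<close> costs \<open>Cd * 2 powr (D * (j + 1))\<close>. This is where the
  weight \<open>2 powr (D * j)\<close> of the summability hypothesis is spent.\<close>

definition tower_const :: "(nat \<Rightarrow> real) \<Rightarrow> real" where
  "tower_const \<beta> = Cd * 2 powr D * (\<Sum>j. \<beta> j * 2 powr (D * real j))"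

lemma sum_dilated_balls:
  assumes \<beta>: "\<And>j. 0 \<le> \<beta> j" "summable (\<lambda>j. \<beta> j * 2 powr (D * real j))" and r: "0 < r"
  shows "(\<Sum>j. ennreal (\<beta> j) * emeasure M (ball x (2 ^ (j + 1) * r))) \<le> ennreal (tower_const \<beta>) * emeasure M (ball x r)"
proof -
  have "(\<Sum>j. ennreal (\<beta> j) * emeasure M (ball x (2 ^ (j + 1) * r))) \<le>
    (\<Sum>j. ennreal (Cd * 2 powr D * (\<beta> j * 2 powr (D * real j))) * emeasure M (ball x r))"
  proof (rule suminf_le)
    fix j
    have "(2 ^ (j + 1)) powr D = 2 powr (D * real j) * 2 powr D"
      by (simp add: powr_realpow[symmetric] powr_powr powr_add[symmetric] algebra_simps del: power_Suc)
    then have "emeasure M (ball x (2 ^ (j + 1) * r)) \<le> ennreal (Cd * (2 powr (D * real j) * 2 powr D)) * emeasure M (ball x r)"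
      using ball_dilate[OF r, of "2 ^ (j + 1)" x] one_le_two_power[of j] by simp
    then have "ennreal (\<beta> j) * emeasure M (ball x (2 ^ (j + 1) * r)) \<le>
      ennreal (\<beta> j) * (ennreal (Cd * (2 powr (D * real j) * 2 powr D)) * emeasure M (ball x r))"
      by (rule mult_left_mono) simp
    also have "\<dots> = ennreal (Cd * 2 powr D * (\<beta> j * 2 powr (D * real j))) * emeasure M (ball x r)"
      using \<beta>(1)[of j] Cd_ge_1
      by (subst mult.assoc[symmetric], subst ennreal_mult'[symmetric]) (simp_all add: mult_ac)
    finally show "ennreal (\<beta> j) * emeasure M (ball x (2 ^ (j + 1) * r)) \<le>
      ennreal (Cd * 2 powr D * (\<beta> j * 2 powr (D * real j))) * emeasure M (ball x r)" .
  qed auto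
  also have "\<dots> = (\<Sum>j. ennreal (Cd * 2 powr D * (\<beta> j * 2 powr (D * real j)))) * emeasure M (ball x r)"
    by (rule ennreal_suminf_multc)
  also have "(\<Sum>j. ennreal (Cd * 2 powr D * (\<beta> j * 2 powr (D * real j)))) = ennreal (tower_const \<beta>)"
    unfolding tower_const_def using \<beta> Cd_ge_1
    by (subst suminf_ennreal2) (auto intro!: summable_mult simp: suminf_mult)
  finally show ?thesis .
qed

lemma tower_const_nonneg:
  assumes \<beta>: "\<And>j. 0 \<le> \<beta> j" "summable (\<lambda>j. \<beta> j * 2 powr (D * real j))"
  shows "0 \<le> tower_const \<beta>"
  unfolding tower_const_def using \<beta> Cd_ge_1 by (intro mult_nonneg_nonneg suminf_nonneg) auto

lemma tower_integral:
  assumes \<beta>: "\<And>j. 0 \<le> \<beta> j" "summable (\<lambda>j. \<beta> j * 2 powr (D * real j))" and r: "0 < r"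
  shows "(\<integral>\<^sup>+y. tower \<beta> x r y \<partial>M) \<le> ennreal (tower_const \<beta>) * emeasure M (ball x r)"
proof -
  have "(\<integral>\<^sup>+y. tower \<beta> x r y \<partial>M) = (\<Sum>j. \<integral>\<^sup>+y. ennreal (\<beta> j) * indicator (ball x (2 ^ (j + 1) * r)) y \<partial>M)"
    unfolding tower_def by (rule nn_integral_suminf) measurable
  also have "\<dots> = (\<Sum>j. ennreal (\<beta> j) * emeasure M (ball x (2 ^ (j + 1) * r)))"
    by (intro suminf_cong nn_integral_cmult_indicator) measurable
  also note sum_dilated_balls[OF assms]
  finally show ?thesis .
qed

text \<open>A bound at one good point per ball spreads to all points. For given \<open>y\<close> let
  \<open>z m\<close> be the nearest good point. If \<open>y\<close> lies in the dilate of radius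
  \<open>\<rho> \<ge> r i\<close> about \<open>x i\<close>, then \<open>z m\<close> is no farther
  from \<open>y\<close> than \<open>z i\<close>, hence within \<open>2 * \<rho> + r i\<close> of
  \<open>x i\<close>, and the dilate four times as large contains it.\<close>

lemma finite_towers_bound:
  fixes F :: "nat set"
  assumes F: "finite F" and z: "\<And>i. i \<in> F \<Longrightarrow> z i \<in> ball (x i) (r i)"
    and L: "\<And>i. i \<in> F \<Longrightarrow> (\<Sum>k\<in>F. tower \<beta> (x k) (4 * r k) (z i)) \<le> L"
  shows "(\<Sum>i\<in>F. tower \<beta> (x i) (r i) y) \<le> L"
proof (cases "F = {}")
  case False
  obtain m where m: "m \<in> F" "\<And>i. i \<in> F \<Longrightarrow> dist y (z m) \<le> dist y (z i)"
    using ex_min_if_finite[of "(\<lambda>i. dist y (z i)) ` F"] F False by (metis arg_min_if_finite(1) arg_min_least)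
  have "tower \<beta> (x i) (r i) y \<le> tower \<beta> (x i) (4 * r i) (z m)" if i: "i \<in> F" for i
    unfolding tower_def
  proof (intro suminf_le mult_left_mono)
    fix j
    have "dist (x i) (z m) < 2 ^ (j + 1) * (4 * r i)" if "dist (x i) y < 2 ^ (j + 1) * r i"
    proof -
      have ri: "dist (x i) (z i) < r i" using z[OF i] by simp
      then have r0: "0 < r i" by (meson le_less_trans zero_le_dist)
      have "dist (x i) (z m) \<le> dist (x i) y + dist y (z m)" by (rule dist_triangle)
      also have "\<dots> \<le> dist (x i) y + dist y (z i)" using m(2)[OF i] by simp
      also have "\<dots> \<le> dist (x i) y + (dist (x i) y + dist (x i) (z i))"
        using dist_triangle[of y "z i" "x i"] by (simp add: dist_commute)
      also have "\<dots> < 2 * (2 ^ (j + 1) * r i) + r i" using that ri by simp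
      also have "\<dots> \<le> 2 * (2 ^ (j + 1) * r i) + 2 ^ (j + 1) * r i"
        using r0 one_le_two_power[of j] by (simp add: mult_le_cancel_right1)
      also have "\<dots> \<le> 2 ^ (j + 1) * (4 * r i)" using r0 by simp
      finally show ?thesis .
    qed
    then show "indicator (ball (x i) (2 ^ (j + 1) * r i)) y \<le> (indicator (ball (x i) (2 ^ (j + 1) * (4 * r i))) (z m) :: ennreal)"
      by (auto split: split_indicator)
  qed auto
  then have "(\<Sum>i\<in>F. tower \<beta> (x i) (r i) y) \<le> (\<Sum>i\<in>F. tower \<beta> (x i) (4 * r i) (z m))"
    by (rule sum_mono)
  also have "\<dots> \<le> L" by (rule L[OF m(1)])
  finally show ?thesis .
qed simp

text \<open>
  The overlap bound is enforced by discarding every ball that is contained in the set where the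
  sum of all towers is large; that set has small measure compared with the union of the cubes, so
  that the discarded part \<open>R\<close> carries only a fraction \<open>\<epsilon>\<close> of the mass.
\<close>
lemma cz_finite_step:
  assumes p: "0 < p" and \<epsilon>: "0 < \<epsilon>"
    and \<beta>: "\<And>j. 0 \<le> \<beta> j" "summable (\<lambda>j. \<beta> j * 2 powr (D * real j))"
  obtains C where "1 \<le> C"
    "\<And>(f::'a \<Rightarrow> 'k::{real_normed_vector, second_countable_topology}) t X. f \<in> Linf_c M \<Longrightarrow> 0 < t \<Longrightarrow> 0 < X \<Longrightarrow> pmass M p f \<le> ennreal X \<Longrightarrow>
      \<exists>(F::nat set) P x r R. finite F \<and> disjoint_family_on P F \<and> R \<in> sets borel \<and>
        (\<forall>i\<in>F. P i \<in> sets borel \<and> P i \<inter> R = {} \<and> 0 < r i \<and> P i \<subseteq> ball (x i) (r i) \<and>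
          (\<integral>\<^sup>+y\<in>P i. ennreal (norm (f y) powr p) \<partial>M) \<le> ennreal (C * t powr p) * emeasure M (ball (x i) (r i))) \<and>
        (\<Sum>i\<in>F. emeasure M (ball (x i) (r i))) \<le> ennreal (C * X / t powr p) \<and>
        (\<forall>y. (\<Sum>i\<in>F. tower \<beta> (x i) (r i) y) \<le> ennreal C) \<and>
        (\<integral>\<^sup>+y\<in>R. ennreal (norm (f y) powr p) \<partial>M) \<le> ennreal (\<epsilon> * X) \<and>
        (\<forall>y. y \<notin> R \<longrightarrow> y \<notin> (\<Union>i\<in>F. P i) \<longrightarrow> norm (f y) \<le> t)"
proof -
  define S where "S = tower_const \<beta> * (Cd * 4 powr D)"
  have S: "0 \<le> S" using tower_const_nonneg[OF \<beta>] Cd_ge_1 by (simp add: S_def)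
  \<comment> \<open>By Chebyshev the set \<open>B\<close> where the towers exceed \<open>L\<close>
    has measure at most \<open>5 * S * Kc * X / (\<tau> * L)\<close>. The cells inside
    \<open>B\<close> carry at most \<open>Kc * \<tau>\<close> times that mass, and \<open>L\<close>
    makes this at most half of \<open>\<epsilon> * X\<close>.\<close>
  define L where "L = 10 * S * Kc * Kc / \<epsilon> + 1"
  have L: "1 \<le> L" using S \<epsilon> Kc_pos by (simp add: L_def)
  define C where "C = 5 * Kc + L"
  have C: "1 \<le> C" "5 * Kc \<le> C" "L \<le> C" "Kc \<le> C" using L Kc_pos by (auto simp: C_def)
  show ?thesis
  proof (rule that[OF C(1)])
    fix f :: "'a \<Rightarrow> 'k" and t X :: real
    assume f: "f \<in> Linf_c M" and t: "0 < t" and X: "0 < X" and fX: "pmass M p f \<le> ennreal X"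
    have fm[measurable]: "f \<in> borel_measurable M" by (rule Linf_c_measurable[OF f])
    define \<tau> where "\<tau> = t powr p"
    have \<tau>: "0 < \<tau>" using t by (simp add: \<tau>_def)
    let ?g = "\<lambda>y. ennreal (norm (f y) powr p)"
    have gm: "?g \<in> borel_measurable M" by measurable
    obtain \<rho> where \<rho>: "{y. f y \<noteq> 0} \<subseteq> ball 0 \<rho>" using Linf_c_support[OF f] bounded_subset_ballD by blast
    define E where "E = {y. t < norm (f y)}"
    have "{y\<in>space M. t < norm (f y)} \<in> sets M" by measurable
    then have Em: "E \<in> sets borel" by (simp add: E_def)
    have E\<rho>: "E \<subseteq> ball 0 \<rho>" using \<rho> t by (auto simp: E_def)
    have "emeasure M E \<le> ennreal (X / \<tau>)"
    proof -
      have "ennreal \<tau> * emeasure M E = (\<integral>\<^sup>+y\<in>E. ennreal \<tau> \<partial>M)"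
        using Em by (subst nn_set_integral_const) auto
      also have "\<dots> \<le> pmass M p f"
        unfolding pmass_def \<tau>_def using t p
        by (intro nn_integral_mono) (auto simp: E_def split: split_indicator intro!: ennreal_leI powr_mono2)
      finally have "ennreal \<tau> * emeasure M E \<le> ennreal X" using fX by (rule order_trans)
      then have "ennreal (1 / \<tau>) * (ennreal \<tau> * emeasure M E) \<le> ennreal (1 / \<tau>) * ennreal X"
        by (rule mult_left_mono) simp
      then show ?thesis using \<tau> X by (simp add: mult.assoc[symmetric] ennreal_mult'[symmetric])
    qed
    moreover have "bounded E" using E\<rho> bounded_ball bounded_subset by blast
    moreover have X\<tau>: "0 < X / \<tau>" using X \<tau> by simp
    ultimately obtain U where U: "open U" "E \<subseteq> U" "emeasure M U \<le> ennreal (X / \<tau>) + ennreal (X / \<tau>)"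
      using outer_open[OF Em, of "X / \<tau>"] by (meson add_right_mono order_trans)
    have [measurable]: "U \<in> sets M" using U(1) by simp
    define v where "v y = ?g y + ennreal (2 * \<tau>) * indicator U y" for y
    have vm[measurable]: "v \<in> borel_measurable M" unfolding v_def by measurable
    \<comment> \<open>\<open>X\<close> comes from \<open>f\<close> and \<open>4 * X\<close> from the
      height \<open>2 * \<tau>\<close> on \<open>U\<close>, whose measure is at most
      \<open>2 * X / \<tau>\<close>.\<close>
    have vX: "(\<integral>\<^sup>+y. v y \<partial>M) \<le> ennreal (5 * X)"
    proof -
      have "(\<integral>\<^sup>+y. v y \<partial>M) = pmass M p f + ennreal (2 * \<tau>) * emeasure M U"
        unfolding v_def pmass_def
        by (subst nn_integral_add) (measurable, simp add: nn_integral_cmult_indicator[OF \<open>U \<in> sets M\<close>])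
      also have "\<dots> \<le> ennreal X + ennreal (2 * \<tau>) * (ennreal (X / \<tau>) + ennreal (X / \<tau>))"
        by (intro add_mono mult_left_mono fX U(3)) auto
      also have "\<dots> = ennreal (5 * X)"
        using X \<tau> by (simp add: ennreal_plus[symmetric] ennreal_mult'[symmetric] field_simps del: ennreal_plus)
      finally show ?thesis .
    qed
    \<comment> \<open>A starting cell so large that the average of \<open>v\<close> over it is at
      most \<tau>.\<close>
    obtain R1 where R1: "1 \<le> R1" "5 * X / \<tau> \<le> measure M (ball 0 R1)"
      using measure_ball_unbounded by blast
    define R0 where "R0 = max R1 \<rho>"
    have R0: "0 < R0" "5 * X / \<tau> \<le> measure M (ball 0 R0)" "ball 0 \<rho> \<subseteq> ball (0::'a) R0"
    proof -
      have "measure M (ball 0 R1) \<le> measure M (ball 0 R0)"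
        by (rule measure_mono_bounded) (auto simp: R0_def)
      then show "5 * X / \<tau> \<le> measure M (ball 0 R0)" using R1 by simp
    qed (use R1 in \<open>auto simp: R0_def\<close>)
    define a :: 'a where "a = 0 - R0 *\<^sub>R One"
    let ?Q0 = "cube a (2 * R0) 0"
    have s: "0 < 2 * R0" using R0 by simp
    have BQ0: "ball 0 R0 \<subseteq> ?Q0" unfolding a_def by (rule ball_subset_centered_cube[OF R0(1)])
    have base: "(\<integral>\<^sup>+y\<in>?Q0. v y \<partial>M) \<le> ennreal \<tau> * emeasure M ?Q0"
    proof -
      have "(\<integral>\<^sup>+y\<in>?Q0. v y \<partial>M) \<le> (\<integral>\<^sup>+y. v y \<partial>M)"
        by (intro nn_integral_mono) (auto split: split_indicator)
      also have "\<dots> \<le> ennreal (\<tau> * (5 * X / \<tau>))" using vX \<tau> by simp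
      also have "\<dots> \<le> ennreal (\<tau> * measure M (ball 0 R0))"
        using R0(2) \<tau> by (intro ennreal_leI mult_left_mono) auto
      also have "\<dots> = ennreal \<tau> * emeasure M (ball 0 R0)"
        using \<tau> by (simp add: emeasure_ball_eq ennreal_mult)
      also have "\<dots> \<le> ennreal \<tau> * emeasure M ?Q0"
        by (intro mult_left_mono emeasure_mono BQ0) auto
      finally show ?thesis .
    qed
    obtain Q :: "nat \<Rightarrow> 'a set" where Q: "disjoint_family Q" "\<And>i. Q i \<in> sets borel" "\<And>i. Q i \<subseteq> ?Q0"
      "\<And>i. Q i \<noteq> {} \<Longrightarrow> \<exists>j y. Q i = cube a (2 * R0 / 2 ^ j) y"
      "\<And>i. ennreal \<tau> * emeasure M (Q i) \<le> (\<integral>\<^sup>+x\<in>Q i. v x \<partial>M)"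
      "\<And>i. (\<integral>\<^sup>+x\<in>Q i. v x \<partial>M) \<le> ennreal (Kc * \<tau>) * emeasure M (Q i)"
      "\<And>U. open U \<Longrightarrow> (\<And>y. y \<in> U \<Longrightarrow> ennreal (2 * \<tau>) \<le> v y) \<Longrightarrow> U \<inter> ?Q0 \<subseteq> (\<Union>i. Q i)"
      by (rule calderon_zygmund[OF s vm \<tau> base]) blast
    have Qm[measurable]: "Q i \<in> sets M" for i using Q(2) by simp
    have "\<exists>x r. Q i \<noteq> {} \<longrightarrow> 0 < r \<and> Q i \<subseteq> ball x r \<and> emeasure M (ball x r) \<le> ennreal Kc * emeasure M (Q i)" for i
    proof (cases "Q i = {}")
      case False
      then obtain j y where Qi: "Q i = cube a (2 * R0 / 2 ^ j) y" using Q(4) by blast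
      have h: "0 < 2 * R0 / 2 ^ j" using R0 by simp
      show ?thesis unfolding Qi
        using cube_subset_ball[OF h, of a y] emeasure_dilated_cube[OF h, of 1 a y] mult_pos_pos[OF _ h, of "real DIM('a)"] DIM_positive[where 'a='a]
        by (intro exI[of _ "cube_center a (2 * R0 / 2 ^ j) y"] exI[of _ "real DIM('a) * (2 * R0 / 2 ^ j)"]) auto
    qed simp
    then obtain x r where xr: "\<And>i. Q i \<noteq> {} \<Longrightarrow> 0 < r i" "\<And>i. Q i \<noteq> {} \<Longrightarrow> Q i \<subseteq> ball (x i) (r i)"
      "\<And>i. Q i \<noteq> {} \<Longrightarrow> emeasure M (ball (x i) (r i)) \<le> ennreal Kc * emeasure M (Q i)"
      by metis
    let ?W = "\<Union>i. Q i"
    have EW: "E \<subseteq> ?W"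
      using Q(7)[OF U(1)] U(2) E\<rho> R0(3) BQ0 by (force simp: v_def)
    have fQ: "(\<integral>\<^sup>+y\<in>Q i. ?g y \<partial>M) \<le> ennreal (Kc * \<tau>) * emeasure M (Q i)" for i
      by (rule order_trans[OF nn_set_integral_le Q(6)]) (simp add: v_def)
    have sumQ: "(\<Sum>i. emeasure M (Q i)) \<le> ennreal (5 * X / \<tau>)"
    proof -
      have "ennreal \<tau> * (\<Sum>i. emeasure M (Q i)) = (\<Sum>i. ennreal \<tau> * emeasure M (Q i))" by simp
      also have "\<dots> \<le> (\<Sum>i. \<integral>\<^sup>+x\<in>Q i. v x \<partial>M)" by (intro suminf_le Q(5)) auto
      also have "\<dots> = (\<integral>\<^sup>+x\<in>?W. v x \<partial>M)"
        by (rule nn_integral_disjoint_family[symmetric]) (use Qm Q(1) vm in blast)+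
      also have "\<dots> \<le> (\<integral>\<^sup>+x. v x \<partial>M)" by (intro nn_integral_mono) (auto split: split_indicator)
      finally have "ennreal \<tau> * (\<Sum>i. emeasure M (Q i)) \<le> ennreal (5 * X)" using vX by (rule order_trans)
      then have "ennreal (1 / \<tau>) * (ennreal \<tau> * (\<Sum>i. emeasure M (Q i))) \<le> ennreal (1 / \<tau>) * ennreal (5 * X)"
        by (rule mult_left_mono) simp
      then show ?thesis using \<tau> X by (simp add: mult.assoc[symmetric] ennreal_mult'[symmetric])
    qed
    \<comment> \<open>The balls are enlarged by 4 in advance, as \<open>finite_towers_bound\<close>
      requires.\<close>
    define G where "G y = (\<Sum>i. (if Q i = {} then 0 else tower \<beta> (x i) (4 * r i) y))" for y
    have Gm[measurable]: "G \<in> borel_measurable M" 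
    proof -
      have "(\<lambda>y. if Q i = {} then 0 else tower \<beta> (x i) (4 * r i) y) \<in> borel_measurable M" for i
        by (cases "Q i = {}") auto
      note this[measurable]
      show ?thesis unfolding G_def[abs_def] by measurable
    qed
    have Gint: "(\<integral>\<^sup>+y. G y \<partial>M) \<le> ennreal (S * Kc * 5 * X / \<tau>)"
    proof -
      have "(\<integral>\<^sup>+y. G y \<partial>M) = (\<Sum>i. \<integral>\<^sup>+y. (if Q i = {} then 0 else tower \<beta> (x i) (4 * r i) y) \<partial>M)"
        unfolding G_def by (rule nn_integral_suminf) auto
      also have "\<dots> \<le> (\<Sum>i. ennreal (S * Kc) * emeasure M (Q i))"
      proof (rule suminf_le)
        fix i
        show "(\<integral>\<^sup>+y. (if Q i = {} then 0 else tower \<beta> (x i) (4 * r i) y) \<partial>M) \<le> ennreal (S * Kc) * emeasure M (Q i)"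
        proof (cases "Q i = {}")
          case False
          have "(\<integral>\<^sup>+y. tower \<beta> (x i) (4 * r i) y \<partial>M) \<le> ennreal (tower_const \<beta>) * emeasure M (ball (x i) (4 * r i))"
            using xr(1)[OF False] by (intro tower_integral \<beta>) auto
          also have "\<dots> \<le> ennreal (tower_const \<beta>) * (ennreal (Cd * 4 powr D) * (ennreal Kc * emeasure M (Q i)))"
            using xr(1,3)[OF False]
            by (intro mult_left_mono order_trans[OF ball_dilate[of "r i" 4 "x i"]]) (auto intro: mult_left_mono)
          also have "\<dots> = ennreal (S * Kc) * emeasure M (Q i)"
            unfolding S_def using tower_const_nonneg[OF \<beta>] Cd_ge_1 Kc_pos
            by (simp add: mult.assoc[symmetric] ennreal_mult[symmetric])
          finally show ?thesis using False by simp
        qed simp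
      qed auto
      also have "\<dots> = ennreal (S * Kc) * (\<Sum>i. emeasure M (Q i))" by simp
      also have "\<dots> \<le> ennreal (S * Kc) * ennreal (5 * X / \<tau>)"
        by (intro mult_left_mono sumQ) auto
      also have "\<dots> = ennreal (S * Kc * 5 * X / \<tau>)"
        using S Kc_pos X \<tau> by (simp add: ennreal_mult[symmetric] mult_ac)
      finally show ?thesis .
    qed
    define B where "B = {y. ennreal L < G y}"
    have "{y\<in>space M. ennreal L < G y} \<in> sets M" by measurable
    then have Bm[measurable]: "B \<in> sets M" by (simp add: B_def)
    have B: "ennreal (Kc * \<tau>) * emeasure M B \<le> ennreal (\<epsilon> / 2 * X)"
    proof -
      have "ennreal L * emeasure M B = (\<integral>\<^sup>+y\<in>B. ennreal L \<partial>M)"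
        by (rule nn_set_integral_const[symmetric]) measurable
      also have "\<dots> \<le> (\<integral>\<^sup>+y. G y \<partial>M)"
        by (intro nn_integral_mono) (auto simp: B_def split: split_indicator)
      also note Gint
      finally have "ennreal (Kc * \<tau> / L) * (ennreal L * emeasure M B) \<le> ennreal (Kc * \<tau> / L) * ennreal (S * Kc * 5 * X / \<tau>)"
        by (rule mult_left_mono) simp
      moreover have "ennreal (Kc * \<tau> / L) * (ennreal L * emeasure M B) = ennreal (Kc * \<tau>) * emeasure M B"
        using L Kc_pos \<tau> by (simp add: mult.assoc[symmetric] ennreal_mult'[symmetric])
      moreover have "ennreal (Kc * \<tau> / L) * ennreal (S * Kc * 5 * X / \<tau>) = ennreal (5 * S * Kc * Kc / L * X)"
        using L Kc_pos \<tau> S X by (simp add: ennreal_mult[symmetric] mult_ac)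
      moreover have "5 * S * Kc * Kc / L * X \<le> \<epsilon> / 2 * X"
      proof (rule mult_right_mono)
        have "10 * S * Kc * Kc / \<epsilon> \<le> L" by (simp add: L_def)
        then have "10 * S * Kc * Kc \<le> L * \<epsilon>" using \<epsilon> by (simp add: pos_divide_le_eq)
        then show "5 * S * Kc * Kc / L \<le> \<epsilon> / 2" using L by (simp add: field_simps)
      qed (use X in simp)
      ultimately show ?thesis by (metis ennreal_leI order_trans)
    qed
    have sumf: "(\<Sum>i. \<integral>\<^sup>+y\<in>Q i. ?g y \<partial>M) \<le> ennreal X"
    proof -
      have "(\<Sum>i. \<integral>\<^sup>+y\<in>Q i. ?g y \<partial>M) = (\<integral>\<^sup>+x\<in>?W. ?g x \<partial>M)"
        by (rule nn_integral_disjoint_family[symmetric]) (use Q(1) in measurable)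
      also have "\<dots> \<le> pmass M p f" unfolding pmass_def by (intro nn_integral_mono) (auto split: split_indicator)
      finally show ?thesis using fX by (rule order_trans)
    qed
    \<comment> \<open>Only finitely many cells are kept; the tail of the series carries little mass
      and joins the discarded part.\<close>
    have "\<exists>n. (\<Sum>i. \<integral>\<^sup>+y\<in>Q (i + n). ?g y \<partial>M) \<le> ennreal (\<epsilon> / 2 * X)"
      using sumf \<epsilon> X by (intro ennreal_suminf_tail) (auto intro: le_less_trans)
    then obtain n where n: "(\<Sum>i. \<integral>\<^sup>+y\<in>Q (i + n). ?g y \<partial>M) \<le> ennreal (\<epsilon> / 2 * X)" by blast
    \<comment> \<open>A kept cell has a point outside \<open>B\<close>; these points are the good
      points for \<open>finite_towers_bound\<close>.\<close>
    define F where "F = {i. i < n \<and> \<not> Q i \<subseteq> B}"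
    have F: "finite F" "\<And>i. i \<in> F \<Longrightarrow> Q i \<noteq> {}" by (auto simp: F_def)
    define R where "R = ?W - (\<Union>i\<in>F. Q i)"
    have Rm: "R \<in> sets borel" using Q(2) F(1) by (auto simp: R_def)
    show "\<exists>(F::nat set) P x r R. finite F \<and> disjoint_family_on P F \<and> R \<in> sets borel \<and>
        (\<forall>i\<in>F. P i \<in> sets borel \<and> P i \<inter> R = {} \<and> 0 < r i \<and> P i \<subseteq> ball (x i) (r i) \<and>
          (\<integral>\<^sup>+y\<in>P i. ennreal (norm (f y) powr p) \<partial>M) \<le> ennreal (C * t powr p) * emeasure M (ball (x i) (r i))) \<and>
        (\<Sum>i\<in>F. emeasure M (ball (x i) (r i))) \<le> ennreal (C * X / t powr p) \<and>
        (\<forall>y. (\<Sum>i\<in>F. tower \<beta> (x i) (r i) y) \<le> ennreal C) \<and>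
        (\<integral>\<^sup>+y\<in>R. ennreal (norm (f y) powr p) \<partial>M) \<le> ennreal (\<epsilon> * X) \<and>
        (\<forall>y. y \<notin> R \<longrightarrow> y \<notin> (\<Union>i\<in>F. P i) \<longrightarrow> norm (f y) \<le> t)"
    proof (intro exI[of _ F] exI[of _ Q] exI[of _ x] exI[of _ r] exI[of _ R] conjI ballI allI impI)
      show "finite F" "R \<in> sets borel" by fact+
      show "disjoint_family_on Q F" using Q(1) by (auto simp: disjoint_family_on_def)
      fix i assume i: "i \<in> F"
      note ne = F(2)[OF i]
      show "Q i \<in> sets borel" "0 < r i" "Q i \<subseteq> ball (x i) (r i)" using Q(2) xr(1,2)[OF ne] by auto
      show "Q i \<inter> R = {}" using i by (auto simp: R_def)
      have "(\<integral>\<^sup>+y\<in>Q i. ?g y \<partial>M) \<le> ennreal (Kc * \<tau>) * emeasure M (Q i)" by (rule fQ)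
      also have "\<dots> \<le> ennreal (C * t powr p) * emeasure M (ball (x i) (r i))"
        using C \<tau> xr(2)[OF ne] unfolding \<tau>_def by (intro mult_mono ennreal_leI emeasure_mono mult_right_mono) auto
      finally show "(\<integral>\<^sup>+y\<in>Q i. ?g y \<partial>M) \<le> ennreal (C * t powr p) * emeasure M (ball (x i) (r i))" .
    next
      have "(\<Sum>i\<in>F. emeasure M (ball (x i) (r i))) \<le> (\<Sum>i\<in>F. ennreal Kc * emeasure M (Q i))"
        using F(2) xr(3) by (intro sum_mono) auto
      also have "\<dots> \<le> (\<Sum>i. ennreal Kc * emeasure M (Q i))" by (intro sum_le_suminf F(1)) auto
      also have "\<dots> = ennreal Kc * (\<Sum>i. emeasure M (Q i))" by simp
      also have "\<dots> \<le> ennreal Kc * ennreal (5 * X / \<tau>)" by (intro mult_left_mono sumQ) auto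
      also have "\<dots> = ennreal (5 * Kc * X / \<tau>)" using Kc_pos X \<tau> by (simp add: ennreal_mult[symmetric] mult_ac)
      also have "\<dots> \<le> ennreal (C * X / t powr p)"
        unfolding \<tau>_def using C(2) X by (intro ennreal_leI divide_right_mono mult_right_mono) auto
      finally show "(\<Sum>i\<in>F. emeasure M (ball (x i) (r i))) \<le> ennreal (C * X / t powr p)" .
    next
      fix y
      have "\<exists>z. z \<in> Q i \<and> z \<notin> B" if "i \<in> F" for i using that by (auto simp: F_def)
      then obtain z where z: "\<And>i. i \<in> F \<Longrightarrow> z i \<in> Q i" "\<And>i. i \<in> F \<Longrightarrow> z i \<notin> B" by metis
      have "(\<Sum>i\<in>F. tower \<beta> (x i) (r i) y) \<le> ennreal L"
      proof (rule finite_towers_bound[OF F(1), of z])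
        show "z i \<in> ball (x i) (r i)" if "i \<in> F" for i using z(1)[OF that] xr(2)[OF F(2)[OF that]] by blast
        fix i assume i: "i \<in> F"
        have "(\<Sum>k\<in>F. tower \<beta> (x k) (4 * r k) (z i)) = (\<Sum>k\<in>F. (if Q k = {} then 0 else tower \<beta> (x k) (4 * r k) (z i)))"
          using F(2) by (intro sum.cong) auto
        also have "\<dots> \<le> G (z i)" unfolding G_def by (intro sum_le_suminf F(1)) auto
        also have "\<dots> \<le> ennreal L" using z(2)[OF i] by (simp add: B_def not_less)
        finally show "(\<Sum>k\<in>F. tower \<beta> (x k) (4 * r k) (z i)) \<le> ennreal L" .
      qed
      also have "\<dots> \<le> ennreal C" using C(3) by (rule ennreal_leI)
      finally show "(\<Sum>i\<in>F. tower \<beta> (x i) (r i) y) \<le> ennreal C" .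
    next
      define Q' where "Q' i = (if Q i \<subseteq> B then Q i else {})" for i
      have Q'm[measurable]: "Q' i \<in> sets M" for i using Q(2) by (auto simp: Q'_def)
      have Q'd: "disjoint_family Q'" using Q(1) by (auto simp: disjoint_family_on_def Q'_def)
      have "disjoint_family (\<lambda>i. Q (i + n))" using Q(1) by (auto simp: disjoint_family_on_def)
      note Qnd = this
      have "R \<subseteq> (\<Union>i. Q' i) \<union> (\<Union>i. Q (i + n))"
      proof
        fix y assume "y \<in> R"
        then obtain i where i: "y \<in> Q i" "i \<notin> F" by (auto simp: R_def)
        show "y \<in> (\<Union>i. Q' i) \<union> (\<Union>i. Q (i + n))"
        proof (cases "i < n")
          case True
          then have "Q i \<subseteq> B" using i(2) by (simp add: F_def)
          then have "y \<in> Q' i" using i(1) by (simp add: Q'_def)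
          then show ?thesis by blast
        next
          case False
          then have "y \<in> Q ((i - n) + n)" using i(1) by simp
          then show ?thesis by blast
        qed
      qed
      then have "(\<integral>\<^sup>+y\<in>R. ?g y \<partial>M) \<le> (\<integral>\<^sup>+y. ?g y * indicator (\<Union>i. Q' i) y + ?g y * indicator (\<Union>i. Q (i + n)) y \<partial>M)"
        by (intro nn_integral_mono) (auto split: split_indicator)
      also have "\<dots> = (\<integral>\<^sup>+y\<in>(\<Union>i. Q' i). ?g y \<partial>M) + (\<integral>\<^sup>+y\<in>(\<Union>i. Q (i + n)). ?g y \<partial>M)"
        by (intro nn_integral_add) measurable
      also have "\<dots> = (\<Sum>i. \<integral>\<^sup>+y\<in>Q' i. ?g y \<partial>M) + (\<Sum>i. \<integral>\<^sup>+y\<in>Q (i + n). ?g y \<partial>M)"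
        using nn_integral_disjoint_family[OF gm Q'm Q'd] nn_integral_disjoint_family[OF gm Qm Qnd] by simp
      also have "\<dots> \<le> ennreal (\<epsilon> / 2 * X) + ennreal (\<epsilon> / 2 * X)"
      proof (rule add_mono[OF _ n])
        have "(\<Sum>i. \<integral>\<^sup>+y\<in>Q' i. ?g y \<partial>M) \<le> (\<Sum>i. ennreal (Kc * \<tau>) * emeasure M (Q' i))"
          using fQ by (intro suminf_le) (auto simp: Q'_def)
        also have "\<dots> = ennreal (Kc * \<tau>) * (\<Sum>i. emeasure M (Q' i))" by simp
        also have "(\<Sum>i. emeasure M (Q' i)) = emeasure M (\<Union>i. Q' i)"
          using Q'm Q'd by (intro suminf_emeasure) auto
        also have "ennreal (Kc * \<tau>) * emeasure M (\<Union>i. Q' i) \<le> ennreal (Kc * \<tau>) * emeasure M B"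
          using Bm by (intro mult_left_mono emeasure_mono) (auto simp: Q'_def split: if_splits)
        also note B
        finally show "(\<Sum>i. \<integral>\<^sup>+y\<in>Q' i. ?g y \<partial>M) \<le> ennreal (\<epsilon> / 2 * X)" .
      qed
      also have "\<dots> = ennreal (\<epsilon> * X)"
        using \<epsilon> X by (subst ennreal_plus[symmetric]) auto
      finally show "(\<integral>\<^sup>+y\<in>R. ?g y \<partial>M) \<le> ennreal (\<epsilon> * X)" .
    next
      fix y assume "y \<notin> R" "y \<notin> (\<Union>i\<in>F. Q i)"
      then have "y \<notin> ?W" by (auto simp: R_def)
      then have "y \<notin> E" using EW by blast
      then show "norm (f y) \<le> t" by (simp add: E_def)
    qed
  qed
qed

end

text \<open>Pieces are pairs (round, index within the round) coded by one natural number. A bound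
  \<open>c * (1 / 2) ^ n\<close> for the \<open>n\<close>-th round sums to \<open>2 * c\<close>,
  whatever finite set of codes is taken.\<close>

lemma sum_prod_decode_le:
  fixes \<phi> :: "nat \<times> nat \<Rightarrow> ennreal"
  assumes F: "finite F" "\<And>i. i \<in> F \<Longrightarrow> snd (prod_decode i) \<in> A (fst (prod_decode i))"
    and A: "\<And>n. finite (A n)" and c: "\<And>n. (\<Sum>m\<in>A n. \<phi> (n, m)) \<le> ennreal (c * (1 / 2) ^ n)" and c0: "0 \<le> c"
  shows "(\<Sum>i\<in>F. \<phi> (prod_decode i)) \<le> ennreal (2 * c)"
proof -
  define N where "N = Suc (Max (insert 0 ((fst \<circ> prod_decode) ` F)))"
  have N: "fst (prod_decode i) < N" if "i \<in> F" for i
    unfolding N_def using F(1) that by (intro le_imp_less_Suc Max_ge) auto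
  have "(\<Sum>i\<in>F. \<phi> (prod_decode i)) = sum \<phi> (prod_decode ` F)"
    by (subst sum.reindex) (auto intro: inj_on_subset[OF inj_prod_decode])
  also have "\<dots> \<le> sum \<phi> (Sigma {..<N} A)"
  proof (rule sum_mono2)
    show "prod_decode ` F \<subseteq> Sigma {..<N} A"
    proof
      fix u assume "u \<in> prod_decode ` F"
      then obtain i where "i \<in> F" "u = prod_decode i" by blast
      then show "u \<in> Sigma {..<N} A" using N F(2) by (cases u) force
    qed
  qed (use A in auto)
  also have "\<dots> = (\<Sum>n<N. \<Sum>m\<in>A n. \<phi> (n, m))"
    by (subst sum.Sigma) (use A in auto)
  also have "\<dots> \<le> (\<Sum>n<N. ennreal (c * (1 / 2) ^ n))" by (intro sum_mono c)
  also have "\<dots> = ennreal (c * (\<Sum>n<N. (1 / 2) ^ n))"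
    using c0 by (simp add: sum_distrib_left)
  also have "\<dots> \<le> ennreal (2 * c)"
  proof (rule ennreal_leI)
    have "(\<Sum>n<N. (1 / 2 :: real) ^ n) \<le> (\<Sum>n. (1 / 2 :: real) ^ n)"
      by (intro sum_le_suminf) auto
    also have "\<dots> = 2" by (simp add: suminf_geometric)
    finally show "c * (\<Sum>n<N. (1 / 2) ^ n) \<le> 2 * c" using c0 by (simp add: mult_left_mono mult.commute)
  qed
  finally show ?thesis .
qed

section \<open>Repeated decomposition of the discarded part at halved heights\<close>

context doubling_measure
begin

text \<open>
  \<open>w i\<close> is the height at which the piece \<open>P i\<close> was selected: the discarded part of \<open>f\<close> is decomposed
  again, at height \<open>t / 2 ^ n\<close> in the \<open>n\<close>-th round.
\<close>
definition cz_cover :: "real \<Rightarrow> (nat \<Rightarrow> real) \<Rightarrow> real \<Rightarrow> ('a \<Rightarrow> 'k::real_normed_vector) \<Rightarrow> real \<Rightarrow> real \<Rightarrow>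
    nat set \<Rightarrow> (nat \<Rightarrow> 'a set) \<Rightarrow> (nat \<Rightarrow> 'a) \<Rightarrow> (nat \<Rightarrow> real) \<Rightarrow> (nat \<Rightarrow> real) \<Rightarrow> bool" where
  "cz_cover p \<beta> C f t X J P x r w \<longleftrightarrow> disjoint_family P \<and> (\<forall>i. P i \<in> sets borel) \<and> (\<forall>i. i \<notin> J \<longrightarrow> P i = {}) \<and>
        (\<forall>i\<in>J. 0 < r i \<and> P i \<subseteq> ball (x i) (r i) \<and> 0 < w i \<and> w i \<le> t \<and>
          (\<integral>\<^sup>+y\<in>P i. ennreal (norm (f y) powr p) \<partial>M) \<le> ennreal (C * w i powr p) * emeasure M (ball (x i) (r i))) \<and>
        (\<forall>F. finite F \<longrightarrow> F \<subseteq> J \<longrightarrow> (\<Sum>i\<in>F. emeasure M (ball (x i) (r i))) \<le> ennreal (C * X / t powr p)) \<and>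
        (\<forall>F y. finite F \<longrightarrow> F \<subseteq> J \<longrightarrow> (\<Sum>i\<in>F. ennreal (w i) * tower \<beta> (x i) (r i) y) \<le> ennreal (C * t)) \<and>
        (AE y in M. y \<notin> (\<Union>i. P i) \<longrightarrow> norm (f y) \<le> t)"

lemma cz_decomposition:
  assumes p: "0 < p"
    and \<beta>: "\<And>j. 0 \<le> \<beta> j" "summable (\<lambda>j. \<beta> j * 2 powr (D * real j))"
  obtains C where "1 \<le> C"
    "\<And>(f::'a \<Rightarrow> 'k::{real_normed_vector, second_countable_topology}) t X. f \<in> Linf_c M \<Longrightarrow> 0 < t \<Longrightarrow> 0 < X \<Longrightarrow> pmass M p f \<le> ennreal X \<Longrightarrow>
      \<exists>J P x r w. cz_cover p \<beta> C f t X J P x r w"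
proof -
  \<comment> \<open>In round \<open>n\<close> the mass is at most \<open>\<epsilon> ^ n * X\<close>
    and the height is \<open>t / 2 ^ n\<close>, so the balls measure at most a multiple of
    \<open>(\<epsilon> * 2 powr p) ^ n * X / t powr p\<close>. With this \<epsilon> the ratio is
    exactly one half.\<close>
  define \<epsilon> where "\<epsilon> = 1 / (2 * 2 powr p)"
  have two_p: "1 \<le> 2 powr p" using p by (intro ge_one_powr_ge_zero) auto
  have \<epsilon>: "0 < \<epsilon>" by (simp add: \<epsilon>_def)
  have \<epsilon>1: "\<epsilon> \<le> 1 / 2" using two_p by (simp add: \<epsilon>_def field_simps)
  define ok where "ok C f t X F P x r R \<longleftrightarrow> finite F \<and> disjoint_family_on P F \<and> R \<in> sets borel \<and>
        (\<forall>i\<in>F. P i \<in> sets borel \<and> P i \<inter> R = {} \<and> 0 < r i \<and> P i \<subseteq> ball (x i) (r i) \<and>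
          (\<integral>\<^sup>+y\<in>P i. ennreal (norm (f y) powr p) \<partial>M) \<le> ennreal (C * t powr p) * emeasure M (ball (x i) (r i))) \<and>
        (\<Sum>i\<in>F. emeasure M (ball (x i) (r i))) \<le> ennreal (C * X / t powr p) \<and>
        (\<forall>y. (\<Sum>i\<in>F. tower \<beta> (x i) (r i) y) \<le> ennreal C) \<and>
        (\<integral>\<^sup>+y\<in>R. ennreal (norm (f y) powr p) \<partial>M) \<le> ennreal (\<epsilon> * X) \<and>
        (\<forall>y. y \<notin> R \<longrightarrow> y \<notin> (\<Union>i\<in>F. P i) \<longrightarrow> norm (f y) \<le> t)"
    for C and f :: "'a \<Rightarrow> 'k" and t X and F :: "nat set" and P x r R
  obtain C where C: "1 \<le> C" "\<And>(f::'a \<Rightarrow> 'k) t X. f \<in> Linf_c M \<Longrightarrow> 0 < t \<Longrightarrow> 0 < X \<Longrightarrow> pmass M p f \<le> ennreal X \<Longrightarrow>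
      \<exists>(F::nat set) P x r R. ok C f t X F P x r R"
    unfolding ok_def by (rule cz_finite_step[OF p \<epsilon> \<beta>, where 'k='k]) blast
  have C2: "1 \<le> 2 * C" using C(1) by simp
  show ?thesis
  proof (rule that[OF C2])
    fix f :: "'a \<Rightarrow> 'k" and t X :: real
    assume f: "f \<in> Linf_c M" and t: "0 < t" and X: "0 < X" and fX: "pmass M p f \<le> ennreal X"
    let ?g = "\<lambda>y. ennreal (norm (f y) powr p)"
    define small where "small n R \<longleftrightarrow> R \<in> sets borel \<and> (\<integral>\<^sup>+y\<in>R. ?g y \<partial>M) \<le> ennreal (\<epsilon> ^ n * X)" for n R
    define tn where "tn n = t / 2 ^ n" for n :: nat
    have tn: "0 < tn n" "tn n \<le> t" for n
    proof -
      have "t * 1 \<le> t * 2 ^ n" using t by (intro mult_left_mono) auto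
      then show "0 < tn n" "tn n \<le> t" using t by (simp_all add: tn_def field_simps)
    qed
    have tnp: "tn n powr p = t powr p / (2 powr p) ^ n" for n
      using t by (simp add: tn_def powr_divide powr_realpow[symmetric] powr_powr mult.commute)
    have "\<forall>n R. \<exists>F P x r R'. small n R \<longrightarrow> ok C (restr R f) (tn n) (\<epsilon> ^ n * X) F P x r R'"
    proof (intro allI)
      fix n R
      show "\<exists>F P x r R'. small n R \<longrightarrow> ok C (restr R f) (tn n) (\<epsilon> ^ n * X) F P x r R'"
      proof (cases "small n R")
        case True
        then have "restr R f \<in> Linf_c M" "pmass M p (restr R f) \<le> ennreal (\<epsilon> ^ n * X)"
          using f p by (auto simp: small_def pmass_restr intro: Linf_c_restr)
        then show ?thesis using C(2)[of "restr R f" "tn n" "\<epsilon> ^ n * X"] tn(1) \<epsilon> X by simp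
      qed simp
    qed
    then obtain FF PP xx rr RR where
      step: "\<And>n R. small n R \<Longrightarrow> ok C (restr R f) (tn n) (\<epsilon> ^ n * X) (FF n R) (PP n R) (xx n R) (rr n R) (RR n R)"
      by metis
    \<comment> \<open>\<open>Rs n\<close> is what is still undecomposed before round
      \<open>n\<close>. Intersecting keeps the sets decreasing, although \<open>RR\<close> alone
      need not lie in the preceding set.\<close>
    define Rs where "Rs = rec_nat UNIV (\<lambda>n R. R \<inter> RR n R)"
    have Rs0: "Rs 0 = UNIV" and RsS: "Rs (Suc n) = Rs n \<inter> RR n (Rs n)" for n by (simp_all add: Rs_def)
    have restr_int: "(\<integral>\<^sup>+y\<in>S. ennreal (norm (restr R f y) powr p) \<partial>M) = (\<integral>\<^sup>+y\<in>R \<inter> S. ?g y \<partial>M)" for R S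
      using p by (intro nn_integral_cong) (auto simp: restr_def split: split_indicator)
    have small: "small n (Rs n)" for n
    proof (induction n)
      case 0
      then show ?case using fX by (simp add: small_def Rs0 pmass_def)
    next
      case (Suc n)
      then show ?case using step[OF Suc] by (auto simp: small_def RsS ok_def restr_int mult.assoc)
    qed
    define Fn where "Fn n = FF n (Rs n)" for n
    define xn where "xn n = xx n (Rs n)" for n
    define rn where "rn n = rr n (Rs n)" for n
    define Pn where "Pn n m = (if m \<in> Fn n then Rs n \<inter> PP n (Rs n) m else {})" for n m
    have ok: "ok C (restr (Rs n) f) (tn n) (\<epsilon> ^ n * X) (Fn n) (PP n (Rs n)) (xn n) (rn n) (RR n (Rs n))" for n
      unfolding Fn_def xn_def rn_def by (rule step[OF small])
    have Fn: "finite (Fn n)" for n using ok[of n] by (simp add: ok_def)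
    have PnRs: "Pn n m \<subseteq> Rs n" for n m by (simp add: Pn_def)
    have Pn_disj: "Pn n m \<inter> RR n (Rs n) = {}" for n m using ok[of n] by (auto simp: Pn_def ok_def)
    have Rs_dec: "Rs n' \<subseteq> RR n (Rs n)" if "n < n'" for n n'
      using that
    proof (induction n')
      case (Suc k)
      then show ?case by (cases "k = n") (auto simp: RsS)
    qed simp
    define P where "P i = (case prod_decode i of (n, m) \<Rightarrow> Pn n m)" for i
    define x where "x i = (case prod_decode i of (n, m) \<Rightarrow> xn n m)" for i
    define r where "r i = (case prod_decode i of (n, m) \<Rightarrow> rn n m)" for i
    define w where "w i = tn (fst (prod_decode i))" for i
    define J where "J = {i. snd (prod_decode i) \<in> Fn (fst (prod_decode i))}"
    show "\<exists>J P x r w. cz_cover p \<beta> (2 * C) f t X J P x r w"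
      unfolding cz_cover_def
    proof (rule exI[of _ J], rule exI[of _ P], rule exI[of _ x], rule exI[of _ r], rule exI[of _ w], intro conjI allI ballI impI)
      show "disjoint_family P"
        unfolding disjoint_family_on_def
      proof (intro ballI impI)
        fix i i' :: nat assume "i \<noteq> i'"
        obtain n m n' m' where d: "prod_decode i = (n, m)" "prod_decode i' = (n', m')" by (metis surj_pair)
        have ne: "(n, m) \<noteq> (n', m')" using \<open>i \<noteq> i'\<close> d by (metis prod_decode_inverse)
        have "Pn n m \<inter> Pn n' m' = {}"
        proof (rule linorder_cases[of n n'])
          assume "n < n'"
          then show ?thesis using PnRs[of n' m'] Rs_dec[of n n'] Pn_disj[of n m] by blast
        next
          assume "n' < n"
          then show ?thesis using PnRs[of n m] Rs_dec[of n' n] Pn_disj[of n' m'] by blast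
        next
          assume n: "n = n'"
          have "disjoint_family_on (PP n (Rs n)) (Fn n)" using ok[of n] by (simp add: ok_def)
          then show ?thesis using n ne by (auto simp: Pn_def disjoint_family_on_def)
        qed
        then show "P i \<inter> P i' = {}" by (simp add: P_def d)
      qed
      show "P i \<in> sets borel" for i
      proof -
        obtain n m where d: "prod_decode i = (n, m)" by (metis surj_pair)
        have "Rs n \<in> sets borel" using small[of n] by (simp add: small_def)
        moreover have "m \<in> Fn n \<Longrightarrow> PP n (Rs n) m \<in> sets borel" using ok[of n] by (auto simp: ok_def)
        ultimately show ?thesis by (auto simp: P_def d Pn_def)
      qed
      show "P i = {}" if "i \<notin> J" for i
        using that by (auto simp: P_def J_def Pn_def split: prod.splits)
    next
      fix i assume i: "i \<in> J"
      obtain n m where d: "prod_decode i = (n, m)" by (metis surj_pair)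
      have m: "m \<in> Fn n" using i d by (simp add: J_def)
      show "0 < r i" "P i \<subseteq> ball (x i) (r i)"
        using ok[of n] m by (auto simp: r_def x_def P_def d Pn_def ok_def)
      show "0 < w i" "w i \<le> t" using tn by (auto simp: w_def)
      have "(\<integral>\<^sup>+y\<in>P i. ?g y \<partial>M) \<le> ennreal (C * tn n powr p) * emeasure M (ball (xn n m) (rn n m))"
        using ok[of n] m by (auto simp: P_def d Pn_def ok_def restr_int)
      also have "\<dots> \<le> ennreal (2 * C * w i powr p) * emeasure M (ball (x i) (r i))"
        using C(1) by (auto simp: w_def x_def r_def d intro!: mult_right_mono ennreal_leI)
      finally show "(\<integral>\<^sup>+y\<in>P i. ?g y \<partial>M) \<le> ennreal (2 * C * w i powr p) * emeasure M (ball (x i) (r i))" .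
    next
      fix F assume F: "finite F" "F \<subseteq> J"
      have "(\<Sum>i\<in>F. emeasure M (ball (x i) (r i))) =
        (\<Sum>i\<in>F. (\<lambda>u. emeasure M (ball (xn (fst u) (snd u)) (rn (fst u) (snd u)))) (prod_decode i))"
        by (intro sum.cong) (auto simp: x_def r_def split: prod.splits)
      also have "\<dots> \<le> ennreal (2 * (C * X / t powr p))"
      proof (rule sum_prod_decode_le[OF F(1), of Fn])
        show "snd (prod_decode i) \<in> Fn (fst (prod_decode i))" if "i \<in> F" for i
          using that F(2) by (auto simp: J_def)
        fix n
        have "(\<Sum>m\<in>Fn n. emeasure M (ball (xn n m) (rn n m))) \<le> ennreal (C * (\<epsilon> ^ n * X) / tn n powr p)"
          using ok[of n] by (simp add: ok_def)
        also have "C * (\<epsilon> ^ n * X) / tn n powr p = C * X / t powr p * (\<epsilon> * 2 powr p) ^ n"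
          by (simp add: tnp power_mult_distrib)
        also have "\<epsilon> * 2 powr p = 1 / 2" using two_p by (simp add: \<epsilon>_def)
        finally show "(\<Sum>m\<in>Fn n. emeasure M (ball (xn (fst (n, m)) (snd (n, m))) (rn (fst (n, m)) (snd (n, m)))))
          \<le> ennreal (C * X / t powr p * (1 / 2) ^ n)" by simp
      qed (use Fn C(1) X in auto)
      finally show "(\<Sum>i\<in>F. emeasure M (ball (x i) (r i))) \<le> ennreal (2 * C * X / t powr p)" by (simp add: mult.assoc)
    next
      fix F y assume F: "finite F" "F \<subseteq> J"
      have "(\<Sum>i\<in>F. ennreal (w i) * tower \<beta> (x i) (r i) y) =
        (\<Sum>i\<in>F. (\<lambda>u. ennreal (tn (fst u)) * tower \<beta> (xn (fst u) (snd u)) (rn (fst u) (snd u)) y) (prod_decode i))"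
        by (intro sum.cong) (auto simp: x_def r_def w_def split: prod.splits)
      also have "\<dots> \<le> ennreal (2 * (C * t))"
      proof (rule sum_prod_decode_le[OF F(1), of Fn])
        show "snd (prod_decode i) \<in> Fn (fst (prod_decode i))" if "i \<in> F" for i
          using that F(2) by (auto simp: J_def)
        fix n
        have "(\<Sum>m\<in>Fn n. ennreal (tn n) * tower \<beta> (xn n m) (rn n m) y) = ennreal (tn n) * (\<Sum>m\<in>Fn n. tower \<beta> (xn n m) (rn n m) y)"
          by (rule sum_distrib_left[symmetric])
        also have "\<dots> \<le> ennreal (tn n) * ennreal C"
          using ok[of n] by (intro mult_left_mono) (auto simp: ok_def)
        also have "\<dots> = ennreal (C * t * (1 / 2) ^ n)"
          using C(1) t by (simp add: ennreal_mult'[symmetric] tn_def power_divide)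
        finally show "(\<Sum>m\<in>Fn n. ennreal (tn (fst (n, m))) * tower \<beta> (xn (fst (n, m)) (snd (n, m))) (rn (fst (n, m)) (snd (n, m))) y)
          \<le> ennreal (C * t * (1 / 2) ^ n)" by simp
      qed (use Fn C(1) t in auto)
      finally show "(\<Sum>i\<in>F. ennreal (w i) * tower \<beta> (x i) (r i) y) \<le> ennreal (2 * C * t)" by (simp add: mult.assoc)
    next
      have fm[measurable]: "f \<in> borel_measurable M" by (rule Linf_c_measurable[OF f])
      \<comment> \<open>A point that is never covered either leaves the sets \<open>Rs n\<close> in
        some round, where \<open>f\<close> is then at most the height of that round, or stays in all
        of them; the latter set has zero mass because \<open>\<epsilon> ^ n\<close> tends to 0, so
        \<open>f\<close> vanishes almost everywhere on it.\<close>
      let ?R = "\<Inter>n. Rs n"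
      have Rsm: "Rs n \<in> sets M" for n using small[of n] by (simp add: small_def)
      have Rm: "?R \<in> sets M" using Rsm by blast
      note Rm[measurable]
      have "(\<integral>\<^sup>+y\<in>?R. ?g y \<partial>M) \<le> 0"
      proof (rule LIMSEQ_le_const)
        have "(\<lambda>n. \<epsilon> ^ n * X) \<longlonglongrightarrow> 0 * X"
          using \<epsilon> \<epsilon>1 by (intro tendsto_intros LIMSEQ_power_zero) auto
        then have "(\<lambda>n. ennreal (\<epsilon> ^ n * X)) \<longlonglongrightarrow> ennreal (0 * X)" by (rule tendsto_ennrealI)
        then show "(\<lambda>n. ennreal (\<epsilon> ^ n * X)) \<longlonglongrightarrow> 0" by simp
        have "(\<integral>\<^sup>+y\<in>?R. ?g y \<partial>M) \<le> ennreal (\<epsilon> ^ n * X)" for n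
          by (rule order_trans[OF nn_set_integral_subset[of ?R "Rs n"]]) (use small[of n] in \<open>auto simp: small_def\<close>)
        then show "\<exists>N. \<forall>n\<ge>N. (\<integral>\<^sup>+y\<in>?R. ?g y \<partial>M) \<le> ennreal (\<epsilon> ^ n * X)" by blast
      qed
      then have "(\<integral>\<^sup>+y\<in>?R. ?g y \<partial>M) = 0" by simp
      then have "AE y in M. ?g y * indicator ?R y = 0"
        by (subst (asm) nn_integral_0_iff_AE) measurable
      then show "AE y in M. y \<notin> (\<Union>i. P i) \<longrightarrow> norm (f y) \<le> t"
      proof (eventually_elim, intro impI)
        fix y assume z: "?g y * indicator ?R y = 0" and y: "y \<notin> (\<Union>i. P i)"
        have yP: "y \<notin> Pn n m" for n m
        proof -
          have "P (prod_encode (n, m)) = Pn n m" by (simp add: P_def)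
          then show ?thesis using y by blast
        qed
        show "norm (f y) \<le> t"
        proof (cases "y \<in> ?R")
          case True
          then have "norm (f y) powr p = 0" using z by (simp add: indicator_def)
          then show ?thesis using t by simp
        next
          case False
          then obtain k where k: "y \<notin> Rs k" by blast
          define n where "n = (LEAST k. y \<notin> Rs k)"
          have n: "y \<notin> Rs n" unfolding n_def by (rule LeastI[of _ k]) fact
          have "n \<noteq> 0" using n Rs0 by (metis UNIV_I)
          then obtain n' where n': "n = Suc n'" by (cases n) auto
          have R1: "y \<in> Rs n'" using not_less_Least[of n' "\<lambda>k. y \<notin> Rs k"] n' by (simp add: n_def)
          then have R2: "y \<notin> RR n' (Rs n')" using n n' RsS by simp
          have "y \<notin> (\<Union>i\<in>Fn n'. PP n' (Rs n') i)" using yP[of n'] R1 unfolding Pn_def by (metis IntI UN_E)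
          then have "norm (restr (Rs n') f y) \<le> tn n'" using ok[of n'] R2 by (simp add: ok_def)
          then show ?thesis using R1 tn(2)[of n'] by (simp add: restr_def)
        qed
      qed
    qed
  qed
qed

end

section \<open>Sums of functions decaying along annuli\<close>

lemma eroot_mono: "a \<le> b \<Longrightarrow> 0 < q \<Longrightarrow> eroot q a \<le> eroot q b"
  unfolding eroot_def
  by (auto simp: top_unique less_top intro!: ennreal_leI powr_mono2 enn2real_mono)

lemma eroot_ennreal_powr: "0 \<le> c \<Longrightarrow> 0 < q \<Longrightarrow> eroot q (ennreal (c powr q)) = ennreal c"
  by (simp add: eroot_def powr_powr)

lemma eroot_le_iff:
  assumes "0 \<le> c" "0 < q" shows "eroot q a \<le> ennreal c \<longleftrightarrow> a \<le> ennreal (c powr q)"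
proof
  assume *: "eroot q a \<le> ennreal c"
  then have fin: "a \<noteq> \<infinity>" by (auto simp: eroot_def top_unique)
  then obtain a' where a': "a = ennreal a'" "0 \<le> a'" by (cases a) auto
  have "a' powr (1 / q) \<le> c" using * assms a' by (simp add: eroot_def)
  then have "(a' powr (1 / q)) powr q \<le> c powr q" using assms by (intro powr_mono2) auto
  then show "a \<le> ennreal (c powr q)" using a' assms by (simp add: powr_powr ennreal_leI)
next
  assume "a \<le> ennreal (c powr q)"
  then show "eroot q a \<le> ennreal c" using eroot_mono[of a _ q] eroot_ennreal_powr[of c q] assms by metis
qed

lemma young_powr:
  fixes u v s :: real
  assumes "1 < s" "0 \<le> u" "0 \<le> v"
  shows "u * v \<le> u powr s + v powr (s / (s - 1))"
proof -
  let ?s' = "s / (s - 1)"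
  have s': "1 < ?s'" using assms(1) by (simp add: field_simps)
  have "u * v \<le> u powr s / s + v powr ?s' / ?s'"
    using assms s' by (intro Youngs_inequality) (auto simp: field_simps)
  also have "\<dots> \<le> u powr s / 1 + v powr ?s' / 1"
    using assms s' by (intro add_mono divide_left_mono) auto
  finally show ?thesis by simp
qed

text \<open>Replaces Hoelder's inequality. Young's inequality is applied to \<open>u / a\<close> and
  \<open>v / c\<close>, so the result has the product \<open>a * c\<close> that Hoelder would give,
  at the cost of \<open>K1 + K2\<close> as constant.\<close>

lemma set_integral_young:
  fixes u v :: "'a \<Rightarrow> real"
  assumes [measurable]: "u \<in> borel_measurable M" "v \<in> borel_measurable M" "S \<in> sets M"
    and s: "1 < s" and pos: "\<And>y. 0 \<le> u y" "\<And>y. 0 \<le> v y" and ac: "0 < a" "0 < c" and K: "0 \<le> K1" "0 \<le> K2"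
    and u: "(\<integral>\<^sup>+y\<in>S. ennreal (u y powr s) \<partial>M) \<le> ennreal (K1 * a powr s) * m"
    and v: "(\<integral>\<^sup>+y\<in>S. ennreal (v y powr (s / (s - 1))) \<partial>M) \<le> ennreal (K2 * c powr (s / (s - 1))) * m"
  shows "(\<integral>\<^sup>+y\<in>S. ennreal (u y * v y) \<partial>M) \<le> ennreal (a * c * (K1 + K2)) * m"
proof -
  let ?s' = "s / (s - 1)"
  have "(\<integral>\<^sup>+y\<in>S. ennreal (u y * v y) \<partial>M) \<le>
    (\<integral>\<^sup>+y\<in>S. ennreal (a * c / a powr s) * ennreal (u y powr s) + ennreal (a * c / c powr ?s') * ennreal (v y powr ?s') \<partial>M)"
  proof (rule nn_set_integral_le)
    fix y
    have "u y * v y = a * c * (u y / a * (v y / c))" using ac by simp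
    also have "\<dots> \<le> a * c * ((u y / a) powr s + (v y / c) powr ?s')"
      using ac pos[of y] by (intro mult_left_mono young_powr s) auto
    also have "\<dots> = a * c / a powr s * u y powr s + a * c / c powr ?s' * v y powr ?s'"
      using ac pos[of y] by (simp add: powr_divide field_simps)
    finally show "ennreal (u y * v y) \<le> ennreal (a * c / a powr s) * ennreal (u y powr s) + ennreal (a * c / c powr ?s') * ennreal (v y powr ?s')"
      using ac by (simp add: ennreal_mult'[symmetric] ennreal_plus[symmetric] ennreal_leI del: ennreal_plus)
  qed
  also have "\<dots> = ennreal (a * c / a powr s) * (\<integral>\<^sup>+y\<in>S. ennreal (u y powr s) \<partial>M) +
      ennreal (a * c / c powr ?s') * (\<integral>\<^sup>+y\<in>S. ennreal (v y powr ?s') \<partial>M)"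
    by (subst nn_set_integral_add) (measurable, simp add: mult.assoc nn_integral_cmult)
  also have "\<dots> \<le> ennreal (a * c / a powr s) * (ennreal (K1 * a powr s) * m) + ennreal (a * c / c powr ?s') * (ennreal (K2 * c powr ?s') * m)"
    by (intro add_mono mult_left_mono u v) auto
  also have "\<dots> = ennreal (a * c * K1) * m + ennreal (a * c * K2) * m"
    using ac by (simp add: mult.assoc[symmetric] ennreal_mult'[symmetric])
  also have "\<dots> = ennreal (a * c * (K1 + K2)) * m"
    using ac K by (simp add: distrib_left distrib_right)
  finally show ?thesis .
qed

lemma suminf_shift_le:
  fixes f :: "nat \<Rightarrow> ennreal" shows "(\<Sum>j. f (Suc j)) \<le> (\<Sum>j. f j)"
  using suminf_offset[of f 1] by simp

text \<open>The endpoint 0 is included because the functions to which Jensen's inequality is applied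
  may vanish.\<close>

lemma convex_on_powr_nonneg:
  assumes "1 \<le> q" shows "convex_on {0..} (\<lambda>z::real. z powr q)"
proof (rule convex_onI)
  fix t x y :: real
  assume t: "0 < t" "t < 1" and xy: "x \<in> {0..}" "y \<in> {0..}"
  have tq: "t powr q \<le> t" "(1 - t) powr q \<le> 1 - t" using t assms powr_mono'[of 1 q t] powr_mono'[of 1 q "1 - t"] by auto
  show "((1 - t) *\<^sub>R x + t *\<^sub>R y) powr q \<le> (1 - t) * x powr q + t * y powr q"
  proof (cases "x = 0 \<or> y = 0")
    case True
    then show ?thesis using tq t xy assms by (auto simp: powr_mult intro!: mult_right_mono)
  next
    case False
    then show ?thesis using convex_onD[OF powr_convex[OF assms], of t x y] t xy by auto
  qed
qed auto

lemma annulus_cover: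
  fixes x :: "'a::euclidean_space"
  assumes r: "0 < r" shows "\<exists>j\<ge>1. y \<in> annulus x r j \<and> (y \<notin> ball x (4 * r) \<longrightarrow> 2 \<le> j)"
proof (cases "dist x y < 4 * r")
  case True
  then show ?thesis by (intro exI[of _ 1]) (auto simp: annulus_def)
next
  case False
  obtain n :: nat where "dist x y / r < 2 ^ n" using real_arch_pow[of 2 "dist x y / r"] by auto
  then have n: "dist x y < 2 ^ n * r" using r by (simp add: field_simps)
  define i where "i = (LEAST i. dist x y < 2 ^ i * r)"
  have i: "dist x y < 2 ^ i * r" unfolding i_def by (rule LeastI[of _ n]) (rule n)
  have "\<not> i \<le> 2"
  proof
    assume "i \<le> 2"
    then have "(2::real) ^ i \<le> 2 ^ 2" by (intro power_increasing) auto
    then have "2 ^ i * r \<le> 4 * r" using r by (intro mult_right_mono) auto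
    then show False using i False by simp
  qed
  then obtain j where j: "i = Suc j" "2 \<le> j" by (cases i) auto
  have "\<not> dist x y < 2 ^ j * r" using not_less_Least[of j "\<lambda>i. dist x y < 2 ^ i * r"] j(1) by (simp add: i_def)
  then show ?thesis using i j by (intro exI[of _ j]) (auto simp: annulus_def)
qed

lemma annulus_subset: "1 \<le> j \<Longrightarrow> annulus x r j \<subseteq> ball x (2 ^ (j + 1) * r)"
  by (auto simp: annulus_def le_Suc_eq split: if_splits)

lemma annulus_borel [measurable]: "annulus x r j \<in> sets borel"
  by (simp add: annulus_def)

context doubling_measure
begin

lemma annulus_sets_M [measurable]: "annulus x r j \<in> sets M"
  by simp

lemma john_nirenberg_power:
  assumes e: "0 < e"
  shows "\<exists>C\<ge>1. \<forall>b::'a \<Rightarrow> 'k::{banach, second_countable_topology}. BMO1 b \<longrightarrow> (\<forall>l\<le>(k::nat). \<forall>x r j. 0 < r \<longrightarrow>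
    (\<integral>\<^sup>+y\<in>ball x (2 ^ j * r). ennreal ((norm (b y - mean M (ball x r) b) ^ l) powr e) \<partial>M) \<le>
     ennreal (C * ((1 + real j) ^ l) powr e) * emeasure M (ball x (2 ^ j * r)))"
proof -
  define ok where "ok l C \<longleftrightarrow> C \<ge> 1 \<and> (\<forall>b::'a \<Rightarrow> 'k. BMO1 b \<longrightarrow> (\<forall>x r j. 0 < r \<longrightarrow>
    (\<integral>\<^sup>+y\<in>ball x (2 ^ j * r). ennreal (norm (b y - mean M (ball x r) b) powr (real l * e)) \<partial>M) \<le>
     ennreal (C * (1 + real j) powr (real l * e)) * emeasure M (ball x (2 ^ j * r))))" for l C
  have "\<exists>C. ok l C" for l
    unfolding ok_def using john_nirenberg_dilate[of "real l * e", where 'k='k] e by simp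
  then obtain c where "\<And>l. ok l (c l)" by metis
  then have c: "1 \<le> c l" "\<And>(b::'a \<Rightarrow> 'k) x r j. BMO1 b \<Longrightarrow> 0 < r \<Longrightarrow>
    (\<integral>\<^sup>+y\<in>ball x (2 ^ j * r). ennreal (norm (b y - mean M (ball x r) b) powr (real l * e)) \<partial>M) \<le>
     ennreal (c l * (1 + real j) powr (real l * e)) * emeasure M (ball x (2 ^ j * r))" for l
    unfolding ok_def by blast+
  define C where "C = (\<Sum>l\<le>k. c l)"
  have c0: "0 \<le> c l" for l using c(1)[of l] by simp
  have cC: "c l \<le> C" if "l \<le> k" for l
    unfolding C_def using that c0 by (intro member_le_sum) auto
  have C1: "1 \<le> C" using cC[of 0] c(1)[of 0] by simp
  show ?thesis
  proof (intro exI[of _ C] conjI allI impI C1)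
    fix b :: "'a \<Rightarrow> 'k" and l :: nat and x :: 'a and r :: real and j :: nat
    assume b: "BMO1 b" and l: "l \<le> k" and r: "0 < r"
    show "(\<integral>\<^sup>+y\<in>ball x (2 ^ j * r). ennreal ((norm (b y - mean M (ball x r) b) ^ l) powr e) \<partial>M) \<le>
     ennreal (C * ((1 + real j) ^ l) powr e) * emeasure M (ball x (2 ^ j * r))"
    \<comment> \<open>\<open>z ^ 0 = 1\<close> for all \<open>z\<close>, whereas
      \<open>0 powr 0 = 0\<close>; the two ways of writing the power therefore disagree for
      \<open>l = 0\<close> at points where \<open>b\<close> equals the mean.\<close>
    proof (cases "l = 0")
      case True
      then have "(\<integral>\<^sup>+y\<in>ball x (2 ^ j * r). ennreal ((norm (b y - mean M (ball x r) b) ^ l) powr e) \<partial>M) = ennreal 1 * emeasure M (ball x (2 ^ j * r))"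
        by (simp add: nn_set_integral_const)
      also have "\<dots> \<le> ennreal (C * ((1 + real j) ^ l) powr e) * emeasure M (ball x (2 ^ j * r))"
        using True C1 by (intro mult_right_mono ennreal_leI) auto
      finally show ?thesis .
    next
      case False
      have pw: "(z ^ l) powr e = z powr (real l * e)" if "0 \<le> z" for z :: real
        using that False by (cases "z = 0") (auto simp: powr_realpow[symmetric] powr_powr)
      have "(\<integral>\<^sup>+y\<in>ball x (2 ^ j * r). ennreal ((norm (b y - mean M (ball x r) b) ^ l) powr e) \<partial>M) \<le>
        ennreal (c l * (1 + real j) powr (real l * e)) * emeasure M (ball x (2 ^ j * r))"
        using c(2)[OF b r, of x l j] by (simp add: pw)
      also have "\<dots> \<le> ennreal (C * ((1 + real j) ^ l) powr e) * emeasure M (ball x (2 ^ j * r))"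
        using cC[OF l] by (intro mult_right_mono ennreal_leI) (auto simp: pw intro: mult_right_mono)
      finally show ?thesis .
    qed
  qed
qed

lemma john_nirenberg_annulus:
  assumes e: "0 < e"
  shows "\<exists>C\<ge>1. \<forall>b::'a \<Rightarrow> 'k::{banach, second_countable_topology}. BMO1 b \<longrightarrow> (\<forall>l\<le>(k::nat). \<forall>x r. 0 < r \<longrightarrow>
    (\<integral>\<^sup>+y\<in>ball x r. ennreal ((norm (b y - mean M (ball x r) b) ^ l) powr e) \<partial>M) \<le> ennreal C * emeasure M (ball x r) \<and>
    (\<forall>j\<ge>1. (\<integral>\<^sup>+y\<in>annulus x r j. ennreal ((norm (b y - mean M (ball x r) b) ^ l) powr e) \<partial>M) \<le>
     ennreal (C * ((1 + real j) ^ l) powr e) * emeasure M (ball x (2 ^ (j + 1) * r))))"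
proof -
  obtain C where C: "1 \<le> C" "\<And>(b::'a \<Rightarrow> 'k) l x r j. BMO1 b \<Longrightarrow> l \<le> k \<Longrightarrow> 0 < r \<Longrightarrow>
    (\<integral>\<^sup>+y\<in>ball x (2 ^ j * r). ennreal ((norm (b y - mean M (ball x r) b) ^ l) powr e) \<partial>M) \<le>
     ennreal (C * ((1 + real j) ^ l) powr e) * emeasure M (ball x (2 ^ j * r))"
    using john_nirenberg_power[OF e, where 'k='k and k=k] by blast
  define C' where "C' = C * (2 ^ k) powr e"
  have one: "1 \<le> (2 ^ k :: real) powr e" using e by (intro ge_one_powr_ge_zero) auto
  have C': "1 \<le> C'" "C \<le> C'"
  proof -
    have "C * 1 \<le> C'" unfolding C'_def using C(1) one by (intro mult_left_mono) auto
    then show "1 \<le> C'" "C \<le> C'" using C(1) by auto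
  qed
  show ?thesis
  proof (intro exI[of _ C'] conjI allI impI C'(1))
    fix b :: "'a \<Rightarrow> 'k" and l :: nat and x :: 'a and r :: real
    assume b: "BMO1 b" and l: "l \<le> k" and r: "0 < r"
    let ?f = "\<lambda>y. ennreal ((norm (b y - mean M (ball x r) b) ^ l) powr e)"
    have "(\<integral>\<^sup>+y\<in>ball x r. ?f y \<partial>M) \<le> ennreal C * emeasure M (ball x r)"
      using C(2)[OF b l r, of x 0] by simp
    also have "\<dots> \<le> ennreal C' * emeasure M (ball x r)"
      using C' by (intro mult_right_mono ennreal_leI) auto
    finally show "(\<integral>\<^sup>+y\<in>ball x r. ?f y \<partial>M) \<le> ennreal C' * emeasure M (ball x r)" .
    fix j :: nat assume j: "1 \<le> j"
    have "(\<integral>\<^sup>+y\<in>annulus x r j. ?f y \<partial>M) \<le> (\<integral>\<^sup>+y\<in>ball x (2 ^ (j + 1) * r). ?f y \<partial>M)"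
      by (rule nn_set_integral_subset[OF annulus_subset[OF j]])
    also have "\<dots> \<le> ennreal (C * ((1 + real (j + 1)) ^ l) powr e) * emeasure M (ball x (2 ^ (j + 1) * r))"
      by (rule C(2)[OF b l r])
    also have "\<dots> \<le> ennreal (C' * ((1 + real j) ^ l) powr e) * emeasure M (ball x (2 ^ (j + 1) * r))"
    proof (intro mult_right_mono ennreal_leI)
      have "(1 + real (j + 1)) ^ l \<le> (2 * (1 + real j)) ^ l" by (intro power_mono) auto
      also have "\<dots> = 2 ^ l * (1 + real j) ^ l" by (rule power_mult_distrib)
      also have "\<dots> \<le> 2 ^ k * (1 + real j) ^ l" using l by (intro mult_right_mono power_increasing) auto
      finally have "((1 + real (j + 1)) ^ l) powr e \<le> (2 ^ k * (1 + real j) ^ l) powr e"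
        using e by (intro powr_mono2) auto
      also have "\<dots> = (2 ^ k) powr e * ((1 + real j) ^ l) powr e" by (rule powr_mult)
      finally show "C * ((1 + real (j + 1)) ^ l) powr e \<le> C' * ((1 + real j) ^ l) powr e"
        unfolding C'_def mult.assoc using C(1) by (intro mult_left_mono) auto
    qed simp
    finally show "(\<integral>\<^sup>+y\<in>annulus x r j. ?f y \<partial>M) \<le> ennreal (C' * ((1 + real j) ^ l) powr e) * emeasure M (ball x (2 ^ (j + 1) * r))" .
  qed
qed

text \<open>
  Jensen's inequality with the weights \<open>w i * \<beta> j\<close>, whose sum is at most \<open>L\<close> at every point,
  takes the place of the usual duality argument with the maximal function.
\<close>
lemma sum_powr_towers:
  fixes u :: "nat \<Rightarrow> 'a \<Rightarrow> real" and F :: "nat set"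
  assumes q: "1 \<le> q" and \<beta>: "\<And>j. 0 < \<beta> j" "summable (\<lambda>j. \<beta> j * 2 powr (D * real j))"
    and F: "finite F" and rw: "\<And>i. i \<in> F \<Longrightarrow> 0 < r i" "\<And>i. i \<in> F \<Longrightarrow> 0 < w i" "\<And>i. i \<in> F \<Longrightarrow> w i \<le> t"
    and um[measurable]: "\<And>i. i \<in> F \<Longrightarrow> u i \<in> borel_measurable M" and u0: "\<And>i y. 0 \<le> u i y" and K: "0 \<le> K" and L: "0 < L"
    and ann: "\<And>i j. i \<in> F \<Longrightarrow> 1 \<le> j \<Longrightarrow> (\<integral>\<^sup>+y\<in>annulus (x i) (r i) j. ennreal (u i y powr q) \<partial>M)
       \<le> ennreal (K * (w i * \<beta> j) powr q) * emeasure M (ball (x i) (2 ^ (j + 1) * r i))"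
    and tow: "\<And>y. (\<Sum>i\<in>F. ennreal (w i) * tower \<beta> (x i) (r i) y) \<le> ennreal L"
  shows "(\<integral>\<^sup>+y. ennreal ((\<Sum>i\<in>F. u i y) powr q) \<partial>M) \<le>
    ennreal (L powr (q - 1) * K * t * tower_const \<beta>) * (\<Sum>i\<in>F. emeasure M (ball (x i) (r i)))"
proof -
  \<comment> \<open>Annuli are numbered from 1 and series from 0; the shift is undone below by
    \<open>suminf_shift_le\<close>.\<close>
  let ?C = "\<lambda>i j. annulus (x i) (r i) (Suc j)"
  \<comment> \<open>The coefficient produced by Jensen: \<open>(\<Sum> u) powr q \<le> V powr (q -
    1) * (\<Sum> v powr (1 - q) * u powr q)\<close>, where \<open>v\<close> is the weight
    \<open>w i * \<beta> (Suc j)\<close> of the annulus in which the point lies.\<close>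
  define c where "c i j = (w i * \<beta> (Suc j)) powr (1 - q)" for i j
  define H where "H i y = (\<Sum>j. ennreal (c i j) * (ennreal (u i y powr q) * indicator (?C i j) y))" for i y
  have pt: "ennreal ((\<Sum>i\<in>F. u i y) powr q) \<le> ennreal (L powr (q - 1)) * (\<Sum>i\<in>F. H i y)" for y
  proof (cases "F = {}")
    case False
    have "\<exists>j. y \<in> ?C i j" if "i \<in> F" for i
      using annulus_cover[OF rw(1)[OF that], of y "x i"] by (metis Suc_le_D One_nat_def)
    then obtain J where J: "\<And>i. i \<in> F \<Longrightarrow> y \<in> ?C i (J i)" by metis
    define v where "v i = w i * \<beta> (Suc (J i))" for i
    have v: "0 < v i" if "i \<in> F" for i using rw(2)[OF that] \<beta>(1) by (simp add: v_def)
    define V where "V = (\<Sum>i\<in>F. v i)"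
    have V0: "0 < V" unfolding V_def using F False v by (intro sum_pos) auto
    have "ennreal V = (\<Sum>i\<in>F. ennreal (v i))" unfolding V_def using v by (subst sum_ennreal) (auto intro: less_imp_le)
    also have "\<dots> \<le> (\<Sum>i\<in>F. ennreal (w i) * tower \<beta> (x i) (r i) y)"
    proof (rule sum_mono)
      fix i assume i: "i \<in> F"
      have "y \<in> ball (x i) (2 ^ (Suc (J i) + 1) * r i)" using J[OF i] annulus_subset[of "Suc (J i)" "x i" "r i"] by auto
      then have "ennreal (\<beta> (Suc (J i))) \<le> (\<Sum>j\<in>{Suc (J i)}. ennreal (\<beta> j) * indicator (ball (x i) (2 ^ (j + 1) * r i)) y)"
        by simp
      also have "\<dots> \<le> tower \<beta> (x i) (r i) y" unfolding tower_def by (intro sum_le_suminf) auto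
      finally have "ennreal (w i) * ennreal (\<beta> (Suc (J i))) \<le> ennreal (w i) * tower \<beta> (x i) (r i) y" by (rule mult_left_mono) simp
      then show "ennreal (v i) \<le> ennreal (w i) * tower \<beta> (x i) (r i) y"
        using rw(2)[OF i] \<beta>(1)[of "Suc (J i)"] by (simp add: v_def ennreal_mult)
    qed
    also note tow
    finally have VL: "V \<le> L" using L by (simp add: ennreal_le_iff)
    \<comment> \<open>The sum is \<open>V\<close> times a convex combination with weights
      \<open>v i / V\<close>; dividing by \<open>v i\<close> needs every \<open>\<beta> j\<close> to
      be positive.\<close>
    have "(\<Sum>i\<in>F. u i y) = V * (\<Sum>i\<in>F. v i / V * (u i y / v i))"
      using V0 v by (simp add: sum_distrib_left) (rule sum.cong, auto simp: less_imp_neq[symmetric] dest: v)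
    then have "(\<Sum>i\<in>F. u i y) powr q = V powr q * (\<Sum>i\<in>F. v i / V * (u i y / v i)) powr q"
      using V0 u0 v by (simp add: powr_mult sum_nonneg)
    also have "\<dots> \<le> V powr q * (\<Sum>i\<in>F. v i / V * (u i y / v i) powr q)"
    proof (rule mult_left_mono)
      have cv: "convex_on {0..} (\<lambda>z. z powr q)" using q by (rule convex_on_powr_nonneg)
      show "(\<Sum>i\<in>F. v i / V * (u i y / v i)) powr q \<le> (\<Sum>i\<in>F. v i / V * (u i y / v i) powr q)"
        using convex_on_sum[OF F False cv, of "\<lambda>i. v i / V" "\<lambda>i. u i y / v i"] V0 v u0
        by (simp add: sum_divide_distrib[symmetric] V_def[symmetric] less_imp_le)
    qed simp
    also have "\<dots> = V powr (q - 1) * (\<Sum>i\<in>F. v i powr (1 - q) * u i y powr q)"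
      unfolding sum_distrib_left
    proof (rule sum.cong)
      fix i assume "i \<in> F"
      then show "V powr q * (v i / V * (u i y / v i) powr q) = V powr (q - 1) * (v i powr (1 - q) * u i y powr q)"
        using V0 v[of i] u0[of i y] by (simp add: powr_divide powr_diff)
    qed simp
    also have "\<dots> \<le> L powr (q - 1) * (\<Sum>i\<in>F. v i powr (1 - q) * u i y powr q)"
      using VL V0 q by (intro mult_right_mono powr_mono2 sum_nonneg) auto
    finally have "ennreal ((\<Sum>i\<in>F. u i y) powr q) \<le> ennreal (L powr (q - 1)) * ennreal (\<Sum>i\<in>F. v i powr (1 - q) * u i y powr q)"
      by (simp add: ennreal_mult'[symmetric] ennreal_leI)
    also have "ennreal (\<Sum>i\<in>F. v i powr (1 - q) * u i y powr q) = (\<Sum>i\<in>F. ennreal (v i powr (1 - q) * u i y powr q))"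
      by (subst sum_ennreal) auto
    also have "\<dots> \<le> (\<Sum>i\<in>F. H i y)"
    proof (rule sum_mono)
      fix i assume i: "i \<in> F"
      have "ennreal (v i powr (1 - q) * u i y powr q) = (\<Sum>j\<in>{J i}. ennreal (c i j) * (ennreal (u i y powr q) * indicator (?C i j) y))"
        using J[OF i] by (simp add: c_def v_def ennreal_mult)
      also have "\<dots> \<le> H i y" unfolding H_def by (intro sum_le_suminf) auto
      finally show "ennreal (v i powr (1 - q) * u i y powr q) \<le> H i y" .
    qed
    finally show ?thesis by (simp add: mult_left_mono)
  qed simp
  have Hint: "(\<integral>\<^sup>+y. H i y \<partial>M) \<le> ennreal (K * t * tower_const \<beta>) * emeasure M (ball (x i) (r i))" if i: "i \<in> F" for i
  proof -
    note um[OF i, measurable]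
    have "(\<integral>\<^sup>+y. H i y \<partial>M) = (\<Sum>j. \<integral>\<^sup>+y. ennreal (c i j) * (ennreal (u i y powr q) * indicator (?C i j) y) \<partial>M)"
      unfolding H_def by (rule nn_integral_suminf) measurable
    also have "\<dots> = (\<Sum>j. ennreal (c i j) * (\<integral>\<^sup>+y\<in>?C i j. ennreal (u i y powr q) \<partial>M))"
      by (intro suminf_cong nn_integral_cmult) measurable
    also have "\<dots> \<le> (\<Sum>j. ennreal (K * w i) * (ennreal (\<beta> (Suc j)) * emeasure M (ball (x i) (2 ^ (Suc j + 1) * r i))))"
    proof (rule suminf_le)
      fix j
      have "ennreal (c i j) * (\<integral>\<^sup>+y\<in>?C i j. ennreal (u i y powr q) \<partial>M) \<le>
        ennreal (c i j) * (ennreal (K * (w i * \<beta> (Suc j)) powr q) * emeasure M (ball (x i) (2 ^ (Suc j + 1) * r i)))"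
        using ann[OF i, of "Suc j"] by (intro mult_left_mono) auto
      also have "\<dots> = ennreal (c i j * (K * (w i * \<beta> (Suc j)) powr q)) * emeasure M (ball (x i) (2 ^ (Suc j + 1) * r i))"
        by (simp only: mult.assoc[symmetric], subst ennreal_mult'[symmetric]) (auto simp: c_def mult.assoc)
      \<comment> \<open>The powers \<open>1 - q\<close> and \<open>q\<close> cancel, so the bound
        becomes linear in \<beta> and \<open>sum_dilated_balls\<close> applies whatever
        \<open>q\<close> is.\<close>
      also have "c i j * (K * (w i * \<beta> (Suc j)) powr q) = K * w i * \<beta> (Suc j)"
      proof -
        have "0 < w i * \<beta> (Suc j)" using rw(2)[OF i] \<beta>(1) by simp
        then have "(w i * \<beta> (Suc j)) powr (1 - q) * (w i * \<beta> (Suc j)) powr q = w i * \<beta> (Suc j)"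
          by (simp add: powr_add[symmetric])
        then show ?thesis by (simp add: c_def mult_ac)
      qed
      also have "ennreal (K * w i * \<beta> (Suc j)) = ennreal (K * w i) * ennreal (\<beta> (Suc j))"
        using K rw(2)[OF i] \<beta>(1)[of "Suc j"] by (intro ennreal_mult) auto
      finally show "ennreal (c i j) * (\<integral>\<^sup>+y\<in>?C i j. ennreal (u i y powr q) \<partial>M) \<le>
        ennreal (K * w i) * (ennreal (\<beta> (Suc j)) * emeasure M (ball (x i) (2 ^ (Suc j + 1) * r i)))"
        by (simp only: mult.assoc)
    qed auto
    also have "\<dots> = ennreal (K * w i) * (\<Sum>j. (ennreal (\<beta> (Suc j)) * emeasure M (ball (x i) (2 ^ (Suc j + 1) * r i))))"
      by (rule ennreal_suminf_cmult)
    also have "\<dots> \<le> ennreal (K * w i) * (\<Sum>j. (ennreal (\<beta> j) * emeasure M (ball (x i) (2 ^ (j + 1) * r i))))"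
      by (intro mult_left_mono suminf_shift_le) auto
    also have "\<dots> \<le> ennreal (K * w i) * (ennreal (tower_const \<beta>) * emeasure M (ball (x i) (r i)))"
      using \<beta> rw(1)[OF i] by (intro mult_left_mono sum_dilated_balls) (auto intro: less_imp_le)
    also have "\<dots> = ennreal (K * w i * tower_const \<beta>) * emeasure M (ball (x i) (r i))"
      using K rw(2)[OF i] by (simp add: mult.assoc[symmetric] ennreal_mult'[symmetric])
    also have "\<dots> \<le> ennreal (K * t * tower_const \<beta>) * emeasure M (ball (x i) (r i))"
      using K rw(3)[OF i] tower_const_nonneg[of \<beta>] \<beta>
      by (intro mult_right_mono ennreal_leI mult_left_mono) (auto intro: less_imp_le)
    finally show ?thesis .
  qed
  have Hm: "H i \<in> borel_measurable M" if "i \<in> F" for i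
    using um[OF that] unfolding H_def[abs_def] by measurable
  have "(\<integral>\<^sup>+y. ennreal ((\<Sum>i\<in>F. u i y) powr q) \<partial>M) \<le> (\<integral>\<^sup>+y. ennreal (L powr (q - 1)) * (\<Sum>i\<in>F. H i y) \<partial>M)"
    by (intro nn_integral_mono pt)
  also have "\<dots> = ennreal (L powr (q - 1)) * (\<Sum>i\<in>F. \<integral>\<^sup>+y. H i y \<partial>M)"
    using Hm by (subst nn_integral_cmult) (auto simp: nn_integral_sum intro: borel_measurable_sum)
  also have "\<dots> \<le> ennreal (L powr (q - 1)) * (\<Sum>i\<in>F. ennreal (K * t * tower_const \<beta>) * emeasure M (ball (x i) (r i)))"
    by (intro mult_left_mono sum_mono Hint) auto
  also have "\<dots> = ennreal (L powr (q - 1)) * ennreal (K * t * tower_const \<beta>) * (\<Sum>i\<in>F. emeasure M (ball (x i) (r i)))"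
    by (simp add: sum_distrib_left mult.assoc)
  also have "ennreal (L powr (q - 1)) * ennreal (K * t * tower_const \<beta>) = ennreal (L powr (q - 1) * K * t * tower_const \<beta>)"
    by (simp add: ennreal_mult'[symmetric] mult.assoc)
  finally show ?thesis .
qed

text \<open>Counterpart of \<open>sum_powr_towers\<close> for the infinite exponent; it is stated at
  a single point \<open>y\<close> so that the exceptional null sets can be collected
  beforehand.\<close>

lemma sum_bound_towers:
  fixes u :: "nat \<Rightarrow> 'a \<Rightarrow> real" and F :: "nat set"
  assumes \<beta>: "\<And>j. 0 < \<beta> j" and F: "finite F" and rw: "\<And>i. i \<in> F \<Longrightarrow> 0 < r i" "\<And>i. i \<in> F \<Longrightarrow> 0 < w i"
    and K: "0 \<le> K" and L: "0 < L" and u0: "\<And>i. 0 \<le> u i y"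
    and ann: "\<And>i j. i \<in> F \<Longrightarrow> 1 \<le> j \<Longrightarrow> y \<in> annulus (x i) (r i) j \<Longrightarrow> u i y \<le> K * (w i * \<beta> j)"
    and tow: "(\<Sum>i\<in>F. ennreal (w i) * tower \<beta> (x i) (r i) y) \<le> ennreal L"
  shows "(\<Sum>i\<in>F. u i y) \<le> K * L"
proof -
  have "ennreal (u i y) \<le> ennreal K * (ennreal (w i) * tower \<beta> (x i) (r i) y)" if i: "i \<in> F" for i
  proof -
    obtain j where j: "1 \<le> j" "y \<in> annulus (x i) (r i) j" using annulus_cover[OF rw(1)[OF i], of y "x i"] by blast
    have "y \<in> ball (x i) (2 ^ (j + 1) * r i)" using j annulus_subset by blast
    then have "ennreal (\<beta> j) \<le> (\<Sum>j\<in>{j}. ennreal (\<beta> j) * indicator (ball (x i) (2 ^ (j + 1) * r i)) y)" by simp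
    also have "\<dots> \<le> tower \<beta> (x i) (r i) y" unfolding tower_def by (intro sum_le_suminf) auto
    finally have t: "ennreal (\<beta> j) \<le> tower \<beta> (x i) (r i) y" .
    have "ennreal (u i y) \<le> ennreal (K * (w i * \<beta> j))" by (intro ennreal_leI ann i j)
    also have "\<dots> = ennreal K * (ennreal (w i) * ennreal (\<beta> j))"
      using K rw(2)[OF i] \<beta>[of j] by (simp add: ennreal_mult)
    also have "\<dots> \<le> ennreal K * (ennreal (w i) * tower \<beta> (x i) (r i) y)" by (intro mult_left_mono t) auto
    finally show ?thesis .
  qed
  then have "(\<Sum>i\<in>F. ennreal (u i y)) \<le> (\<Sum>i\<in>F. ennreal K * (ennreal (w i) * tower \<beta> (x i) (r i) y))" by (rule sum_mono)
  also have "\<dots> = ennreal K * (\<Sum>i\<in>F. (ennreal (w i) * tower \<beta> (x i) (r i) y))" by (rule sum_distrib_left[symmetric])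
  also have "\<dots> \<le> ennreal K * ennreal L" by (intro mult_left_mono tow) auto
  finally have "ennreal (\<Sum>i\<in>F. u i y) \<le> ennreal (K * L)" using K u0 by (simp add: sum_ennreal ennreal_mult')
  then show ?thesis using K L by (simp add: ennreal_le_iff)
qed

end

section \<open>Averages and weak-type bounds\<close>

lemma ennreal_divide_le_iff_real:
  assumes "0 < m" shows "x / ennreal m \<le> c \<longleftrightarrow> x \<le> c * ennreal m"
proof
  assume "x / ennreal m \<le> c"
  then have "x / ennreal m * ennreal m \<le> c * ennreal m" by (rule mult_right_mono) simp
  moreover have "x / ennreal m * ennreal m = x"
    using assms mult_divide_eq_ennreal[of "ennreal m" x] by (simp add: ennreal_times_divide mult.commute)
  ultimately show "x \<le> c * ennreal m" by simp
next
  assume "x \<le> c * ennreal m"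
  then show "x / ennreal m \<le> c" using assms by (intro divide_le_posI_ennreal) (auto simp: mult.commute)
qed

lemma avg_norm_real_le_iff:
  assumes m: "emeasure M N = ennreal m" "0 < m" and q: "0 < q" "0 \<le> c"
  shows "avg_norm M (ereal q) N S f \<le> ennreal c \<longleftrightarrow>
    (\<integral>\<^sup>+x\<in>S. ennreal (norm (f x) powr q) \<partial>M) \<le> ennreal (c powr q) * emeasure M N"
  unfolding avg_norm_def using eroot_le_iff[OF q(2,1)] ennreal_divide_le_iff_real[OF m(2)] m(1) by simp

lemma avg_norm_infinity_le_D:
  assumes S: "S \<in> sets M" and f: "f \<in> borel_measurable M" and le: "avg_norm M \<infinity> N S f \<le> ennreal c" and c: "0 \<le> c"
  shows "AE x in M. x \<in> S \<longrightarrow> norm (f x) \<le> c"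
proof -
  have "AE x in restrict_space M S. ennreal (norm (f x)) \<le> esssup (restrict_space M S) (\<lambda>x. ennreal (norm (f x)))"
    by (rule esssup_AE)
  then have "AE x in restrict_space M S. norm (f x) \<le> c"
  proof eventually_elim
    case (elim x)
    then have "ennreal (norm (f x)) \<le> ennreal c" using le by (simp add: avg_norm_def)
    then show ?case by (subst (asm) ennreal_le_iff[OF c])
  qed
  then show ?thesis using S sets.sets_into_space[OF S]
    by (subst (asm) AE_restrict_space_iff) (auto simp: Int_absorb2)
qed

text \<open>Common form, without division, of the average bound for finite and infinite
  \<open>q\<^sub>0\<close>; \<open>m\<close> is the measure of the normalising ball.\<close>

definition annular_bound :: "'a measure \<Rightarrow> ereal \<Rightarrow> 'a set \<Rightarrow> ennreal \<Rightarrow> real \<Rightarrow> ('a \<Rightarrow> 'k::real_normed_vector) \<Rightarrow> bool" where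
  "annular_bound M q\<^sub>0 S m c a \<longleftrightarrow>
    (q\<^sub>0 = \<infinity> \<longrightarrow> (AE x in M. x \<in> S \<longrightarrow> norm (a x) \<le> c)) \<and>
    (\<forall>q. q\<^sub>0 = ereal q \<longrightarrow> (\<integral>\<^sup>+x\<in>S. ennreal (norm (a x) powr q) \<partial>M) \<le> ennreal (c powr q) * m)"

text \<open>
  For finite \<open>q\<^sub>0\<close> the number \<open>K\<close> is the \<open>q\<^sub>0\<close>-th power of the weak-type constant.
\<close>
definition weak_bound :: "'a measure \<Rightarrow> ereal \<Rightarrow> ('a \<Rightarrow> 'k::real_normed_vector) set \<Rightarrow>
    (('a \<Rightarrow> 'k) \<Rightarrow> 'a \<Rightarrow> 'k) \<Rightarrow> real \<Rightarrow> bool" where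
  "weak_bound M q\<^sub>0 X S K \<longleftrightarrow>
    (\<forall>q. q\<^sub>0 = ereal q \<longrightarrow> (\<forall>f\<in>X. \<forall>t>0. emeasure M {y\<in>space M. t < norm (S f y)} \<le> ennreal (K / t powr q) * pmass M q f)) \<and>
    (q\<^sub>0 = \<infinity> \<longrightarrow> (\<forall>f\<in>X. \<forall>B\<ge>0. (AE y in M. norm (f y) \<le> B) \<longrightarrow> (AE y in M. norm (S f y) \<le> K * B)))"

lemma Lspace_real_iff:
  "0 < q \<Longrightarrow> f \<in> Lspace M (ereal q) \<longleftrightarrow> f \<in> borel_measurable M \<and> pmass M q f < \<infinity>"
  by (auto simp: Lspace_def Lnorm_def pmass_def eroot_def less_top)

lemma Lnorm_inf_le:
  assumes "f \<in> borel_measurable M" "AE x in M. norm (f x) \<le> B"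
  shows "Lnorm M \<infinity> f \<le> ennreal B"
  unfolding Lnorm_def using assms by (auto intro!: esssup_I elim!: eventually_mono simp: ennreal_leI)

lemma Lspace_inf_iff:
  "f \<in> Lspace M \<infinity> \<longleftrightarrow> f \<in> borel_measurable M \<and> (\<exists>B\<ge>0. AE x in M. norm (f x) \<le> B)"
proof
  assume f: "f \<in> Lspace M \<infinity>"
  then have "esssup M (\<lambda>x. ennreal (norm (f x))) < \<infinity>" by (simp add: Lspace_def Lnorm_def)
  then obtain B where B: "esssup M (\<lambda>x. ennreal (norm (f x))) = ennreal B" "0 \<le> B"
    by (cases "esssup M (\<lambda>x. ennreal (norm (f x)))") auto
  have "AE x in M. ennreal (norm (f x)) \<le> ennreal B" using esssup_AE[of "\<lambda>x. ennreal (norm (f x))" M] B by simp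
  then have "AE x in M. norm (f x) \<le> B" using B by simp
  then show "f \<in> borel_measurable M \<and> (\<exists>B\<ge>0. AE x in M. norm (f x) \<le> B)" using f B by (auto simp: Lspace_def)
next
  assume "f \<in> borel_measurable M \<and> (\<exists>B\<ge>0. AE x in M. norm (f x) \<le> B)"
  then obtain B where "f \<in> borel_measurable M" "AE x in M. norm (f x) \<le> B" by blast
  then show "f \<in> Lspace M \<infinity>" using Lnorm_inf_le[of f M B] by (auto simp: Lspace_def le_less_trans)
qed

lemma weak_boundI:
  assumes wt: "weak_type_bound M q\<^sub>0 X S (ennreal W)" and X: "X \<subseteq> Lspace M q\<^sub>0" and q0: "0 < q\<^sub>0" and W: "0 \<le> W"
  shows "weak_bound M q\<^sub>0 X S (if q\<^sub>0 = \<infinity> then W else W powr real_of_ereal q\<^sub>0)"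
  unfolding weak_bound_def
proof (intro conjI allI impI ballI)
  fix q f and t :: real assume q: "q\<^sub>0 = ereal q" and f: "f \<in> X" and t: "0 < t"
  have q': "0 < q" using q q0 by simp
  have fin: "pmass M q f < \<infinity>" using X f q Lspace_real_iff[OF q', of f M] by auto
  then obtain P where P: "pmass M q f = ennreal P" "0 \<le> P" by (cases "pmass M q f") auto
  let ?E = "{y\<in>space M. t < norm (S f y)}"
  have "ennreal t * eroot q (emeasure M ?E) \<le> weak_Lnorm M q\<^sub>0 (S f)"
    unfolding weak_Lnorm_def using q t by (auto intro!: SUP_upper2[of t])
  also have "\<dots> \<le> ennreal W * Lnorm M q\<^sub>0 f" using wt f by (simp add: weak_type_bound_def)
  also have "Lnorm M q\<^sub>0 f = ennreal (P powr (1 / q))"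
    using q P by (simp add: Lnorm_def pmass_def eroot_def)
  finally have "ennreal (1 / t) * (ennreal t * eroot q (emeasure M ?E)) \<le> ennreal (1 / t) * (ennreal W * ennreal (P powr (1 / q)))"
    by (rule mult_left_mono) simp
  then have "eroot q (emeasure M ?E) \<le> ennreal (W * P powr (1 / q) / t)"
    using t W by (simp add: mult.assoc[symmetric] ennreal_mult'[symmetric])
  then have "emeasure M ?E \<le> ennreal ((W * P powr (1 / q) / t) powr q)"
    using W t q' by (subst (asm) eroot_le_iff) auto
  also have "(W * P powr (1 / q) / t) powr q = W powr q / t powr q * P"
    using W t q' P by (simp add: powr_mult powr_divide powr_powr)
  finally show "emeasure M ?E \<le> ennreal ((if q\<^sub>0 = \<infinity> then W else W powr real_of_ereal q\<^sub>0) / t powr q) * pmass M q f"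
    using q P by (simp add: ennreal_mult''[symmetric])
next
  fix f and B :: real assume q: "q\<^sub>0 = \<infinity>" and f: "f \<in> X" and B: "0 \<le> B" "AE y in M. norm (f y) \<le> B"
  have "f \<in> borel_measurable M" using X f by (auto simp: Lspace_def)
  have "esssup M (\<lambda>x. ennreal (norm (S f x))) = weak_Lnorm M q\<^sub>0 (S f)"
    using q by (simp add: weak_Lnorm_def Lnorm_def)
  also have "\<dots> \<le> ennreal W * Lnorm M q\<^sub>0 f" using wt f by (simp add: weak_type_bound_def)
  also have "\<dots> \<le> ennreal W * ennreal B"
    unfolding q by (intro mult_left_mono Lnorm_inf_le B) (use \<open>f \<in> borel_measurable M\<close> in auto)
  finally have le: "esssup M (\<lambda>x. ennreal (norm (S f x))) \<le> ennreal (W * B)" using W by (simp add: ennreal_mult')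
  have "AE x in M. ennreal (norm (S f x)) \<le> esssup M (\<lambda>x. ennreal (norm (S f x)))" by (rule esssup_AE)
  then show "AE y in M. norm (S f y) \<le> (if q\<^sub>0 = \<infinity> then W else W powr real_of_ereal q\<^sub>0) * B"
  proof eventually_elim
    case (elim x)
    then have "ennreal (norm (S f x)) \<le> ennreal (W * B)" using le by simp
    then show ?case using W B q by (subst (asm) ennreal_le_iff) auto
  qed
qed

text \<open>\<open>N\<close> will be \<open>X / t powr p\<close>. The height
  \<open>(K + 1) * c * t\<close> serves both cases: for infinite \<open>q\<^sub>0\<close> it lies
  above the essential bound \<open>K * c * t\<close>, so the level set is null, and for finite
  \<open>q\<^sub>0\<close> the factor \<open>(K + 1) * c \<ge> 1\<close> only helps.\<close>

lemma weak_bound_apply: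
  assumes wt: "weak_bound M q\<^sub>0 X S K" and v: "v \<in> X" and Sm: "(\<lambda>y. norm (S v y)) \<in> borel_measurable M"
    and q0: "0 < q\<^sub>0" and t: "0 < t" and N: "0 \<le> N" and c: "1 \<le> c" and K: "0 \<le> K"
    and fin: "\<And>q. q\<^sub>0 = ereal q \<Longrightarrow> pmass M q v \<le> ennreal (c * t powr q * N)"
    and inf: "q\<^sub>0 = \<infinity> \<Longrightarrow> AE y in M. norm (v y) \<le> c * t"
  shows "emeasure M {y\<in>space M. (K + 1) * c * t < norm (S v y)} \<le> ennreal (K * c * N)"
proof (cases q\<^sub>0)
  case (real q)
  have q: "0 < q" using q0 real by simp
  let ?t = "(K + 1) * c * t"
  have t': "0 < ?t" using K c t by simp
  have "emeasure M {y\<in>space M. ?t < norm (S v y)} \<le> ennreal (K / ?t powr q) * pmass M q v"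
    using wt v real t' by (simp add: weak_bound_def)
  also have "\<dots> \<le> ennreal (K / ?t powr q) * ennreal (c * t powr q * N)"
    by (intro mult_left_mono fin real) auto
  also have "\<dots> = ennreal (K / ?t powr q * (c * t powr q * N))"
    using K by (subst ennreal_mult'[symmetric]) auto
  also have "\<dots> \<le> ennreal (K * c * N)"
  proof (rule ennreal_leI)
    have "1 \<le> ((K + 1) * c) powr q" using K c q by (intro ge_one_powr_ge_zero) (auto simp: mult_ge1_I)
    moreover have "K / ?t powr q * (c * t powr q * N) = K * c * N / ((K + 1) * c) powr q"
      using t K c by (simp add: powr_mult)
    ultimately show "K / ?t powr q * (c * t powr q * N) \<le> K * c * N"
      using mult_nonneg_nonneg[OF mult_nonneg_nonneg[OF K, of c] N] c
      by (simp add: divide_le_eq mult_le_cancel_left1)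
  qed
  finally show ?thesis .
next
  case PInf
  have "AE y in M. norm (S v y) \<le> K * (c * t)"
    using wt v PInf inf c t by (simp add: weak_bound_def)
  then have "AE y in M. \<not> ((K + 1) * c * t < norm (S v y))"
  proof eventually_elim
    case (elim y)
    have "K * (c * t) \<le> (K + 1) * c * t" using c t by (simp add: algebra_simps)
    then show ?case using elim by simp
  qed
  then have "emeasure M {y\<in>space M. (K + 1) * c * t < norm (S v y)} = 0"
    by (subst (asm) AE_iff_measurable[OF _ refl]) (use Sm in \<open>auto intro: borel_measurable_le\<close>)
  then show ?thesis by simp
qed (use q0 in auto)

context doubling_measure
begin

lemma Linf_c_subset_Lspace:
  assumes q0: "0 < q\<^sub>0" shows "Linf_c M \<subseteq> Lspace M q\<^sub>0"
proof
  fix f :: "'a \<Rightarrow> 'k::real_normed_vector" assume f: "f \<in> Linf_c M"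
  obtain B where B: "0 < B" "\<And>x. norm (f x) \<le> B" using Linf_c_bounded[OF f] by blast
  show "f \<in> Lspace M q\<^sub>0"
  proof (cases q\<^sub>0)
    case (real q)
    have q: "0 < q" using q0 real by simp
    obtain \<rho> where \<rho>: "{y. f y \<noteq> 0} \<subseteq> ball 0 \<rho>" using Linf_c_support[OF f] bounded_subset_ballD by blast
    have "pmass M q f \<le> (\<integral>\<^sup>+y\<in>ball 0 \<rho>. ennreal (B powr q) \<partial>M)"
      unfolding pmass_def using \<rho> B q
      by (intro nn_integral_mono) (auto split: split_indicator intro!: ennreal_leI powr_mono2)
    also have "\<dots> = ennreal (B powr q) * emeasure M (ball 0 \<rho>)" by (intro nn_set_integral_const) simp
    also have "\<dots> < \<infinity>" using ball_finite by (simp add: ennreal_mult_less_top)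
    finally show ?thesis using Linf_c_measurable[OF f] real q by (simp add: Lspace_real_iff)
  next
    case PInf
    then show ?thesis using Linf_c_measurable[OF f] B by (auto simp: Lspace_inf_iff intro!: exI[of _ B])
  qed (use q0 in auto)
qed

lemma pmass_Linf_c_finite: "f \<in> Linf_c M \<Longrightarrow> 0 < p \<Longrightarrow> pmass M p f < \<infinity>"
  using Linf_c_subset_Lspace[of "ereal p"] Lspace_real_iff[of p f M] by auto

text \<open>The gap between \<open>p\<^sub>0\<close> and \<open>p\<close> pays for the power of
  \<open>b\<close>: Young with the exponent \<open>p / p\<^sub>0\<close> on \<open>h\<close> and
  John-Nirenberg on the other factor.\<close>

lemma local_average:
  assumes p: "1 \<le> p\<^sub>0" "p\<^sub>0 < p" and K: "0 \<le> K"
  shows "\<exists>C\<ge>1. \<forall>(b::'a \<Rightarrow> 'k::{real_normed_field, banach, second_countable_topology}) l x r w h.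
    BMO1 b \<longrightarrow> l \<le> k \<longrightarrow> 0 < r \<longrightarrow> 0 < w \<longrightarrow> h \<in> borel_measurable M \<longrightarrow>
    (\<integral>\<^sup>+y\<in>ball x r. ennreal (norm (h y) powr p) \<partial>M) \<le> ennreal (K * w powr p) * emeasure M (ball x r) \<longrightarrow>
    avg_norm M (ereal p\<^sub>0) (ball x r) (ball x r) (\<lambda>y. (mean M (ball x r) b - b y) ^ l * h y) \<le> ennreal (C * w)"
proof -
  define s where "s = p / p\<^sub>0"
  define s' where "s' = s / (s - 1)"
  have s: "1 < s" using p by (simp add: s_def)
  have s': "0 < s'" using s by (simp add: s'_def)
  have e: "0 < p\<^sub>0 * s'" using p s' by simp
  obtain C where C: "1 \<le> C" "\<And>(b::'a \<Rightarrow> 'k) l x r. BMO1 b \<Longrightarrow> l \<le> k \<Longrightarrow> 0 < r \<Longrightarrow>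
    (\<integral>\<^sup>+y\<in>ball x r. ennreal ((norm (b y - mean M (ball x r) b) ^ l) powr (p\<^sub>0 * s')) \<partial>M) \<le> ennreal C * emeasure M (ball x r)"
    using john_nirenberg_annulus[OF e, where 'k='k and k=k] by blast
  define C' where "C' = (K + C) powr (1 / p\<^sub>0)"
  have C': "1 \<le> C'" unfolding C'_def using K C(1) p by (intro ge_one_powr_ge_zero) auto
  show ?thesis
  proof (intro exI[of _ C'] conjI allI impI C')
    fix b :: "'a \<Rightarrow> 'k" and l :: nat and x :: 'a and r w :: real and h :: "'a \<Rightarrow> 'k"
    assume b: "BMO1 b" and l: "l \<le> k" and r: "0 < r" and w: "0 < w" and h[measurable]: "h \<in> borel_measurable M"
      and hp: "(\<integral>\<^sup>+y\<in>ball x r. ennreal (norm (h y) powr p) \<partial>M) \<le> ennreal (K * w powr p) * emeasure M (ball x r)"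
    have [measurable]: "b \<in> borel_measurable M" using b by (simp add: BMO1_def)
    let ?c = "mean M (ball x r) b"
    have "(\<integral>\<^sup>+y\<in>ball x r. ennreal (norm ((?c - b y) ^ l * h y) powr p\<^sub>0) \<partial>M) =
      (\<integral>\<^sup>+y\<in>ball x r. ennreal (norm (h y) powr p\<^sub>0 * (norm (b y - ?c) ^ l) powr p\<^sub>0) \<partial>M)"
      by (intro nn_integral_cong) (simp add: norm_mult norm_power powr_mult mult.commute norm_minus_commute)
    also have "\<dots> \<le> ennreal (w powr p\<^sub>0 * 1 * (K + C)) * emeasure M (ball x r)"
    proof (rule set_integral_young[OF _ _ _ s])
      show "(\<integral>\<^sup>+y\<in>ball x r. ennreal ((norm (h y) powr p\<^sub>0) powr s) \<partial>M) \<le> ennreal (K * (w powr p\<^sub>0) powr s) * emeasure M (ball x r)"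
        using hp p by (simp add: powr_powr s_def)
      show "(\<integral>\<^sup>+y\<in>ball x r. ennreal (((norm (b y - ?c) ^ l) powr p\<^sub>0) powr (s / (s - 1))) \<partial>M) \<le> ennreal (C * 1 powr (s / (s - 1))) * emeasure M (ball x r)"
        using C(2)[OF b l r, of x] by (simp add: powr_powr s'_def)
    qed (use w K C(1) in auto)
    also have "w powr p\<^sub>0 * 1 * (K + C) = (C' * w) powr p\<^sub>0"
      unfolding C'_def using p K C(1) w by (simp add: powr_mult powr_powr)
    finally show "avg_norm M (ereal p\<^sub>0) (ball x r) (ball x r) (\<lambda>y. (?c - b y) ^ l * h y) \<le> ennreal (C' * w)"
      using p C' w r by (subst avg_norm_real_le_iff[OF emeasure_ball_eq measure_ball_pos]) auto
  qed
qed

text \<open>Here the gap between \<open>q\<close> and \<open>q\<^sub>0\<close> pays for the power of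
  \<open>b\<close>. For infinite \<open>q\<^sub>0\<close> the function \<open>a\<close> is bounded
  on the annulus and John-Nirenberg at the exponent \<open>q\<close> is enough.\<close>

lemma annular_product:
  assumes q: "1 \<le> q" "ereal q < q\<^sub>0"
  shows "\<exists>C\<ge>1. \<forall>(b::'a \<Rightarrow> 'k::{real_normed_field, banach, second_countable_topology}) l x r j c (a::'a \<Rightarrow> 'k).
    BMO1 b \<longrightarrow> l \<le> k \<longrightarrow> 0 < r \<longrightarrow> 1 \<le> j \<longrightarrow> 0 < c \<longrightarrow> a \<in> borel_measurable M \<longrightarrow>
    annular_bound M q\<^sub>0 (annulus x r j) (emeasure M (ball x (2 ^ (j + 1) * r))) c a \<longrightarrow>
    (\<integral>\<^sup>+y\<in>annulus x r j. ennreal ((norm (b y - mean M (ball x r) b) ^ l * norm (a y)) powr q) \<partial>M) \<le>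
      ennreal (C * ((1 + real j) ^ l * c) powr q) * emeasure M (ball x (2 ^ (j + 1) * r))"
proof (cases q\<^sub>0)
  case (real Q)
  define s where "s = Q / q"
  define s' where "s' = s / (s - 1)"
  have s: "1 < s" using q real by (simp add: s_def)
  have s': "0 < s'" using s by (simp add: s'_def)
  have e: "0 < q * s'" using q s' by simp
  obtain C where C: "1 \<le> C" "\<And>(b::'a \<Rightarrow> 'k) l x r j. BMO1 b \<Longrightarrow> l \<le> k \<Longrightarrow> 0 < r \<Longrightarrow> 1 \<le> j \<Longrightarrow>
    (\<integral>\<^sup>+y\<in>annulus x r j. ennreal ((norm (b y - mean M (ball x r) b) ^ l) powr (q * s')) \<partial>M) \<le>
     ennreal (C * ((1 + real j) ^ l) powr (q * s')) * emeasure M (ball x (2 ^ (j + 1) * r))"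
    using john_nirenberg_annulus[OF e, where 'k='k and k=k] by blast
  show ?thesis
  proof (intro exI[of _ "1 + C"] conjI allI impI)
    show "1 \<le> 1 + C" using C(1) by simp
    fix b :: "'a \<Rightarrow> 'k" and l :: nat and x :: 'a and r c :: real and j :: nat and a :: "'a \<Rightarrow> 'k"
    assume b: "BMO1 b" and l: "l \<le> k" and r: "0 < r" and j: "1 \<le> j" and c: "0 < c" and a[measurable]: "a \<in> borel_measurable M"
      and ab: "annular_bound M q\<^sub>0 (annulus x r j) (emeasure M (ball x (2 ^ (j + 1) * r))) c a"
    have [measurable]: "b \<in> borel_measurable M" using b by (simp add: BMO1_def)
    let ?c = "mean M (ball x r) b" and ?S = "annulus x r j" and ?m = "emeasure M (ball x (2 ^ (j + 1) * r))"
    have "(\<integral>\<^sup>+y\<in>?S. ennreal ((norm (b y - ?c) ^ l * norm (a y)) powr q) \<partial>M) =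
      (\<integral>\<^sup>+y\<in>?S. ennreal (norm (a y) powr q * (norm (b y - ?c) ^ l) powr q) \<partial>M)"
      by (intro nn_integral_cong) (simp add: powr_mult mult.commute)
    also have "\<dots> \<le> ennreal (c powr q * ((1 + real j) ^ l) powr q * (1 + C)) * ?m"
    proof (rule set_integral_young[OF _ _ _ s])
      show "(\<integral>\<^sup>+y\<in>?S. ennreal ((norm (a y) powr q) powr s) \<partial>M) \<le> ennreal (1 * (c powr q) powr s) * ?m"
        using ab real q by (simp add: powr_powr s_def annular_bound_def)
      show "(\<integral>\<^sup>+y\<in>?S. ennreal (((norm (b y - ?c) ^ l) powr q) powr (s / (s - 1))) \<partial>M) \<le> ennreal (C * (((1 + real j) ^ l) powr q) powr (s / (s - 1))) * ?m"
        using C(2)[OF b l r j, of x] by (simp add: powr_powr s'_def)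
    qed (use c C(1) in auto)
    also have "c powr q * ((1 + real j) ^ l) powr q * (1 + C) = (1 + C) * ((1 + real j) ^ l * c) powr q"
      by (simp add: powr_mult)
    finally show "(\<integral>\<^sup>+y\<in>?S. ennreal ((norm (b y - ?c) ^ l * norm (a y)) powr q) \<partial>M) \<le> ennreal ((1 + C) * ((1 + real j) ^ l * c) powr q) * ?m" .
  qed
next
  case PInf
  have e: "0 < q" using q by simp
  obtain C where C: "1 \<le> C" "\<And>(b::'a \<Rightarrow> 'k) l x r j. BMO1 b \<Longrightarrow> l \<le> k \<Longrightarrow> 0 < r \<Longrightarrow> 1 \<le> j \<Longrightarrow>
    (\<integral>\<^sup>+y\<in>annulus x r j. ennreal ((norm (b y - mean M (ball x r) b) ^ l) powr q) \<partial>M) \<le>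
     ennreal (C * ((1 + real j) ^ l) powr q) * emeasure M (ball x (2 ^ (j + 1) * r))"
    using john_nirenberg_annulus[OF e, where 'k='k and k=k] by blast
  show ?thesis
  proof (intro exI[of _ C] conjI allI impI C(1))
    fix b :: "'a \<Rightarrow> 'k" and l :: nat and x :: 'a and r c :: real and j :: nat and a :: "'a \<Rightarrow> 'k"
    assume b: "BMO1 b" and l: "l \<le> k" and r: "0 < r" and j: "1 \<le> j" and c: "0 < c" and a[measurable]: "a \<in> borel_measurable M"
      and ab: "annular_bound M q\<^sub>0 (annulus x r j) (emeasure M (ball x (2 ^ (j + 1) * r))) c a"
    have [measurable]: "b \<in> borel_measurable M" using b by (simp add: BMO1_def)
    let ?c = "mean M (ball x r) b" and ?S = "annulus x r j" and ?m = "emeasure M (ball x (2 ^ (j + 1) * r))"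
    have "AE y in M. y \<in> ?S \<longrightarrow> norm (a y) \<le> c" using ab PInf by (simp add: annular_bound_def)
    then have "(\<integral>\<^sup>+y\<in>?S. ennreal ((norm (b y - ?c) ^ l * norm (a y)) powr q) \<partial>M) \<le>
      (\<integral>\<^sup>+y. ennreal (c powr q) * (ennreal ((norm (b y - ?c) ^ l) powr q) * indicator ?S y) \<partial>M)"
    proof (intro nn_integral_mono_AE, eventually_elim)
      case (elim y)
      show ?case
      proof (cases "y \<in> ?S")
        case True
        then have "(norm (b y - ?c) ^ l * norm (a y)) powr q \<le> (norm (b y - ?c) ^ l * c) powr q"
          using elim q by (intro powr_mono2 mult_left_mono) auto
        also have "\<dots> = c powr q * (norm (b y - ?c) ^ l) powr q" by (simp add: powr_mult)
        finally show ?thesis using True by (simp add: ennreal_mult'[symmetric] ennreal_leI)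
      qed simp
    qed
    also have "\<dots> = ennreal (c powr q) * (\<integral>\<^sup>+y\<in>?S. ennreal ((norm (b y - ?c) ^ l) powr q) \<partial>M)"
      by (rule nn_integral_cmult) measurable
    also have "\<dots> \<le> ennreal (c powr q) * (ennreal (C * ((1 + real j) ^ l) powr q) * ?m)"
      by (intro mult_left_mono C b l r j) auto
    also have "\<dots> = ennreal (C * ((1 + real j) ^ l * c) powr q) * ?m"
      by (simp add: mult.assoc[symmetric] ennreal_mult'[symmetric] powr_mult) (simp add: mult_ac)
    finally show "(\<integral>\<^sup>+y\<in>?S. ennreal ((norm (b y - ?c) ^ l * norm (a y)) powr q) \<partial>M) \<le> ennreal (C * ((1 + real j) ^ l * c) powr q) * ?m" .
  qed
qed (use q in auto)

text \<open>The hypothesis \<open>1 < \<rho>\<close> lets a power of \<open>b\<close> be absorbed: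
  John-Nirenberg is used at the conjugate exponent of \<rho>. After this only first powers of
  \<open>\<gamma> j * (1 + j) ^ k\<close> remain, and the annuli sum to
  \<open>tower_const\<close>.\<close>

lemma off_diagonal_product:
  assumes \<rho>: "1 < \<rho>"
  shows "\<exists>C\<ge>1. \<forall>(b::'a \<Rightarrow> 'k::{real_normed_field, banach, second_countable_topology}) l x r \<kappa> (\<gamma>::nat \<Rightarrow> real) (u::'a \<Rightarrow> real).
    BMO1 b \<longrightarrow> l \<le> k \<longrightarrow> 0 < r \<longrightarrow> 0 < \<kappa> \<longrightarrow> (\<forall>j. 0 < \<gamma> j) \<longrightarrow> summable (\<lambda>j. \<gamma> j * (1 + real j) ^ k * 2 powr (D * real j)) \<longrightarrow>
    u \<in> borel_measurable M \<longrightarrow> (\<forall>y. 0 \<le> u y) \<longrightarrow>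
    (\<forall>j::nat. 2 \<le> j \<longrightarrow> (\<integral>\<^sup>+y\<in>annulus x r j. ennreal (u y powr \<rho>) \<partial>M) \<le> ennreal ((\<gamma> j * \<kappa>) powr \<rho>) * emeasure M (ball x (2 ^ (j + 1) * r))) \<longrightarrow>
    (\<integral>\<^sup>+y\<in>- ball x (4 * r). ennreal (norm (b y - mean M (ball x r) b) ^ l * u y) \<partial>M) \<le>
      ennreal (C * \<kappa> * tower_const (\<lambda>j. \<gamma> j * (1 + real j) ^ k)) * emeasure M (ball x r)"
proof -
  define s' where "s' = \<rho> / (\<rho> - 1)"
  have e: "0 < s'" using \<rho> by (simp add: s'_def)
  obtain C where C: "1 \<le> C" "\<And>(b::'a \<Rightarrow> 'k) l x r j. BMO1 b \<Longrightarrow> l \<le> k \<Longrightarrow> 0 < r \<Longrightarrow> 1 \<le> j \<Longrightarrow>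
    (\<integral>\<^sup>+y\<in>annulus x r j. ennreal ((norm (b y - mean M (ball x r) b) ^ l) powr s') \<partial>M) \<le>
     ennreal (C * ((1 + real j) ^ l) powr s') * emeasure M (ball x (2 ^ (j + 1) * r))"
    using john_nirenberg_annulus[OF e, where 'k='k and k=k] by blast
  show ?thesis
  proof (intro exI[of _ "1 + C"] conjI allI impI)
    show "1 \<le> 1 + C" using C(1) by simp
    fix b :: "'a \<Rightarrow> 'k" and l :: nat and x :: 'a and r \<kappa> :: real and \<gamma> :: "nat \<Rightarrow> real" and u :: "'a \<Rightarrow> real"
    assume b: "BMO1 b" and l: "l \<le> k" and r: "0 < r" and \<kappa>: "0 < \<kappa>" and \<gamma>: "\<forall>j. 0 < \<gamma> j"
      and sm: "summable (\<lambda>j. \<gamma> j * (1 + real j) ^ k * 2 powr (D * real j))"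
      and u[measurable]: "u \<in> borel_measurable M" and u0: "\<forall>y. 0 \<le> u y"
      and ub: "\<forall>j::nat. 2 \<le> j \<longrightarrow> (\<integral>\<^sup>+y\<in>annulus x r j. ennreal (u y powr \<rho>) \<partial>M) \<le> ennreal ((\<gamma> j * \<kappa>) powr \<rho>) * emeasure M (ball x (2 ^ (j + 1) * r))"
    have [measurable]: "b \<in> borel_measurable M" using b by (simp add: BMO1_def)
    let ?c = "mean M (ball x r) b"
    let ?\<beta> = "\<lambda>j. \<gamma> j * (1 + real j) ^ k"
    let ?f = "\<lambda>y. ennreal (norm (b y - ?c) ^ l * u y)"
    have "(\<integral>\<^sup>+y\<in>- ball x (4 * r). ?f y \<partial>M) \<le> (\<integral>\<^sup>+y. (\<Sum>j. ?f y * indicator (annulus x r (j + 2)) y) \<partial>M)"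
    proof (rule nn_integral_mono)
      fix y
      show "?f y * indicator (- ball x (4 * r)) y \<le> (\<Sum>j. ?f y * indicator (annulus x r (j + 2)) y)"
      proof (cases "y \<in> ball x (4 * r)")
        case False
        then obtain j :: nat where "2 \<le> j" "y \<in> annulus x r j" using annulus_cover[OF r, of y x] by blast
        then obtain i where i: "y \<in> annulus x r (i + 2)" by (metis le_add_diff_inverse2)
        have "?f y * indicator (- ball x (4 * r)) y \<le> (\<Sum>j\<in>{i}. ?f y * indicator (annulus x r (j + 2)) y)"
          using i by (auto split: split_indicator)
        also have "\<dots> \<le> (\<Sum>j. ?f y * indicator (annulus x r (j + 2)) y)" by (intro sum_le_suminf) auto
        finally show ?thesis .
      qed simp
    qed
    also have "\<dots> = (\<Sum>j. \<integral>\<^sup>+y\<in>annulus x r (j + 2). ?f y \<partial>M)"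
      by (rule nn_integral_suminf) measurable
    also have "\<dots> \<le> (\<Sum>j. ennreal ((1 + C) * \<kappa>) * (ennreal (?\<beta> (j + 2)) * emeasure M (ball x (2 ^ ((j + 2) + 1) * r))))"
    proof (rule suminf_le)
      fix i :: nat
      define j where "j = i + 2"
      have j: "2 \<le> j" "1 \<le> j" by (auto simp: j_def)
      let ?S = "annulus x r j" and ?m = "emeasure M (ball x (2 ^ (j + 1) * r))"
      have "(\<integral>\<^sup>+y\<in>?S. ?f y \<partial>M) = (\<integral>\<^sup>+y\<in>?S. ennreal (u y * norm (b y - ?c) ^ l) \<partial>M)"
        by (simp add: mult.commute)
      also have "\<dots> \<le> ennreal (\<gamma> j * \<kappa> * (1 + real j) ^ l * (1 + C)) * ?m"
      proof (rule set_integral_young[OF _ _ _ \<rho>])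
        show "(\<integral>\<^sup>+y\<in>?S. ennreal (u y powr \<rho>) \<partial>M) \<le> ennreal (1 * (\<gamma> j * \<kappa>) powr \<rho>) * ?m" using ub j by simp
        show "(\<integral>\<^sup>+y\<in>?S. ennreal ((norm (b y - ?c) ^ l) powr (\<rho> / (\<rho> - 1))) \<partial>M) \<le> ennreal (C * ((1 + real j) ^ l) powr (\<rho> / (\<rho> - 1))) * ?m"
          using C(2)[OF b l r j(2), of x] by (simp add: s'_def)
      qed (use \<kappa> \<gamma> u0 C(1) in auto)
      also have "\<dots> \<le> ennreal ((1 + C) * \<kappa> * ?\<beta> j) * ?m"
      proof (intro mult_right_mono ennreal_leI)
        have "(1 + real j) ^ l \<le> (1 + real j) ^ k" using l by (intro power_increasing) auto
        then have "(1 + C) * \<kappa> * \<gamma> j * (1 + real j) ^ l \<le> (1 + C) * \<kappa> * \<gamma> j * (1 + real j) ^ k"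
          using C(1) \<kappa> \<gamma> by (intro mult_left_mono) (auto simp: less_imp_le)
        then show "\<gamma> j * \<kappa> * (1 + real j) ^ l * (1 + C) \<le> (1 + C) * \<kappa> * ?\<beta> j" by (simp only: mult_ac)
      qed simp
      also have "\<dots> = ennreal ((1 + C) * \<kappa>) * (ennreal (?\<beta> j) * ?m)"
        using C(1) \<kappa> \<gamma>[rule_format, of j] by (subst ennreal_mult) (auto simp: mult.assoc)
      finally show "(\<integral>\<^sup>+y\<in>annulus x r (i + 2). ?f y \<partial>M) \<le> ennreal ((1 + C) * \<kappa>) * (ennreal (?\<beta> (i + 2)) * emeasure M (ball x (2 ^ ((i + 2) + 1) * r)))"
        unfolding j_def .
    qed auto
    also have "\<dots> = ennreal ((1 + C) * \<kappa>) * (\<Sum>j. ennreal (?\<beta> (j + 2)) * emeasure M (ball x (2 ^ ((j + 2) + 1) * r)))"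
      by (rule ennreal_suminf_cmult)
    also have "\<dots> \<le> ennreal ((1 + C) * \<kappa>) * (\<Sum>j. ennreal (?\<beta> j) * emeasure M (ball x (2 ^ (j + 1) * r)))"
      using suminf_offset[of "\<lambda>j. ennreal (?\<beta> j) * emeasure M (ball x (2 ^ (j + 1) * r))" 2]
      by (intro mult_left_mono) auto
    also have "\<dots> \<le> ennreal ((1 + C) * \<kappa>) * (ennreal (tower_const ?\<beta>) * emeasure M (ball x r))"
      using \<gamma> by (intro mult_left_mono sum_dilated_balls sm r) (auto intro: less_imp_le)
    also have "\<dots> = ennreal ((1 + C) * \<kappa> * tower_const ?\<beta>) * emeasure M (ball x r)"
      using C(1) \<kappa> by (simp add: mult.assoc[symmetric] ennreal_mult'[symmetric])
    finally show "(\<integral>\<^sup>+y\<in>- ball x (4 * r). ?f y \<partial>M) \<le> ennreal ((1 + C) * \<kappa> * tower_const ?\<beta>) * emeasure M (ball x r)" .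
  qed
qed

end

section \<open>Operators with off-diagonal decay\<close>

lemma suminf_indexed_le:
  fixes \<phi> :: "nat \<Rightarrow> ennreal"
  assumes "\<And>F. finite F \<Longrightarrow> F \<subseteq> J \<Longrightarrow> sum \<phi> F \<le> B"
  shows "(\<Sum>i. if i \<in> J then \<phi> i else 0) \<le> B"
proof -
  have "(\<Sum>i<n. if i \<in> J then \<phi> i else 0) \<le> B" for n
  proof -
    have "(\<Sum>i<n. if i \<in> J then \<phi> i else 0) = sum \<phi> ({..<n} \<inter> J)" by (simp add: sum.inter_restrict)
    also have "\<dots> \<le> B" by (rule assms) auto
    finally show ?thesis .
  qed
  then show ?thesis by (simp add: suminf_eq_SUP SUP_le_iff)
qed

lemma ennreal_minus_le_of_le_add:
  fixes a b c :: ennreal assumes "a \<le> b + c" "a \<noteq> top" shows "a - b \<le> c"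
  using assms by (simp add: ennreal_minus_le_iff)

lemma suminf_exist_split2:
  fixes f :: "nat \<Rightarrow> 'b::{real_normed_vector, banach}"
  assumes "summable f" shows "(\<lambda>n. \<Sum>i. f (i + n)) \<longlonglongrightarrow> 0"
  by (intro LIMSEQ_I) (use suminf_exist_split[OF _ assms] in auto)

lemma tendsto_powr_zero_real:
  fixes f :: "nat \<Rightarrow> real"
  assumes "f \<longlonglongrightarrow> 0" "0 < q" "\<And>n. 0 \<le> f n" shows "(\<lambda>n. f n powr q) \<longlonglongrightarrow> 0"
  using tendsto_powr'[OF assms(1) tendsto_const[of q]] assms(2,3) by simp

lemma AE_norm_zero_from_levels:
  fixes u :: "'a \<Rightarrow> ennreal"
  assumes [measurable]: "u \<in> borel_measurable M" and z: "\<And>e. 0 < e \<Longrightarrow> emeasure M {y\<in>space M. ennreal e < u y} = 0"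
  shows "AE y in M. u y = 0"
proof -
  have "AE y in M. u y \<le> ennreal (1 / real (Suc n))" for n
  proof (rule AE_I[where N="{y\<in>space M. ennreal (1 / real (Suc n)) < u y}"])
    show "{y \<in> space M. \<not> u y \<le> ennreal (1 / real (Suc n))} \<subseteq> {y\<in>space M. ennreal (1 / real (Suc n)) < u y}" by (auto simp: not_le)
    show "emeasure M {y\<in>space M. ennreal (1 / real (Suc n)) < u y} = 0" by (rule z) simp
  qed measurable
  then have "AE y in M. \<forall>n. u y \<le> ennreal (1 / real (Suc n))" by (simp add: AE_all_countable)
  then show ?thesis
  proof eventually_elim
    case (elim y)
    have "(\<lambda>n. ennreal (1 / real (Suc n))) \<longlonglongrightarrow> ennreal 0"
      by (intro tendsto_ennrealI lim_1_over_n[THEN LIMSEQ_Suc])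
    then have "u y \<le> ennreal 0" by (rule LIMSEQ_le_const) (use elim in auto)
    then show ?case by simp
  qed
qed

text \<open>What the estimates of the A-parts need from \<open>cz_cover\<close>: the balls and
  heights without the function and its pieces. \<open>N\<close> stands for
  \<open>X / t powr p\<close>.\<close>

definition (in doubling_measure) tower_family ::
  "(nat \<Rightarrow> real) \<Rightarrow> real \<Rightarrow> real \<Rightarrow> real \<Rightarrow> nat set \<Rightarrow> (nat \<Rightarrow> 'a) \<Rightarrow> (nat \<Rightarrow> real) \<Rightarrow> (nat \<Rightarrow> real) \<Rightarrow> bool" where
  "tower_family \<beta> C t N J x r w \<longleftrightarrow> (\<forall>i\<in>J. 0 < r i \<and> 0 < w i \<and> w i \<le> t) \<and>
    (\<forall>F. finite F \<longrightarrow> F \<subseteq> J \<longrightarrow> (\<Sum>i\<in>F. emeasure M (ball (x i) (r i))) \<le> ennreal (C * N)) \<and>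
    (\<forall>F y. finite F \<longrightarrow> F \<subseteq> J \<longrightarrow> (\<Sum>i\<in>F. ennreal (w i) * tower \<beta> (x i) (r i) y) \<le> ennreal (C * t))"

context doubling_measure
begin

text \<open>The exceptional set is the union of the balls \<open>4 B\<close>, on which nothing is
  known about \<open>\<phi> i\<close>, together with the level set of the sum outside them, which
  Chebyshev at height \<open>t\<close> controls because \<open>w i \<le> t\<close>.\<close>

lemma off_diagonal_exceptional_set:
  fixes \<phi> :: "nat \<Rightarrow> 'a \<Rightarrow> ennreal"
  assumes tf: "tower_family \<beta> C t N J x r w" and t: "0 < t" and C: "0 \<le> C" and N: "0 \<le> N" and c: "0 \<le> c"
    and \<phi>m: "\<And>i. i \<in> J \<Longrightarrow> \<phi> i \<in> borel_measurable M"
    and off: "\<And>i. i \<in> J \<Longrightarrow> (\<integral>\<^sup>+y\<in>- ball (x i) (4 * r i). \<phi> i y \<partial>M) \<le> ennreal (c * w i) * emeasure M (ball (x i) (r i))"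
  shows "\<exists>E\<in>sets M. emeasure M E \<le> ennreal ((Cd * 4 powr D + c) * C * N) \<and>
    (\<forall>y. y \<notin> E \<longrightarrow> (\<Sum>i. if i \<in> J then \<phi> i y else 0) \<le> ennreal t)"
proof -
  have fam: "\<And>i. i \<in> J \<Longrightarrow> 0 < r i" "\<And>i. i \<in> J \<Longrightarrow> 0 < w i" "\<And>i. i \<in> J \<Longrightarrow> w i \<le> t"
    "\<And>F. finite F \<Longrightarrow> F \<subseteq> J \<Longrightarrow> (\<Sum>i\<in>F. emeasure M (ball (x i) (r i))) \<le> ennreal (C * N)"
    using tf by (auto simp: tower_family_def)
  define \<psi> where "\<psi> i = (if i \<in> J then \<phi> i else (\<lambda>_. 0))" for i
  have [measurable]: "\<psi> i \<in> borel_measurable M" for i using \<phi>m by (auto simp: \<psi>_def)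
  define E1 where "E1 = (\<Union>i\<in>J. ball (x i) (4 * r i))"
  have E1m[measurable]: "E1 \<in> sets M" by (auto simp: E1_def)
  have E1: "emeasure M E1 \<le> ennreal (Cd * 4 powr D * C * N)"
  proof -
    have "emeasure M E1 \<le> (\<Sum>i. emeasure M (if i \<in> J then ball (x i) (4 * r i) else {}))"
      by (rule order_trans[OF _ emeasure_subadditive_countably]) (auto simp: E1_def intro!: emeasure_mono)
    also have "\<dots> = (\<Sum>i. if i \<in> J then emeasure M (ball (x i) (4 * r i)) else 0)" by (intro suminf_cong) auto
    also have "\<dots> \<le> ennreal (Cd * 4 powr D * C * N)"
    proof (rule suminf_indexed_le)
      fix F assume F: "finite F" "F \<subseteq> J"
      have "(\<Sum>i\<in>F. emeasure M (ball (x i) (4 * r i))) \<le> (\<Sum>i\<in>F. ennreal (Cd * 4 powr D) * emeasure M (ball (x i) (r i)))"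
        using F fam(1) by (intro sum_mono ball_dilate) auto
      also have "\<dots> = ennreal (Cd * 4 powr D) * (\<Sum>i\<in>F. emeasure M (ball (x i) (r i)))" by (rule sum_distrib_left[symmetric])
      also have "\<dots> \<le> ennreal (Cd * 4 powr D) * ennreal (C * N)" by (intro mult_left_mono fam(4) F) auto
      also have "\<dots> = ennreal (Cd * 4 powr D * C * N)"
        using Cd_ge_1 by (subst ennreal_mult'[symmetric]) (auto simp: mult.assoc)
      finally show "(\<Sum>i\<in>F. emeasure M (ball (x i) (4 * r i))) \<le> ennreal (Cd * 4 powr D * C * N)" .
    qed
    finally show ?thesis .
  qed
  define S where "S y = (\<Sum>i. \<psi> i y)" for y
  have Sm[measurable]: "S \<in> borel_measurable M" unfolding S_def[abs_def] by measurable
  define E2 where "E2 = {y. y \<notin> E1 \<and> ennreal t < S y}"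
  have "{y\<in>space M. y \<notin> E1 \<and> ennreal t < S y} \<in> sets M" by measurable
  then have E2m[measurable]: "E2 \<in> sets M" by (simp add: E2_def)
  have "ennreal t * emeasure M E2 = (\<integral>\<^sup>+y\<in>E2. ennreal t \<partial>M)" by (simp add: nn_set_integral_const[OF E2m])
  also have "\<dots> \<le> (\<integral>\<^sup>+y. (\<Sum>i. \<psi> i y * indicator (- E1) y) \<partial>M)"
  proof (rule nn_integral_mono)
    fix y
    have "(\<Sum>i. \<psi> i y * indicator (- E1) y) = S y * indicator (- E1) y"
      by (simp add: S_def ennreal_suminf_multc)
    then show "ennreal t * indicator E2 y \<le> (\<Sum>i. \<psi> i y * indicator (- E1) y)"
      by (auto simp: E2_def split: split_indicator intro: less_imp_le)
  qed
  also have "\<dots> = (\<Sum>i. \<integral>\<^sup>+y\<in>- E1. \<psi> i y \<partial>M)" by (rule nn_integral_suminf) measurable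
  also have "\<dots> \<le> (\<Sum>i. if i \<in> J then ennreal (c * w i) * emeasure M (ball (x i) (r i)) else 0)"
  proof (rule suminf_le)
    fix i
    show "(\<integral>\<^sup>+y\<in>- E1. \<psi> i y \<partial>M) \<le> (if i \<in> J then ennreal (c * w i) * emeasure M (ball (x i) (r i)) else 0)"
    proof (cases "i \<in> J")
      case True
      have "(\<integral>\<^sup>+y\<in>- E1. \<phi> i y \<partial>M) \<le> (\<integral>\<^sup>+y\<in>- ball (x i) (4 * r i). \<phi> i y \<partial>M)"
        using True by (intro nn_set_integral_subset) (auto simp: E1_def)
      also note off[OF True]
      finally show ?thesis using True by (simp add: \<psi>_def)
    qed (simp add: \<psi>_def)
  qed auto
  also have "\<dots> \<le> ennreal (c * t) * ennreal (C * N)"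
  proof (rule suminf_indexed_le)
    fix F assume F: "finite F" "F \<subseteq> J"
    have "(\<Sum>i\<in>F. ennreal (c * w i) * emeasure M (ball (x i) (r i))) \<le> (\<Sum>i\<in>F. ennreal (c * t) * emeasure M (ball (x i) (r i)))"
      using F fam(3) c by (intro sum_mono mult_right_mono ennreal_leI mult_left_mono) auto
    also have "\<dots> = ennreal (c * t) * (\<Sum>i\<in>F. emeasure M (ball (x i) (r i)))" by (rule sum_distrib_left[symmetric])
    also have "\<dots> \<le> ennreal (c * t) * ennreal (C * N)" by (intro mult_left_mono fam(4) F) auto
    finally show "(\<Sum>i\<in>F. ennreal (c * w i) * emeasure M (ball (x i) (r i))) \<le> ennreal (c * t) * ennreal (C * N)" .
  qed
  finally have "ennreal (1 / t) * (ennreal t * emeasure M E2) \<le> ennreal (1 / t) * (ennreal (c * t) * ennreal (C * N))"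
    by (rule mult_left_mono) simp
  then have E2: "emeasure M E2 \<le> ennreal (c * C * N)"
    using t c C N by (simp add: mult.assoc[symmetric] ennreal_mult'[symmetric])
  show ?thesis
  proof (intro bexI[of _ "E1 \<union> E2"] conjI allI impI)
    have "emeasure M (E1 \<union> E2) \<le> emeasure M E1 + emeasure M E2" by (rule emeasure_subadditive[OF E1m E2m])
    also have "\<dots> \<le> ennreal (Cd * 4 powr D * C * N) + ennreal (c * C * N)" by (intro add_mono E1 E2)
    also have "\<dots> = ennreal ((Cd * 4 powr D + c) * C * N)"
      using Cd_ge_1 C N c by (subst ennreal_plus[symmetric]) (auto simp: distrib_right)
    finally show "emeasure M (E1 \<union> E2) \<le> ennreal ((Cd * 4 powr D + c) * C * N)" .
    fix y assume "y \<notin> E1 \<union> E2"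
    then have "S y \<le> ennreal t" by (auto simp: E2_def not_less)
    moreover have "(\<Sum>i. if i \<in> J then \<phi> i y else 0) = S y" unfolding S_def \<psi>_def by (intro suminf_cong) auto
    ultimately show "(\<Sum>i. if i \<in> J then \<phi> i y else 0) \<le> ennreal t" by simp
  qed measurable
qed

end

text \<open>Nothing about \<open>b\<close> is fixed here, since the constants have to be uniform in
  \<open>b\<close>. \<rho> is the exponent \<open>r\<close> of the theorem. The numbers
  \<open>\<alpha> j\<close> are assumed positive because they become the weights in Jensen's
  inequality.\<close>

locale cz_operator = doubling_measure M D Cd
  for M :: "'a::euclidean_space measure" and D Cd :: real +
  fixes T :: "('a \<Rightarrow> 'k::{real_normed_field, banach, second_countable_topology}) \<Rightarrow> 'a \<Rightarrow> 'k"
    and \<D> :: "('a \<Rightarrow> 'k) set" and A :: "real \<Rightarrow> ('a \<Rightarrow> 'k) \<Rightarrow> 'a \<Rightarrow> 'k"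
    and \<alpha> :: "nat \<Rightarrow> real" and p\<^sub>0 \<rho> KT :: real and q\<^sub>0 :: ereal and k :: nat
  assumes p0: "1 \<le> p\<^sub>0" and p0_q0: "ereal p\<^sub>0 < q\<^sub>0" and \<rho>: "1 < \<rho>"
    and D_meas: "\<D> \<subseteq> borel_measurable M" and L_D: "Lspace M q\<^sub>0 \<subseteq> \<D>"
    and T_meas: "f \<in> \<D> \<Longrightarrow> (\<lambda>x. norm (T f x)) \<in> borel_measurable M"
    and T_sub: "sublinear_on \<D> T"
    and T_countable: "q\<^sub>0 = \<infinity> \<Longrightarrow> countably_sublinear_on M \<D> T"
    and T_weak_q0: "weak_bound M q\<^sub>0 (Lspace M q\<^sub>0) T KT" and KT: "0 \<le> KT"
    and A_L: "0 < t \<Longrightarrow> f \<in> Linf_c M \<Longrightarrow> A t f \<in> Lspace M q\<^sub>0"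
    and \<alpha>_pos: "0 < \<alpha> j"
    and A_avg: "0 < t \<Longrightarrow> f \<in> Linf_c M \<Longrightarrow> (\<And>y. y \<notin> ball x t \<Longrightarrow> f y = 0) \<Longrightarrow> 1 \<le> j \<Longrightarrow>
           avg_norm M q\<^sub>0 (ball x (2 ^ (j + 1) * t)) (annulus x t j) (A t f)
             \<le> ennreal (\<alpha> j) * avg_norm M (ereal p\<^sub>0) (ball x t) (ball x t) f"
    and TA_avg: "0 < t \<Longrightarrow> f \<in> Linf_c M \<Longrightarrow> (\<And>y. y \<notin> ball x t \<Longrightarrow> f y = 0) \<Longrightarrow> 2 \<le> j \<Longrightarrow>
           avg_norm M (ereal \<rho>) (ball x (2 ^ (j + 1) * t)) (annulus x t j) (T (\<lambda>y. f y - A t f y))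
             \<le> ennreal (\<alpha> j) * avg_norm M (ereal p\<^sub>0) (ball x t) (ball x t) f"
    and \<alpha>_sum: "summable (\<lambda>j. \<alpha> j * (1 + real j) ^ k * 2 powr (D * real j))"
begin

definition \<beta> :: "nat \<Rightarrow> real" where "\<beta> j = \<alpha> j * (1 + real j) ^ k"

lemma \<beta>_pos: "0 < \<beta> j" using \<alpha>_pos by (simp add: \<beta>_def)

lemma \<beta>_nonneg: "0 \<le> \<beta> j" using \<beta>_pos[of j] by simp

lemma \<beta>_sum: "summable (\<lambda>j. \<beta> j * 2 powr (D * real j))" using \<alpha>_sum by (simp add: \<beta>_def)

lemma \<alpha>_power_le_\<beta>: "l \<le> k \<Longrightarrow> (1 + real j) ^ l * \<alpha> j \<le> \<beta> j"
proof -
  assume "l \<le> k"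
  then have "(1 + real j) ^ l \<le> (1 + real j) ^ k" by (intro power_increasing) auto
  then show ?thesis using \<alpha>_pos[of j] by (simp add: \<beta>_def mult.commute)
qed

lemma \<alpha>_le_\<beta>: "\<alpha> j \<le> \<beta> j" using \<alpha>_power_le_\<beta>[of 0 j] by simp

lemma q0_pos: "0 < q\<^sub>0"
  using p0 p0_q0 by (metis ereal_less(2) less_trans order_less_le_trans zero_less_one)

lemma D_zero: "(\<lambda>x. 0) \<in> \<D>" using T_sub by (simp add: sublinear_on_def)

lemma D_add: "f \<in> \<D> \<Longrightarrow> g \<in> \<D> \<Longrightarrow> (\<lambda>x. f x + g x) \<in> \<D>" using T_sub by (simp add: sublinear_on_def)

lemma D_scale: "f \<in> \<D> \<Longrightarrow> (\<lambda>x. c * f x) \<in> \<D>" using T_sub by (simp add: sublinear_on_def)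

lemma T_add: "f \<in> \<D> \<Longrightarrow> g \<in> \<D> \<Longrightarrow> norm (T (\<lambda>y. f y + g y) x) \<le> norm (T f x) + norm (T g x)"
  using T_sub by (simp add: sublinear_on_def)

lemma T_scale: "f \<in> \<D> \<Longrightarrow> norm (T (\<lambda>y. c * f y) x) = norm c * norm (T f x)"
  using T_sub by (simp add: sublinear_on_def)

lemma T_zero: "T (\<lambda>y. 0) x = 0"
  using T_scale[OF D_zero, of 0 x] by simp

lemma D_diff: "f \<in> \<D> \<Longrightarrow> g \<in> \<D> \<Longrightarrow> (\<lambda>x. f x - g x) \<in> \<D>"
  using D_add[of f "\<lambda>x. (-1) * g x"] D_scale[of g "-1"] by simp

lemma T_sum:
  assumes "finite F" "\<And>i. i \<in> F \<Longrightarrow> f i \<in> \<D>"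
  shows "(\<lambda>y. \<Sum>i\<in>F. c i * f i y) \<in> \<D> \<and> norm (T (\<lambda>y. \<Sum>i\<in>F. c i * f i y) x) \<le> (\<Sum>i\<in>F. norm (c i) * norm (T (f i) x))"
  using assms
proof (induction F rule: finite_induct)
  case empty
  then show ?case by (simp add: D_zero T_zero)
next
  case (insert i F)
  have fi: "(\<lambda>y. c i * f i y) \<in> \<D>" using insert.prems by (intro D_scale) auto
  have IH: "(\<lambda>y. \<Sum>i\<in>F. c i * f i y) \<in> \<D>" "norm (T (\<lambda>y. \<Sum>i\<in>F. c i * f i y) x) \<le> (\<Sum>i\<in>F. norm (c i) * norm (T (f i) x))"
    using insert by auto
  have "norm (T (\<lambda>y. c i * f i y + (\<Sum>i\<in>F. c i * f i y)) x) \<le> norm (c i) * norm (T (f i) x) + (\<Sum>i\<in>F. norm (c i) * norm (T (f i) x))"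
    using T_add[OF fi IH(1), of x] IH(2) T_scale[of "f i" "c i" x] insert.prems by auto
  then show ?case using insert.hyps D_add[OF fi IH(1)] by simp
qed

lemma Lspace_D: "f \<in> Lspace M q\<^sub>0 \<Longrightarrow> f \<in> \<D>" using L_D by blast

lemma Linf_c_Lspace: "f \<in> Linf_c M \<Longrightarrow> f \<in> Lspace M q\<^sub>0" using Linf_c_subset_Lspace[OF q0_pos] by blast

lemma Linf_c_D: "f \<in> Linf_c M \<Longrightarrow> f \<in> \<D>" using Linf_c_Lspace Lspace_D by blast

lemma Lspace_dominated:
  assumes f: "f \<in> Lspace M q\<^sub>0" and g: "g \<in> borel_measurable M" and le: "AE x in M. norm (g x) \<le> norm (f x)"
  shows "g \<in> Lspace M q\<^sub>0"
proof (cases q\<^sub>0)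
  case (real q)
  have q: "0 < q" using q0_pos real by simp
  have "pmass M q g \<le> pmass M q f"
    unfolding pmass_def using le q
    by (intro nn_integral_mono_AE) (auto elim!: eventually_mono intro!: ennreal_leI powr_mono2)
  then show ?thesis using f g q real by (auto simp: Lspace_real_iff)
next
  case PInf
  then obtain B where "0 \<le> B" "AE x in M. norm (f x) \<le> B" using f by (auto simp: Lspace_inf_iff)
  then have "AE x in M. norm (g x) \<le> B" using le by (auto elim!: eventually_elim2 order_trans)
  then show ?thesis using PInf g \<open>0 \<le> B\<close> by (auto simp: Lspace_inf_iff)
qed (use q0_pos in auto)

lemma Lspace_restr: "f \<in> Lspace M q\<^sub>0 \<Longrightarrow> S \<in> sets M \<Longrightarrow> restr S f \<in> Lspace M q\<^sub>0"
  by (rule Lspace_dominated[of f]) (auto simp: norm_restr_le Lspace_def intro!: restr_measurable)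

text \<open>\<open>T\<close> acts on functions rather than on classes; the weak type is what makes a
  change on a null set harmless.\<close>

lemma T_null:
  assumes f: "f \<in> Lspace M q\<^sub>0" and z: "AE x in M. f x = 0"
  shows "AE x in M. T f x = 0"
proof -
  have [measurable]: "(\<lambda>x. norm (T f x)) \<in> borel_measurable M" by (intro T_meas Lspace_D f)
  have "AE x in M. ennreal (norm (T f x)) = 0"
  proof (cases q\<^sub>0)
    case (real q)
    have "pmass M q f = (\<integral>\<^sup>+x. 0 \<partial>M)"
      unfolding pmass_def using z by (intro nn_integral_cong_AE) (auto elim: eventually_mono)
    then have 0: "emeasure M {y\<in>space M. e < norm (T f y)} \<le> 0" if "0 < e" for e
      using T_weak_q0 f real that by (auto simp: weak_bound_def)
    show ?thesis
    proof (rule AE_norm_zero_from_levels)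
      fix e :: real assume e: "0 < e"
      have "{y\<in>space M. ennreal e < ennreal (norm (T f y))} = {y\<in>space M. e < norm (T f y)}"
        using e by (auto simp: ennreal_less_iff)
      then show "emeasure M {y\<in>space M. ennreal e < ennreal (norm (T f y))} = 0" using 0[OF e] by simp
    qed measurable
  next
    case PInf
    have "AE x in M. norm (f x) \<le> 0" using z by (auto elim: eventually_mono)
    then have "AE x in M. norm (T f x) \<le> KT * 0" using T_weak_q0 f PInf unfolding weak_bound_def by blast
    then show ?thesis by (auto elim: eventually_mono)
  qed (use q0_pos in auto)
  then show ?thesis by (auto elim: eventually_mono)
qed

text \<open>For finite \<open>q\<^sub>0\<close>, finite sublinearity bounds the image by the partial
  sums plus the image of the remainder \<open>R n\<close>. The remainders tend to 0 in
  \<open>L^q\<^sub>0\<close> by dominated convergence, so by the weak type their images tend to 0 in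
  measure. For infinite \<open>q\<^sub>0\<close> the claim is the hypothesis
  \<open>T_countable\<close>.\<close>

lemma T_countable_sum:
  fixes g :: "nat \<Rightarrow> 'a \<Rightarrow> 'k"
  assumes g: "\<And>i. g i \<in> Lspace M q\<^sub>0" and sm: "\<And>x. summable (\<lambda>i. norm (g i x))"
    and S: "(\<lambda>x. of_real (\<Sum>i. norm (g i x)) :: 'k) \<in> Lspace M q\<^sub>0"
  shows "AE x in M. ennreal (norm (T (\<lambda>y. \<Sum>i. g i y) x)) \<le> (\<Sum>i. ennreal (norm (T (g i) x)))"
proof -
  have gm[measurable]: "g i \<in> borel_measurable M" for i using g by (simp add: Lspace_def)
  let ?u = "\<lambda>y. \<Sum>i. g i y" and ?S = "\<lambda>x. \<Sum>i. norm (g i x)"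
  have um[measurable]: "?u \<in> borel_measurable M" by measurable
  have Sn: "0 \<le> ?S x" for x by (intro suminf_nonneg sm) auto
  have uL: "?u \<in> Lspace M q\<^sub>0"
    by (rule Lspace_dominated[OF S um]) (use Sn summable_norm[OF sm] in \<open>auto intro!: AE_I2\<close>)
  show ?thesis
  proof (cases q\<^sub>0)
    case PInf
    then show ?thesis using T_countable g sm S uL L_D unfolding countably_sublinear_on_def by blast
  next
    case (real q)
    have q: "0 < q" using q0_pos real by simp
    define R where "R n y = (\<Sum>i. g (i + n) y)" for n y
    have sg: "summable (\<lambda>i. g i y)" for y using sm[of y] by (rule summable_norm_cancel)
    have Rm[measurable]: "R n \<in> borel_measurable M" for n unfolding R_def[abs_def] by measurable
    have uR: "?u y = (\<Sum>i<n. 1 * g i y) + R n y" for n y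
      using suminf_split_initial_segment[OF sg, of y n] by (simp add: R_def add.commute)
    have RS: "norm (R n y) \<le> ?S y" for n y
    proof -
      have "norm (R n y) \<le> (\<Sum>i. norm (g (i + n) y))"
        unfolding R_def by (intro summable_norm summable_ignore_initial_segment sm)
      also have "\<dots> \<le> ?S y" using suminf_split_initial_segment[OF sm, of y n] by (simp add: sum_nonneg)
      finally show ?thesis .
    qed
    have RL: "R n \<in> Lspace M q\<^sub>0" for n
      by (rule Lspace_dominated[OF S Rm]) (use RS Sn in \<open>auto intro!: AE_I2\<close>)
    have R0: "(\<lambda>n. R n y) \<longlonglongrightarrow> 0" for y
      unfolding R_def using sg[of y] by (rule suminf_exist_split2)
    have lim: "(\<lambda>n. pmass M q (R n)) \<longlonglongrightarrow> 0"
    proof -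
      have "(\<lambda>n. \<integral>\<^sup>+y. ennreal (norm (R n y) powr q) \<partial>M) \<longlonglongrightarrow> (\<integral>\<^sup>+y. ennreal 0 \<partial>M)"
      proof (rule nn_integral_dominated_convergence[where w="\<lambda>y. ennreal (?S y powr q)"])
        show "(\<integral>\<^sup>+y. ennreal (?S y powr q) \<partial>M) < \<infinity>" using S real q Sn by (simp add: Lspace_real_iff pmass_def)
        show "AE y in M. ennreal (norm (R n y) powr q) \<le> ennreal (?S y powr q)" for n
          using RS q by (intro AE_I2 ennreal_leI powr_mono2) auto
        have "(\<lambda>n. norm (R n y) powr q) \<longlonglongrightarrow> 0" for y
          using tendsto_norm_zero[OF R0[of y]] q by (rule tendsto_powr_zero_real) simp
        then show "AE y in M. (\<lambda>n. ennreal (norm (R n y) powr q)) \<longlonglongrightarrow> ennreal 0"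
          by (intro AE_I2 tendsto_ennrealI)
      qed measurable
      then show ?thesis by (simp add: pmass_def)
    qed
    define W where "W x = (\<Sum>i. ennreal (norm (T (g i) x)))" for x
    have Tg[measurable]: "(\<lambda>x. norm (T (g i) x)) \<in> borel_measurable M" for i by (intro T_meas Lspace_D g)
    have Tu[measurable]: "(\<lambda>x. norm (T ?u x)) \<in> borel_measurable M" by (intro T_meas Lspace_D uL)
    have TR[measurable]: "(\<lambda>x. norm (T (R n) x)) \<in> borel_measurable M" for n by (intro T_meas Lspace_D RL)
    have Wm[measurable]: "W \<in> borel_measurable M" unfolding W_def[abs_def] by measurable
    have main: "ennreal (norm (T ?u x)) \<le> W x + ennreal (norm (T (R n) x))" for n x
    proof -
      have s: "(\<lambda>y. \<Sum>i<n. 1 * g i y) \<in> \<D>" "norm (T (\<lambda>y. \<Sum>i<n. 1 * g i y) x) \<le> (\<Sum>i<n. norm (1::'k) * norm (T (g i) x))"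
        using T_sum[of "{..<n}" g "\<lambda>_. 1" x] Lspace_D g by auto
      have "?u = (\<lambda>y. (\<Sum>i<n. 1 * g i y) + R n y)" using uR by blast
      then have "norm (T ?u x) \<le> norm (T (\<lambda>y. \<Sum>i<n. 1 * g i y) x) + norm (T (R n) x)"
        using T_add[OF s(1) Lspace_D[OF RL[of n]], of x] by simp
      also have "\<dots> \<le> (\<Sum>i<n. norm (T (g i) x)) + norm (T (R n) x)" using s(2) by simp
      finally have "ennreal (norm (T ?u x)) \<le> (\<Sum>i<n. ennreal (norm (T (g i) x))) + ennreal (norm (T (R n) x))"
        by (simp add: sum_ennreal ennreal_plus[symmetric] sum_nonneg ennreal_leI del: ennreal_plus)
      also have "(\<Sum>i<n. ennreal (norm (T (g i) x))) \<le> W x" unfolding W_def by (intro sum_le_suminf) auto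
      finally show ?thesis by (simp add: add_right_mono)
    qed
    have "AE x in M. ennreal (norm (T ?u x)) - W x = 0"
    proof (rule AE_norm_zero_from_levels)
      fix e :: real assume e: "0 < e"
      have "emeasure M {y\<in>space M. ennreal e < ennreal (norm (T ?u y)) - W y} \<le> ennreal (KT / e powr q) * pmass M q (R n)" for n
      proof -
        have "emeasure M {y\<in>space M. ennreal e < ennreal (norm (T ?u y)) - W y} \<le> emeasure M {y\<in>space M. e < norm (T (R n) y)}"
        proof (rule emeasure_mono)
          show "{y\<in>space M. ennreal e < ennreal (norm (T ?u y)) - W y} \<subseteq> {y\<in>space M. e < norm (T (R n) y)}"
          proof clarify
            fix y assume "ennreal e < ennreal (norm (T ?u y)) - W y"
            also have "\<dots> \<le> ennreal (norm (T (R n) y))" using main[of y n] by (rule ennreal_minus_le_of_le_add) simp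
            finally show "e < norm (T (R n) y)" using e by (simp add: ennreal_less_iff)
          qed
        qed measurable
        also have "\<dots> \<le> ennreal (KT / e powr q) * pmass M q (R n)" using T_weak_q0 RL real e by (simp add: weak_bound_def)
        finally show ?thesis .
      qed
      moreover have "(\<lambda>n. ennreal (KT / e powr q) * pmass M q (R n)) \<longlonglongrightarrow> ennreal (KT / e powr q) * 0"
        using lim by (intro ennreal_tendsto_cmult) auto
      ultimately have "emeasure M {y\<in>space M. ennreal e < ennreal (norm (T ?u y)) - W y} \<le> 0"
        by (intro LIMSEQ_le_const[of "\<lambda>n. ennreal (KT / e powr q) * pmass M q (R n)"]) auto
      then show "emeasure M {y\<in>space M. ennreal e < ennreal (norm (T ?u y)) - W y} = 0" by simp
    qed measurable
    then show ?thesis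
    proof eventually_elim
      case (elim x)
      then have "ennreal (norm (T ?u x)) \<le> W x" by (simp add: diff_eq_0_iff_ennreal)
      then show ?case by (simp add: W_def)
    qed
  qed (use q0_pos in auto)
qed

end

section \<open>Decomposable functions and extension of the weak type of \<open>T\<close> beyond
  bounded functions\<close>

lemma restr_sums:
  fixes u :: "'a \<Rightarrow> 'k::real_normed_vector"
  assumes "disjoint_family Z"
  shows "(\<lambda>i::nat. restr (Z i) u y) sums restr (\<Union>i. Z i) u y"
    and "(\<lambda>i::nat. norm (restr (Z i) u y)) sums norm (restr (\<Union>i. Z i) u y)"
proof -
  have "(\<lambda>i. restr (Z i) u y) sums restr (\<Union>i. Z i) u y \<and> (\<lambda>i. norm (restr (Z i) u y)) sums norm (restr (\<Union>i. Z i) u y)"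
  proof (cases "y \<in> (\<Union>i. Z i)")
    case True
    then obtain j where j: "y \<in> Z j" by blast
    have e: "restr (Z i) u y = (if i = j then u y else 0)" for i
      using assms j by (auto simp: restr_def disjoint_family_on_def)
    have e2: "restr (\<Union>i. Z i) u y = u y" using j by (auto simp: restr_def)
    show ?thesis using sums_single[of j "\<lambda>_. u y"] sums_single[of j "\<lambda>_. norm (u y)"]
      unfolding e2 by (simp add: e if_distrib[of norm] cong: if_cong)
  next
    case False
    then show ?thesis by (auto simp: restr_def)
  qed
  then show "(\<lambda>i::nat. restr (Z i) u y) sums restr (\<Union>i. Z i) u y"
    "(\<lambda>i::nat. norm (restr (Z i) u y)) sums norm (restr (\<Union>i. Z i) u y)" by blast+
qed

lemma restr_restr: "restr S (restr S' f) = restr (S \<inter> S') f"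
  by (auto simp: restr_def fun_eq_iff)

lemma pmass_mono:
  assumes "0 < p" "\<And>x. norm (f x) \<le> norm (g x)" shows "pmass M p f \<le> pmass M p g"
  unfolding pmass_def using assms by (intro nn_integral_mono ennreal_leI powr_mono2) auto

lemma pmass_restr_tendsto_0:
  fixes u :: "'a \<Rightarrow> 'k::{real_normed_vector, second_countable_topology}"
  assumes [measurable]: "u \<in> borel_measurable M" "\<And>n. Y n \<in> sets M" and p: "0 < p" and fin: "pmass M p u < \<infinity>"
    and ev: "\<And>y. y \<in> space M \<Longrightarrow> u y \<noteq> 0 \<Longrightarrow> eventually (\<lambda>n. y \<notin> Y n) sequentially"
  shows "(\<lambda>n::nat. pmass M p (restr (Y n) u)) \<longlonglongrightarrow> 0"
proof -
  have "(\<lambda>n. \<integral>\<^sup>+y. ennreal (norm (restr (Y n) u y) powr p) \<partial>M) \<longlonglongrightarrow> (\<integral>\<^sup>+y. 0 \<partial>M)"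
  proof (rule nn_integral_dominated_convergence[where w="\<lambda>y. ennreal (norm (u y) powr p)"])
    show "(\<integral>\<^sup>+y. ennreal (norm (u y) powr p) \<partial>M) < \<infinity>" using fin by (simp add: pmass_def)
    show "AE y in M. ennreal (norm (restr (Y n) u y) powr p) \<le> ennreal (norm (u y) powr p)" for n
      using p by (intro AE_I2 ennreal_leI powr_mono2) (auto simp: norm_restr_le)
    show "AE y in M. (\<lambda>n. ennreal (norm (restr (Y n) u y) powr p)) \<longlonglongrightarrow> 0"
    proof (rule AE_I2)
      fix y assume y: "y \<in> space M"
      show "(\<lambda>n. ennreal (norm (restr (Y n) u y) powr p)) \<longlonglongrightarrow> 0"
      proof (cases "u y = 0")
        case False
        have "eventually (\<lambda>n. ennreal (norm (restr (Y n) u y) powr p) = 0) sequentially"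
          using ev[OF y False] by eventually_elim (simp add: restr_def)
        then show ?thesis by (rule tendsto_eventually)
      next
        case True
        then have "restr (Y n) u y = 0" for n by (simp add: restr_def)
        then show ?thesis by simp
      qed
    qed
  qed measurable
  then show ?thesis by (simp add: pmass_def)
qed

context doubling_measure
begin

lemma BMO1_power_pmass_finite:
  fixes b :: "'a \<Rightarrow> 'k::{real_normed_field, banach, second_countable_topology}"
  assumes b: "BMO1 b" and f: "f \<in> Linf_c M" and p: "0 < p"
  shows "pmass M p (\<lambda>y. b y ^ l * f y) < \<infinity>"
proof -
  have bm[measurable]: "b \<in> borel_measurable M" using b by (simp add: BMO1_def)
  obtain B where B: "0 < B" "\<And>x. norm (f x) \<le> B" using Linf_c_bounded[OF f] by blast
  obtain r0 where "{y. f y \<noteq> 0} \<subseteq> ball 0 r0" using Linf_c_support[OF f] bounded_subset_ballD by blast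
  then obtain r where r: "0 < r" "{y. f y \<noteq> 0} \<subseteq> ball 0 r"
    using subset_ball[of r0 "max r0 1" 0] by (intro that[of "max r0 1"]) auto
  let ?c = "mean M (ball 0 r) b"
  obtain C where C: "\<And>l' x r. l' \<le> l \<Longrightarrow> 0 < r \<Longrightarrow>
    (\<integral>\<^sup>+y\<in>ball x r. ennreal ((norm (b y - mean M (ball x r) b) ^ l') powr p) \<partial>M) \<le> ennreal C * emeasure M (ball x r)"
    using john_nirenberg_annulus[OF p, where 'k='k and k=l] b by blast
  define K where "K = (2 ^ l) powr p * 2 powr p * B powr p"
  have "pmass M p (\<lambda>y. b y ^ l * f y) \<le>
    (\<integral>\<^sup>+y\<in>ball 0 r. ennreal K * ennreal ((norm (b y - ?c) ^ l) powr p) + ennreal (K * (norm ?c ^ l) powr p) \<partial>M)"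
    unfolding pmass_def
  proof (rule nn_integral_mono)
    fix y
    show "ennreal (norm (b y ^ l * f y) powr p) \<le>
      (ennreal K * ennreal ((norm (b y - ?c) ^ l) powr p) + ennreal (K * (norm ?c ^ l) powr p)) * indicator (ball 0 r) y"
    proof (cases "y \<in> ball 0 r")
      case True
      have "norm (b y) \<le> 2 * max (norm (b y - ?c)) (norm ?c)"
        using norm_triangle_ineq[of "b y - ?c" ?c] by simp
      then have "norm (b y) ^ l \<le> (2 * max (norm (b y - ?c)) (norm ?c)) ^ l" by (rule power_mono) simp
      also have "\<dots> = 2 ^ l * max (norm (b y - ?c)) (norm ?c) ^ l" by (rule power_mult_distrib)
      also have "\<dots> \<le> 2 ^ l * (norm (b y - ?c) ^ l + norm ?c ^ l)"
        by (intro mult_left_mono) (auto simp: max_def)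
      finally have "norm (b y ^ l * f y) \<le> 2 ^ l * (norm (b y - ?c) ^ l + norm ?c ^ l) * B"
        using B(2)[of y] unfolding norm_mult norm_power by (intro mult_mono) auto
      then have "norm (b y ^ l * f y) powr p \<le> (2 ^ l * (norm (b y - ?c) ^ l + norm ?c ^ l) * B) powr p"
        using p by (intro powr_mono2) auto
      also have "\<dots> = (2 ^ l) powr p * B powr p * (norm (b y - ?c) ^ l + norm ?c ^ l) powr p"
        by (simp add: powr_mult)
      also have "\<dots> \<le> (2 ^ l) powr p * B powr p * (2 powr p * ((norm (b y - ?c) ^ l) powr p + (norm ?c ^ l) powr p))"
        using p by (intro mult_left_mono powr_add_le) auto
      also have "\<dots> = K * (norm (b y - ?c) ^ l) powr p + K * (norm ?c ^ l) powr p"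
        by (simp add: K_def algebra_simps)
      finally show ?thesis using True
        by (simp add: K_def ennreal_mult'[symmetric] ennreal_plus[symmetric] ennreal_leI del: ennreal_plus)
    next
      case False
      then have "f y = 0" using r(2) by blast
      then show ?thesis by simp
    qed
  qed
  also have "\<dots> = ennreal K * (\<integral>\<^sup>+y\<in>ball 0 r. ennreal ((norm (b y - ?c) ^ l) powr p) \<partial>M) + ennreal (K * (norm ?c ^ l) powr p) * emeasure M (ball 0 r)"
    by (subst nn_set_integral_add) (measurable, simp add: nn_set_integral_const mult.assoc nn_integral_cmult)
  also have "\<dots> \<le> ennreal K * (ennreal C * emeasure M (ball 0 r)) + ennreal (K * (norm ?c ^ l) powr p) * emeasure M (ball 0 r)"
    by (intro add_right_mono mult_left_mono C r) auto
  also have "\<dots> < \<infinity>" using ball_finite[of 0 r] by (simp add: ennreal_mult_less_top)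
  finally show ?thesis .
qed

lemma tower_family_sum_power:
  fixes u :: "nat \<Rightarrow> 'a \<Rightarrow> real"
  assumes tf: "tower_family \<beta> C t N J x r w" and \<beta>: "\<And>j. 0 < \<beta> j" "summable (\<lambda>j. \<beta> j * 2 powr (D * real j))"
    and q: "1 \<le> q" and t: "0 < t" and C: "0 < C" and N: "0 \<le> N" and K: "0 \<le> K" and F: "finite F" "F \<subseteq> J"
    and um: "\<And>i. i \<in> F \<Longrightarrow> u i \<in> borel_measurable M" and u0: "\<And>i y. 0 \<le> u i y"
    and ann: "\<And>i j. i \<in> F \<Longrightarrow> 1 \<le> j \<Longrightarrow> (\<integral>\<^sup>+y\<in>annulus (x i) (r i) j. ennreal (u i y powr q) \<partial>M)
       \<le> ennreal (K * (w i * \<beta> j) powr q) * emeasure M (ball (x i) (2 ^ (j + 1) * r i))"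
  shows "(\<integral>\<^sup>+y. ennreal ((\<Sum>i\<in>F. u i y) powr q) \<partial>M) \<le> ennreal (C powr q * K * tower_const \<beta> * t powr q * N)"
proof -
  have tc: "0 \<le> tower_const \<beta>" using tower_const_nonneg[of \<beta>] \<beta> by (simp add: less_imp_le)
  have Ct: "0 < C * t" using C t by simp
  have "(\<integral>\<^sup>+y. ennreal ((\<Sum>i\<in>F. u i y) powr q) \<partial>M) \<le>
    ennreal ((C * t) powr (q - 1) * K * t * tower_const \<beta>) * (\<Sum>i\<in>F. emeasure M (ball (x i) (r i)))"
    using tf F unfolding tower_family_def
    by (intro sum_powr_towers[OF q \<beta> F(1) _ _ _ um u0 K Ct ann]) auto
  also have "\<dots> \<le> ennreal ((C * t) powr (q - 1) * K * t * tower_const \<beta>) * ennreal (C * N)"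
    using tf F unfolding tower_family_def by (intro mult_left_mono) auto
  also have "\<dots> = ennreal ((C * t) powr (q - 1) * K * t * tower_const \<beta> * (C * N))"
    using K t tc C N by (subst ennreal_mult'[symmetric]) auto
  also have "(C * t) powr (q - 1) * K * t * tower_const \<beta> * (C * N) = (C * t) powr (q - 1) * (C * t) * K * tower_const \<beta> * N"
    by (simp only: mult_ac)
  also have "(C * t) powr (q - 1) * (C * t) = (C * t) powr q"
    using Ct by (simp add: powr_diff)
  also have "(C * t) powr q = C powr q * t powr q" by (rule powr_mult)
  also have "C powr q * t powr q * K * tower_const \<beta> * N = C powr q * K * tower_const \<beta> * t powr q * N"
    by (simp only: mult_ac)
  finally show ?thesis .
qed

end

context cz_operator
begin

text \<open>
  For \<open>q\<^sub>0 = \<infinity>\<close> the functions \<open>b\<^sup>l f\<close> need not be bounded, so they lie outside \<open>L\<^bsup>q\<^sub>0\<^esup>\<close> and countable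
  sublinearity is available for them only along partitions.
\<close>
definition decomposable :: "('a \<Rightarrow> 'k) \<Rightarrow> bool" where
  "decomposable u \<longleftrightarrow> (\<forall>S\<in>sets M. restr S u \<in> \<D>) \<and>
    (\<forall>Z :: nat \<Rightarrow> 'a set. disjoint_family Z \<longrightarrow> (\<forall>i. Z i \<in> sets M) \<longrightarrow>
      (AE x in M. ennreal (norm (T (restr (\<Union>i. Z i) u) x)) \<le> (\<Sum>i. ennreal (norm (T (restr (Z i) u) x)))))"

lemma decomposable_Lspace:
  assumes u: "u \<in> Lspace M q\<^sub>0" shows "decomposable u"
  unfolding decomposable_def
proof (intro conjI ballI allI impI)
  show "restr S u \<in> \<D>" if "S \<in> sets M" for S using Lspace_restr[OF u that] Lspace_D by blast
  fix Z :: "nat \<Rightarrow> 'a set" assume Z: "disjoint_family Z" "\<forall>i. Z i \<in> sets M"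
  have Zm: "(\<Union>i. Z i) \<in> sets M" using Z by blast
  have ruL: "restr (\<Union>i. Z i) u \<in> Lspace M q\<^sub>0" by (rule Lspace_restr[OF u Zm])
  have eq: "(\<Sum>i. restr (Z i) u y) = restr (\<Union>i. Z i) u y" "(\<Sum>i. norm (restr (Z i) u y)) = norm (restr (\<Union>i. Z i) u y)" for y
    using restr_sums[OF Z(1), of u y] by (auto simp: sums_iff)
  have "AE x in M. ennreal (norm (T (\<lambda>y. \<Sum>i. restr (Z i) u y) x)) \<le> (\<Sum>i. ennreal (norm (T (restr (Z i) u) x)))"
  proof (rule T_countable_sum)
    show "restr (Z i) u \<in> Lspace M q\<^sub>0" for i using Z by (intro Lspace_restr u) auto
    show "summable (\<lambda>i. norm (restr (Z i) u y))" for y using restr_sums(2)[OF Z(1), of u y] by (auto simp: sums_iff)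
    show "(\<lambda>x. of_real (\<Sum>i. norm (restr (Z i) u x)) :: 'k) \<in> Lspace M q\<^sub>0"
      unfolding eq using ruL by (intro Lspace_dominated[OF ruL]) (auto simp: Lspace_def)
  qed
  then show "AE x in M. ennreal (norm (T (restr (\<Union>i. Z i) u) x)) \<le> (\<Sum>i. ennreal (norm (T (restr (Z i) u) x)))"
    by (simp add: eq)
qed

text \<open>For finite \<open>q\<^sub>0\<close> John-Nirenberg puts the function into
  \<open>L^q\<^sub>0\<close>. For infinite \<open>q\<^sub>0\<close> membership in \<D> comes from
  \<open>commutators_defined\<close> with centre 0, up to the sign \<open>(-1) ^ l\<close>;
  countable sublinearity also asks for the modulus of the function to lie in \<D>.\<close>

lemma decomposable_power:
  assumes b: "BMO1 b" and cd: "commutators_defined M \<D> b k'" and f: "f \<in> Linf_c M" and l: "l \<le> k'"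
  shows "decomposable (\<lambda>y. b y ^ l * f y)"
proof (cases q\<^sub>0)
  case (real q)
  have q: "0 < q" using q0_pos real by simp
  have [measurable]: "b \<in> borel_measurable M" "f \<in> borel_measurable M" using b f by (auto simp: BMO1_def Linf_c_def)
  show ?thesis
    using BMO1_power_pmass_finite[OF b f q, of l] q real by (intro decomposable_Lspace) (simp add: Lspace_real_iff)
next
  case PInf
  have bm[measurable]: "b \<in> borel_measurable M" and fm[measurable]: "f \<in> borel_measurable M" using b f by (auto simp: BMO1_def Linf_c_def)
  let ?u = "\<lambda>y. b y ^ l * f y"
  have inD: "(\<lambda>y. (0 - b y) ^ l * g y) \<in> \<D>" if "g \<in> Linf_c M" for g
    using cd that l unfolding commutators_defined_def by blast
  have rD: "restr S ?u \<in> \<D>" if S: "S \<in> sets M" for S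
  proof -
    have "(\<lambda>y. (-1) ^ l * ((0 - b y) ^ l * restr S f y)) \<in> \<D>" by (intro D_scale inD Linf_c_restr f S)
    also have "(\<lambda>y. (-1) ^ l * ((0 - b y) ^ l * restr S f y)) = restr S ?u"
    proof
      fix y
      have "(-1) ^ l * (0 - b y) ^ l = (-1 * (0 - b y)) ^ l" by (rule power_mult_distrib[symmetric])
      also have "\<dots> = b y ^ l" by simp
      finally have "(-1) ^ l * ((0 - b y) ^ l * restr S f y) = b y ^ l * restr S f y" by (simp only: mult.assoc[symmetric])
      also have "\<dots> = restr S ?u y" unfolding restr_def by simp
      finally show "(-1) ^ l * ((0 - b y) ^ l * restr S f y) = restr S ?u y" .
    qed
    finally show ?thesis .
  qed
  have nD: "(\<lambda>y. of_real (norm (restr S ?u y)) :: 'k) \<in> \<D>" if S[measurable]: "S \<in> sets M" for S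
  proof -
    \<comment> \<open>The modulus is written as \<open>(0 - b) ^ l\<close> times a function in
      \<open>Linf_c M\<close>. Division by 0 gives 0, which is the right value because the numerator
      vanishes wherever the denominator does.\<close>
    define g where "g y = of_real (norm (restr S ?u y)) / (0 - b y) ^ l" for y
    have "g \<in> Linf_c M"
    proof -
      obtain B where B: "\<And>x. norm (f x) \<le> B" using Linf_c_bounded[OF f] by blast
      show ?thesis
      proof (rule Linf_cI)
        show "g \<in> borel_measurable M" unfolding g_def[abs_def] by measurable
        have "norm (g y) \<le> norm (f y)" for y
          by (cases "b y ^ l = 0") (auto simp: g_def restr_def norm_divide norm_mult norm_power)
        then show "norm (g y) \<le> B" for y using B order_trans by blast
        show "g y = 0" if "y \<notin> {x. f x \<noteq> 0}" for y using that by (simp add: g_def restr_def)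
      qed (rule Linf_c_support[OF f])
    qed
    then have "(\<lambda>y. (0 - b y) ^ l * g y) \<in> \<D>" by (rule inD)
    also have "(\<lambda>y. (0 - b y) ^ l * g y) = (\<lambda>y. of_real (norm (restr S ?u y)))"
    proof
      fix y
      have "norm (restr S ?u y) = 0" if "(0 - b y) ^ l = 0"
        using that by (simp add: restr_def norm_mult norm_power)
      then show "(0 - b y) ^ l * g y = of_real (norm (restr S ?u y))"
        by (cases "(0 - b y) ^ l = 0") (auto simp: g_def)
    qed
    finally show ?thesis .
  qed
  show ?thesis
    unfolding decomposable_def
  proof (intro conjI ballI allI impI)
    show "restr S ?u \<in> \<D>" if "S \<in> sets M" for S by (rule rD[OF that])
    fix Z :: "nat \<Rightarrow> 'a set" assume Z: "disjoint_family Z" "\<forall>i. Z i \<in> sets M"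
    have Zm: "(\<Union>i. Z i) \<in> sets M" using Z by blast
    have eq: "(\<Sum>i. restr (Z i) ?u y) = restr (\<Union>i. Z i) ?u y" "(\<Sum>i. norm (restr (Z i) ?u y)) = norm (restr (\<Union>i. Z i) ?u y)" for y
      using restr_sums[OF Z(1), of ?u y] by (auto simp: sums_iff)
    have "AE x in M. ennreal (norm (T (\<lambda>y. \<Sum>i. restr (Z i) ?u y) x)) \<le> (\<Sum>i. ennreal (norm (T (restr (Z i) ?u) x)))"
    proof (rule T_countable[OF PInf, unfolded countably_sublinear_on_def, rule_format])
      show "restr (Z i) ?u \<in> \<D>" for i using Z(2) by (intro rD) blast
      show "summable (\<lambda>i. norm (restr (Z i) ?u y))" for y using restr_sums(2)[OF Z(1), of ?u y] by (rule sums_summable)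
      show "(\<lambda>x. of_real (\<Sum>i. norm (restr (Z i) ?u x)) :: 'k) \<in> \<D>" unfolding eq by (rule nD[OF Zm])
      show "(\<lambda>x. \<Sum>i. restr (Z i) ?u x) \<in> \<D>" unfolding eq by (rule rD[OF Zm])
    qed
    then show "AE x in M. ennreal (norm (T (restr (\<Union>i. Z i) ?u) x)) \<le> (\<Sum>i. ennreal (norm (T (restr (Z i) ?u) x)))"
      by (simp add: eq)
  qed
qed (use q0_pos in auto)

text \<open>The set \<open>S\<close> is cut into countably many disjoint parts on which
  \<open>u\<close> is bounded with bounded support. The first part gets the height \<open>t\<close>
  and almost all of the mass; the heights \<open>t / 2 ^ i\<close> of the others add up to another
  \<open>t\<close>, and their masses are made to decay faster than these heights.\<close>

lemma T_weak_extend: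
  assumes wk: "\<And>f t. f \<in> Linf_c M \<Longrightarrow> 0 < t \<Longrightarrow> emeasure M {y. t < norm (T f y)} \<le> ennreal (K / t powr p) * pmass M p f"
    and K: "0 \<le> K" and p: "0 < p" and u: "decomposable u" and um[measurable]: "u \<in> borel_measurable M" and fin: "pmass M p u < \<infinity>"
    and Ym: "\<And>n. Y n \<in> sets M" and Y: "incseq Y" "(\<Union>n. Y n) = UNIV" "\<And>n. restr (Y n) u \<in> Linf_c M"
    and S[measurable]: "S \<in> sets M" and t: "0 < t" and \<epsilon>: "0 < \<epsilon>"
  shows "emeasure M {y. 2 * t < norm (T (restr S u) y)} \<le> ennreal (K / t powr p) * (pmass M p (restr S u) + ennreal \<epsilon>)"
proof -
  have lim: "(\<lambda>n. pmass M p (restr (- Y n) u)) \<longlonglongrightarrow> 0"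
  proof (rule pmass_restr_tendsto_0[OF um _ p fin])
    show "- Y n \<in> sets M" for n using sets.compl_sets[OF Ym[of n]] by (simp add: Compl_eq_Diff_UNIV)
    fix y :: 'a
    obtain n where n: "y \<in> Y n" using Y(2) by blast
    then have "\<forall>m\<ge>n. y \<notin> - Y m" using Y(1) by (auto simp: incseq_def)
    then show "eventually (\<lambda>n. y \<notin> - Y n) sequentially" by (auto simp: eventually_sequentially)
  qed
  \<comment> \<open>The part with index \<open>Suc i\<close> is estimated at height
    \<open>t / 2 ^ Suc i\<close>, which costs \<open>(2 ^ Suc i) powr p\<close>. With
    \<open>e i\<close> this leaves \<open>\<epsilon> / 2 ^ Suc i\<close>, and the sum over
    \<open>i\<close> is \<epsilon>.\<close>
  define e where "e i = \<epsilon> / (2 ^ Suc i * (2 ^ Suc i) powr p)" for i :: nat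
  have e: "0 < e i" for i using \<epsilon> by (simp add: e_def)
  have "\<exists>n\<ge>i. pmass M p (restr (- Y n) u) \<le> ennreal (e i)" for i
  proof -
    have "eventually (\<lambda>n. pmass M p (restr (- Y n) u) < ennreal (e i)) sequentially"
      using lim e[of i] by (intro order_tendstoD(2)[of _ 0]) auto
    then obtain n0 where "\<forall>n\<ge>n0. pmass M p (restr (- Y n) u) < ennreal (e i)" by (auto simp: eventually_sequentially)
    then show ?thesis by (intro exI[of _ "max i n0"]) (auto intro: less_imp_le)
  qed
  then obtain n where n: "\<And>i. i \<le> n i" "\<And>i. pmass M p (restr (- Y (n i)) u) \<le> ennreal (e i)" by metis
  define Z where "Z = disjointed (\<lambda>i. Y (n i))"
  have Zd: "disjoint_family Z" unfolding Z_def by (rule disjoint_family_disjointed)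
  have ZU: "(\<Union>i. Z i) = UNIV"
  proof -
    have "y \<in> (\<Union>i. Y (n i))" for y
    proof -
      obtain i where "y \<in> Y i" using Y(2) by blast
      then have "y \<in> Y (n i)" using Y(1) n(1)[of i] by (auto simp: incseq_def)
      then show ?thesis by blast
    qed
    then show ?thesis unfolding Z_def UN_disjointed_eq by blast
  qed
  have Zm[measurable]: "Z i \<in> sets M" for i
    unfolding Z_def disjointed_def using Ym by auto
  have ZY: "Z i \<subseteq> Y (n i)" for i unfolding Z_def by (rule disjointed_subset)
  have ZS: "Z (Suc i) \<subseteq> - Y (n i)" for i unfolding Z_def disjointed_def by auto
  let ?Z = "\<lambda>i. S \<inter> Z i"
  have dZ: "disjoint_family ?Z" using Zd by (auto simp: disjoint_family_on_def)
  have UZ: "(\<Union>i. ?Z i) = S" using ZU by blast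
  have zL: "restr (?Z i) u \<in> Linf_c M" for i
  proof -
    have "restr (?Z i) (restr (Y (n i)) u) \<in> Linf_c M" by (intro Linf_c_restr Y) measurable
    moreover have "?Z i \<inter> Y (n i) = ?Z i" using ZY by blast
    ultimately show ?thesis by (simp add: restr_restr)
  qed
  have ae: "AE x in M. ennreal (norm (T (restr S u) x)) \<le> (\<Sum>i. ennreal (norm (T (restr (?Z i) u) x)))"
  proof -
    have "AE x in M. ennreal (norm (T (restr (\<Union>i. ?Z i) u) x)) \<le> (\<Sum>i. ennreal (norm (T (restr (?Z i) u) x)))"
      using conjunct2[OF u[unfolded decomposable_def], rule_format, of ?Z] dZ S Zm by blast
    then show ?thesis unfolding UZ .
  qed
  have Tm[measurable]: "(\<lambda>x. norm (T (restr (?Z i) u) x)) \<in> borel_measurable M" for i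
    by (intro T_meas Linf_c_D zL)
  have TSm[measurable]: "(\<lambda>x. norm (T (restr S u) x)) \<in> borel_measurable M"
    using u S by (intro T_meas) (auto simp: decomposable_def)
  let ?E = "\<lambda>i. {y\<in>space M. t / 2 ^ i < norm (T (restr (?Z i) u) y)}"
  have Em: "?E i \<in> sets M" for i by measurable
  have "emeasure M {y. 2 * t < norm (T (restr S u) y)} \<le> emeasure M (\<Union>i. ?E i)"
  proof (rule emeasure_mono_AE)
    show "AE y in M. y \<in> {y. 2 * t < norm (T (restr S u) y)} \<longrightarrow> y \<in> (\<Union>i. ?E i)"
      using ae
    proof eventually_elim
      case (elim y)
      note le = elim
      show ?case
      proof (intro impI, rule ccontr)
        assume y: "y \<in> {y. 2 * t < norm (T (restr S u) y)}" and nE: "y \<notin> (\<Union>i. ?E i)"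
      have *: "norm (T (restr (?Z i) u) y) \<le> t * (1 / 2) ^ i" for i using nE by (auto simp: not_less power_divide)
      have "(\<Sum>i. ennreal (norm (T (restr (?Z i) u) y))) \<le> (\<Sum>i. ennreal (t * (1 / 2) ^ i))"
        by (intro suminf_le ennreal_leI *) auto
      also have "\<dots> = ennreal (\<Sum>i. t * (1 / 2) ^ i)"
        using t by (intro suminf_ennreal2) (auto intro!: summable_mult summable_geometric)
      also have "(\<Sum>i. t * (1 / 2) ^ i) = 2 * t"
        by (subst suminf_mult) (auto intro!: summable_geometric simp: suminf_geometric)
      finally have "ennreal (norm (T (restr S u) y)) \<le> ennreal (2 * t)" using le by (rule order_trans[rotated])
      then have "norm (T (restr S u) y) \<le> 2 * t" using t by (subst (asm) ennreal_le_iff) auto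
      then show False using y by simp
      qed
    qed
  qed measurable
  also have "\<dots> \<le> (\<Sum>i. emeasure M (?E i))"
    using Em by (intro emeasure_subadditive_countably) blast
  also have "\<dots> \<le> (\<Sum>i. ennreal (K / t powr p) * (case i of 0 \<Rightarrow> pmass M p (restr S u) | Suc i \<Rightarrow> ennreal (\<epsilon> * (1 / 2) ^ Suc i)))"
  proof (rule suminf_le)
    fix i
    have pt: "(t / 2 ^ i) powr p = t powr p / (2 ^ i) powr p" using t by (simp add: powr_divide)
    have "emeasure M (?E i) \<le> ennreal (K / (t / 2 ^ i) powr p) * pmass M p (restr (?Z i) u)"
      using wk[OF zL[of i], of "t / 2 ^ i"] t by simp
    also have "\<dots> = ennreal (K / t powr p) * (ennreal ((2 ^ i) powr p) * pmass M p (restr (?Z i) u))"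
      unfolding pt using K by (simp add: mult.assoc[symmetric] ennreal_mult'[symmetric])
    also have "\<dots> \<le> ennreal (K / t powr p) * (case i of 0 \<Rightarrow> pmass M p (restr S u) | Suc i \<Rightarrow> ennreal (\<epsilon> * (1 / 2) ^ Suc i))"
    proof (rule mult_left_mono)
      show "ennreal ((2 ^ i) powr p) * pmass M p (restr (?Z i) u) \<le> (case i of 0 \<Rightarrow> pmass M p (restr S u) | Suc i \<Rightarrow> ennreal (\<epsilon> * (1 / 2) ^ Suc i))"
      proof (cases i)
        case 0
        then show ?thesis using p by (auto intro!: pmass_mono simp: restr_def)
      next
        case (Suc j)
        have "pmass M p (restr (?Z i) u) \<le> pmass M p (restr (- Y (n j)) u)"
          using ZS[of j] Suc p by (intro pmass_mono) (auto simp: restr_def)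
        also note n(2)[of j]
        finally have "ennreal ((2 ^ i) powr p) * pmass M p (restr (?Z i) u) \<le> ennreal ((2 ^ i) powr p) * ennreal (e j)"
          by (rule mult_left_mono) simp
        also have "\<dots> = ennreal ((2 ^ i) powr p * e j)" by (simp add: ennreal_mult')
        also have "(2 ^ i) powr p * e j = \<epsilon> * (1 / 2) ^ Suc j"
          unfolding e_def Suc by (simp add: power_divide)
        finally show ?thesis using Suc by simp
      qed
    qed simp
    finally show "emeasure M (?E i) \<le> ennreal (K / t powr p) * (case i of 0 \<Rightarrow> pmass M p (restr S u) | Suc i \<Rightarrow> ennreal (\<epsilon> * (1 / 2) ^ Suc i))" .
  qed auto
  also have "\<dots> = ennreal (K / t powr p) * (\<Sum>i. case i of 0 \<Rightarrow> pmass M p (restr S u) | Suc i \<Rightarrow> ennreal (\<epsilon> * (1 / 2) ^ Suc i))"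
    by (rule ennreal_suminf_cmult)
  also have "(\<Sum>i. case i of 0 \<Rightarrow> pmass M p (restr S u) | Suc i \<Rightarrow> ennreal (\<epsilon> * (1 / 2) ^ Suc i)) =
    (\<Sum>i. ennreal (\<epsilon> * (1 / 2) ^ Suc i)) + pmass M p (restr S u)"
    using suminf_offset[of "\<lambda>i. case i of 0 \<Rightarrow> pmass M p (restr S u) | Suc i \<Rightarrow> ennreal (\<epsilon> * (1 / 2) ^ Suc i)" 1]
    by (simp add: add.commute del: power_Suc)
  also have "(\<Sum>i. ennreal (\<epsilon> * (1 / 2) ^ Suc i)) = ennreal (\<Sum>i. \<epsilon> * (1 / 2) ^ Suc i)"
    using \<epsilon> by (intro suminf_ennreal2 summable_mult sums_summable[OF power_half_series]) auto
  also have "(\<Sum>i. \<epsilon> * (1 / 2) ^ Suc i) = \<epsilon>"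
    using power_half_series by (subst suminf_mult) (auto simp: sums_iff)
  finally show ?thesis by (simp add: add.commute)
qed

lemma piece_A_bound:
  assumes r: "0 < r" and g: "g \<in> Linf_c M" "\<And>y. y \<notin> ball x r \<Longrightarrow> g y = 0" and \<kappa>: "0 < \<kappa>"
    and avg: "avg_norm M (ereal p\<^sub>0) (ball x r) (ball x r) g \<le> ennreal \<kappa>" and j: "1 \<le> j"
  shows "annular_bound M q\<^sub>0 (annulus x r j) (emeasure M (ball x (2 ^ (j + 1) * r))) (\<alpha> j * \<kappa>) (A r g)"
proof -
  have Am: "A r g \<in> borel_measurable M" using A_L[OF r g(1)] by (simp add: Lspace_def)
  have R: "0 < 2 ^ (j + 1) * r" using r by simp
  have "avg_norm M q\<^sub>0 (ball x (2 ^ (j + 1) * r)) (annulus x r j) (A r g) \<le> ennreal (\<alpha> j) * ennreal \<kappa>"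
    by (rule order_trans[OF A_avg[OF r g j]]) (auto intro: mult_left_mono avg)
  then have le: "avg_norm M q\<^sub>0 (ball x (2 ^ (j + 1) * r)) (annulus x r j) (A r g) \<le> ennreal (\<alpha> j * \<kappa>)"
    using \<kappa> \<alpha>_pos[of j] by (simp add: ennreal_mult)
  show ?thesis
    unfolding annular_bound_def
  proof (intro conjI allI impI)
    assume "q\<^sub>0 = \<infinity>"
    then show "AE y in M. y \<in> annulus x r j \<longrightarrow> norm (A r g y) \<le> \<alpha> j * \<kappa>"
      using le \<kappa> \<alpha>_pos[of j] Am by (intro avg_norm_infinity_le_D) auto
  next
    fix q assume q: "q\<^sub>0 = ereal q"
    have "0 < q" using q q0_pos by simp
    then show "(\<integral>\<^sup>+y\<in>annulus x r j. ennreal (norm (A r g y) powr q) \<partial>M) \<le> ennreal ((\<alpha> j * \<kappa>) powr q) * emeasure M (ball x (2 ^ (j + 1) * r))"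
      using le q \<kappa> \<alpha>_pos[of j] avg_norm_real_le_iff[OF emeasure_ball_eq measure_ball_pos[OF R], of q "\<alpha> j * \<kappa>" x "annulus x r j" "A r g"] by simp
  qed
qed

lemma piece_TA_bound:
  assumes r: "0 < r" and g: "g \<in> Linf_c M" "\<And>y. y \<notin> ball x r \<Longrightarrow> g y = 0" and \<kappa>: "0 < \<kappa>"
    and avg: "avg_norm M (ereal p\<^sub>0) (ball x r) (ball x r) g \<le> ennreal \<kappa>" and j: "2 \<le> j"
  shows "(\<integral>\<^sup>+y\<in>annulus x r j. ennreal (norm (T (\<lambda>y. g y - A r g y) y) powr \<rho>) \<partial>M) \<le>
    ennreal ((\<alpha> j * \<kappa>) powr \<rho>) * emeasure M (ball x (2 ^ (j + 1) * r))"
proof -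
  have R: "0 < 2 ^ (j + 1) * r" using r by simp
  have "avg_norm M (ereal \<rho>) (ball x (2 ^ (j + 1) * r)) (annulus x r j) (T (\<lambda>y. g y - A r g y)) \<le> ennreal (\<alpha> j) * ennreal \<kappa>"
    by (rule order_trans[OF TA_avg[OF r g j]]) (auto intro: mult_left_mono avg)
  then have le: "avg_norm M (ereal \<rho>) (ball x (2 ^ (j + 1) * r)) (annulus x r j) (T (\<lambda>y. g y - A r g y)) \<le> ennreal (\<alpha> j * \<kappa>)"
    using \<kappa> \<alpha>_pos[of j] by (simp add: ennreal_mult)
  then show ?thesis
    using \<rho> \<kappa> \<alpha>_pos[of j] avg_norm_real_le_iff[OF emeasure_ball_eq measure_ball_pos[OF R], of \<rho> "\<alpha> j * \<kappa>" x "annulus x r j" "T (\<lambda>y. g y - A r g y)"] by simp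
qed

end

section \<open>The weak-type estimate for T\<close>

lemma ennreal_mult_le_add_epsilon:
  fixes x :: ennreal
  assumes c: "0 \<le> c" and P: "0 \<le> P" and le: "\<And>e. 0 < e \<Longrightarrow> x \<le> ennreal (c * (P + e))"
  shows "x \<le> ennreal (c * P)"
proof (rule ennreal_le_epsilon)
  fix e :: real assume e: "0 < e"
  have "x \<le> ennreal (c * (P + e / (c + 1)))" using c e by (intro le) simp
  also have "\<dots> \<le> ennreal (c * P + e)"
  proof (rule ennreal_leI)
    have "c * (e / (c + 1)) \<le> e" using c e by (simp add: field_simps)
    then show "c * (P + e / (c + 1)) \<le> c * P + e" by (simp add: distrib_left)
  qed
  also have "\<dots> = ennreal (c * P) + ennreal e" using c P e by (intro ennreal_plus) auto
  finally show "x \<le> ennreal (c * P) + ennreal e" .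
qed

lemma ennreal_suminf_split_head: "(\<Sum>i. F i) = F 0 + (\<Sum>i. F (Suc i))" for F :: "nat \<Rightarrow> ennreal"
  using suminf_offset[of F 1] by (simp add: add.commute)

text \<open>Level estimates are proved for \<open>X > 0\<close> only, and \<open>pmass M p f\<close>
  may vanish; so \<open>X\<close> is the mass plus \<open>e\<close>, and \<open>e\<close> tends to
  0.\<close>

lemma weak_from_level_estimate:
  assumes fin: "pmass M p f < \<infinity>" and p: "0 < p" and c: "0 < c" and K: "0 \<le> K" and t: "0 < t"
    and lev: "\<And>t X. 0 < t \<Longrightarrow> 0 < X \<Longrightarrow> pmass M p f \<le> ennreal X \<Longrightarrow>
      emeasure M {y\<in>space M. c * t < norm (S y)} \<le> ennreal (K * (X / t powr p))"
  shows "emeasure M {y\<in>space M. t < norm (S y)} \<le> ennreal (K * c powr p / t powr p) * pmass M p f"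
proof -
  obtain P where P: "pmass M p f = ennreal P" "0 \<le> P" using fin by (cases "pmass M p f") auto
  have "emeasure M {y\<in>space M. t < norm (S y)} \<le> ennreal (K * c powr p / t powr p * P)"
  proof (rule ennreal_mult_le_add_epsilon)
    fix e :: real assume e: "0 < e"
    have "emeasure M {y\<in>space M. c * (t / c) < norm (S y)} \<le> ennreal (K * ((P + e) / (t / c) powr p))"
      using t c P e by (intro lev) (auto intro!: ennreal_leI)
    then show "emeasure M {y\<in>space M. t < norm (S y)} \<le> ennreal (K * c powr p / t powr p * (P + e))"
      using c t by (simp add: powr_divide mult_ac)
  qed (use K P in auto)
  also have "\<dots> = ennreal (K * c powr p / t powr p) * ennreal P" using P by (intro ennreal_mult'')
  finally show ?thesis using P by simp
qed

lemma pmass_add_le: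
  fixes f g :: "'a \<Rightarrow> 'k::{real_normed_vector, second_countable_topology}"
  assumes [measurable]: "f \<in> borel_measurable M" "g \<in> borel_measurable M" and q: "0 < q"
    and le: "\<And>y. norm (h y) \<le> norm (f y) + norm (g y)"
  shows "pmass M q h \<le> ennreal (2 powr q) * (pmass M q f + pmass M q g)"
proof -
  have "pmass M q h \<le> (\<integral>\<^sup>+y. ennreal (2 powr q) * (ennreal (norm (f y) powr q) + ennreal (norm (g y) powr q)) \<partial>M)"
    unfolding pmass_def
  proof (rule nn_integral_mono)
    fix y
    have "norm (h y) powr q \<le> (norm (f y) + norm (g y)) powr q" using le[of y] q by (intro powr_mono2) auto
    also have "\<dots> \<le> 2 powr q * (norm (f y) powr q + norm (g y) powr q)" using q by (intro powr_add_le) auto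
    finally show "ennreal (norm (h y) powr q) \<le> ennreal (2 powr q) * (ennreal (norm (f y) powr q) + ennreal (norm (g y) powr q))"
      by (simp add: ennreal_mult'[symmetric] ennreal_plus[symmetric] ennreal_leI del: ennreal_plus)
  qed
  also have "\<dots> = ennreal (2 powr q) * (pmass M q f + pmass M q g)"
    unfolding pmass_def by (subst nn_integral_cmult) (measurable, simp add: nn_integral_add)
  finally show ?thesis .
qed

context doubling_measure
begin

text \<open>Lets the estimates with powers of \<open>b\<close> serve for \<open>T\<close> itself,
  with \<open>l = 0\<close>.\<close>

lemma BMO1_zero: "BMO1 (\<lambda>_. 0)"
  by (simp add: BMO1_def mean_def set_lebesgue_integral_def)

end

context cz_operator
begin

lemma Lspace_add:
  fixes f g :: "'a \<Rightarrow> 'k"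
  assumes f: "f \<in> Lspace M q\<^sub>0" and g: "g \<in> Lspace M q\<^sub>0"
  shows "(\<lambda>y. f y + g y) \<in> Lspace M q\<^sub>0"
proof (cases q\<^sub>0)
  case (real q)
  have q: "0 < q" using q0_pos real by simp
  have [measurable]: "f \<in> borel_measurable M" "g \<in> borel_measurable M" using f g by (auto simp: Lspace_def)
  have "pmass M q (\<lambda>y. f y + g y) \<le> ennreal (2 powr q) * (pmass M q f + pmass M q g)"
    by (rule pmass_add_le[of f M g q "\<lambda>y. f y + g y"]) (use q in \<open>auto intro: norm_triangle_ineq\<close>)
  also have "\<dots> < \<infinity>" using f g real q by (auto simp: Lspace_real_iff ennreal_mult_less_top)
  finally show ?thesis using real q by (simp add: Lspace_real_iff)
next
  case PInf
  obtain B where B: "0 \<le> B" "AE x in M. norm (f x) \<le> B" using f PInf by (auto simp: Lspace_inf_iff)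
  obtain B' where B': "0 \<le> B'" "AE x in M. norm (g x) \<le> B'" using g PInf by (auto simp: Lspace_inf_iff)
  have "AE x in M. norm (f x + g x) \<le> B + B'"
    using B(2) B'(2) by eventually_elim (rule norm_triangle_mono)
  then show ?thesis using f g PInf B(1) B'(1) by (auto simp: Lspace_inf_iff intro!: exI[of _ "B + B'"])
qed (use q0_pos in auto)

lemma Lspace_norm: "f \<in> Lspace M q\<^sub>0 \<Longrightarrow> (\<lambda>y. of_real (norm (f y)) :: 'k) \<in> Lspace M q\<^sub>0"
  by (rule Lspace_dominated) (auto simp: Lspace_def)

lemma tower_family_A_sum:
  fixes a :: "nat \<Rightarrow> 'a \<Rightarrow> 'k"
  assumes tf: "tower_family \<beta> C t N J x r w" and t: "0 < t" and C: "0 < C" and N: "0 \<le> N" and \<kappa>: "0 < \<kappa>"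
    and am: "\<And>i. i \<in> J \<Longrightarrow> a i \<in> borel_measurable M"
    and ab: "\<And>i j. i \<in> J \<Longrightarrow> 1 \<le> j \<Longrightarrow> annular_bound M q\<^sub>0 (annulus (x i) (r i) j) (emeasure M (ball (x i) (2 ^ (j + 1) * r i))) (\<alpha> j * (\<kappa> * w i)) (a i)"
  shows "q\<^sub>0 = ereal q \<Longrightarrow> finite F \<Longrightarrow> F \<subseteq> J \<Longrightarrow>
      (\<integral>\<^sup>+y. ennreal ((\<Sum>i\<in>F. norm (a i y)) powr q) \<partial>M) \<le> ennreal (C powr q * \<kappa> powr q * tower_const \<beta> * t powr q * N)"
    and "q\<^sub>0 = \<infinity> \<Longrightarrow> AE y in M. \<forall>F. finite F \<longrightarrow> F \<subseteq> J \<longrightarrow> (\<Sum>i\<in>F. norm (a i y)) \<le> \<kappa> * C * t"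
proof -
  have w: "0 < w i" if "i \<in> J" for i using tf that by (simp add: tower_family_def)
  have \<alpha>\<beta>: "\<alpha> j * (\<kappa> * w i) \<le> \<kappa> * (w i * \<beta> j)" if "i \<in> J" for i j
  proof -
    have "\<alpha> j * (\<kappa> * w i) \<le> \<beta> j * (\<kappa> * w i)" using w[OF that] \<kappa> \<alpha>_le_\<beta> by (intro mult_right_mono) auto
    then show ?thesis by (simp only: mult_ac)
  qed
  have pos: "0 \<le> \<alpha> j * (\<kappa> * w i)" if "i \<in> J" for i j using w[OF that] \<kappa> \<alpha>_pos[of j] by simp
  show "(\<integral>\<^sup>+y. ennreal ((\<Sum>i\<in>F. norm (a i y)) powr q) \<partial>M) \<le> ennreal (C powr q * \<kappa> powr q * tower_const \<beta> * t powr q * N)"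
    if q: "q\<^sub>0 = ereal q" and F: "finite F" "F \<subseteq> J"
  proof -
    have q1: "1 \<le> q" using p0 p0_q0 q by simp
    have "(\<integral>\<^sup>+y\<in>annulus (x i) (r i) j. ennreal (norm (a i y) powr q) \<partial>M)
       \<le> ennreal (\<kappa> powr q * (w i * \<beta> j) powr q) * emeasure M (ball (x i) (2 ^ (j + 1) * r i))"
      if i: "i \<in> F" and j: "1 \<le> j" for i j
    proof -
      have iJ: "i \<in> J" using i F by blast
      have "(\<integral>\<^sup>+y\<in>annulus (x i) (r i) j. ennreal (norm (a i y) powr q) \<partial>M)
        \<le> ennreal ((\<alpha> j * (\<kappa> * w i)) powr q) * emeasure M (ball (x i) (2 ^ (j + 1) * r i))"
        using ab[OF iJ j] q by (simp add: annular_bound_def)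
      also have "\<dots> \<le> ennreal ((\<kappa> * (w i * \<beta> j)) powr q) * emeasure M (ball (x i) (2 ^ (j + 1) * r i))"
        using \<alpha>\<beta>[OF iJ] pos[OF iJ] q1 by (intro mult_right_mono ennreal_leI powr_mono2) auto
      finally show ?thesis by (simp only: powr_mult)
    qed
    then show ?thesis
      using F am by (intro tower_family_sum_power[OF tf \<beta>_pos \<beta>_sum q1 t C N _ F]) auto
  qed
  show "AE y in M. \<forall>F. finite F \<longrightarrow> F \<subseteq> J \<longrightarrow> (\<Sum>i\<in>F. norm (a i y)) \<le> \<kappa> * C * t" if q: "q\<^sub>0 = \<infinity>"
  proof -
    have "AE y in M. i \<in> J \<longrightarrow> 1 \<le> j \<longrightarrow> y \<in> annulus (x i) (r i) j \<longrightarrow> norm (a i y) \<le> \<alpha> j * (\<kappa> * w i)" for i j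
      using ab[of i j] q by (cases "i \<in> J \<and> 1 \<le> j") (auto simp: annular_bound_def)
    then have "AE y in M. \<forall>i j. i \<in> J \<longrightarrow> 1 \<le> j \<longrightarrow> y \<in> annulus (x i) (r i) j \<longrightarrow> norm (a i y) \<le> \<alpha> j * (\<kappa> * w i)"
      by (simp add: AE_all_countable)
    then show ?thesis
    proof eventually_elim
      case (elim y)
      show ?case
      proof (intro allI impI)
        fix F assume F: "finite F" "F \<subseteq> J"
        have Ct: "0 < C * t" using C t by simp
        have "(\<Sum>i\<in>F. norm (a i y)) \<le> \<kappa> * (C * t)"
        proof (rule sum_bound_towers[where \<beta>=\<beta> and x=x and r=r and w=w and u="\<lambda>i y. norm (a i y)" and y=y])
          show "norm (a i y) \<le> \<kappa> * (w i * \<beta> j)" if "i \<in> F" "1 \<le> j" "y \<in> annulus (x i) (r i) j" for i j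
            using elim[rule_format, of i j] \<alpha>\<beta>[of i j] that F by (meson order_trans subsetD)
          show "0 < r i" if "i \<in> F" for i using tf that F by (auto simp: tower_family_def)
          show "(\<Sum>i\<in>F. ennreal (w i) * tower \<beta> (x i) (r i) y) \<le> ennreal (C * t)" using tf F by (simp add: tower_family_def)
        qed (use \<beta>_pos F w \<kappa> Ct in auto)
        then show "(\<Sum>i\<in>F. norm (a i y)) \<le> \<kappa> * C * t" by (simp add: mult.assoc)
      qed
    qed
  qed
qed

text \<open>\<open>T_countable_sum\<close> wants absolute convergence at every point, while the
  series of A-parts converges only almost everywhere; the terms are therefore cut off to the set
  \<open>Gd\<close> of convergence. The bounds pass from finite sums to the series because they do
  not depend on the finite set.\<close>

lemma A_series:
  fixes a :: "nat \<Rightarrow> 'a \<Rightarrow> 'k"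
  assumes tf: "tower_family \<beta> C t N J x r w" and t: "0 < t" and C: "0 < C" and N: "0 \<le> N" and \<kappa>: "0 < \<kappa>"
    and am: "\<And>i. a i \<in> borel_measurable M" and a0: "\<And>i. i \<notin> J \<Longrightarrow> a i = (\<lambda>_. 0)"
    and ab: "\<And>i j. i \<in> J \<Longrightarrow> 1 \<le> j \<Longrightarrow> annular_bound M q\<^sub>0 (annulus (x i) (r i) j) (emeasure M (ball (x i) (2 ^ (j + 1) * r i))) (\<alpha> j * (\<kappa> * w i)) (a i)"
  obtains Gd where "Gd \<in> sets M" "AE y in M. y \<in> Gd" "\<And>y. summable (\<lambda>i. norm (restr Gd (a i) y))"
    "\<And>q. q\<^sub>0 = ereal q \<Longrightarrow> pmass M q (\<lambda>y. \<Sum>i. norm (restr Gd (a i) y)) \<le> ennreal (C powr q * \<kappa> powr q * tower_const \<beta> * t powr q * N)"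
    "q\<^sub>0 = \<infinity> \<Longrightarrow> AE y in M. (\<Sum>i. norm (restr Gd (a i) y)) \<le> \<kappa> * C * t"
proof -
  note am[measurable]
  define Gd where "Gd = {y. (\<Sum>i. ennreal (norm (a i y))) < \<infinity>}"
  have "{y\<in>space M. (\<Sum>i. ennreal (norm (a i y))) < \<infinity>} \<in> sets M" by measurable
  then have Gm: "Gd \<in> sets M" by (simp add: Gd_def)
  have GS: "y \<in> Gd \<longleftrightarrow> summable (\<lambda>i. norm (a i y))" for y
  proof
    assume "y \<in> Gd"
    then show "summable (\<lambda>i. norm (a i y))" by (intro summable_suminf_not_top) (auto simp: Gd_def less_top)
  next
    assume "summable (\<lambda>i. norm (a i y))"
    then have "(\<Sum>i. ennreal (norm (a i y))) = ennreal (\<Sum>i. norm (a i y))" by (intro suminf_ennreal2) auto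
    then show "y \<in> Gd" by (simp add: Gd_def)
  qed
  have sm: "summable (\<lambda>i. norm (restr Gd (a i) y))" for y
    using GS[of y] by (cases "y \<in> Gd") (auto simp: restr_def)
  have part: "(\<Sum>i<n. norm (a i y)) = (\<Sum>i\<in>{..<n} \<inter> J. norm (a i y))" for n y
    by (rule sum.mono_neutral_cong_right) (use a0 in auto)
  have sums: "q\<^sub>0 = ereal q \<Longrightarrow> finite F \<Longrightarrow> F \<subseteq> J \<Longrightarrow>
      (\<integral>\<^sup>+y. ennreal ((\<Sum>i\<in>F. norm (a i y)) powr q) \<partial>M) \<le> ennreal (C powr q * \<kappa> powr q * tower_const \<beta> * t powr q * N)"
    "q\<^sub>0 = \<infinity> \<Longrightarrow> AE y in M. \<forall>F. finite F \<longrightarrow> F \<subseteq> J \<longrightarrow> (\<Sum>i\<in>F. norm (a i y)) \<le> \<kappa> * C * t" for q F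
    using tower_family_A_sum[OF tf t C N \<kappa>, of a] am ab by blast+
  have fin: "pmass M q (\<lambda>y. \<Sum>i. norm (restr Gd (a i) y)) \<le> ennreal (C powr q * \<kappa> powr q * tower_const \<beta> * t powr q * N) \<and> (AE y in M. y \<in> Gd)"
    if q: "q\<^sub>0 = ereal q" for q
  proof -
    have q0: "0 < q" using q q0_pos by simp
    let ?B = "ennreal (C powr q * \<kappa> powr q * tower_const \<beta> * t powr q * N)"
    let ?S = "\<lambda>y. SUP n. ennreal ((\<Sum>i<n. norm (a i y)) powr q)"
    have "(\<integral>\<^sup>+y. ?S y \<partial>M) = (SUP n. \<integral>\<^sup>+y. ennreal ((\<Sum>i<n. norm (a i y)) powr q) \<partial>M)"
    proof (rule nn_integral_monotone_convergence_SUP)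
      show "incseq (\<lambda>n y. ennreal ((\<Sum>i<n. norm (a i y)) powr q))"
        using q0 by (intro incseq_SucI le_funI ennreal_leI powr_mono2) (auto intro: sum_nonneg)
    qed measurable
    also have "\<dots> \<le> ?B"
      by (rule SUP_least) (simp only: part, rule sums(1)[OF q], auto)
    finally have S: "(\<integral>\<^sup>+y. ?S y \<partial>M) \<le> ?B" .
    then have "AE y in M. ?S y \<noteq> \<infinity>"
      by (intro nn_integral_noteq_infinite) (auto simp: top_unique)
    then have G: "AE y in M. y \<in> Gd"
    proof eventually_elim
      case (elim y)
      then obtain Bd where Bd: "?S y = ennreal Bd" "0 \<le> Bd" by (cases "?S y") auto
      have "(\<Sum>i<n. norm (a i y)) \<le> Bd powr (1 / q)" for n
      proof -
        have "ennreal ((\<Sum>i<n. norm (a i y)) powr q) \<le> ennreal Bd" unfolding Bd(1)[symmetric] by (rule SUP_upper) simp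
        then have "(\<Sum>i<n. norm (a i y)) powr q \<le> Bd" using Bd(2) by (simp add: ennreal_le_iff)
        then have "((\<Sum>i<n. norm (a i y)) powr q) powr (1 / q) \<le> Bd powr (1 / q)" using q0 by (intro powr_mono2) auto
        then show ?thesis using q0 by (simp add: powr_powr sum_nonneg)
      qed
      then have "summable (\<lambda>i. norm (a i y))" by (intro summableI_nonneg_bounded) auto
      then show ?case by (simp add: GS)
    qed
    have "pmass M q (\<lambda>y. \<Sum>i. norm (restr Gd (a i) y)) \<le> (\<integral>\<^sup>+y. ?S y \<partial>M)"
      unfolding pmass_def
    proof (rule nn_integral_mono)
      fix y
      show "ennreal (norm (\<Sum>i. norm (restr Gd (a i) y)) powr q) \<le> ?S y"
      proof (cases "y \<in> Gd")
        case True
        then have e: "norm (restr Gd (a i) y) = norm (a i y)" for i by (simp add: restr_def)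
        have s: "summable (\<lambda>i. norm (a i y))" using True GS by blast
        have "(\<lambda>n. ennreal ((\<Sum>i<n. norm (a i y)) powr q)) \<longlonglongrightarrow> ennreal ((\<Sum>i. norm (a i y)) powr q)"
        proof (intro tendsto_ennrealI tendsto_powr')
          show "(\<lambda>n. \<Sum>i<n. norm (a i y)) \<longlonglongrightarrow> (\<Sum>i. norm (a i y))" using s by (rule summable_LIMSEQ)
        qed (use q0 in \<open>auto intro!: sum_nonneg always_eventually\<close>)
        then have "ennreal ((\<Sum>i. norm (a i y)) powr q) \<le> ?S y"
          by (rule LIMSEQ_le_const2) (intro exI allI impI SUP_upper UNIV_I)
        then show ?thesis unfolding e using s by (simp add: suminf_nonneg)
      qed (simp add: restr_def)
    qed
    then show ?thesis using S G by (auto intro: order_trans)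
  qed
  have inf: "AE y in M. y \<in> Gd \<and> (\<Sum>i. norm (restr Gd (a i) y)) \<le> \<kappa> * C * t" if q: "q\<^sub>0 = \<infinity>"
    using sums(2)[OF q]
  proof eventually_elim
    case (elim y)
    have b: "(\<Sum>i<n. norm (a i y)) \<le> \<kappa> * C * t" for n
      unfolding part using elim by auto
    then have s: "summable (\<lambda>i. norm (a i y))" by (intro summableI_nonneg_bounded) auto
    then have "y \<in> Gd" by (simp add: GS)
    moreover have "(\<Sum>i. norm (a i y)) \<le> \<kappa> * C * t" using s b by (rule suminf_le_const)
    ultimately show ?case by (simp add: restr_def)
  qed
  show ?thesis
  proof (rule that[OF Gm _ sm])
    show "AE y in M. y \<in> Gd"
    proof (cases q\<^sub>0)
      case PInf
      then show ?thesis using inf by (auto elim: eventually_mono)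
    qed (use fin q0_pos in auto)
    show "pmass M q (\<lambda>y. \<Sum>i. norm (restr Gd (a i) y)) \<le> ennreal (C powr q * \<kappa> powr q * tower_const \<beta> * t powr q * N)" if "q\<^sub>0 = ereal q" for q
      using fin[OF that] by blast
    show "AE y in M. (\<Sum>i. norm (restr Gd (a i) y)) \<le> \<kappa> * C * t" if "q\<^sub>0 = \<infinity>"
      using inf[OF that] by (auto elim: eventually_mono)
  qed
qed

text \<open>The case of order 0. \<open>f\<close> is the sum of \<open>G0\<close>, made of the
  bounded part and all A-parts, and of the differences \<open>h i - a i\<close>. \<open>G0\<close>
  falls under the weak type \<open>(q\<^sub>0, q\<^sub>0)\<close>, the differences are small off
  \<open>4 B\<close>, and all pieces are handled at once by \<open>T_countable_sum\<close>.\<close>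

lemma T_weak_level:
  assumes p: "p\<^sub>0 < p" "ereal p < q\<^sub>0"
  shows "\<exists>c>0. \<exists>K\<ge>0. \<forall>f\<in>Linf_c M. \<forall>t>0. \<forall>X>0. pmass M p f \<le> ennreal X \<longrightarrow>
    emeasure M {y\<in>space M. c * t < norm (T f y)} \<le> ennreal (K * (X / t powr p))"
proof -
  have pp: "0 < p" using p p0 by simp
  obtain C where C: "1 \<le> C" and dec: "\<And>(f::'a \<Rightarrow> 'k) t X. f \<in> Linf_c M \<Longrightarrow> 0 < t \<Longrightarrow> 0 < X \<Longrightarrow> pmass M p f \<le> ennreal X \<Longrightarrow>
      \<exists>J P x r w. cz_cover p \<beta> C f t X J P x r w"
    by (rule cz_decomposition[OF pp \<beta>_nonneg \<beta>_sum, where 'k='k]) blast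
  have C0: "0 \<le> C" "0 < C" using C by auto
  obtain Cl where Cl: "1 \<le> Cl" "\<And>(b::'a \<Rightarrow> 'k) l x r w h. BMO1 b \<Longrightarrow> l \<le> 0 \<Longrightarrow> 0 < r \<Longrightarrow> 0 < w \<Longrightarrow> h \<in> borel_measurable M \<Longrightarrow>
    (\<integral>\<^sup>+y\<in>ball x r. ennreal (norm (h y) powr p) \<partial>M) \<le> ennreal (C * w powr p) * emeasure M (ball x r) \<Longrightarrow>
    avg_norm M (ereal p\<^sub>0) (ball x r) (ball x r) (\<lambda>y. (mean M (ball x r) b - b y) ^ l * h y) \<le> ennreal (Cl * w)"
    using local_average[OF p0 p(1) C0(1), where 'k='k and k=0] by blast
  obtain Co where Co: "1 \<le> Co" "\<And>(b::'a \<Rightarrow> 'k) l x r \<kappa> \<gamma> (u::'a \<Rightarrow> real).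
    BMO1 b \<Longrightarrow> l \<le> k \<Longrightarrow> 0 < r \<Longrightarrow> 0 < \<kappa> \<Longrightarrow> (\<forall>j. 0 < \<gamma> j) \<Longrightarrow> summable (\<lambda>j. \<gamma> j * (1 + real j) ^ k * 2 powr (D * real j)) \<Longrightarrow>
    u \<in> borel_measurable M \<Longrightarrow> (\<forall>y. 0 \<le> u y) \<Longrightarrow>
    (\<forall>j::nat. 2 \<le> j \<longrightarrow> (\<integral>\<^sup>+y\<in>annulus x r j. ennreal (u y powr \<rho>) \<partial>M) \<le> ennreal ((\<gamma> j * \<kappa>) powr \<rho>) * emeasure M (ball x (2 ^ (j + 1) * r))) \<Longrightarrow>
    (\<integral>\<^sup>+y\<in>- ball x (4 * r). ennreal (norm (b y - mean M (ball x r) b) ^ l * u y) \<partial>M) \<le>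
      ennreal (Co * \<kappa> * tower_const (\<lambda>j. \<gamma> j * (1 + real j) ^ k)) * emeasure M (ball x r)"
    using off_diagonal_product[OF \<rho>, where 'k='k and k=k] by blast
  define tw where "tw = tower_const \<beta>"
  have tw: "0 \<le> tw" unfolding tw_def by (rule tower_const_nonneg[OF \<beta>_nonneg \<beta>_sum])
  have tw\<beta>: "tower_const (\<lambda>j. \<alpha> j * (1 + real j) ^ k) = tw" unfolding tw_def \<beta>_def ..
  define Q where "Q = real_of_ereal q\<^sub>0"
  \<comment> \<open>The first summand bounds \<open>G0\<close> for infinite
    \<open>q\<^sub>0\<close>, the second for finite \<open>q\<^sub>0\<close>, with
    \<open>2 powr Q\<close> from \<open>pmass_add_le\<close>. For infinite \<open>q\<^sub>0\<close>
    the default \<open>Q = 0\<close> leaves a harmless nonnegative term.\<close>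
  define c1 where "c1 = (1 + Cl * C) + 2 powr Q * (1 + C powr Q * Cl powr Q * tw)"
  have c1: "1 \<le> c1" using Cl(1) C tw by (auto simp: c1_def intro!: add_increasing2)
  define c2 where "c2 = Co * Cl * tw"
  have c2: "0 \<le> c2" using Co(1) Cl(1) tw by (simp add: c2_def)
  define K where "K = KT * c1 + (Cd * 4 powr D + c2) * C"
  have K: "0 \<le> K" using KT c1 c2 C Cd_ge_1 by (auto simp: K_def intro!: add_nonneg_nonneg mult_nonneg_nonneg)
  show ?thesis
  proof (rule exI[of _ "(KT + 1) * c1 + 1"], intro exI[of _ K] conjI K ballI allI impI)
    show "0 < (KT + 1) * c1 + 1" using KT c1 by (simp add: add_nonneg_pos)
    fix f :: "'a \<Rightarrow> 'k" and t X :: real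
    assume f: "f \<in> Linf_c M" and t: "0 < t" and X: "0 < X" and fX: "pmass M p f \<le> ennreal X"
    define N where "N = X / t powr p"
    have N: "0 \<le> N" using X t by (simp add: N_def)
    have fm[measurable]: "f \<in> borel_measurable M" by (rule Linf_c_measurable[OF f])
    obtain J P x r w where cov: "cz_cover p \<beta> C f t X J P x r w" using dec[OF f t X fX] by (elim exE) (rule that)
    note cv = cov[unfolded cz_cover_def]
    have Pd: "disjoint_family P" using cv by simp
    have PJ: "P i = {}" if "i \<notin> J" for i using cv that by simp
    have Pm: "P i \<in> sets M" for i using cv by simp
    have pc: "0 < r i \<and> P i \<subseteq> ball (x i) (r i) \<and> 0 < w i \<and> w i \<le> t \<and>
          (\<integral>\<^sup>+y\<in>P i. ennreal (norm (f y) powr p) \<partial>M) \<le> ennreal (C * w i powr p) * emeasure M (ball (x i) (r i))" if "i \<in> J" for i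
      using cv that by simp
    have s1: "(\<Sum>i\<in>F. emeasure M (ball (x i) (r i))) \<le> ennreal (C * X / t powr p)" if "finite F" "F \<subseteq> J" for F
      using cv that by simp
    have s2: "(\<Sum>i\<in>F. ennreal (w i) * tower \<beta> (x i) (r i) y) \<le> ennreal (C * t)" if "finite F" "F \<subseteq> J" for F y
      using cv that by simp
    have fZ: "AE y in M. y \<notin> (\<Union>i. P i) \<longrightarrow> norm (f y) \<le> t" using cv by simp
    note Pm[measurable]
    have tf: "tower_family \<beta> C t N J x r w"
      unfolding tower_family_def N_def using pc s1 s2 by (simp add: times_divide_eq_right)
    define h where "h i = restr (P i) f" for i
    have hL: "h i \<in> Linf_c M" for i unfolding h_def by (intro Linf_c_restr f Pm)
    have hm[measurable]: "h i \<in> borel_measurable M" for i by (rule Linf_c_measurable[OF hL])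
    have h0: "h i y = 0" if "i \<in> J" "y \<notin> ball (x i) (r i)" for i y using pc[OF that(1)] that(2) by (auto simp: h_def restr_def)
    have havg: "avg_norm M (ereal p\<^sub>0) (ball (x i) (r i)) (ball (x i) (r i)) (h i) \<le> ennreal (Cl * w i)" if i: "i \<in> J" for i
    proof -
      have "(\<integral>\<^sup>+y\<in>ball (x i) (r i). ennreal (norm (h i y) powr p) \<partial>M) = (\<integral>\<^sup>+y\<in>P i. ennreal (norm (f y) powr p) \<partial>M)"
        using pc[OF i] pp by (intro nn_integral_cong) (auto simp: h_def restr_def split: split_indicator)
      then show ?thesis using Cl(2)[OF BMO1_zero, of 0 "r i" "w i" "h i" "x i"] pc[OF i] by simp
    qed
    have \<kappa>: "0 < Cl * w i" if "i \<in> J" for i using Cl(1) pc[OF that] by simp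
    define a where "a i = (if i \<in> J then A (r i) (h i) else (\<lambda>_. 0))" for i
    have aL: "a i \<in> Lspace M q\<^sub>0" for i
      using A_L[OF _ hL] pc Linf_c_Lspace[of "\<lambda>_. 0"] Linf_c_restr[OF f, of "{}"] by (auto simp: a_def restr_def[abs_def])
    have am[measurable]: "a i \<in> borel_measurable M" for i using aL by (simp add: Lspace_def)
    have ab: "annular_bound M q\<^sub>0 (annulus (x i) (r i) j) (emeasure M (ball (x i) (2 ^ (j + 1) * r i))) (\<alpha> j * (Cl * w i)) (a i)"
      if i: "i \<in> J" and j: "1 \<le> j" for i j
      using piece_A_bound[OF _ hL h0[OF i] \<kappa>[OF i] havg[OF i] j] pc[OF i] i by (simp add: a_def)
    have a0: "a i = (\<lambda>_. 0)" if "i \<notin> J" for i using that by (simp add: a_def)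
    have Cl0: "0 < Cl" using Cl(1) by simp
    obtain Gd where Gd[measurable]: "Gd \<in> sets M" and GdAE: "AE y in M. y \<in> Gd" and sma: "\<And>y. summable (\<lambda>i. norm (restr Gd (a i) y))"
      and sq: "\<And>q. q\<^sub>0 = ereal q \<Longrightarrow> pmass M q (\<lambda>y. \<Sum>i. norm (restr Gd (a i) y)) \<le> ennreal (C powr q * Cl powr q * tower_const \<beta> * t powr q * N)"
      and si: "q\<^sub>0 = \<infinity> \<Longrightarrow> AE y in M. (\<Sum>i. norm (restr Gd (a i) y)) \<le> Cl * C * t"
      by (rule A_series[OF tf t C0(2) N Cl0 am a0 ab]) (assumption | rule that)+
    let ?a = "\<lambda>i. restr Gd (a i)" and ?\<sigma> = "\<lambda>y. \<Sum>i. norm (restr Gd (a i) y)"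
    have a2m[measurable]: "?a i \<in> borel_measurable M" for i by measurable
    have \<sigma>0: "0 \<le> ?\<sigma> y" for y by (rule suminf_nonneg[OF sma]) simp
    have \<sigma>m[measurable]: "?\<sigma> \<in> borel_measurable M" by measurable
    let ?\<sigma>k = "\<lambda>y. of_real (?\<sigma> y) :: 'k"
    have \<sigma>L: "?\<sigma>k \<in> Lspace M q\<^sub>0"
    proof (cases q\<^sub>0)
      case (real q)
      have "0 < q" using real q0_pos by simp
      moreover have "pmass M q ?\<sigma>k = pmass M q ?\<sigma>" by (simp add: pmass_def)
      moreover have "\<dots> < \<infinity>" using sq[OF real] by (rule le_less_trans) simp
      ultimately show ?thesis using real by (simp add: Lspace_real_iff)
    next
      case PInf
      have "AE y in M. norm (?\<sigma>k y) \<le> Cl * C * t" using si[OF PInf] by eventually_elim (simp add: \<sigma>0)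
      then show ?thesis using PInf C0 Cl0 t by (auto simp: Lspace_inf_iff intro!: exI[of _ "Cl * C * t"])
    qed (use q0_pos in auto)
    define Z where "Z = - (\<Union>i. P i)"
    have Zm[measurable]: "Z \<in> sets M"
    proof -
      have "(\<Union>i. P i) \<in> sets M" using Pm by blast
      from sets.compl_sets[OF this] show ?thesis by (simp add: Z_def Compl_eq_Diff_UNIV)
    qed
    define G0 where "G0 y = restr Z f y + (\<Sum>i. ?a i y)" for y
    have sma2: "summable (\<lambda>i. ?a i y)" for y using sma[of y] by (rule summable_norm_cancel)
    have G0m[measurable]: "G0 \<in> borel_measurable M" unfolding G0_def[abs_def] by measurable
    have G0le: "norm (G0 y) \<le> norm (restr Z f y) + ?\<sigma> y" for y
      unfolding G0_def using norm_triangle_ineq[of "restr Z f y" "\<Sum>i. ?a i y"] summable_norm[OF sma[of y]] by linarith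
    have ZL: "restr Z f \<in> Linf_c M" by (intro Linf_c_restr f Zm)
    have ZAE: "AE y in M. norm (restr Z f y) \<le> t"
      using fZ by eventually_elim (use t in \<open>auto simp: restr_def Z_def\<close>)
    have G0L: "G0 \<in> Lspace M q\<^sub>0"
    proof (rule Lspace_dominated[OF Lspace_add[OF Lspace_norm[OF Linf_c_Lspace[OF ZL]] \<sigma>L] G0m], rule AE_I2)
      fix y
      have "norm (of_real (norm (restr Z f y)) + ?\<sigma>k y) = norm (restr Z f y) + ?\<sigma> y"
        unfolding of_real_add[symmetric] norm_of_real using \<sigma>0[of y] by simp
      then show "norm (G0 y) \<le> norm (of_real (norm (restr Z f y)) + ?\<sigma>k y)" using G0le[of y] by simp
    qed
    have TG0: "emeasure M {y\<in>space M. (KT + 1) * c1 * t < norm (T G0 y)} \<le> ennreal (KT * c1 * N)"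
    proof (rule weak_bound_apply[OF T_weak_q0 G0L _ q0_pos t N c1 KT])
      show "(\<lambda>y. norm (T G0 y)) \<in> borel_measurable M" by (intro T_meas Lspace_D G0L)
      fix q assume q: "q\<^sub>0 = ereal q"
      have Qq: "Q = q" using q by (simp add: Q_def)
      have q': "0 < q" "p < q" using q q0_pos p by auto
      have Zq: "pmass M q (restr Z f) \<le> ennreal (t powr q * N)"
      proof -
        have "pmass M q (restr Z f) \<le> (\<integral>\<^sup>+y. ennreal (t powr (q - p)) * ennreal (norm (f y) powr p) \<partial>M)"
          unfolding pmass_def using ZAE
        proof (intro nn_integral_mono_AE, eventually_elim)
          case (elim y)
          let ?n = "norm (restr Z f y)"
          have "?n powr q = ?n powr (q - p) * ?n powr p" by (simp add: powr_add[symmetric])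
          also have "\<dots> \<le> t powr (q - p) * norm (f y) powr p"
            using elim q' pp norm_restr_le[of Z f y] by (intro mult_mono powr_mono2) auto
          finally show ?case by (simp add: ennreal_mult'[symmetric] ennreal_leI)
        qed
        also have "\<dots> = ennreal (t powr (q - p)) * pmass M p f" unfolding pmass_def by (rule nn_integral_cmult) measurable
        also have "\<dots> \<le> ennreal (t powr (q - p)) * ennreal X" by (intro mult_left_mono fX) simp
        also have "\<dots> = ennreal (t powr q * N)"
          using t by (simp add: ennreal_mult'[symmetric] N_def powr_diff)
        finally show ?thesis .
      qed
      have "pmass M q G0 \<le> ennreal (2 powr q) * (pmass M q (restr Z f) + pmass M q ?\<sigma>k)"
        by (rule pmass_add_le[of "restr Z f" M ?\<sigma>k q G0]) (use G0le \<sigma>0 q' in auto)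
      also have "pmass M q ?\<sigma>k = pmass M q ?\<sigma>" by (simp add: pmass_def)
      also have "ennreal (2 powr q) * (pmass M q (restr Z f) + pmass M q ?\<sigma>) \<le>
        ennreal (2 powr q) * (ennreal (t powr q * N) + ennreal (C powr q * Cl powr q * tower_const \<beta> * t powr q * N))"
        by (intro mult_left_mono add_mono Zq sq q) auto
      also have "\<dots> = ennreal (2 powr q * (1 + C powr q * Cl powr q * tw) * t powr q * N)"
        unfolding tw_def[symmetric] using N tw
        by (subst ennreal_plus[symmetric]) (auto simp: ennreal_mult'[symmetric] algebra_simps)
      also have "\<dots> \<le> ennreal (c1 * t powr q * N)"
        using N Cl(1) C unfolding c1_def Qq by (intro ennreal_leI mult_right_mono) auto
      finally show "pmass M q G0 \<le> ennreal (c1 * t powr q * N)" .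
    next
      assume q: "q\<^sub>0 = \<infinity>"
      show "AE y in M. norm (G0 y) \<le> c1 * t"
        using ZAE si[OF q]
      proof eventually_elim
        case (elim y)
        have "norm (G0 y) \<le> t + Cl * C * t" using G0le[of y] elim by linarith
        also have "\<dots> \<le> c1 * t" using t tw by (simp add: c1_def algebra_simps)
        finally show ?case .
      qed
    qed
    \<comment> \<open>\<open>G0\<close> and the differences are merged into one series, the form in
      which countable sublinearity is available.\<close>
    define g where "g i = (case i of 0 \<Rightarrow> G0 | Suc i \<Rightarrow> (\<lambda>y. h i y - ?a i y))" for i
    have a2L: "?a i \<in> Lspace M q\<^sub>0" for i by (intro Lspace_restr aL Gd)
    have gL: "g i \<in> Lspace M q\<^sub>0" for i
    proof (cases i)
      case (Suc j)
      have "(\<lambda>y. h j y + (- ?a j y)) \<in> Lspace M q\<^sub>0"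
        by (intro Lspace_add Linf_c_Lspace hL Lspace_dominated[OF a2L[of j]]) auto
      then show ?thesis by (simp add: g_def Suc)
    qed (simp add: g_def G0L)
    have hs: "(\<lambda>i. h i y) sums restr (\<Union>i. P i) f y" "(\<lambda>i. norm (h i y)) sums norm (restr (\<Union>i. P i) f y)" for y
      unfolding h_def by (rule restr_sums[OF Pd])+
    have smg1: "summable (\<lambda>i. norm (h i y - ?a i y))" for y
      by (rule summable_comparison_test[OF _ summable_add[OF sums_summable[OF hs(2)[of y]] sma[of y]]])
        (auto intro!: exI[of _ 0] norm_triangle_ineq4)
    have smg: "summable (\<lambda>i. norm (g i y))" for y
      by (subst summable_Suc_iff[symmetric]) (simp add: g_def smg1)
    have gsum: "(\<Sum>i. g i y) = f y" for y
    proof -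
      have "(\<Sum>i. g i y) = (\<Sum>i. g (Suc i) y) + g 0 y"
        using suminf_split_head[OF summable_norm_cancel[OF smg[of y]]] by (simp add: algebra_simps)
      also have "(\<Sum>i. g (Suc i) y) = (\<Sum>i. h i y) - (\<Sum>i. ?a i y)"
        unfolding g_def by (simp add: suminf_diff[OF sums_summable[OF hs(1)[of y]] sma2])
      also have "(\<Sum>i. h i y) = restr (\<Union>i. P i) f y" using hs(1)[of y] by (simp add: sums_iff)
      finally show ?thesis by (simp add: g_def G0_def restr_def Z_def)
    qed
    have SL: "(\<lambda>y. of_real (\<Sum>i. norm (g i y)) :: 'k) \<in> Lspace M q\<^sub>0"
    proof (rule Lspace_dominated[OF Lspace_add[OF Lspace_add[OF Lspace_norm[OF G0L] Lspace_norm[OF Linf_c_Lspace[OF f]]] \<sigma>L]])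
      have [measurable]: "g i \<in> borel_measurable M" for i using gL by (simp add: Lspace_def)
      show "(\<lambda>y. of_real (\<Sum>i. norm (g i y)) :: 'k) \<in> borel_measurable M" by measurable
      show "AE y in M. norm (of_real (\<Sum>i. norm (g i y)) :: 'k) \<le> norm (of_real (norm (G0 y)) + of_real (norm (f y)) + ?\<sigma>k y)"
      proof (rule AE_I2)
        fix y
        have "(\<Sum>i. norm (g i y)) = (\<Sum>i. norm (h i y - ?a i y)) + norm (G0 y)"
          using suminf_split_head[OF smg[of y]] by (simp add: g_def)
        also have "(\<Sum>i. norm (h i y - ?a i y)) \<le> (\<Sum>i. norm (h i y) + norm (?a i y))"
          by (intro suminf_le smg1 summable_add sma sums_summable[OF hs(2)] norm_triangle_ineq4)
        also have "(\<Sum>i. norm (h i y) + norm (?a i y)) = norm (restr (\<Union>i. P i) f y) + ?\<sigma> y"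
          using hs(2)[of y] by (subst suminf_add[symmetric]) (auto simp: sums_iff sma)
        finally have "(\<Sum>i. norm (g i y)) \<le> norm (G0 y) + norm (f y) + ?\<sigma> y"
          using norm_restr_le[of "\<Union>i. P i" f y] by linarith
        moreover have "0 \<le> (\<Sum>i. norm (g i y))" by (rule suminf_nonneg[OF smg]) simp
        moreover have "norm (of_real (norm (G0 y)) + of_real (norm (f y)) + ?\<sigma>k y) = norm (G0 y) + norm (f y) + ?\<sigma> y"
          unfolding of_real_add[symmetric] norm_of_real using \<sigma>0[of y] by simp
        ultimately show "norm (of_real (\<Sum>i. norm (g i y)) :: 'k) \<le> norm (of_real (norm (G0 y)) + of_real (norm (f y)) + ?\<sigma>k y)"
          by (simp add: norm_of_real)
      qed
    qed
    have main: "AE y in M. ennreal (norm (T f y)) \<le> (\<Sum>i. ennreal (norm (T (g i) y)))"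
      using T_countable_sum[OF gL smg SL] by (simp add: gsum)
    define \<phi> where "\<phi> i y = ennreal (norm (T (\<lambda>y. h i y - A (r i) (h i) y) y))" for i y
    have hAD: "(\<lambda>y. h i y - A (r i) (h i) y) \<in> \<D>" if "i \<in> J" for i
      using pc[OF that] by (intro D_diff Linf_c_D hL Lspace_D A_L) auto
    have \<phi>m: "\<phi> i \<in> borel_measurable M" if "i \<in> J" for i
      unfolding \<phi>_def[abs_def] using T_meas[OF hAD[OF that]] by measurable
    have off: "(\<integral>\<^sup>+y\<in>- ball (x i) (4 * r i). \<phi> i y \<partial>M) \<le> ennreal (c2 * w i) * emeasure M (ball (x i) (r i))" if i: "i \<in> J" for i
    proof -
      have "(\<integral>\<^sup>+y\<in>- ball (x i) (4 * r i). ennreal (norm ((\<lambda>_. 0::'k) y - mean M (ball (x i) (r i)) (\<lambda>_. 0::'k)) ^ 0 * norm (T (\<lambda>y. h i y - A (r i) (h i) y) y)) \<partial>M) \<le>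
        ennreal (Co * (Cl * w i) * tower_const (\<lambda>j. \<alpha> j * (1 + real j) ^ k)) * emeasure M (ball (x i) (r i))"
        using piece_TA_bound[OF _ hL h0[OF i] \<kappa>[OF i] havg[OF i]] pc[OF i] \<alpha>_pos \<alpha>_sum \<kappa>[OF i]
        by (intro Co(2)[OF BMO1_zero] T_meas hAD i) auto
      then show ?thesis unfolding tw\<beta> by (simp add: \<phi>_def c2_def mult_ac)
    qed
    obtain E where E[measurable]: "E \<in> sets M" "emeasure M E \<le> ennreal ((Cd * 4 powr D + c2) * C * N)"
      "\<And>y. y \<notin> E \<Longrightarrow> (\<Sum>i. if i \<in> J then \<phi> i y else 0) \<le> ennreal t"
      using off_diagonal_exceptional_set[OF tf t C0(1) N c2 \<phi>m off] by blast
    \<comment> \<open>The hypothesis on \<open>T (I - A)\<close> speaks of the full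
      \<open>a i\<close>, the series of the cut-off one. They differ on a null set, which
      \<open>T\<close> does not notice by \<open>T_null\<close>.\<close>
    have "AE y in M. T (restr (- Gd) (a i)) y = 0" for i
    proof (rule T_null)
      have Gc: "- Gd \<in> sets M" using sets.compl_sets[OF Gd] by (simp add: Compl_eq_Diff_UNIV)
      show "restr (- Gd) (a i) \<in> Lspace M q\<^sub>0" by (intro Lspace_restr aL Gc)
      show "AE y in M. restr (- Gd) (a i) y = 0" using GdAE by eventually_elim (simp add: restr_def)
    qed
    then have nul: "AE y in M. \<forall>i. T (restr (- Gd) (a i)) y = 0" by (simp add: AE_all_countable)
    have Gc: "- Gd \<in> sets M" using sets.compl_sets[OF Gd] by (simp add: Compl_eq_Diff_UNIV)
    have "AE y in M. ennreal (norm (T f y)) \<le> ennreal (norm (T G0 y)) + (\<Sum>i. if i \<in> J then \<phi> i y else 0)"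
    proof (rule eventually_mono[OF eventually_conj[OF main nul]])
      fix y assume "ennreal (norm (T f y)) \<le> (\<Sum>i. ennreal (norm (T (g i) y))) \<and> (\<forall>i. T (restr (- Gd) (a i)) y = 0)"
      then have elim: "ennreal (norm (T f y)) \<le> (\<Sum>i. ennreal (norm (T (g i) y)))" "\<And>i. T (restr (- Gd) (a i)) y = 0" by blast+
      have "(\<Sum>i. ennreal (norm (T (g i) y))) = ennreal (norm (T (g 0) y)) + (\<Sum>i. ennreal (norm (T (g (Suc i)) y)))"
        by (rule ennreal_suminf_split_head)
      also have "\<dots> \<le> ennreal (norm (T G0 y)) + (\<Sum>i. if i \<in> J then \<phi> i y else 0)"
      proof (intro add_mono suminf_le)
        show "ennreal (norm (T (g 0) y)) \<le> ennreal (norm (T G0 y))" by (simp add: g_def)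
        fix i
        show "ennreal (norm (T (g (Suc i)) y)) \<le> (if i \<in> J then \<phi> i y else 0)"
        proof (cases "i \<in> J")
          case True
          have e: "g (Suc i) = (\<lambda>y. (h i y - A (r i) (h i) y) + restr (- Gd) (a i) y)"
            using True by (auto simp: g_def a_def restr_def fun_eq_iff)
          have "norm (T (g (Suc i)) y) \<le> norm (T (\<lambda>y. h i y - A (r i) (h i) y) y) + norm (T (restr (- Gd) (a i)) y)"
            unfolding e by (intro T_add hAD True Lspace_D Lspace_restr aL Gc)
          then show ?thesis using True elim(2) by (simp add: \<phi>_def ennreal_leI)
        next
          case False
          then have "g (Suc i) = (\<lambda>_. 0)" by (auto simp: g_def a0 h_def PJ restr_def fun_eq_iff)
          then show ?thesis using False T_zero by simp
        qed
      qed auto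
      finally show "ennreal (norm (T f y)) \<le> ennreal (norm (T G0 y)) + (\<Sum>i. if i \<in> J then \<phi> i y else 0)"
        using elim(1) by (rule order_trans[rotated])
    qed
    then have sub: "AE y in M. y \<in> {y\<in>space M. ((KT + 1) * c1 + 1) * t < norm (T f y)} \<longrightarrow>
      y \<in> {y\<in>space M. (KT + 1) * c1 * t < norm (T G0 y)} \<union> E"
    proof eventually_elim
      case (elim y)
      show ?case
      proof (intro impI, rule ccontr)
        assume y: "y \<in> {y\<in>space M. ((KT + 1) * c1 + 1) * t < norm (T f y)}"
          and n: "y \<notin> {y\<in>space M. (KT + 1) * c1 * t < norm (T G0 y)} \<union> E"
        have "ennreal (norm (T f y)) \<le> ennreal ((KT + 1) * c1 * t) + ennreal t"
          using n E(3)[of y] by (intro order_trans[OF elim] add_mono ennreal_leI) auto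
        also have "\<dots> = ennreal (((KT + 1) * c1 + 1) * t)"
          using KT c1 t by (subst ennreal_plus[symmetric]) (auto simp: distrib_right)
        finally have "norm (T f y) \<le> ((KT + 1) * c1 + 1) * t"
          using KT c1 t by (subst (asm) ennreal_le_iff) auto
        then show False using y by simp
      qed
    qed
    have TG0m[measurable]: "(\<lambda>y. norm (T G0 y)) \<in> borel_measurable M" by (intro T_meas Lspace_D G0L)
    have "emeasure M {y\<in>space M. ((KT + 1) * c1 + 1) * t < norm (T f y)} \<le>
      emeasure M ({y\<in>space M. (KT + 1) * c1 * t < norm (T G0 y)} \<union> E)"
      by (rule emeasure_mono_AE[OF sub]) measurable
    also have "\<dots> \<le> emeasure M {y\<in>space M. (KT + 1) * c1 * t < norm (T G0 y)} + emeasure M E"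
      by (rule emeasure_subadditive) measurable
    also have "\<dots> \<le> ennreal (KT * c1 * N) + ennreal ((Cd * 4 powr D + c2) * C * N)" by (intro add_mono TG0 E(2))
    also have "\<dots> = ennreal (K * N)"
      using KT c1 c2 N C0 Cd_ge_1 by (subst ennreal_plus[symmetric]) (auto simp: K_def distrib_right)
    finally show "emeasure M {y\<in>space M. ((KT + 1) * c1 + 1) * t < norm (T f y)} \<le> ennreal (K * (X / t powr p))"
      by (simp add: N_def)
  qed
qed

lemma T_weak:
  assumes p: "p\<^sub>0 < p" "ereal p < q\<^sub>0"
  shows "\<exists>K\<ge>0. \<forall>f\<in>Linf_c M. \<forall>t>0. emeasure M {y. t < norm (T f y)} \<le> ennreal (K / t powr p) * pmass M p f"
proof -
  have pp: "0 < p" using p p0 by simp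
  obtain c K where cK: "0 < c" "0 \<le> K" "\<And>f t X. f \<in> Linf_c M \<Longrightarrow> 0 < t \<Longrightarrow> 0 < X \<Longrightarrow> pmass M p f \<le> ennreal X \<Longrightarrow>
    emeasure M {y\<in>space M. c * t < norm (T f y)} \<le> ennreal (K * (X / t powr p))"
    using T_weak_level[OF p] by blast
  show ?thesis
  proof (intro exI[of _ "K * c powr p"] conjI ballI allI impI)
    show "0 \<le> K * c powr p" using cK by simp
    fix f :: "'a \<Rightarrow> 'k" and t :: real assume f: "f \<in> Linf_c M" and t: "0 < t"
    show "emeasure M {y. t < norm (T f y)} \<le> ennreal (K * c powr p / t powr p) * pmass M p f"
      using weak_from_level_estimate[OF pmass_Linf_c_finite[OF f pp] pp cK(1,2) t, of "T f"] cK(3)[OF f] by simp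
  qed
qed

end

section \<open>Induction on the order of the commutator\<close>

context cz_operator
begin

text \<open>With a power of \<open>b\<close> in front the exponent has to stay strictly below
  \<open>q\<^sub>0\<close>. The growth \<open>(1 + j) ^ l\<close> from John-Nirenberg is absorbed by
  passing from \<open>\<alpha> j\<close> to \<open>\<beta> j\<close>.\<close>

lemma tower_family_product_sum:
  assumes q: "1 \<le> q" "ereal q < q\<^sub>0"
  shows "\<exists>Ca\<ge>1. \<forall>(b::'a \<Rightarrow> 'k) C t N J x r w \<kappa> (a::nat \<Rightarrow> 'a \<Rightarrow> 'k) l F.
    BMO1 b \<longrightarrow> tower_family \<beta> C t N J x r w \<longrightarrow> 0 < t \<longrightarrow> 0 < C \<longrightarrow> 0 \<le> N \<longrightarrow> 0 < \<kappa> \<longrightarrow>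
    (\<forall>i\<in>J. a i \<in> borel_measurable M) \<longrightarrow>
    (\<forall>i\<in>J. \<forall>j\<ge>1. annular_bound M q\<^sub>0 (annulus (x i) (r i) j) (emeasure M (ball (x i) (2 ^ (j + 1) * r i))) (\<alpha> j * (\<kappa> * w i)) (a i)) \<longrightarrow>
    l \<le> k \<longrightarrow> finite F \<longrightarrow> F \<subseteq> J \<longrightarrow>
    (\<integral>\<^sup>+y. ennreal ((\<Sum>i\<in>F. norm (b y - mean M (ball (x i) (r i)) b) ^ l * norm (a i y)) powr q) \<partial>M)
      \<le> ennreal (C powr q * (Ca * \<kappa> powr q) * tower_const \<beta> * t powr q * N)"
proof -
  obtain Ca where Ca: "Ca \<ge> 1" "\<And>(b::'a \<Rightarrow> 'k) l x r j c (a::'a \<Rightarrow> 'k).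
    BMO1 b \<Longrightarrow> l \<le> k \<Longrightarrow> 0 < r \<Longrightarrow> 1 \<le> j \<Longrightarrow> 0 < c \<Longrightarrow> a \<in> borel_measurable M \<Longrightarrow>
    annular_bound M q\<^sub>0 (annulus x r j) (emeasure M (ball x (2 ^ (j + 1) * r))) c a \<Longrightarrow>
    (\<integral>\<^sup>+y\<in>annulus x r j. ennreal ((norm (b y - mean M (ball x r) b) ^ l * norm (a y)) powr q) \<partial>M) \<le>
      ennreal (Ca * ((1 + real j) ^ l * c) powr q) * emeasure M (ball x (2 ^ (j + 1) * r))"
    using annular_product[OF q, where 'k='k and k=k] by blast
  show ?thesis
  proof (intro exI[of _ Ca] conjI Ca(1) allI impI)
    fix b :: "'a \<Rightarrow> 'k" and C t N :: real and J :: "nat set" and x r w and \<kappa> :: real and a :: "nat \<Rightarrow> 'a \<Rightarrow> 'k" and l :: nat and F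
    assume b: "BMO1 b" and tf: "tower_family \<beta> C t N J x r w" and t: "0 < t" and C: "0 < C" and N: "0 \<le> N" and \<kappa>: "0 < \<kappa>"
      and am: "\<forall>i\<in>J. a i \<in> borel_measurable M"
      and ab: "\<forall>i\<in>J. \<forall>j\<ge>1. annular_bound M q\<^sub>0 (annulus (x i) (r i) j) (emeasure M (ball (x i) (2 ^ (j + 1) * r i))) (\<alpha> j * (\<kappa> * w i)) (a i)"
      and l: "l \<le> k" and F: "finite F" "F \<subseteq> J"
    have bm[measurable]: "b \<in> borel_measurable M" using b by (simp add: BMO1_def)
    have rw: "0 < r i" "0 < w i" if "i \<in> J" for i using tf that by (auto simp: tower_family_def)
    show "(\<integral>\<^sup>+y. ennreal ((\<Sum>i\<in>F. norm (b y - mean M (ball (x i) (r i)) b) ^ l * norm (a i y)) powr q) \<partial>M)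
      \<le> ennreal (C powr q * (Ca * \<kappa> powr q) * tower_const \<beta> * t powr q * N)"
    proof (rule tower_family_sum_power[OF tf \<beta>_pos \<beta>_sum q(1) t C N _ F])
      show "0 \<le> Ca * \<kappa> powr q" using Ca(1) by simp
      show "(\<lambda>y. norm (b y - mean M (ball (x i) (r i)) b) ^ l * norm (a i y)) \<in> borel_measurable M" if "i \<in> F" for i
      proof -
        have [measurable]: "a i \<in> borel_measurable M" using am F that by blast
        show ?thesis by measurable
      qed
      show "0 \<le> norm (b y - mean M (ball (x i) (r i)) b) ^ l * norm (a i y)" for i y by simp
      fix i j assume i: "i \<in> F" and j: "1 \<le> (j::nat)"
      have iJ: "i \<in> J" using i F by blast
      have c: "0 < \<alpha> j * (\<kappa> * w i)" using \<alpha>_pos \<kappa> rw(2)[OF iJ] by simp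
      have "(\<integral>\<^sup>+y\<in>annulus (x i) (r i) j. ennreal ((norm (b y - mean M (ball (x i) (r i)) b) ^ l * norm (a i y)) powr q) \<partial>M) \<le>
        ennreal (Ca * ((1 + real j) ^ l * (\<alpha> j * (\<kappa> * w i))) powr q) * emeasure M (ball (x i) (2 ^ (j + 1) * r i))"
        by (rule Ca(2)[OF b l rw(1)[OF iJ] j c]) (use am ab iJ j in auto)
      also have "\<dots> \<le> ennreal (Ca * (\<kappa> * (w i * \<beta> j)) powr q) * emeasure M (ball (x i) (2 ^ (j + 1) * r i))"
      proof (intro mult_right_mono ennreal_leI mult_left_mono powr_mono2)
        have "(1 + real j) ^ l * \<alpha> j * (\<kappa> * w i) \<le> \<beta> j * (\<kappa> * w i)"
          using \<alpha>_power_le_\<beta>[OF l] \<kappa> rw(2)[OF iJ] by (intro mult_right_mono) auto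
        then show "(1 + real j) ^ l * (\<alpha> j * (\<kappa> * w i)) \<le> \<kappa> * (w i * \<beta> j)" by (simp only: mult_ac)
      qed (use q Ca(1) c in auto)
      finally show "(\<integral>\<^sup>+y\<in>annulus (x i) (r i) j. ennreal ((norm (b y - mean M (ball (x i) (r i)) b) ^ l * norm (a i y)) powr q) \<partial>M) \<le>
        ennreal (Ca * \<kappa> powr q * (w i * \<beta> j) powr q) * emeasure M (ball (x i) (2 ^ (j + 1) * r i))"
        by (simp only: powr_mult mult.assoc)
    qed
  qed
qed

text \<open>Every point of the support of \<open>u\<close> eventually leaves the sets
  \<open>S n\<close>, so the masses tend to 0 by dominated convergence, and
  \<open>T_weak_extend\<close> turns this into smallness of the images in measure.\<close>

lemma T_restr_small:
  assumes wk: "\<And>f t. f \<in> Linf_c M \<Longrightarrow> 0 < t \<Longrightarrow> emeasure M {y. t < norm (T f y)} \<le> ennreal (K / t powr p) * pmass M p f"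
    and K: "0 \<le> K" and p: "0 < p" and u: "decomposable u" "u \<in> borel_measurable M" "pmass M p u < \<infinity>"
    and Y: "\<And>n. Y n \<in> sets M" "incseq Y" "(\<Union>n. Y n) = UNIV" "\<And>n. restr (Y n) u \<in> Linf_c M"
    and S: "\<And>n. S n \<in> sets M" and ev: "\<And>y. u y \<noteq> 0 \<Longrightarrow> eventually (\<lambda>n. y \<notin> S n) sequentially"
    and s: "0 < s" and e: "0 < e"
  shows "eventually (\<lambda>n. emeasure M {y. s < norm (T (restr (S n) u) y)} \<le> ennreal e) sequentially"
proof -
  define K' where "K' = K / (s / 2) powr p"
  have K': "0 \<le> K'" using K by (simp add: K'_def)
  define d where "d = e / (2 * (K' + 1))"
  have d: "0 < d" using K' e by (simp add: d_def)
  have "(\<lambda>n. pmass M p (restr (S n) u)) \<longlonglongrightarrow> 0"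
    using ev by (intro pmass_restr_tendsto_0[OF u(2) S p u(3)]) auto
  then have "eventually (\<lambda>n. pmass M p (restr (S n) u) < ennreal d) sequentially"
    using d by (intro order_tendstoD(2)[of _ 0]) auto
  then show ?thesis
  proof eventually_elim
    case (elim n)
    have "emeasure M {y. 2 * (s / 2) < norm (T (restr (S n) u) y)} \<le> ennreal K' * (pmass M p (restr (S n) u) + ennreal d)"
      unfolding K'_def using s d by (intro T_weak_extend[OF wk K p u Y S]) auto
    also have "\<dots> \<le> ennreal K' * (ennreal d + ennreal d)"
      using elim by (intro mult_left_mono add_right_mono) auto
    also have "\<dots> = ennreal (K' * (2 * d))"
      using d K' by (subst ennreal_plus[symmetric]) (auto simp: ennreal_mult')
    also have "\<dots> \<le> ennreal e"
    proof (rule ennreal_leI)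
      have "K' * (2 * d) = K' * e / (K' + 1)" using K' by (simp add: d_def field_simps)
      also have "\<dots> \<le> e" using K' e by (simp add: pos_divide_le_eq algebra_simps)
      finally show "K' * (2 * d) \<le> e" .
    qed
    finally show ?case by simp
  qed
qed

text \<open>\<open>B\<close> will be the value \<open>b x\<close>, but for \<open>T\<close> it is a
  constant. The remainder \<open>e\<close> is expanded in powers of \<open>B\<close> and
  \<open>b\<close>. For \<open>h i\<close> the power is expanded around \<open>c i\<close>, and
  \<open>a i\<close> is subtracted from and added to \<open>g i\<close>. In the added part the
  coefficient \<open>(B - c i) ^ s\<close> would depend on \<open>x\<close> inside a sum over
  \<open>i\<close>; it is expanded once more as \<open>((B - b y) + (b y - c i)) ^ s\<close>, so
  that the sum over \<open>i\<close> becomes the functions \<open>V s l\<close>, independent of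
  \<open>B\<close>, to which commutators of order \<open>l\<close> are applied.\<close>

lemma commutator_split:
  fixes b :: "'a \<Rightarrow> 'k" and B :: 'k and g a a1 a2 :: "nat \<Rightarrow> nat \<Rightarrow> 'a \<Rightarrow> 'k"
  assumes I: "finite I" and f: "\<And>y. f y = f0 y + e y + (\<Sum>i\<in>I. h i y)"
    and f0: "(\<lambda>y. (B - b y) ^ m * f0 y) \<in> \<D>" and eD: "\<And>l. l \<le> m \<Longrightarrow> (\<lambda>y. b y ^ l * e y) \<in> \<D>"
    and g: "\<And>i l y. g i l y = (c i - b y) ^ l * h i y" and gaD: "\<And>i l. i \<in> I \<Longrightarrow> l \<le> m \<Longrightarrow> (\<lambda>y. g i l y - a i l y) \<in> \<D>"
    and a: "\<And>i l y. a i l y = a1 i l y + a2 i l y" and a2D: "\<And>i l. i \<in> I \<Longrightarrow> l \<le> m \<Longrightarrow> a2 i l \<in> \<D>"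
    and V: "\<And>s l y. V s l y = (\<Sum>i\<in>I. (b y - c i) ^ (s - l) * a1 i (m - s) y)"
    and VD: "\<And>s l. s \<le> m \<Longrightarrow> l \<le> s \<Longrightarrow> (\<lambda>y. (B - b y) ^ l * V s l y) \<in> \<D>"
  shows "norm (T (\<lambda>y. (B - b y) ^ m * f y) x) \<le> norm (T (\<lambda>y. (B - b y) ^ m * f0 y) x)
    + (\<Sum>s\<le>m. real (m choose s) * norm B ^ s * norm (T (\<lambda>y. b y ^ (m - s) * e y) x))
    + (\<Sum>i\<in>I. \<Sum>s\<le>m. real (m choose s) * norm (B - c i) ^ s * norm (T (\<lambda>y. g i (m - s) y - a i (m - s) y) x))
    + (\<Sum>i\<in>I. \<Sum>s\<le>m. real (m choose s) * norm (B - c i) ^ s * norm (T (a2 i (m - s)) x))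
    + (\<Sum>s\<le>m. \<Sum>l\<le>s. real (m choose s) * real (s choose l) * norm (T (\<lambda>y. (B - b y) ^ l * V s l y) x))"
proof -
  let ?ce = "\<lambda>s. of_nat (m choose s) * B ^ s * (-1) ^ (m - s) :: 'k"
  let ?cg = "\<lambda>(i, s). of_nat (m choose s) * (B - c i) ^ s :: 'k"
  let ?cv = "\<lambda>(s, l). of_nat (m choose s) * of_nat (s choose l) :: 'k"
  let ?IS = "I \<times> {..m}" and ?SL = "Sigma {..m} (\<lambda>s. {..s})"
  define F1 where "F1 y = (\<Sum>s\<le>m. ?ce s * (b y ^ (m - s) * e y))" for y
  define F2 where "F2 y = (\<Sum>u\<in>?IS. ?cg u * (g (fst u) (m - snd u) y - a (fst u) (m - snd u) y))" for y
  define F3 where "F3 y = (\<Sum>u\<in>?IS. ?cg u * a2 (fst u) (m - snd u) y)" for y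
  define F4 where "F4 y = (\<Sum>u\<in>?SL. ?cv u * ((B - b y) ^ snd u * V (fst u) (snd u) y))" for y
  have fin: "finite ?IS" "finite ?SL" using I by auto
  have T1: "F1 \<in> \<D> \<and> norm (T F1 x) \<le> (\<Sum>s\<le>m. norm (?ce s) * norm (T (\<lambda>y. b y ^ (m - s) * e y) x))"
    unfolding F1_def[abs_def] by (rule T_sum[of "{..m}" "\<lambda>s y. b y ^ (m - s) * e y"]) (auto intro: eD)
  have T2: "F2 \<in> \<D> \<and> norm (T F2 x) \<le> (\<Sum>u\<in>?IS. norm (?cg u) * norm (T (\<lambda>y. g (fst u) (m - snd u) y - a (fst u) (m - snd u) y) x))"
    unfolding F2_def[abs_def] using fin by (intro T_sum[of ?IS "\<lambda>u y. g (fst u) (m - snd u) y - a (fst u) (m - snd u) y"]) (auto intro: gaD)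
  have T3: "F3 \<in> \<D> \<and> norm (T F3 x) \<le> (\<Sum>u\<in>?IS. norm (?cg u) * norm (T (a2 (fst u) (m - snd u)) x))"
    unfolding F3_def[abs_def] using fin by (intro T_sum[of ?IS "\<lambda>u. a2 (fst u) (m - snd u)"]) (auto intro: a2D)
  have T4: "F4 \<in> \<D> \<and> norm (T F4 x) \<le> (\<Sum>u\<in>?SL. norm (?cv u) * norm (T (\<lambda>y. (B - b y) ^ snd u * V (fst u) (snd u) y) x))"
    unfolding F4_def[abs_def] using fin by (intro T_sum[of ?SL "\<lambda>u y. (B - b y) ^ snd u * V (fst u) (snd u) y"]) (auto intro: VD)
  have binom: "(u + v) ^ n = (\<Sum>s\<le>n. of_nat (n choose s) * u ^ s * v ^ (n - s))" for u v :: 'k and n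
    by (rule binomial_ring)
  have id: "(B - b y) ^ m * f y = (B - b y) ^ m * f0 y + (F1 y + (F2 y + (F3 y + F4 y)))" for y
  proof -
    have e1: "(B - b y) ^ m * e y = F1 y"
    proof -
      have "(B - b y) ^ m = (\<Sum>s\<le>m. of_nat (m choose s) * B ^ s * (- b y) ^ (m - s))" using binom[of B "- b y" m] by simp
      also have "\<dots> = (\<Sum>s\<le>m. ?ce s * b y ^ (m - s))"
      proof (rule sum.cong[OF refl])
        fix s
        have "(- b y) ^ (m - s) = (-1) ^ (m - s) * b y ^ (m - s)" by (rule power_minus)
        then show "of_nat (m choose s) * B ^ s * (- b y) ^ (m - s) = ?ce s * b y ^ (m - s)" by (simp only: mult.assoc)
      qed
      finally show ?thesis unfolding F1_def by (simp only: sum_distrib_right mult.assoc)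
    qed
    \<comment> \<open>\<open>a = a1 + a2\<close>, so \<open>F2 + F3\<close> carries the difference
      of \<open>g\<close> and \<open>a1\<close>; \<open>F4\<close> gives back exactly the
      \<open>a1\<close> part.\<close>
    have F23: "F2 y + F3 y = (\<Sum>i\<in>I. \<Sum>s\<le>m. of_nat (m choose s) * (B - c i) ^ s * (g i (m - s) y - a1 i (m - s) y))"
      unfolding F2_def F3_def sum.distrib[symmetric] sum.cartesian_product
      by (intro sum.cong) (auto simp: a algebra_simps)
    have F4: "F4 y = (\<Sum>i\<in>I. \<Sum>s\<le>m. of_nat (m choose s) * (B - c i) ^ s * a1 i (m - s) y)"
    proof -
      have "F4 y = (\<Sum>s\<le>m. \<Sum>l\<le>s. of_nat (m choose s) * of_nat (s choose l) * ((B - b y) ^ l * V s l y))"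
        unfolding F4_def by (subst sum.Sigma) (auto intro!: sum.cong)
      also have "\<dots> = (\<Sum>s\<le>m. \<Sum>l\<le>s. \<Sum>i\<in>I. of_nat (m choose s) * (of_nat (s choose l) * (B - b y) ^ l * (b y - c i) ^ (s - l)) * a1 i (m - s) y)"
        unfolding V sum_distrib_left by (intro sum.cong refl) (simp only: mult_ac)
      also have "\<dots> = (\<Sum>s\<le>m. \<Sum>i\<in>I. \<Sum>l\<le>s. of_nat (m choose s) * (of_nat (s choose l) * (B - b y) ^ l * (b y - c i) ^ (s - l)) * a1 i (m - s) y)"
        by (intro sum.cong refl sum.swap)
      also have "\<dots> = (\<Sum>s\<le>m. \<Sum>i\<in>I. of_nat (m choose s) * (B - c i) ^ s * a1 i (m - s) y)"
      proof (intro sum.cong refl)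
        fix s i
        have "(B - c i) ^ s = (\<Sum>l\<le>s. of_nat (s choose l) * (B - b y) ^ l * (b y - c i) ^ (s - l))"
          using binom[of "B - b y" "b y - c i" s] by simp
        then show "(\<Sum>l\<le>s. of_nat (m choose s) * (of_nat (s choose l) * (B - b y) ^ l * (b y - c i) ^ (s - l)) * a1 i (m - s) y) =
          of_nat (m choose s) * (B - c i) ^ s * a1 i (m - s) y"
          by (simp only: sum_distrib_left sum_distrib_right)
      qed
      also have "\<dots> = (\<Sum>i\<in>I. \<Sum>s\<le>m. of_nat (m choose s) * (B - c i) ^ s * a1 i (m - s) y)" by (rule sum.swap)
      finally show ?thesis .
    qed
    have hi: "(B - b y) ^ m * h i y = (\<Sum>s\<le>m. of_nat (m choose s) * (B - c i) ^ s * g i (m - s) y)" for i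
    proof -
      have "(B - b y) ^ m = (\<Sum>s\<le>m. of_nat (m choose s) * (B - c i) ^ s * (c i - b y) ^ (m - s))"
        using binom[of "B - c i" "c i - b y" m] by simp
      then show ?thesis unfolding g by (simp only: sum_distrib_right mult.assoc)
    qed
    have "F2 y + F3 y + F4 y = (\<Sum>i\<in>I. (B - b y) ^ m * h i y)"
      unfolding F23 F4 hi sum.distrib[symmetric] by (intro sum.cong refl) (simp add: algebra_simps)
    then show ?thesis
      unfolding f by (simp only: distrib_left sum_distrib_left e1 add.assoc)
  qed
  have D34: "(\<lambda>y. F3 y + F4 y) \<in> \<D>" using T3 T4 D_add by blast
  have D234: "(\<lambda>y. F2 y + (F3 y + F4 y)) \<in> \<D>" using T2 D34 D_add by blast
  have D1234: "(\<lambda>y. F1 y + (F2 y + (F3 y + F4 y))) \<in> \<D>" using T1 D234 D_add by blast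
  have "norm (T (\<lambda>y. (B - b y) ^ m * f y) x) \<le> norm (T (\<lambda>y. (B - b y) ^ m * f0 y) x) + (norm (T F1 x) + (norm (T F2 x) + (norm (T F3 x) + norm (T F4 x))))"
    unfolding id
    using T_add[OF f0 D1234, of x] T_add[OF conjunct1[OF T1] D234, of x] T_add[OF conjunct1[OF T2] D34, of x]
      T_add[OF conjunct1[OF T3] conjunct1[OF T4], of x] by linarith
  moreover have "(\<Sum>s\<le>m. norm (?ce s) * norm (T (\<lambda>y. b y ^ (m - s) * e y) x)) =
    (\<Sum>s\<le>m. real (m choose s) * norm B ^ s * norm (T (\<lambda>y. b y ^ (m - s) * e y) x))"
    by (intro sum.cong) (auto simp: norm_mult norm_power)
  moreover have "(\<Sum>u\<in>?IS. norm (?cg u) * norm (T (\<lambda>y. g (fst u) (m - snd u) y - a (fst u) (m - snd u) y) x)) =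
    (\<Sum>i\<in>I. \<Sum>s\<le>m. real (m choose s) * norm (B - c i) ^ s * norm (T (\<lambda>y. g i (m - s) y - a i (m - s) y) x))"
    unfolding sum.cartesian_product by (intro sum.cong) (auto simp: norm_mult norm_power)
  moreover have "(\<Sum>u\<in>?IS. norm (?cg u) * norm (T (a2 (fst u) (m - snd u)) x)) =
    (\<Sum>i\<in>I. \<Sum>s\<le>m. real (m choose s) * norm (B - c i) ^ s * norm (T (a2 i (m - s)) x))"
    unfolding sum.cartesian_product by (intro sum.cong) (auto simp: norm_mult norm_power)
  moreover have "(\<Sum>u\<in>?SL. norm (?cv u) * norm (T (\<lambda>y. (B - b y) ^ snd u * V (fst u) (snd u) y) x)) =
    (\<Sum>s\<le>m. \<Sum>l\<le>s. real (m choose s) * real (s choose l) * norm (T (\<lambda>y. (B - b y) ^ l * V s l y) x))"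
    by (subst sum.Sigma) (auto simp: norm_mult intro!: sum.cong)
  ultimately show ?thesis using T1 T2 T3 T4 by linarith
qed

text \<open>Symbols of norm at most one with one common constant \<open>KW\<close>, measured as in
  \<open>weak_bound\<close>, that is, as a \<open>q\<^sub>0\<close>-th power for finite
  \<open>q\<^sub>0\<close>. Uniformity over this class is what the induction carries along.\<close>

definition admissible :: "real \<Rightarrow> ('a \<Rightarrow> 'k) \<Rightarrow> bool" where
  "admissible KW b \<longleftrightarrow> BMO1 b \<and> commutators_defined M \<D> b k \<and>
    (\<forall>m\<in>{1..k}. weak_bound M q\<^sub>0 (Linf_c M) (commutator T b m) KW \<and>
      (\<forall>f\<in>Linf_c M. (\<lambda>x. norm (commutator T b m f x)) \<in> borel_measurable M))"

definition commutator_weak :: "real \<Rightarrow> nat \<Rightarrow> real \<Rightarrow> real \<Rightarrow> bool" where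
  "commutator_weak KW m p K \<longleftrightarrow> (\<forall>b. admissible KW b \<longrightarrow> (\<forall>f\<in>Linf_c M. \<forall>t>0.
    emeasure M {y. t < norm (commutator T b m f y)} \<le> ennreal (K / t powr p) * pmass M p f))"

lemma commutator_0: "commutator T b 0 f = T f"
  by (simp add: commutator_def fun_eq_iff)

lemma commutator_measurable:
  "admissible KW b \<Longrightarrow> l \<le> k \<Longrightarrow> f \<in> Linf_c M \<Longrightarrow> (\<lambda>x. norm (commutator T b l f x)) \<in> borel_measurable M"
  by (cases "l = 0") (auto simp: commutator_0 admissible_def intro: T_meas Linf_c_D)

lemma admissible_measurable: "admissible KW b \<Longrightarrow> b \<in> borel_measurable M"
  by (simp add: admissible_def BMO1_def)

lemma commutator_weak_0:
  assumes "p\<^sub>0 < p" "ereal p < q\<^sub>0" shows "\<exists>K\<ge>0. commutator_weak KW 0 p K"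
  using T_weak[OF assms] by (auto simp: commutator_weak_def commutator_0)

lemma commutator_weak_mono:
  assumes "commutator_weak KW m p K" "K \<le> K'" shows "commutator_weak KW m p K'"
  unfolding commutator_weak_def
proof (intro allI impI ballI)
  fix b f :: "'a \<Rightarrow> 'k" and t :: real assume *: "admissible KW b" "f \<in> Linf_c M" "0 < t"
  have "emeasure M {y. t < norm (commutator T b m f y)} \<le> ennreal (K / t powr p) * pmass M p f"
    using assms(1) * by (simp add: commutator_weak_def)
  also have "\<dots> \<le> ennreal (K' / t powr p) * pmass M p f"
    using assms(2) by (intro mult_right_mono ennreal_leI divide_right_mono) auto
  finally show "emeasure M {y. t < norm (commutator T b m f y)} \<le> ennreal (K' / t powr p) * pmass M p f" .
qed

text \<open>Used for the part of \<open>f\<close> that the finitely many truncated pieces leave out.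
  The functions \<open>b ^ l * f\<close> do not depend on the point of evaluation, so a single
  \<open>n\<close> handles all powers.\<close>

lemma T_power_remainder:
  assumes p: "p\<^sub>0 < p" "ereal p < q\<^sub>0" and b: "admissible KW b" and f: "f \<in> Linf_c M" and m: "m \<le> k"
    and Y: "\<And>n. Y n \<in> sets M" "\<And>y. eventually (\<lambda>n. y \<notin> Y n) sequentially" and s: "0 < s" and e: "0 < e"
  shows "\<exists>n. \<forall>l\<le>m. emeasure M {y. s < norm (T (restr (Y n) (\<lambda>y. b y ^ l * f y)) y)} \<le> ennreal e"
proof -
  have pp: "0 < p" using p p0 by simp
  obtain K where K: "0 \<le> K" "\<And>f t. f \<in> Linf_c M \<Longrightarrow> 0 < t \<Longrightarrow> emeasure M {y. t < norm (T f y)} \<le> ennreal (K / t powr p) * pmass M p f"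
    using T_weak[OF p] by blast
  have b1: "BMO1 b" and cd: "commutators_defined M \<D> b k" using b by (auto simp: admissible_def)
  have bm[measurable]: "b \<in> borel_measurable M" by (rule admissible_measurable[OF b])
  have fm[measurable]: "f \<in> borel_measurable M" by (rule Linf_c_measurable[OF f])
  obtain B where B: "0 < B" "\<And>x. norm (f x) \<le> B" using Linf_c_bounded[OF f] by blast
  define S where "S n = {y. norm (b y) \<le> real n}" for n :: nat
  have Sm[measurable]: "S n \<in> sets M" for n
  proof -
    have "{y\<in>space M. norm (b y) \<le> real n} \<in> sets M" by measurable
    then show ?thesis by (simp add: S_def)
  qed
  have ev: "eventually (\<lambda>n. emeasure M {y. s < norm (T (restr (Y n) (\<lambda>y. b y ^ l * f y)) y)} \<le> ennreal e) sequentially" if l: "l \<in> {..m}" for l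
  proof (rule T_restr_small[OF K(2) K(1) pp, where Y=S])
    let ?u = "\<lambda>y. b y ^ l * f y"
    have lk: "l \<le> k" using l m by simp
    show "decomposable ?u" by (rule decomposable_power[OF b1 cd f lk])
    show "?u \<in> borel_measurable M" by measurable
    show "pmass M p ?u < \<infinity>" by (rule BMO1_power_pmass_finite[OF b1 f pp])
    show "S n \<in> sets M" for n by (rule Sm)
    show "incseq S" by (auto simp: incseq_def S_def)
    show "(\<Union>n. S n) = UNIV" using real_arch_simple by (auto simp: S_def)
    show "restr (S n) ?u \<in> Linf_c M" for n
    proof (rule Linf_cI)
      show "restr (S n) ?u \<in> borel_measurable M" by measurable
      show "norm (restr (S n) ?u y) \<le> real n ^ l * B" for y
        using B by (auto simp: restr_def S_def norm_mult norm_power intro!: mult_mono power_mono)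
      show "restr (S n) ?u y = 0" if "y \<notin> {x. f x \<noteq> 0}" for y using that by (simp add: restr_def)
    qed (rule Linf_c_support[OF f])
  qed (use Y s e in auto)
  have "eventually (\<lambda>n. \<forall>l\<in>{..m}. emeasure M {y. s < norm (T (restr (Y n) (\<lambda>y. b y ^ l * f y)) y)} \<le> ennreal e) sequentially"
    using ev by (intro eventually_ball_finite) auto
  then obtain n where "\<forall>l\<in>{..m}. emeasure M {y. s < norm (T (restr (Y n) (\<lambda>y. b y ^ l * f y)) y)} \<le> ennreal e"
    by (auto simp: eventually_sequentially)
  then show ?thesis by (intro exI[of _ n]) auto
qed

text \<open>One set \<open>S\<close> for all A-parts, on which they, \<open>b\<close> and the
  variable are bounded. Restricted to \<open>S\<close> they yield functions in
  \<open>Linf_c M\<close>, where the weak type of commutators is available; what lies outside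
  \<open>S\<close> is negligible under \<open>T\<close>.\<close>

lemma T_family_remainder:
  fixes u :: "'v \<Rightarrow> 'a \<Rightarrow> 'k" and b :: "'a \<Rightarrow> 'k"
  assumes p: "p\<^sub>0 < p" "ereal p < q\<^sub>0" and F: "finite F" and bm[measurable]: "b \<in> borel_measurable M"
    and u: "\<And>v. v \<in> F \<Longrightarrow> u v \<in> Lspace M q\<^sub>0" "\<And>v. v \<in> F \<Longrightarrow> pmass M p (u v) < \<infinity>" and s: "0 < s" and e: "0 < e"
  shows "\<exists>S n. S \<in> sets M \<and> (\<forall>y\<in>S. norm y \<le> real n \<and> norm (b y) \<le> real n \<and> (\<forall>v\<in>F. norm (u v y) \<le> real n)) \<and>
    (\<forall>v\<in>F. emeasure M {y. s < norm (T (restr (- S) (u v)) y)} \<le> ennreal e)"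
proof -
  have pp: "0 < p" using p p0 by simp
  obtain K where K: "0 \<le> K" "\<And>f t. f \<in> Linf_c M \<Longrightarrow> 0 < t \<Longrightarrow> emeasure M {y. t < norm (T f y)} \<le> ennreal (K / t powr p) * pmass M p f"
    using T_weak[OF p] by blast
  have um[measurable]: "u v \<in> borel_measurable M" if "v \<in> F" for v using u(1)[OF that] by (simp add: Lspace_def)
  define S where "S n = {y. norm y \<le> real n \<and> norm (b y) \<le> real n \<and> (\<forall>v\<in>F. norm (u v y) \<le> real n)}" for n :: nat
  have Sm: "S n \<in> sets M" for n
  proof -
    have "{y. norm y \<le> real n} \<in> sets borel" by measurable
    moreover have "{y\<in>space M. norm (b y) \<le> real n} \<in> sets M" by measurable
    moreover have "{y\<in>space M. \<forall>v\<in>F. norm (u v y) \<le> real n} \<in> sets M"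
    proof (rule sets.sets_Collect_finite_All[OF _ F])
      fix v assume "v \<in> F"
      note um[OF this, measurable]
      show "{y\<in>space M. norm (u v y) \<le> real n} \<in> sets M" by measurable
    qed
    ultimately have "{y. norm y \<le> real n} \<inter> ({y. norm (b y) \<le> real n} \<inter> {y. \<forall>v\<in>F. norm (u v y) \<le> real n}) \<in> sets borel" by simp
    then show ?thesis by (simp add: S_def Int_def)
  qed
  have Sc: "- S n \<in> sets M" for n using sets.compl_sets[OF Sm[of n]] by (simp add: Compl_eq_Diff_UNIV)
  have inc: "incseq S" by (force simp: incseq_def S_def)
  have UN: "(\<Union>n. S n) = UNIV"
  proof -
    have "y \<in> (\<Union>n. S n)" for y
    proof -
      obtain n :: nat where n: "norm y + norm (b y) + (\<Sum>v\<in>F. norm (u v y)) \<le> real n" using real_arch_simple by blast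
      have 0: "0 \<le> (\<Sum>v\<in>F. norm (u v y))" by (simp add: sum_nonneg)
      have "norm (u v y) \<le> real n" if "v \<in> F" for v
      proof -
        have "norm (u v y) \<le> (\<Sum>v\<in>F. norm (u v y))" using F that by (intro member_le_sum) auto
        then show ?thesis using n norm_ge_zero[of y] norm_ge_zero[of "b y"] by linarith
      qed
      moreover have "norm y \<le> real n" "norm (b y) \<le> real n" using n 0 norm_ge_zero[of y] norm_ge_zero[of "b y"] by linarith+
      ultimately have "y \<in> S n" by (simp add: S_def)
      then show ?thesis by blast
    qed
    then show ?thesis by blast
  qed
  have ev: "eventually (\<lambda>n. emeasure M {y. s < norm (T (restr (- S n) (u v)) y)} \<le> ennreal e) sequentially" if v: "v \<in> F" for v
  proof (rule T_restr_small[OF K(2) K(1) pp, where Y=S])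
    show "decomposable (u v)" by (rule decomposable_Lspace[OF u(1)[OF v]])
    show "restr (S n) (u v) \<in> Linf_c M" for n
    proof (rule Linf_cI)
      show "restr (S n) (u v) \<in> borel_measurable M" by (intro restr_measurable um v Sm)
      show "norm (restr (S n) (u v) y) \<le> real n" for y using v by (auto simp: restr_def S_def)
      show "restr (S n) (u v) y = 0" if "y \<notin> cball 0 (real n)" for y using that by (auto simp: restr_def S_def)
    qed simp
    fix y
    obtain n where n: "y \<in> S n" using UN by blast
    then have "\<forall>n'\<ge>n. y \<notin> - S n'" using inc by (auto simp: incseq_def)
    then show "eventually (\<lambda>n. y \<notin> - S n) sequentially" by (auto simp: eventually_sequentially)
  qed (use v um u(2) Sm Sc inc UN s e in auto)
  have "eventually (\<lambda>n. \<forall>v\<in>F. emeasure M {y. s < norm (T (restr (- S n) (u v)) y)} \<le> ennreal e) sequentially"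
    using ev F by (intro eventually_ball_finite) auto
  then obtain n where n: "\<forall>v\<in>F. emeasure M {y. s < norm (T (restr (- S n) (u v)) y)} \<le> ennreal e"
    by (auto simp: eventually_sequentially)
  show ?thesis
    by (rule exI[of _ "S n"], rule exI[of _ n]) (use n Sm in \<open>auto simp: S_def\<close>)
qed

lemma emeasure_UN_le:
  assumes "finite F" "\<And>v. v \<in> F \<Longrightarrow> S v \<in> sets M" "\<And>v. v \<in> F \<Longrightarrow> emeasure M (S v) \<le> ennreal c" "0 \<le> c" "real (card F) * c \<le> d"
  shows "emeasure M (\<Union>v\<in>F. S v) \<le> ennreal d"
proof -
  have "emeasure M (\<Union>v\<in>F. S v) \<le> (\<Sum>v\<in>F. emeasure M (S v))"
    using assms by (intro emeasure_subadditive_finite) auto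
  also have "\<dots> \<le> (\<Sum>v\<in>F. ennreal c)" by (intro sum_mono assms(3))
  also have "\<dots> = ennreal (real (card F) * c)" using assms(4) by (simp add: ennreal_mult ennreal_of_nat_eq_real_of_nat)
  also have "\<dots> \<le> ennreal d" using assms(5) by (rule ennreal_leI)
  finally show ?thesis .
qed

text \<open>
  The constants do not depend on \<open>R\<close>.  Restricting to \<open>norm (b y) \<le> R\<close> bounds the powers of
  \<open>b y\<close> that multiply the remainders in \<open>commutator_split\<close>, which are then made negligible.
\<close>
lemma commutator_level:
  assumes m: "1 \<le> m" "m \<le> k" and KW: "0 \<le> KW" and p: "p\<^sub>0 < p" "ereal p < q\<^sub>0"
    and IH: "\<And>l q. l < m \<Longrightarrow> p\<^sub>0 < q \<Longrightarrow> ereal q < q\<^sub>0 \<Longrightarrow> \<exists>K\<ge>0. commutator_weak KW l q K"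
  obtains c K where "0 < c" "0 \<le> K" "\<And>b f t X R. admissible KW b \<Longrightarrow> f \<in> Linf_c M \<Longrightarrow> 0 < t \<Longrightarrow> 0 < X \<Longrightarrow> 0 \<le> R \<Longrightarrow>
    pmass M p f \<le> ennreal X \<Longrightarrow>
    emeasure M {y. c * t < norm (commutator T b m f y) \<and> norm (b y) \<le> R} \<le> ennreal (K * (X / t powr p))"
proof -
  have pp: "0 < p" "1 \<le> p" using p p0 by auto
  \<comment> \<open>The products of A-parts with powers of \<open>b\<close> are controlled below
    \<open>q\<^sub>0\<close> only, so the lower orders are used at a \<open>q\<close> strictly
    between \<open>p\<close> and \<open>q\<^sub>0\<close>.\<close>
  obtain q where q: "p < q" "ereal q < q\<^sub>0" using ereal_dense2[OF p(2)] by auto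
  have q1: "1 \<le> q" "0 < q" "p\<^sub>0 < q" using q pp p by auto
  obtain Kl where Kl: "\<And>l. l < m \<Longrightarrow> 0 \<le> Kl l \<and> commutator_weak KW l q (Kl l)"
    using IH[OF _ q1(3) q(2)] by metis
  define K1 where "K1 = (\<Sum>l<m. Kl l)"
  have K1: "0 \<le> K1" unfolding K1_def using Kl by (intro sum_nonneg) auto
  have cw: "commutator_weak KW l q K1" if "l < m" for l
  proof (rule commutator_weak_mono)
    show "commutator_weak KW l q (Kl l)" using Kl[OF that] by simp
    show "Kl l \<le> K1" unfolding K1_def using that Kl by (intro member_le_sum) auto
  qed
  obtain C where C: "1 \<le> C" and dec: "\<And>(f::'a \<Rightarrow> 'k) t X. f \<in> Linf_c M \<Longrightarrow> 0 < t \<Longrightarrow> 0 < X \<Longrightarrow> pmass M p f \<le> ennreal X \<Longrightarrow>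
      \<exists>J P x r w. cz_cover p \<beta> C f t X J P x r w"
    by (rule cz_decomposition[OF pp(1) \<beta>_nonneg \<beta>_sum, where 'k='k]) blast
  have C0: "0 \<le> C" "0 < C" using C by auto
  obtain Cl where Cl: "1 \<le> Cl" "\<And>(b::'a \<Rightarrow> 'k) l x r w h. BMO1 b \<Longrightarrow> l \<le> k \<Longrightarrow> 0 < r \<Longrightarrow> 0 < w \<Longrightarrow> h \<in> borel_measurable M \<Longrightarrow>
    (\<integral>\<^sup>+y\<in>ball x r. ennreal (norm (h y) powr p) \<partial>M) \<le> ennreal (C * w powr p) * emeasure M (ball x r) \<Longrightarrow>
    avg_norm M (ereal p\<^sub>0) (ball x r) (ball x r) (\<lambda>y. (mean M (ball x r) b - b y) ^ l * h y) \<le> ennreal (Cl * w)"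
    using local_average[OF p0 p(1) C0(1), where 'k='k and k=k] by blast
  have Cl0: "0 < Cl" using Cl(1) by simp
  obtain Co where Co: "1 \<le> Co" "\<And>(b::'a \<Rightarrow> 'k) l x r \<kappa> \<gamma> (u::'a \<Rightarrow> real).
    BMO1 b \<Longrightarrow> l \<le> k \<Longrightarrow> 0 < r \<Longrightarrow> 0 < \<kappa> \<Longrightarrow> (\<forall>j. 0 < \<gamma> j) \<Longrightarrow> summable (\<lambda>j. \<gamma> j * (1 + real j) ^ k * 2 powr (D * real j)) \<Longrightarrow>
    u \<in> borel_measurable M \<Longrightarrow> (\<forall>y. 0 \<le> u y) \<Longrightarrow>
    (\<forall>j::nat. 2 \<le> j \<longrightarrow> (\<integral>\<^sup>+y\<in>annulus x r j. ennreal (u y powr \<rho>) \<partial>M) \<le> ennreal ((\<gamma> j * \<kappa>) powr \<rho>) * emeasure M (ball x (2 ^ (j + 1) * r))) \<Longrightarrow>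
    (\<integral>\<^sup>+y\<in>- ball x (4 * r). ennreal (norm (b y - mean M (ball x r) b) ^ l * u y) \<partial>M) \<le>
      ennreal (Co * \<kappa> * tower_const (\<lambda>j. \<gamma> j * (1 + real j) ^ k)) * emeasure M (ball x r)"
    using off_diagonal_product[OF \<rho>, where 'k='k and k=k] by blast
  obtain Ca where Ca: "1 \<le> Ca" "\<And>(b::'a \<Rightarrow> 'k) C t N J x r w \<kappa> (a::nat \<Rightarrow> 'a \<Rightarrow> 'k) l F.
    BMO1 b \<Longrightarrow> tower_family \<beta> C t N J x r w \<Longrightarrow> 0 < t \<Longrightarrow> 0 < C \<Longrightarrow> 0 \<le> N \<Longrightarrow> 0 < \<kappa> \<Longrightarrow>
    (\<forall>i\<in>J. a i \<in> borel_measurable M) \<Longrightarrow>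
    (\<forall>i\<in>J. \<forall>j\<ge>1. annular_bound M q\<^sub>0 (annulus (x i) (r i) j) (emeasure M (ball (x i) (2 ^ (j + 1) * r i))) (\<alpha> j * (\<kappa> * w i)) (a i)) \<Longrightarrow>
    l \<le> k \<Longrightarrow> finite F \<Longrightarrow> F \<subseteq> J \<Longrightarrow>
    (\<integral>\<^sup>+y. ennreal ((\<Sum>i\<in>F. norm (b y - mean M (ball (x i) (r i)) b) ^ l * norm (a i y)) powr q) \<partial>M)
      \<le> ennreal (C powr q * (Ca * \<kappa> powr q) * tower_const \<beta> * t powr q * N)"
    using tower_family_product_sum[OF q1(1) q(2)] by blast
  \<comment> \<open>The same estimate at the exponent \<open>p\<close> supplies the finiteness of
    \<open>pmass M p (a i l)\<close> that \<open>T_family_remainder\<close> asks for;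
    \<open>Cp\<close> does not enter the final constants.\<close>
  obtain Cp where Cp: "1 \<le> Cp" "\<And>(b::'a \<Rightarrow> 'k) C t N J x r w \<kappa> (a::nat \<Rightarrow> 'a \<Rightarrow> 'k) l F.
    BMO1 b \<Longrightarrow> tower_family \<beta> C t N J x r w \<Longrightarrow> 0 < t \<Longrightarrow> 0 < C \<Longrightarrow> 0 \<le> N \<Longrightarrow> 0 < \<kappa> \<Longrightarrow>
    (\<forall>i\<in>J. a i \<in> borel_measurable M) \<Longrightarrow>
    (\<forall>i\<in>J. \<forall>j\<ge>1. annular_bound M q\<^sub>0 (annulus (x i) (r i) j) (emeasure M (ball (x i) (2 ^ (j + 1) * r i))) (\<alpha> j * (\<kappa> * w i)) (a i)) \<Longrightarrow>
    l \<le> k \<Longrightarrow> finite F \<Longrightarrow> F \<subseteq> J \<Longrightarrow>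
    (\<integral>\<^sup>+y. ennreal ((\<Sum>i\<in>F. norm (b y - mean M (ball (x i) (r i)) b) ^ l * norm (a i y)) powr p) \<partial>M)
      \<le> ennreal (C powr p * (Cp * \<kappa> powr p) * tower_const \<beta> * t powr p * N)"
    using tower_family_product_sum[OF pp(2) p(2)] by blast
  define tw where "tw = tower_const \<beta>"
  have tw: "0 \<le> tw" unfolding tw_def by (rule tower_const_nonneg[OF \<beta>_nonneg \<beta>_sum])
  have tw\<beta>: "tower_const (\<lambda>j. \<alpha> j * (1 + real j) ^ k) = tw" unfolding tw_def \<beta>_def ..
  define Q where "Q = real_of_ereal q\<^sub>0"
  define c1 where "c1 = (1 + Cl * C) + C powr Q * Cl powr Q * tw"
  have c1: "1 \<le> c1" "Cl * C \<le> c1" "C powr Q * Cl powr Q * tw \<le> c1" using Cl0 C0 tw by (auto simp: c1_def)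
  define c2 where "c2 = Co * Cl * tw"
  have c2: "0 \<le> c2" using Co(1) Cl0 tw by (simp add: c2_def)
  define c4 where "c4 = C powr q * (Ca * Cl powr q) * tw"
  have c4: "0 \<le> c4" using Ca(1) tw by (simp add: c4_def)
  \<comment> \<open>The common height, in units of \<open>t\<close>, for all commutators of the
    functions \<open>V s l\<close>: \<open>weak_bound_apply\<close> needs this value at order
    \<open>m\<close>, and for lower orders any value at least 1 would do.\<close>
  define \<theta> where "\<theta> = (KW + 1) * c1"
  have \<theta>: "1 \<le> \<theta>" unfolding \<theta>_def using KW c1 by (intro mult_ge1_I) auto
  define c5 where "c5 = real (card (Sigma {..m} (\<lambda>s. {..s}))) * (KW * c1 + K1 * c4)"
  have c5: "0 \<le> c5" unfolding c5_def using KW c1 K1 c4 by (intro mult_nonneg_nonneg add_nonneg_nonneg of_nat_0_le_iff) auto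
  \<comment> \<open>The height budget in units of \<open>t\<close>: \<open>KW + 1\<close> for the
    bounded part; one each for the remainder of \<open>f\<close>, the differences off
    \<open>4 B\<close> and the cut-off A-parts; and \<theta> times \<open>3 ^ m\<close>, the sum of
    the products of two binomial coefficients, for the functions \<open>V s l\<close>.\<close>
  define cc where "cc = (KW + 1) + 3 + 3 ^ m * \<theta>"
  define K where "K = KW + 1 + (Cd * 4 powr D + 2 ^ m * c2) * C + 1 + c5"
  have K0: "0 \<le> (Cd * 4 powr D + 2 ^ m * c2) * C" using Cd_ge_1 c2 C0 by simp
  show ?thesis
  proof (rule that[of cc K])
    show "0 < cc" using KW \<theta> by (simp add: cc_def add_nonneg_pos)
    show "0 \<le> K" using KW K0 c5 by (simp add: K_def)
    fix b f :: "'a \<Rightarrow> 'k" and t X R :: real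
    assume b: "admissible KW b" and f: "f \<in> Linf_c M" and t: "0 < t" and X: "0 < X" and R: "0 \<le> R" and fX: "pmass M p f \<le> ennreal X"
    have b1: "BMO1 b" and cd: "commutators_defined M \<D> b k" using b by (auto simp: admissible_def)
    have bm[measurable]: "b \<in> borel_measurable M" by (rule admissible_measurable[OF b])
    have fm[measurable]: "f \<in> borel_measurable M" by (rule Linf_c_measurable[OF f])
    obtain Bf where Bf: "0 < Bf" "\<And>x. norm (f x) \<le> Bf" using Linf_c_bounded[OF f] by blast
    define N where "N = X / t powr p"
    have N: "0 < N" "0 \<le> N" using X t by (auto simp: N_def)
    obtain J P x r w where cov: "cz_cover p \<beta> C f t X J P x r w" using dec[OF f t X fX] by (elim exE) (rule that)
    note cv = cov[unfolded cz_cover_def]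
    have Pd: "disjoint_family P" using cv by simp
    have PJ: "P i = {}" if "i \<notin> J" for i using cv that by simp
    have Pm[measurable]: "P i \<in> sets M" for i using cv by simp
    have pc: "0 < r i \<and> P i \<subseteq> ball (x i) (r i) \<and> 0 < w i \<and> w i \<le> t \<and>
          (\<integral>\<^sup>+y\<in>P i. ennreal (norm (f y) powr p) \<partial>M) \<le> ennreal (C * w i powr p) * emeasure M (ball (x i) (r i))" if "i \<in> J" for i
      using cv that by simp
    have s1: "(\<Sum>i\<in>F. emeasure M (ball (x i) (r i))) \<le> ennreal (C * X / t powr p)" if "finite F" "F \<subseteq> J" for F
      using cv that by simp
    have s2: "(\<Sum>i\<in>F. ennreal (w i) * tower \<beta> (x i) (r i) y) \<le> ennreal (C * t)" if "finite F" "F \<subseteq> J" for F y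
      using cv that by simp
    have fZ: "AE y in M. y \<notin> (\<Union>i. P i) \<longrightarrow> norm (f y) \<le> t" using cv by simp
    have tf: "tower_family \<beta> C t N J x r w"
      unfolding tower_family_def N_def using pc s1 s2 by (simp add: times_divide_eq_right)
    define c where "c i = mean M (ball (x i) (r i)) b" for i
    define Z where "Z = - (\<Union>i. P i)"
    have UPm: "(\<Union>i. P i) \<in> sets M" using Pm by blast
    have Zm[measurable]: "Z \<in> sets M" using sets.compl_sets[OF UPm] by (simp add: Z_def Compl_eq_Diff_UNIV)
    have ZL: "restr Z f \<in> Linf_c M" by (intro Linf_c_restr f Zm)
    have ZAE: "AE y in M. norm (restr Z f y) \<le> t"
      using fZ by eventually_elim (use t in \<open>auto simp: restr_def Z_def\<close>)
    define G where "G n = {y. norm (b y) \<le> real n}" for n :: nat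
    have Gm[measurable]: "G n \<in> sets M" for n
    proof -
      have "{y\<in>space M. norm (b y) \<le> real n} \<in> sets M" by measurable
      then show ?thesis by (simp add: G_def)
    qed
    \<comment> \<open>What is lost by keeping the first \<open>n\<close> pieces and only the points
      where \<open>norm (b y) \<le> real n\<close>; on the rest the functions \<open>g i l\<close>
      are bounded.\<close>
    define Y where "Y n = (\<Union>i. P i) - (\<Union>i\<in>J \<inter> {..<n}. P i \<inter> G n)" for n
    have Ym[measurable]: "Y n \<in> sets M" for n
    proof -
      have PG: "P i \<inter> G n \<in> sets M" for i by measurable
      have "(\<Union>i\<in>J \<inter> {..<n}. P i \<inter> G n) \<in> sets M" using PG by (intro sets.finite_UN) auto
      then show ?thesis unfolding Y_def using UPm by (intro sets.Diff)
    qed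
    have Yev: "eventually (\<lambda>n. y \<notin> Y n) sequentially" for y
    proof (cases "y \<in> (\<Union>i. P i)")
      case True
      then obtain i where i: "y \<in> P i" by blast
      then have iJ: "i \<in> J" using PJ by blast
      obtain n0 :: nat where "norm (b y) \<le> real n0" using real_arch_simple by blast
      then have "y \<notin> Y n" if "max (Suc i) n0 \<le> n" for n
        using i iJ that by (auto simp: Y_def G_def)
      then show ?thesis unfolding eventually_sequentially by blast
    qed (simp add: Y_def)
    \<comment> \<open>The coefficients of the remainder terms add up to at most
      \<open>2 ^ m * (1 + R) ^ m\<close> where \<open>norm (b y) \<le> R\<close>, so images of size
      \<tau> contribute at most \<open>t\<close>.\<close>
    define \<tau> where "\<tau> = t / (2 ^ m * (1 + R) ^ m)"
    have \<tau>: "0 < \<tau>" using t R by (simp add: \<tau>_def)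
    have e1: "0 < N / real (m + 1)" using N by simp
    obtain n where n: "\<And>l. l \<le> m \<Longrightarrow> emeasure M {y. \<tau> < norm (T (restr (Y n) (\<lambda>y. b y ^ l * f y)) y)} \<le> ennreal (N / real (m + 1))"
      using T_power_remainder[OF p b f m(2) Ym Yev \<tau> e1] by blast
    define I where "I = J \<inter> {..<n}"
    have I: "finite I" "I \<subseteq> J" by (auto simp: I_def)
    define h where "h i = restr (P i \<inter> G n) f" for i
    have hm[measurable]: "h i \<in> borel_measurable M" for i unfolding h_def by measurable
    have fsplit: "f y = restr Z f y + restr (Y n) f y + (\<Sum>i\<in>I. h i y)" for y
    proof (cases "y \<in> (\<Union>i. P i)")
      case True
      then obtain j where j: "y \<in> P j" by blast
      have uniq: "i = j" if "y \<in> P i" for i using Pd that j by (auto simp: disjoint_family_on_def)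
      have jJ: "j \<in> J" using PJ j by blast
      have hz: "h i y = (if i = j \<and> y \<in> G n then f y else 0)" for i
      proof (cases "y \<in> P i")
        case True
        then have "i = j" by (rule uniq)
        then show ?thesis using True by (simp add: h_def restr_def)
      next
        case False
        then have "i \<noteq> j" using j by auto
        then show ?thesis using False by (simp add: h_def restr_def)
      qed
      show ?thesis
      proof (cases "j < n \<and> y \<in> G n")
        case True
        have "(\<Sum>i\<in>I. h i y) = (\<Sum>i\<in>I. if i = j then f y else 0)" using True by (intro sum.cong) (auto simp: hz)
        also have "\<dots> = f y" using I(1) True jJ by (simp add: I_def)
        finally have "(\<Sum>i\<in>I. h i y) = f y" .
        moreover have "y \<notin> Y n" using True j jJ by (auto simp: Y_def)
        ultimately show ?thesis using j by (simp add: restr_def Z_def) blast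
      next
        case False
        have "(\<Sum>i\<in>I. h i y) = 0" using False by (intro sum.neutral) (auto simp: hz I_def)
        moreover have "y \<in> Y n" unfolding Y_def using False j uniq by blast
        ultimately show ?thesis using j by (simp add: restr_def Z_def) blast
      qed
    next
      case False
      have "(\<Sum>i\<in>I. h i y) = 0" using False by (intro sum.neutral) (auto simp: h_def restr_def)
      then show ?thesis using False by (simp add: restr_def Z_def Y_def)
    qed
    define g where "g i l y = (c i - b y) ^ l * h i y" for i l y
    have gL: "g i l \<in> Linf_c M" for i l
    proof (rule Linf_cI)
      show "g i l \<in> borel_measurable M" unfolding g_def[abs_def] by measurable
      show "norm (g i l y) \<le> (norm (c i) + real n) ^ l * Bf" for y
      proof (cases "y \<in> G n")
        case True
        then have "norm (c i - b y) \<le> norm (c i) + real n"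
          using norm_triangle_ineq4[of "c i" "b y"] by (simp add: G_def)
        then show ?thesis
          using Bf(2)[of y] Bf(1) norm_restr_le[of "P i \<inter> G n" f y]
          by (auto simp: g_def h_def norm_mult norm_power intro!: mult_mono power_mono)
      next
        case False
        then show ?thesis using Bf(1) by (simp add: g_def h_def restr_def)
      qed
      show "g i l y = 0" if "y \<notin> {y. f y \<noteq> 0}" for y using that by (simp add: g_def h_def restr_def)
    qed (rule Linf_c_support[OF f])
    have g0: "g i l y = 0" if "i \<in> J" "y \<notin> ball (x i) (r i)" for i l y
      using pc[OF that(1)] that(2) by (auto simp: g_def h_def restr_def)
    have gavg: "avg_norm M (ereal p\<^sub>0) (ball (x i) (r i)) (ball (x i) (r i)) (g i l) \<le> ennreal (Cl * w i)" if i: "i \<in> J" and l: "l \<le> m" for i l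
    proof -
      have "(\<integral>\<^sup>+y\<in>ball (x i) (r i). ennreal (norm (h i y) powr p) \<partial>M) \<le> (\<integral>\<^sup>+y\<in>P i. ennreal (norm (f y) powr p) \<partial>M)"
        by (intro nn_integral_mono) (auto simp: h_def restr_def split: split_indicator)
      also have "\<dots> \<le> ennreal (C * w i powr p) * emeasure M (ball (x i) (r i))" using pc[OF i] by blast
      finally show ?thesis
        unfolding g_def[abs_def] c_def using l m pc[OF i] by (intro Cl(2)[OF b1]) auto
    qed
    have \<kappa>: "0 < Cl * w i" if "i \<in> J" for i using Cl0 pc[OF that] by simp
    define a where "a i l = A (r i) (g i l)" for i l
    have aL: "a i l \<in> Lspace M q\<^sub>0" if "i \<in> J" for i l using A_L[OF _ gL] pc[OF that] by (simp add: a_def)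
    have am: "\<forall>i\<in>J. a i l \<in> borel_measurable M" for l using aL by (auto simp: Lspace_def)
    have ab: "\<forall>i\<in>J. \<forall>j\<ge>1. annular_bound M q\<^sub>0 (annulus (x i) (r i) j) (emeasure M (ball (x i) (2 ^ (j + 1) * r i))) (\<alpha> j * (Cl * w i)) (a i l)" if l: "l \<le> m" for l
      unfolding a_def
    proof (intro ballI allI impI)
      fix i and j :: nat assume i: "i \<in> J" and j: "1 \<le> j"
      show "annular_bound M q\<^sub>0 (annulus (x i) (r i) j) (emeasure M (ball (x i) (2 ^ (j + 1) * r i))) (\<alpha> j * (Cl * w i)) (A (r i) (g i l))"
        using pc[OF i] by (intro piece_A_bound[OF _ gL g0[OF i] \<kappa>[OF i] gavg[OF i l] j]) auto
    qed
    have ap: "pmass M p (a i l) < \<infinity>" if i: "i \<in> I" and l: "l \<le> m" for i l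
    proof -
      have "pmass M p (a i l) \<le> ennreal (C powr p * (Cp * Cl powr p) * tower_const \<beta> * t powr p * N)"
        using Cp(2)[OF b1 tf t C0(2) N(2) Cl0 am ab[OF l], of 0 "{i}"] i I by (simp add: pmass_def subset_iff)
      then show ?thesis by (rule le_less_trans) simp
    qed
    \<comment> \<open>Bounds \<open>norm (b z - c i)\<close> for all kept pieces as long as
      \<open>norm (b z) \<le> R\<close>. It depends on \<open>R\<close> and on the pieces, but it
      only fixes how small the images of the cut-off parts must be.\<close>
    define \<Gamma> where "\<Gamma> = 1 + R + (\<Sum>i\<in>I. norm (c i))"
    have \<Gamma>: "1 \<le> \<Gamma>" using R by (simp add: \<Gamma>_def sum_nonneg)
    define \<tau>' where "\<tau>' = t / (2 ^ m * real (card I + 1) * \<Gamma> ^ m)"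
    have \<tau>': "0 < \<tau>'" using t \<Gamma> by (simp add: \<tau>'_def)
    define IM where "IM = I \<times> {..m}"
    have IM: "finite IM" using I by (simp add: IM_def)
    define e2 where "e2 = N / real (card IM + 1)"
    have e2: "0 < e2" using N by (simp add: e2_def)
    have uL: "(\<lambda>u. a (fst u) (snd u)) v \<in> Lspace M q\<^sub>0" "pmass M p ((\<lambda>u. a (fst u) (snd u)) v) < \<infinity>" if "v \<in> IM" for v
      using that aL ap I by (auto simp: IM_def)
    have "\<exists>S n'. (S \<in> sets M \<and> (\<forall>y\<in>S. norm y \<le> real n' \<and> norm (b y) \<le> real n' \<and> (\<forall>v\<in>IM. norm (a (fst v) (snd v) y) \<le> real n')) \<and>
      (\<forall>v\<in>IM. emeasure M {y. \<tau>' < norm (T (restr (- S) (a (fst v) (snd v))) y)} \<le> ennreal e2))"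
      by (rule T_family_remainder[where u="\<lambda>u. a (fst u) (snd u)", OF p IM bm _ _ \<tau>' e2]) (rule uL, assumption)+
    then obtain S n' where SS: "(S \<in> sets M \<and> (\<forall>y\<in>S. norm y \<le> real n' \<and> norm (b y) \<le> real n' \<and> (\<forall>v\<in>IM. norm (a (fst v) (snd v) y) \<le> real n')) \<and>
      (\<forall>v\<in>IM. emeasure M {y. \<tau>' < norm (T (restr (- S) (a (fst v) (snd v))) y)} \<le> ennreal e2))"
      by (elim exE) (rule that)
    have Sm[measurable]: "S \<in> sets M" using SS by blast
    have Sb: "norm y \<le> real n' \<and> norm (b y) \<le> real n' \<and> (\<forall>v\<in>IM. norm (a (fst v) (snd v) y) \<le> real n')" if "y \<in> S" for y
      using conjunct1[OF conjunct2[OF SS]] that by (rule bspec)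
    have Sr: "emeasure M {y. \<tau>' < norm (T (restr (- S) (a (fst v) (snd v))) y)} \<le> ennreal e2" if "v \<in> IM" for v
      using conjunct2[OF conjunct2[OF SS]] that by (rule bspec)
    have Sc[measurable]: "- S \<in> sets M" using sets.compl_sets[OF Sm] by (simp add: Compl_eq_Diff_UNIV)
    define a1 where "a1 i l = restr S (a i l)" for i l
    define a2 where "a2 i l = restr (- S) (a i l)" for i l
    have a12: "a i l y = a1 i l y + a2 i l y" for i l y by (simp add: a1_def a2_def restr_def)
    define V where "V s l y = (\<Sum>i\<in>I. (b y - c i) ^ (s - l) * a1 i (m - s) y)" for s l y
    have a1m: "a1 i l \<in> borel_measurable M" if "i \<in> I" for i l
      unfolding a1_def using am I that by (intro restr_measurable Sm) auto
    have VL: "V s l \<in> Linf_c M" if s: "s \<le> m" for s l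
    proof (rule Linf_cI)
      show "V s l \<in> borel_measurable M"
        unfolding V_def[abs_def] using a1m by (intro borel_measurable_sum borel_measurable_times) measurable
      show "norm (V s l y) \<le> (\<Sum>i\<in>I. (real n' + norm (c i)) ^ (s - l) * real n')" for y
        unfolding V_def
      proof (rule sum_norm_le)
        fix i assume i: "i \<in> I"
        show "norm ((b y - c i) ^ (s - l) * a1 i (m - s) y) \<le> (real n' + norm (c i)) ^ (s - l) * real n'"
        proof (cases "y \<in> S")
          case True
          have "(i, m - s) \<in> IM" using i by (simp add: IM_def)
          then have "norm (a i (m - s) y) \<le> real n'" "norm (b y) \<le> real n'" using Sb[OF True] by force+
          moreover from this have "norm (b y - c i) \<le> real n' + norm (c i)" using norm_triangle_ineq4[of "b y" "c i"] by linarith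
          ultimately show ?thesis using True
            by (auto simp: a1_def restr_def norm_mult norm_power intro!: mult_mono power_mono)
        qed (simp add: a1_def restr_def)
      qed
      show "V s l y = 0" if "y \<notin> cball 0 (real n')" for y
      proof -
        have "y \<notin> S" using Sb[of y] that by auto
        then show ?thesis by (simp add: V_def a1_def restr_def)
      qed
    qed simp
    have Vle: "norm (V s l y) \<le> (\<Sum>i\<in>I. norm (b y - c i) ^ (s - l) * norm (a i (m - s) y))" for s l y
      unfolding V_def by (intro sum_norm_le) (auto simp: norm_mult norm_power a1_def norm_restr_le intro!: mult_left_mono)
    have cdD: "(\<lambda>y. (B - b y) ^ l * u y) \<in> \<D>" if "u \<in> Linf_c M" "l \<le> k" for B l u
      using cd that unfolding commutators_defined_def by blast
    have decomp: "decomposable (\<lambda>y. b y ^ l * f y)" if "l \<le> m" for l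
      using that m by (intro decomposable_power[OF b1 cd f]) simp
    have eres: "(\<lambda>y. b y ^ l * restr (Y n) f y) = restr (Y n) (\<lambda>y. b y ^ l * f y)" for l by (auto simp: restr_def fun_eq_iff)
    have eD: "(\<lambda>y. b y ^ l * restr (Y n) f y) \<in> \<D>" if "l \<le> m" for l
      unfolding eres using decomp[OF that] Ym by (simp add: decomposable_def)
    have gaD: "(\<lambda>y. g i l y - a i l y) \<in> \<D>" if "i \<in> J" for i l
      using that by (intro D_diff Linf_c_D gL Lspace_D aL)
    have a2D: "a2 i l \<in> \<D>" if "i \<in> J" for i l
      unfolding a2_def using that by (intro Lspace_D Lspace_restr aL Sc)
    \<comment> \<open>\<open>commutator_split\<close> with \<open>B = b z\<close>. The dependence on
      \<open>z\<close> survives only in scalar coefficients and in genuine commutators.\<close>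
    have split: "norm (commutator T b m f z) \<le> norm (commutator T b m (restr Z f) z)
      + (\<Sum>s\<le>m. real (m choose s) * norm (b z) ^ s * norm (T (restr (Y n) (\<lambda>y. b y ^ (m - s) * f y)) z))
      + (\<Sum>i\<in>I. \<Sum>s\<le>m. real (m choose s) * norm (b z - c i) ^ s * norm (T (\<lambda>y. g i (m - s) y - a i (m - s) y) z))
      + (\<Sum>i\<in>I. \<Sum>s\<le>m. real (m choose s) * norm (b z - c i) ^ s * norm (T (a2 i (m - s)) z))
      + (\<Sum>s\<le>m. \<Sum>l\<le>s. real (m choose s) * real (s choose l) * norm (commutator T b l (V s l) z))" for z
      unfolding commutator_def eres[symmetric]
      by (rule commutator_split[OF I(1) fsplit cdD[OF ZL m(2)] eD g_def gaD a12 a2D V_def]) (use I m in \<open>auto intro!: cdD VL\<close>)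
    define E1 where "E1 = {y\<in>space M. (KW + 1) * 1 * t < norm (commutator T b m (restr Z f) y)}"
    have cmm: "(\<lambda>y. norm (commutator T b l u y)) \<in> borel_measurable M" if "l \<le> m" "u \<in> Linf_c M" for l u
      using commutator_measurable[OF b _ that(2)] that(1) m(2) by simp
    have E1m: "E1 \<in> sets M" unfolding E1_def using cmm[OF _ ZL] by measurable
    have wb: "weak_bound M q\<^sub>0 (Linf_c M) (commutator T b m) KW" using b m by (auto simp: admissible_def)
    have E1: "emeasure M E1 \<le> ennreal (KW * 1 * N)"
      unfolding E1_def
    proof (rule weak_bound_apply[OF wb ZL cmm[OF order_refl ZL] q0_pos t N(2) _ KW])
      fix Q' assume Q': "q\<^sub>0 = ereal Q'"
      have q': "0 < Q'" "p < Q'" using Q' q0_pos p by auto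
      have "pmass M Q' (restr Z f) \<le> (\<integral>\<^sup>+y. ennreal (t powr (Q' - p)) * ennreal (norm (f y) powr p) \<partial>M)"
        unfolding pmass_def using ZAE
      proof (intro nn_integral_mono_AE, eventually_elim)
        case (elim y)
        let ?n = "norm (restr Z f y)"
        have "?n powr Q' = ?n powr (Q' - p) * ?n powr p" by (simp add: powr_add[symmetric])
        also have "\<dots> \<le> t powr (Q' - p) * norm (f y) powr p"
          using elim q' pp norm_restr_le[of Z f y] by (intro mult_mono powr_mono2) auto
        finally show ?case by (simp add: ennreal_mult'[symmetric] ennreal_leI)
      qed
      also have "\<dots> = ennreal (t powr (Q' - p)) * pmass M p f" unfolding pmass_def by (rule nn_integral_cmult) measurable
      also have "\<dots> \<le> ennreal (t powr (Q' - p)) * ennreal X" by (intro mult_left_mono fX) simp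
      also have "\<dots> = ennreal (1 * t powr Q' * N)"
        using t by (simp add: ennreal_mult'[symmetric] N_def powr_diff)
      finally show "pmass M Q' (restr Z f) \<le> ennreal (1 * t powr Q' * N)" .
    qed (use ZAE in auto)
    define E2 where "E2 = (\<Union>l\<in>{..m}. {y. \<tau> < norm (T (restr (Y n) (\<lambda>y. b y ^ l * f y)) y)})"
    have E2m': "{y. \<tau> < norm (T (restr (Y n) (\<lambda>y. b y ^ l * f y)) y)} \<in> sets M" if "l \<le> m" for l
    proof -
      have [measurable]: "(\<lambda>y. norm (T (restr (Y n) (\<lambda>y. b y ^ l * f y)) y)) \<in> borel_measurable M"
        using eD[OF that] by (intro T_meas) (simp add: eres)
      have "{y\<in>space M. \<tau> < norm (T (restr (Y n) (\<lambda>y. b y ^ l * f y)) y)} \<in> sets M" by measurable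
      then show ?thesis by simp
    qed
    have E2m: "E2 \<in> sets M" unfolding E2_def using E2m' by (intro sets.finite_UN) auto
    have E2: "emeasure M E2 \<le> ennreal N"
      unfolding E2_def using n N E2m' by (intro emeasure_UN_le[where c="N / real (m + 1)"]) auto
    define E3 where "E3 = (\<Union>v\<in>IM. {y. \<tau>' < norm (T (restr (- S) (a (fst v) (snd v))) y)})"
    have E3m': "{y. \<tau>' < norm (T (restr (- S) (a (fst v) (snd v))) y)} \<in> sets M" if "v \<in> IM" for v
    proof -
      have [measurable]: "(\<lambda>y. norm (T (restr (- S) (a (fst v) (snd v))) y)) \<in> borel_measurable M"
        using uL(1)[OF that] by (intro T_meas Lspace_D Lspace_restr Sc) simp
      have "{y\<in>space M. \<tau>' < norm (T (restr (- S) (a (fst v) (snd v))) y)} \<in> sets M" by measurable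
      then show ?thesis by simp
    qed
    have E3m: "E3 \<in> sets M" unfolding E3_def using E3m' IM by (intro sets.finite_UN) auto
    have E3: "emeasure M E3 \<le> ennreal N"
      unfolding E3_def
    proof (rule emeasure_UN_le[OF IM E3m' Sr])
      show "real (card IM) * e2 \<le> N" unfolding e2_def using N by (simp add: pos_divide_le_eq field_simps)
    qed (use e2 in auto)
    define \<phi> where "\<phi> i y = (\<Sum>s\<le>m. ennreal (real (m choose s)) * ennreal (norm (b y - c i) ^ s * norm (T (\<lambda>y. g i (m - s) y - a i (m - s) y) y)))" for i y
    have Tga: "(\<lambda>y. norm (T (\<lambda>y. g i l y - a i l y) y)) \<in> borel_measurable M" if "i \<in> J" for i l
      by (intro T_meas gaD that)
    have \<phi>m': "(\<lambda>y. ennreal (norm (b y - c i) ^ s * norm (T (\<lambda>y. g i l y - a i l y) y))) \<in> borel_measurable M" if "i \<in> J" for i s l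
      using Tga[OF that, of l] by measurable
    have \<phi>m: "\<phi> i \<in> borel_measurable M" if "i \<in> J" for i
      unfolding \<phi>_def[abs_def] using \<phi>m'[OF that] by (intro borel_measurable_sum borel_measurable_times_ennreal) auto
    have off: "(\<integral>\<^sup>+y\<in>- ball (x i) (4 * r i). \<phi> i y \<partial>M) \<le> ennreal (2 ^ m * c2 * w i) * emeasure M (ball (x i) (r i))" if i: "i \<in> J" for i
    proof -
      let ?Bc = "- ball (x i) (4 * r i)"
      have Bcm: "?Bc \<in> sets M" by simp
      have one: "(\<integral>\<^sup>+y\<in>?Bc. ennreal (norm (b y - c i) ^ s * norm (T (\<lambda>y. g i (m - s) y - a i (m - s) y) y)) \<partial>M) \<le>
        ennreal (c2 * w i) * emeasure M (ball (x i) (r i))" if s: "s \<le> m" for s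
      proof -
        have "(\<integral>\<^sup>+y\<in>?Bc. ennreal (norm (b y - c i) ^ s * norm (T (\<lambda>y. g i (m - s) y - a i (m - s) y) y)) \<partial>M) \<le>
          ennreal (Co * (Cl * w i) * tower_const (\<lambda>j. \<alpha> j * (1 + real j) ^ k)) * emeasure M (ball (x i) (r i))"
          unfolding c_def
        proof (rule Co(2)[OF b1])
          show "s \<le> k" using s m by simp
          show "\<forall>j::nat. 2 \<le> j \<longrightarrow> (\<integral>\<^sup>+y\<in>annulus (x i) (r i) j. ennreal (norm (T (\<lambda>y. g i (m - s) y - a i (m - s) y) y) powr \<rho>) \<partial>M) \<le> ennreal ((\<alpha> j * (Cl * w i)) powr \<rho>) * emeasure M (ball (x i) (2 ^ (j + 1) * r i))"
            unfolding a_def using pc[OF i]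
            by (intro allI impI piece_TA_bound[OF _ gL g0[OF i] \<kappa>[OF i] gavg[OF i]]) auto
        qed (use pc[OF i] \<kappa>[OF i] \<alpha>_pos \<alpha>_sum Tga[OF i] in auto)
        then show ?thesis unfolding tw\<beta> by (simp add: c2_def mult_ac)
      qed
      have "(\<integral>\<^sup>+y\<in>?Bc. \<phi> i y \<partial>M) = (\<integral>\<^sup>+y. (\<Sum>s\<le>m. ennreal (real (m choose s)) * (ennreal (norm (b y - c i) ^ s * norm (T (\<lambda>y. g i (m - s) y - a i (m - s) y) y)) * indicator ?Bc y)) \<partial>M)"
        unfolding \<phi>_def sum_distrib_right mult.assoc ..
      also have "\<dots> = (\<Sum>s\<le>m. ennreal (real (m choose s)) * (\<integral>\<^sup>+y\<in>?Bc. ennreal (norm (b y - c i) ^ s * norm (T (\<lambda>y. g i (m - s) y - a i (m - s) y) y)) \<partial>M))"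
      proof -
        have mm: "(\<lambda>y. ennreal (norm (b y - c i) ^ s * norm (T (\<lambda>y. g i l y - a i l y) y)) * indicator ?Bc y) \<in> borel_measurable M" for s l
          using \<phi>m'[OF i, of s l] Bcm by measurable
        show ?thesis
          by (subst nn_integral_sum, rule borel_measurable_times_ennreal[OF borel_measurable_const mm])
            (intro sum.cong refl nn_integral_cmult mm)
      qed
      also have "\<dots> \<le> (\<Sum>s\<le>m. ennreal (real (m choose s)) * (ennreal (c2 * w i) * emeasure M (ball (x i) (r i))))"
        by (intro sum_mono mult_left_mono one) auto
      also have "\<dots> = (\<Sum>s\<le>m. ennreal (real (m choose s))) * (ennreal (c2 * w i) * emeasure M (ball (x i) (r i)))"
        by (rule sum_distrib_right[symmetric])
      also have "(\<Sum>s\<le>m. ennreal (real (m choose s))) = ennreal (2 ^ m)"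
      proof -
        have "(\<Sum>s\<le>m. real (m choose s)) = 2 ^ m" using choose_row_sum[of m] by (metis of_nat_sum of_nat_power of_nat_numeral)
        then show ?thesis by (subst sum_ennreal) auto
      qed
      also have "ennreal (2 ^ m) * (ennreal (c2 * w i) * emeasure M (ball (x i) (r i))) = ennreal (2 ^ m * c2 * w i) * emeasure M (ball (x i) (r i))"
        by (simp add: mult.assoc[symmetric] ennreal_mult'[symmetric])
      finally show ?thesis .
    qed
    have c22: "0 \<le> 2 ^ m * c2" using c2 by simp
    obtain E4 where E4m: "E4 \<in> sets M" and E4: "emeasure M E4 \<le> ennreal ((Cd * 4 powr D + 2 ^ m * c2) * C * N)"
      "\<And>y. y \<notin> E4 \<Longrightarrow> (\<Sum>i. if i \<in> J then \<phi> i y else 0) \<le> ennreal t"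
      using off_diagonal_exceptional_set[OF tf t C0(1) N(2) c22 \<phi>m off] by blast
    define SL where "SL = Sigma {..m} (\<lambda>s. {..s})"
    define E5 where "E5 = (\<Union>v\<in>SL. {y\<in>space M. \<theta> * t < norm (commutator T b (snd v) (V (fst v) (snd v)) y)})"
    have E5m': "{y\<in>space M. \<theta> * t < norm (commutator T b (snd v) (V (fst v) (snd v)) y)} \<in> sets M" if "v \<in> SL" for v
    proof -
      have "(\<lambda>y. norm (commutator T b (snd v) (V (fst v) (snd v)) y)) \<in> borel_measurable M"
        using that by (intro cmm VL) (auto simp: SL_def)
      then show ?thesis by measurable
    qed
    have SLf: "finite SL" by (simp add: SL_def)
    have E5m: "E5 \<in> sets M" unfolding E5_def using E5m' SLf by (intro sets.finite_UN) auto
    have E5: "emeasure M E5 \<le> ennreal (c5 * N)"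
      unfolding E5_def
    proof (rule emeasure_UN_le[OF SLf E5m'])
      show "0 \<le> (KW * c1 + K1 * c4) * N" using KW c1 K1 c4 N by simp
      show "real (card SL) * ((KW * c1 + K1 * c4) * N) \<le> c5 * N" by (simp only: c5_def SL_def mult.assoc order_refl)
      fix v assume v: "v \<in> SL"
      obtain s l where vsl: "v = (s, l)" "l \<le> s" "s \<le> m" using v by (auto simp: SL_def)
      have "emeasure M {y\<in>space M. \<theta> * t < norm (commutator T b l (V s l) y)} \<le> ennreal ((KW * c1 + K1 * c4) * N)"
      proof (cases "l = m")
        \<comment> \<open>\<open>l = m\<close> forces \<open>s = m\<close>, so the power of
          \<open>b y - c i\<close> in \<open>V\<close> is the zeroth and the A-parts
          \<open>a i 0\<close> appear bare; hence \<open>L^q\<^sub>0\<close> and the assumed weak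
          type may be used.\<close>
        case True
        then have sm: "s = m" using vsl by simp
        have Vle': "norm (V m m y) \<le> (\<Sum>i\<in>I. norm (a i 0 y))" for y using Vle[of m m y] by simp
        have "emeasure M {y\<in>space M. (KW + 1) * c1 * t < norm (commutator T b m (V m m) y)} \<le> ennreal (KW * c1 * N)"
        proof (rule weak_bound_apply[OF wb VL[OF order_refl] cmm[OF order_refl VL[OF order_refl]] q0_pos t N(2) c1(1) KW])
          fix Q' assume Q': "q\<^sub>0 = ereal Q'"
          have QQ: "Q = Q'" using Q' by (simp add: Q_def)
          have q': "0 < Q'" using Q' q0_pos by simp
          have "pmass M Q' (V m m) \<le> (\<integral>\<^sup>+y. ennreal ((\<Sum>i\<in>I. norm (a i 0 y)) powr Q') \<partial>M)"
            unfolding pmass_def using q' Vle' by (intro nn_integral_mono ennreal_leI powr_mono2) auto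
          also have "\<dots> \<le> ennreal (C powr Q' * Cl powr Q' * tower_const \<beta> * t powr Q' * N)"
            using am ab[of 0] by (intro tower_family_A_sum(1)[OF tf t C0(2) N(2) Cl0 _ _ Q' I]) auto
          also have "\<dots> \<le> ennreal (c1 * t powr Q' * N)"
            using c1(3) N unfolding QQ tw_def by (intro ennreal_leI mult_right_mono) auto
          finally show "pmass M Q' (V m m) \<le> ennreal (c1 * t powr Q' * N)" .
        next
          assume Q': "q\<^sub>0 = \<infinity>"
          have "AE y in M. \<forall>F. finite F \<longrightarrow> F \<subseteq> J \<longrightarrow> (\<Sum>i\<in>F. norm (a i 0 y)) \<le> Cl * C * t"
            using am ab[of 0] by (intro tower_family_A_sum(2)[OF tf t C0(2) N(2) Cl0 _ _ Q']) auto
          then show "AE y in M. norm (V m m y) \<le> c1 * t"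
          proof eventually_elim
            case (elim y)
            have "norm (V m m y) \<le> Cl * C * t" using elim I Vle'[of y] by (meson order_trans)
            also have "\<dots> \<le> c1 * t" using c1(2) t by (intro mult_right_mono) auto
            finally show ?case .
          qed
        qed
        also have "\<dots> \<le> ennreal ((KW * c1 + K1 * c4) * N)"
          using K1 c4 N by (intro ennreal_leI mult_right_mono) auto
        finally show ?thesis using True sm by (simp add: \<theta>_def)
      next
        \<comment> \<open>Here \<open>V\<close> contains a power of \<open>b y - c i\<close> in
          general, and the induction hypothesis at the exponent \<open>q\<close> takes over.\<close>
        case False
        then have lm: "l < m" using vsl by simp
        have \<theta>t: "0 < \<theta> * t" using \<theta> t by simp
        have "emeasure M {y. \<theta> * t < norm (commutator T b l (V s l) y)} \<le> ennreal (K1 / (\<theta> * t) powr q) * pmass M q (V s l)"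
          using cw[OF lm] b VL[OF vsl(3)] \<theta>t by (simp add: commutator_weak_def)
        also have "\<dots> \<le> ennreal (K1 / (\<theta> * t) powr q) * ennreal (c4 * t powr q * N)"
        proof (rule mult_left_mono)
          have "pmass M q (V s l) \<le> (\<integral>\<^sup>+y. ennreal ((\<Sum>i\<in>I. norm (b y - c i) ^ (s - l) * norm (a i (m - s) y)) powr q) \<partial>M)"
            unfolding pmass_def using q1 Vle by (intro nn_integral_mono ennreal_leI powr_mono2) auto
          also have "\<dots> \<le> ennreal (C powr q * (Ca * Cl powr q) * tower_const \<beta> * t powr q * N)"
            unfolding c_def using vsl m by (intro Ca(2)[OF b1 tf t C0(2) N(2) Cl0 am ab _ I]) auto
          finally show "pmass M q (V s l) \<le> ennreal (c4 * t powr q * N)" by (simp add: c4_def tw_def)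
        qed simp
        also have "\<dots> = ennreal (K1 / (\<theta> * t) powr q * (c4 * t powr q * N))"
          using K1 by (subst ennreal_mult'[symmetric]) auto
        also have "\<dots> \<le> ennreal ((KW * c1 + K1 * c4) * N)"
        proof (rule ennreal_leI)
          have "1 \<le> \<theta> powr q" using \<theta> q1 by (intro ge_one_powr_ge_zero) auto
          have "K1 / (\<theta> * t) powr q * (c4 * t powr q * N) = K1 * c4 * N / \<theta> powr q"
            using \<theta> t by (simp add: powr_mult)
          also have "\<dots> \<le> K1 * c4 * N / 1"
            using \<open>1 \<le> \<theta> powr q\<close> K1 c4 N by (intro divide_left_mono) auto
          also have "\<dots> \<le> (KW * c1 + K1 * c4) * N"
            using KW c1 N by (simp add: distrib_right)
          finally show "K1 / (\<theta> * t) powr q * (c4 * t powr q * N) \<le> (KW * c1 + K1 * c4) * N" .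
        qed
        finally show ?thesis by simp
      qed
      then show "emeasure M {y\<in>space M. \<theta> * t < norm (commutator T b (snd v) (V (fst v) (snd v)) y)} \<le> ennreal ((KW * c1 + K1 * c4) * N)"
        using vsl by simp
    qed
    have choose_sum: "(\<Sum>s\<le>m'. real (m' choose s)) = 2 ^ m'" for m' :: nat
      using choose_row_sum[of m'] by (metis of_nat_sum of_nat_power of_nat_numeral)
    have sub: "{y. cc * t < norm (commutator T b m f y) \<and> norm (b y) \<le> R} \<subseteq> E1 \<union> (E2 \<union> (E3 \<union> (E4 \<union> E5)))"
    proof (rule subsetI, rule ccontr)
      fix z assume z: "z \<in> {y. cc * t < norm (commutator T b m f y) \<and> norm (b y) \<le> R}" and nz: "z \<notin> E1 \<union> (E2 \<union> (E3 \<union> (E4 \<union> E5)))"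
      have bz: "norm (b z) \<le> R" using z by simp
      have t1: "norm (commutator T b m (restr Z f) z) \<le> (KW + 1) * t" using nz by (simp add: E1_def not_less)
      have t2: "(\<Sum>s\<le>m. real (m choose s) * norm (b z) ^ s * norm (T (restr (Y n) (\<lambda>y. b y ^ (m - s) * f y)) z)) \<le> t"
      proof -
        have "(\<Sum>s\<le>m. real (m choose s) * norm (b z) ^ s * norm (T (restr (Y n) (\<lambda>y. b y ^ (m - s) * f y)) z)) \<le>
          (\<Sum>s\<le>m. real (m choose s) * (1 + R) ^ m * \<tau>)"
        proof (intro sum_mono mult_mono mult_left_mono)
          fix s assume s: "s \<in> {..m}"
          have "norm (b z) ^ s \<le> (1 + R) ^ s" using bz by (intro power_mono) auto
          also have "\<dots> \<le> (1 + R) ^ m" using s R by (intro power_increasing) auto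
          finally show "norm (b z) ^ s \<le> (1 + R) ^ m" .
          have "z \<notin> {y. \<tau> < norm (T (restr (Y n) (\<lambda>y. b y ^ (m - s) * f y)) y)}" using nz by (auto simp: E2_def)
          then show "norm (T (restr (Y n) (\<lambda>y. b y ^ (m - s) * f y)) z) \<le> \<tau>" by simp
        qed (use R in auto)
        also have "\<dots> = 2 ^ m * (1 + R) ^ m * \<tau>" by (simp add: sum_distrib_right[symmetric] choose_sum)
        also have "\<dots> = t" using R by (simp add: \<tau>_def)
        finally show ?thesis .
      qed
      have t3: "(\<Sum>i\<in>I. \<Sum>s\<le>m. real (m choose s) * norm (b z - c i) ^ s * norm (T (\<lambda>y. g i (m - s) y - a i (m - s) y) z)) \<le> t"
      proof -
        have "ennreal (\<Sum>i\<in>I. \<Sum>s\<le>m. real (m choose s) * norm (b z - c i) ^ s * norm (T (\<lambda>y. g i (m - s) y - a i (m - s) y) z)) = (\<Sum>i\<in>I. \<phi> i z)"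
          unfolding \<phi>_def
          by (subst sum_ennreal[symmetric], simp add: sum_nonneg, intro sum.cong refl, subst sum_ennreal[symmetric], simp, intro sum.cong refl)
            (simp add: ennreal_mult'[symmetric] mult.assoc)
        also have "\<dots> = (\<Sum>i\<in>I. if i \<in> J then \<phi> i z else 0)" using I by (intro sum.cong) auto
        also have "\<dots> \<le> (\<Sum>i. if i \<in> J then \<phi> i z else 0)" by (intro sum_le_suminf I) auto
        also have "\<dots> \<le> ennreal t" using nz by (intro E4) auto
        finally show ?thesis using t by (subst (asm) ennreal_le_iff) auto
      qed
      have t4: "(\<Sum>i\<in>I. \<Sum>s\<le>m. real (m choose s) * norm (b z - c i) ^ s * norm (T (a2 i (m - s)) z)) \<le> t"
      proof -
        have "(\<Sum>i\<in>I. \<Sum>s\<le>m. real (m choose s) * norm (b z - c i) ^ s * norm (T (a2 i (m - s)) z)) \<le>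
          (\<Sum>i\<in>I. \<Sum>s\<le>m. real (m choose s) * \<Gamma> ^ m * \<tau>')"
        proof (intro sum_mono mult_mono mult_left_mono)
          fix i s assume i: "i \<in> I" and s: "s \<in> {..m}"
          have "norm (c i) \<le> (\<Sum>i\<in>I. norm (c i))" using I i by (intro member_le_sum) auto
          then have "norm (b z - c i) \<le> \<Gamma>" using norm_triangle_ineq4[of "b z" "c i"] bz by (simp add: \<Gamma>_def)
          then have "norm (b z - c i) ^ s \<le> \<Gamma> ^ s" by (intro power_mono) auto
          also have "\<dots> \<le> \<Gamma> ^ m" using s \<Gamma> by (intro power_increasing) auto
          finally show "norm (b z - c i) ^ s \<le> \<Gamma> ^ m" .
          have "(i, m - s) \<in> IM" using i by (simp add: IM_def)
          then have "z \<notin> {y. \<tau>' < norm (T (restr (- S) (a (fst (i, m - s)) (snd (i, m - s)))) y)}" using nz unfolding E3_def by blast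
          then show "norm (T (a2 i (m - s)) z) \<le> \<tau>'" by (simp add: a2_def)
        qed (use \<Gamma> in auto)
        also have "\<dots> = real (card I) * (2 ^ m * \<Gamma> ^ m * \<tau>')" by (simp add: sum_distrib_right[symmetric] choose_sum)
        also have "\<dots> \<le> real (card I + 1) * (2 ^ m * \<Gamma> ^ m * \<tau>')" using \<Gamma> \<tau>' by (intro mult_right_mono) auto
        also have "\<dots> = t" using \<Gamma> by (simp add: \<tau>'_def)
        finally show ?thesis .
      qed
      have t5: "(\<Sum>s\<le>m. \<Sum>l\<le>s. real (m choose s) * real (s choose l) * norm (commutator T b l (V s l) z)) \<le> 3 ^ m * \<theta> * t"
      proof -
        have "(\<Sum>s\<le>m. \<Sum>l\<le>s. real (m choose s) * real (s choose l) * norm (commutator T b l (V s l) z)) \<le>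
          (\<Sum>s\<le>m. \<Sum>l\<le>s. real (m choose s) * real (s choose l) * (\<theta> * t))"
        proof (intro sum_mono mult_left_mono)
          fix s l assume "s \<in> {..m}" "l \<in> {..s}"
          then have "(s, l) \<in> SL" by (simp add: SL_def)
          then have "z \<notin> {y\<in>space M. \<theta> * t < norm (commutator T b (snd (s, l)) (V (fst (s, l)) (snd (s, l))) y)}" using nz unfolding E5_def by blast
          then show "norm (commutator T b l (V s l) z) \<le> \<theta> * t" by simp
        qed auto
        also have "\<dots> = (\<Sum>s\<le>m. real (m choose s) * 2 ^ s) * (\<theta> * t)"
          by (simp add: sum_distrib_right[symmetric] sum_distrib_left[symmetric] choose_sum)
        also have "(\<Sum>s\<le>m. real (m choose s) * 2 ^ s) = 3 ^ m"
          using binomial_ring[of "2::real" 1 m] by (simp add: mult.commute)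
        finally show ?thesis by simp
      qed
      have "norm (commutator T b m f z) \<le> (KW + 1) * t + t + t + t + 3 ^ m * \<theta> * t"
        using split[of z] t1 t2 t3 t4 t5 by linarith
      also have "\<dots> = cc * t" by (simp add: cc_def algebra_simps)
      finally show False using z by simp
    qed
    have "emeasure M {y. cc * t < norm (commutator T b m f y) \<and> norm (b y) \<le> R} \<le> emeasure M (E1 \<union> (E2 \<union> (E3 \<union> (E4 \<union> E5))))"
      using E1m E2m E3m E4m E5m by (intro emeasure_mono sub) auto
    also have "\<dots> \<le> emeasure M E1 + (emeasure M E2 + (emeasure M E3 + (emeasure M E4 + emeasure M E5)))"
      using E1m E2m E3m E4m E5m
      by (intro order_trans[OF emeasure_subadditive] add_left_mono order_refl) auto
    also have "\<dots> \<le> ennreal (KW * 1 * N) + (ennreal N + (ennreal N + (ennreal ((Cd * 4 powr D + 2 ^ m * c2) * C * N) + ennreal (c5 * N))))"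
      by (intro add_mono E1 E2 E3 E4 E5)
    also have "\<dots> = ennreal (KW * 1 * N + (N + (N + ((Cd * 4 powr D + 2 ^ m * c2) * C * N + c5 * N))))"
      using KW N K0 c5 by (simp only: ennreal_plus[symmetric] mult_nonneg_nonneg add_nonneg_nonneg mult_1_right)
    also have "KW * 1 * N + (N + (N + ((Cd * 4 powr D + 2 ^ m * c2) * C * N + c5 * N))) = K * (X / t powr p)"
      by (simp add: K_def N_def[symmetric] algebra_simps)
    finally show "emeasure M {y. cc * t < norm (commutator T b m f y) \<and> norm (b y) \<le> R} \<le> ennreal (K * (X / t powr p))" .
  qed
qed

end

section \<open>Interpolation\<close>

lemma nn_integral_powr_from_0:
  fixes c e :: real
  assumes "-1 < e" "0 \<le> c"
  shows "(\<integral>\<^sup>+t. ennreal (t powr e) * indicator {0..c} t \<partial>lborel) = ennreal (c powr (e + 1) / (e + 1))"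
  by (rule nn_integral_has_integral_lebesgue'[OF _ has_integral_powr_from_0]) (use assms in auto)

lemma nn_integral_powr_to_inf:
  fixes c e :: real
  assumes "e < -1" "0 < c"
  shows "(\<integral>\<^sup>+t. ennreal (t powr e) * indicator {c..} t \<partial>lborel) = ennreal (- (c powr (e + 1)) / (e + 1))"
  by (rule nn_integral_has_integral_lebesgue'[OF _ has_integral_powr_to_inf]) (use assms in auto)

text \<open>Marcinkiewicz interpolation in terms of level sets: \<open>F\<close> is integrated along
  its levels, and Fubini turns the two terms of \<open>lev\<close> into integrals of powers of
  \<open>t\<close>. For fixed \<open>y\<close> the first runs over small \<open>t\<close> and
  converges because \<open>p1 < p\<close>, the second over large \<open>t\<close> and converges
  because \<open>p < q\<close>.\<close>

lemma marcinkiewicz_integration: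
  fixes F G :: "'a \<Rightarrow> real"
  assumes sf: "sigma_finite_measure M" and Fm[measurable]: "F \<in> borel_measurable M" and Gm[measurable]: "G \<in> borel_measurable M"
    and pos: "\<And>y. 0 \<le> F y" "\<And>y. 0 \<le> G y"
    and p: "0 < p1" "p1 < p" "p < q" and a: "0 < a" and AB: "0 \<le> A" "0 \<le> B"
    and lev: "\<And>t. 0 < t \<Longrightarrow> emeasure M {y\<in>space M. t < F y} \<le>
      ennreal (A / t powr p1) * (\<integral>\<^sup>+y. ennreal (G y powr p1) * indicator {y. a * t < G y} y \<partial>M) +
      ennreal (B / t powr q) * (\<integral>\<^sup>+y. ennreal (G y powr q) * indicator {y. G y \<le> a * t} y \<partial>M)"
  shows "(\<integral>\<^sup>+y. ennreal (F y powr p) \<partial>M) \<le>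
    ennreal (p * (A * 2 powr p1 * (2 / a) powr (p - p1) / (p - p1) + B * 2 powr q * (2 / a) powr (p - q) / (q - p))) *
    (\<integral>\<^sup>+y. ennreal (G y powr p) \<partial>M)"
proof -
  interpret M: sigma_finite_measure M by (rule sf)
  interpret P: pair_sigma_finite M lborel by standard
  have pp: "0 < p" using p by simp
  define A' where "A' = p * A * 2 powr p1"
  define B' where "B' = p * B * 2 powr q"
  have AB': "0 \<le> A'" "0 \<le> B'" using AB pp by (auto simp: A'_def B'_def)
  define h1 where "h1 y t = ennreal (A' * G y powr p1) * (ennreal (t powr (p - 1 - p1)) * (if 0 < t \<and> a * t / 2 < G y then 1 else 0))" for y t
  define h2 where "h2 y t = ennreal (B' * G y powr q) * (ennreal (t powr (p - 1 - q)) * (if 0 < t \<and> G y \<le> a * t / 2 then 1 else 0))" for y t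
  have h1m[measurable]: "(\<lambda>(y, t). h1 y t) \<in> borel_measurable (M \<Otimes>\<^sub>M lborel)" unfolding h1_def by measurable
  have h2m[measurable]: "(\<lambda>(y, t). h2 y t) \<in> borel_measurable (M \<Otimes>\<^sub>M lborel)" unfolding h2_def by measurable
  have h1y: "(\<integral>\<^sup>+t. h1 y t \<partial>lborel) \<le> ennreal (A' * (2 / a) powr (p - p1) / (p - p1)) * ennreal (G y powr p)" for y
  proof -
    have c0: "0 \<le> 2 * G y / a" using a pos by simp
    have "(\<integral>\<^sup>+t. h1 y t \<partial>lborel) \<le> (\<integral>\<^sup>+t. ennreal (A' * G y powr p1) * (ennreal (t powr (p - 1 - p1)) * indicator {0..2 * G y / a} t) \<partial>lborel)"
      unfolding h1_def using a by (intro nn_integral_mono mult_left_mono) (auto simp: field_simps split: split_indicator)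
    also have "\<dots> = ennreal (A' * G y powr p1) * ennreal ((2 * G y / a) powr (p - 1 - p1 + 1) / (p - 1 - p1 + 1))"
      using p by (subst nn_integral_cmult) (measurable, subst nn_integral_powr_from_0[OF _ c0], auto)
    also have "\<dots> = ennreal (A' * G y powr p1 * ((2 / a) powr (p - p1) * G y powr (p - p1) / (p - p1)))"
    proof -
      have "(2 * G y / a) powr (p - p1) = (2 / a) powr (p - p1) * G y powr (p - p1)"
        by (simp add: powr_mult powr_divide)
      then show ?thesis using AB' by (simp add: ennreal_mult'[symmetric])
    qed
    also have "A' * G y powr p1 * ((2 / a) powr (p - p1) * G y powr (p - p1) / (p - p1)) =
      A' * (2 / a) powr (p - p1) / (p - p1) * (G y powr p1 * G y powr (p - p1))"
      by simp
    also have "G y powr p1 * G y powr (p - p1) = G y powr p" by (simp add: powr_add[symmetric])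
    finally show ?thesis by (simp add: ennreal_mult''[symmetric])
  qed
  have h2y: "(\<integral>\<^sup>+t. h2 y t \<partial>lborel) \<le> ennreal (B' * (2 / a) powr (p - q) / (q - p)) * ennreal (G y powr p)" for y
  proof (cases "G y = 0")
    case True
    then show ?thesis by (simp add: h2_def)
  next
    case False
    then have Gp: "0 < G y" using pos[of y] by simp
    have c0: "0 < 2 * G y / a" using a Gp by simp
    have "(\<integral>\<^sup>+t. h2 y t \<partial>lborel) \<le> (\<integral>\<^sup>+t. ennreal (B' * G y powr q) * (ennreal (t powr (p - 1 - q)) * indicator {2 * G y / a..} t) \<partial>lborel)"
      unfolding h2_def using a by (intro nn_integral_mono mult_left_mono) (auto simp: field_simps split: split_indicator)
    also have "\<dots> = ennreal (B' * G y powr q) * ennreal (- ((2 * G y / a) powr (p - 1 - q + 1)) / (p - 1 - q + 1))"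
      using p by (subst nn_integral_cmult) (measurable, subst nn_integral_powr_to_inf[OF _ c0], auto)
    also have "- ((2 * G y / a) powr (p - 1 - q + 1)) / (p - 1 - q + 1) = (2 / a) powr (p - q) * G y powr (p - q) / (q - p)"
    proof -
      have "(2 * G y / a) powr (p - q) = (2 / a) powr (p - q) * G y powr (p - q)"
        by (simp add: powr_mult powr_divide)
      then show ?thesis using p by (simp add: divide_simps) (simp add: algebra_simps)
    qed
    also have "ennreal (B' * G y powr q) * ennreal ((2 / a) powr (p - q) * G y powr (p - q) / (q - p)) =
      ennreal (B' * G y powr q * ((2 / a) powr (p - q) * G y powr (p - q) / (q - p)))"
      using AB' by (simp add: ennreal_mult'[symmetric])
    also have "B' * G y powr q * ((2 / a) powr (p - q) * G y powr (p - q) / (q - p)) =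
      B' * (2 / a) powr (p - q) / (q - p) * (G y powr q * G y powr (p - q))"
      by simp
    also have "G y powr q * G y powr (p - q) = G y powr p" by (simp add: powr_add[symmetric])
    finally show ?thesis by (simp add: ennreal_mult''[symmetric])
  qed
  \<comment> \<open>The levels are taken with \<open>t \<le> F y\<close>, while \<open>lev\<close>
    speaks of strict inequality. It is therefore applied at \<open>t / 2\<close>, which is the
    origin of the factors \<open>2 powr p1\<close> and \<open>2 powr q\<close> and of the 2 in
    \<open>2 / a\<close>.\<close>
  define l where "l y t = ennreal p * (ennreal (t powr (p - 1)) * (if 0 \<le> t \<and> t \<le> F y then 1 else 0))" for y t
  have lm: "(\<lambda>(y, t). l y t) \<in> borel_measurable (M \<Otimes>\<^sub>M lborel)" unfolding l_def by measurable
  have "(\<integral>\<^sup>+y. ennreal (F y powr p) \<partial>M) = (\<integral>\<^sup>+y. \<integral>\<^sup>+t. l y t \<partial>lborel \<partial>M)"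
  proof (rule nn_integral_cong)
    fix y
    have "(\<integral>\<^sup>+t. l y t \<partial>lborel) = (\<integral>\<^sup>+t. ennreal p * (ennreal (t powr (p - 1)) * indicator {0..F y} t) \<partial>lborel)"
      unfolding l_def by (intro nn_integral_cong) (auto split: split_indicator)
    also have "\<dots> = ennreal p * ennreal (F y powr (p - 1 + 1) / (p - 1 + 1))"
      using pp pos by (subst nn_integral_cmult) (measurable, subst nn_integral_powr_from_0, auto)
    also have "\<dots> = ennreal (F y powr p)" using pp by (simp add: ennreal_mult'[symmetric])
    finally show "ennreal (F y powr p) = (\<integral>\<^sup>+t. l y t \<partial>lborel)" by simp
  qed
  also have "\<dots> = (\<integral>\<^sup>+t. \<integral>\<^sup>+y. l y t \<partial>M \<partial>lborel)"
    using P.Fubini'[OF lm] by simp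
  also have "\<dots> \<le> (\<integral>\<^sup>+t. (\<integral>\<^sup>+y. h1 y t \<partial>M) + (\<integral>\<^sup>+y. h2 y t \<partial>M) \<partial>lborel)"
  proof (rule nn_integral_mono)
    fix t :: real
    show "(\<integral>\<^sup>+y. l y t \<partial>M) \<le> (\<integral>\<^sup>+y. h1 y t \<partial>M) + (\<integral>\<^sup>+y. h2 y t \<partial>M)"
    proof (cases "0 < t")
      case False
      then have "l y t = 0" for y by (cases "t = 0") (auto simp: l_def)
      then show ?thesis by simp
    next
      case True
      have "(\<integral>\<^sup>+y. l y t \<partial>M) \<le> (\<integral>\<^sup>+y. ennreal (p * t powr (p - 1)) * indicator {y\<in>space M. t / 2 < F y} y \<partial>M)"
        unfolding l_def using True pp
        by (intro nn_integral_mono) (auto simp: ennreal_mult'[symmetric] split: split_indicator)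
      also have "\<dots> = ennreal (p * t powr (p - 1)) * emeasure M {y\<in>space M. t / 2 < F y}"
        by (rule nn_integral_cmult_indicator) measurable
      also have "\<dots> \<le> ennreal (p * t powr (p - 1)) *
        (ennreal (A / (t / 2) powr p1) * (\<integral>\<^sup>+y. ennreal (G y powr p1) * indicator {y. a * (t / 2) < G y} y \<partial>M) +
         ennreal (B / (t / 2) powr q) * (\<integral>\<^sup>+y. ennreal (G y powr q) * indicator {y. G y \<le> a * (t / 2)} y \<partial>M))"
        using True by (intro mult_left_mono lev) auto
      also have "\<dots> = ennreal (p * t powr (p - 1) * (A / (t / 2) powr p1)) * (\<integral>\<^sup>+y. ennreal (G y powr p1) * indicator {y. a * (t / 2) < G y} y \<partial>M) +
         ennreal (p * t powr (p - 1) * (B / (t / 2) powr q)) * (\<integral>\<^sup>+y. ennreal (G y powr q) * indicator {y. G y \<le> a * (t / 2)} y \<partial>M)"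
        using pp by (simp only: distrib_left mult.assoc[symmetric]) (simp add: ennreal_mult'[symmetric])
      also have "p * t powr (p - 1) * (A / (t / 2) powr p1) = A' * t powr (p - 1 - p1)"
        using True by (simp add: A'_def powr_divide powr_diff)
      also have "p * t powr (p - 1) * (B / (t / 2) powr q) = B' * t powr (p - 1 - q)"
        using True by (simp add: B'_def powr_divide powr_diff)
      also have "ennreal (A' * t powr (p - 1 - p1)) * (\<integral>\<^sup>+y. ennreal (G y powr p1) * indicator {y. a * (t / 2) < G y} y \<partial>M) = (\<integral>\<^sup>+y. h1 y t \<partial>M)"
      proof -
        have "(\<lambda>y. ennreal (G y powr p1) * (if a * t / 2 < G y then 1 else 0)) \<in> borel_measurable M" by measurable
        then have "(\<integral>\<^sup>+y. ennreal (A' * t powr (p - 1 - p1)) * (ennreal (G y powr p1) * (if a * t / 2 < G y then 1 else 0)) \<partial>M) =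
          ennreal (A' * t powr (p - 1 - p1)) * (\<integral>\<^sup>+y. ennreal (G y powr p1) * (if a * t / 2 < G y then 1 else 0) \<partial>M)"
          by (rule nn_integral_cmult)
        moreover have "(\<integral>\<^sup>+y. ennreal (A' * t powr (p - 1 - p1)) * (ennreal (G y powr p1) * (if a * t / 2 < G y then 1 else 0)) \<partial>M) = (\<integral>\<^sup>+y. h1 y t \<partial>M)"
          using True AB' by (intro nn_integral_cong) (auto simp: h1_def ennreal_mult'[symmetric] mult_ac)
        moreover have "(\<integral>\<^sup>+y. ennreal (G y powr p1) * (if a * t / 2 < G y then 1 else 0) \<partial>M) = (\<integral>\<^sup>+y. ennreal (G y powr p1) * indicator {y. a * (t / 2) < G y} y \<partial>M)"
          by (intro nn_integral_cong) (auto split: split_indicator)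
        ultimately show ?thesis by simp
      qed
      also have "ennreal (B' * t powr (p - 1 - q)) * (\<integral>\<^sup>+y. ennreal (G y powr q) * indicator {y. G y \<le> a * (t / 2)} y \<partial>M) = (\<integral>\<^sup>+y. h2 y t \<partial>M)"
      proof -
        have "(\<lambda>y. ennreal (G y powr q) * (if G y \<le> a * t / 2 then 1 else 0)) \<in> borel_measurable M" by measurable
        then have "(\<integral>\<^sup>+y. ennreal (B' * t powr (p - 1 - q)) * (ennreal (G y powr q) * (if G y \<le> a * t / 2 then 1 else 0)) \<partial>M) =
          ennreal (B' * t powr (p - 1 - q)) * (\<integral>\<^sup>+y. ennreal (G y powr q) * (if G y \<le> a * t / 2 then 1 else 0) \<partial>M)"
          by (rule nn_integral_cmult)
        moreover have "(\<integral>\<^sup>+y. ennreal (B' * t powr (p - 1 - q)) * (ennreal (G y powr q) * (if G y \<le> a * t / 2 then 1 else 0)) \<partial>M) = (\<integral>\<^sup>+y. h2 y t \<partial>M)"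
          using True AB' by (intro nn_integral_cong) (auto simp: h2_def ennreal_mult'[symmetric] mult_ac)
        moreover have "(\<integral>\<^sup>+y. ennreal (G y powr q) * (if G y \<le> a * t / 2 then 1 else 0) \<partial>M) = (\<integral>\<^sup>+y. ennreal (G y powr q) * indicator {y. G y \<le> a * (t / 2)} y \<partial>M)"
          by (intro nn_integral_cong) (auto split: split_indicator)
        ultimately show ?thesis by simp
      qed
      finally show ?thesis .
    qed
  qed
  also have "\<dots> = (\<integral>\<^sup>+t. \<integral>\<^sup>+y. h1 y t \<partial>M \<partial>lborel) + (\<integral>\<^sup>+t. \<integral>\<^sup>+y. h2 y t \<partial>M \<partial>lborel)"
    by (intro nn_integral_add) measurable
  also have "\<dots> = (\<integral>\<^sup>+y. \<integral>\<^sup>+t. h1 y t \<partial>lborel \<partial>M) + (\<integral>\<^sup>+y. \<integral>\<^sup>+t. h2 y t \<partial>lborel \<partial>M)"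
    using P.Fubini'[OF h1m] P.Fubini'[OF h2m] by simp
  also have "\<dots> \<le> (\<integral>\<^sup>+y. ennreal (A' * (2 / a) powr (p - p1) / (p - p1)) * ennreal (G y powr p) \<partial>M) +
      (\<integral>\<^sup>+y. ennreal (B' * (2 / a) powr (p - q) / (q - p)) * ennreal (G y powr p) \<partial>M)"
    by (intro add_mono nn_integral_mono h1y h2y)
  also have "\<dots> = ennreal (A' * (2 / a) powr (p - p1) / (p - p1)) * (\<integral>\<^sup>+y. ennreal (G y powr p) \<partial>M) +
      ennreal (B' * (2 / a) powr (p - q) / (q - p)) * (\<integral>\<^sup>+y. ennreal (G y powr p) \<partial>M)"
    by (subst (1 2) nn_integral_cmult) auto
  also have "\<dots> = ennreal (A' * (2 / a) powr (p - p1) / (p - p1) + B' * (2 / a) powr (p - q) / (q - p)) * (\<integral>\<^sup>+y. ennreal (G y powr p) \<partial>M)"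
    using AB' p by (subst ennreal_plus) (auto simp: distrib_right)
  also have "A' * (2 / a) powr (p - p1) / (p - p1) + B' * (2 / a) powr (p - q) / (q - p) =
    p * (A * 2 powr p1 * (2 / a) powr (p - p1) / (p - p1) + B * 2 powr q * (2 / a) powr (p - q) / (q - p))"
    by (simp add: A'_def B'_def distrib_left mult.assoc)
  finally show ?thesis .
qed

section \<open>Weak and strong type for commutators of all orders\<close>

context cz_operator
begin

text \<open>The exponent is generalised in the induction because the step for \<open>p\<close> uses
  lower orders at a larger exponent. The restriction \<open>norm (b y) \<le> R\<close> disappears by
  exhausting the space with \<open>R = n\<close>, since the constants do not depend on
  \<open>R\<close>.\<close>

lemma commutator_weak_all:
  assumes KW: "0 \<le> KW" and m: "m \<le> k" and p: "p\<^sub>0 < p" "ereal p < q\<^sub>0"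
  shows "\<exists>K\<ge>0. commutator_weak KW m p K"
  using m p
proof (induction m arbitrary: p rule: less_induct)
  case (less m)
  show ?case
  proof (cases "m = 0")
    case True
    then show ?thesis using commutator_weak_0 less.prems by simp
  next
    case False
    have pp: "0 < p" using less.prems p0 by simp
    have IH: "\<exists>K\<ge>0. commutator_weak KW l q K" if "l < m" "p\<^sub>0 < q" "ereal q < q\<^sub>0" for l q
      using less.IH[of l q] that less.prems(1) by simp
    have m1: "1 \<le> m" using False by simp
    obtain c K where cK: "0 < c" "0 \<le> K" and lev: "\<And>b f t X R. admissible KW b \<Longrightarrow> f \<in> Linf_c M \<Longrightarrow> 0 < t \<Longrightarrow> 0 < X \<Longrightarrow> 0 \<le> R \<Longrightarrow>
      pmass M p f \<le> ennreal X \<Longrightarrow>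
      emeasure M {y. c * t < norm (commutator T b m f y) \<and> norm (b y) \<le> R} \<le> ennreal (K * (X / t powr p))"
      by (rule commutator_level[OF m1 less.prems(1) KW less.prems(2,3) IH]) (assumption | rule that)+
    show ?thesis
    proof (intro exI[of _ "K * c powr p"] conjI)
      show "0 \<le> K * c powr p" using cK by simp
      show "commutator_weak KW m p (K * c powr p)"
        unfolding commutator_weak_def
      proof (intro allI impI ballI)
        fix b f :: "'a \<Rightarrow> 'k" and t :: real assume b: "admissible KW b" and f: "f \<in> Linf_c M" and t: "0 < t"
        have cm[measurable]: "(\<lambda>y. norm (commutator T b m f y)) \<in> borel_measurable M"
          by (rule commutator_measurable[OF b less.prems(1) f])
        have bm[measurable]: "b \<in> borel_measurable M" by (rule admissible_measurable[OF b])
        have "emeasure M {y\<in>space M. c * t < norm (commutator T b m f y)} \<le> ennreal (K * (X / t powr p))"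
          if t: "0 < t" and X: "0 < X" and fX: "pmass M p f \<le> ennreal X" for t X
        proof -
          define E where "E n = {y\<in>space M. c * t < norm (commutator T b m f y) \<and> norm (b y) \<le> real n}" for n :: nat
          have Em: "E n \<in> sets M" for n unfolding E_def by measurable
          have "{y\<in>space M. c * t < norm (commutator T b m f y)} = (\<Union>n. E n)"
            unfolding E_def using real_arch_simple by auto
          then have "emeasure M {y\<in>space M. c * t < norm (commutator T b m f y)} = (SUP n. emeasure M (E n))"
            using Em by (subst SUP_emeasure_incseq) (auto simp: incseq_def E_def)
          also have "\<dots> \<le> ennreal (K * (X / t powr p))"
            using lev[OF b f t X _ fX] by (intro SUP_least) (simp add: E_def)
          finally show ?thesis .
        qed
        then show "emeasure M {y. t < norm (commutator T b m f y)} \<le> ennreal (K * c powr p / t powr p) * pmass M p f"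
          using weak_from_level_estimate[OF pmass_Linf_c_finite[OF f pp] pp cK t, of "commutator T b m f"] by simp
      qed
    qed
  qed
qed

lemma commutator_add:
  assumes b: "commutators_defined M \<D> b k" and m: "m \<le> k" and f: "f \<in> Linf_c M" and g: "g \<in> Linf_c M"
  shows "norm (commutator T b m (\<lambda>y. f y + g y) x) \<le> norm (commutator T b m f x) + norm (commutator T b m g x)"
proof -
  have "(\<lambda>y. (b x - b y) ^ m * f y) \<in> \<D>" "(\<lambda>y. (b x - b y) ^ m * g y) \<in> \<D>"
    using b m f g unfolding commutators_defined_def by blast+
  then show ?thesis using T_add unfolding commutator_def by (simp add: distrib_left)
qed

lemma commutator_strong:
  assumes KW: "0 \<le> KW" and m: "1 \<le> m" "m \<le> k" and p: "p\<^sub>0 < p" "ereal p < q\<^sub>0"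
  shows "\<exists>C\<ge>0. \<forall>b. admissible KW b \<longrightarrow> (\<forall>f\<in>Linf_c M. pmass M p (commutator T b m f) \<le> ennreal C * pmass M p f)"
proof -
  define p1 where "p1 = (p\<^sub>0 + p) / 2"
  have p1: "p\<^sub>0 < p1" "p1 < p" "0 < p1" "0 < p" using p p0 by (auto simp: p1_def)
  have "ereal p1 < ereal p" using p1 by simp
  then have p1q: "ereal p1 < q\<^sub>0" using p(2) by (rule less_trans)
  obtain K1 where K1: "0 \<le> K1" "commutator_weak KW m p1 K1" using commutator_weak_all[OF KW m(2) p1(1) p1q] by blast
  \<comment> \<open>For infinite \<open>q\<^sub>0\<close> any exponent above \<open>p\<close> will
    do, because \<open>B = 0\<close> then removes the second term of the level estimate.\<close>
  define q where "q = (if q\<^sub>0 = \<infinity> then p + 1 else real_of_ereal q\<^sub>0)"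
  have q: "p < q" using p q0_pos by (cases q\<^sub>0) (auto simp: q_def)
  \<comment> \<open>The part of \<open>f\<close> below \<open>a * t\<close> satisfies
    \<open>KW * (a * t) \<le> t / 2\<close>; so for infinite \<open>q\<^sub>0\<close> its commutator
    exceeds \<open>t / 2\<close> on a null set only.\<close>
  define a where "a = 1 / (2 * (KW + 1))"
  have a: "0 < a" using KW by (simp add: a_def)
  define A where "A = K1 * 2 powr p1"
  define B where "B = (if q\<^sub>0 = \<infinity> then 0 else KW * 2 powr q)"
  have AB: "0 \<le> A" "0 \<le> B" using K1 KW by (auto simp: A_def B_def)
  define C where "C = p * (A * 2 powr p1 * (2 / a) powr (p - p1) / (p - p1) + B * 2 powr q * (2 / a) powr (p - q) / (q - p))"
  have C: "0 \<le> C" unfolding C_def using AB p1 q by (intro mult_nonneg_nonneg add_nonneg_nonneg divide_nonneg_pos) auto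
  show ?thesis
  proof (intro exI[of _ C] conjI C allI impI ballI)
    fix b f :: "'a \<Rightarrow> 'k" assume b: "admissible KW b" and f: "f \<in> Linf_c M"
    have cd: "commutators_defined M \<D> b k" using b by (simp add: admissible_def)
    have wb: "weak_bound M q\<^sub>0 (Linf_c M) (commutator T b m) KW" using b m by (auto simp: admissible_def)
    have fm[measurable]: "f \<in> borel_measurable M" by (rule Linf_c_measurable[OF f])
    have cm: "(\<lambda>y. norm (commutator T b m g y)) \<in> borel_measurable M" if "g \<in> Linf_c M" for g
      by (rule commutator_measurable[OF b m(2) that])
    show "pmass M p (commutator T b m f) \<le> ennreal C * pmass M p f"
      unfolding pmass_def C_def
    proof (rule marcinkiewicz_integration[OF sigma_finite cm[OF f] _ _ _ p1(3,2) q a AB])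
      show "(\<lambda>y. norm (f y)) \<in> borel_measurable M" by measurable
      fix t :: real assume t: "0 < t"
      define U where "U = {y. a * t < norm (f y)}"
      have "{y\<in>space M. a * t < norm (f y)} \<in> sets M" by measurable
      then have Um[measurable]: "U \<in> sets M" by (simp add: U_def)
      have Uc[measurable]: "- U \<in> sets M" using sets.compl_sets[OF Um] by (simp add: Compl_eq_Diff_UNIV)
      let ?f1 = "restr U f" and ?f2 = "restr (- U) f"
      have fL: "?f1 \<in> Linf_c M" "?f2 \<in> Linf_c M" by (intro Linf_c_restr f Um Uc)+
      have m1: "pmass M s ?f1 = (\<integral>\<^sup>+y. ennreal (norm (f y) powr s) * indicator {y. a * t < norm (f y)} y \<partial>M)" if "0 < s" for s
        unfolding U_def by (rule pmass_restr[OF that])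
      have m2: "pmass M s ?f2 = (\<integral>\<^sup>+y. ennreal (norm (f y) powr s) * indicator {y. norm (f y) \<le> a * t} y \<partial>M)" if "0 < s" for s
        unfolding pmass_restr[OF that] by (intro nn_integral_cong) (auto simp: U_def split: split_indicator)
      have sum: "norm (commutator T b m f y) \<le> norm (commutator T b m ?f1 y) + norm (commutator T b m ?f2 y)" for y
      proof -
        have "f = (\<lambda>y. ?f1 y + ?f2 y)" by (auto simp: restr_def fun_eq_iff)
        then show ?thesis using commutator_add[OF cd m(2) fL, of y] by simp
      qed
      let ?E = "\<lambda>g. {y\<in>space M. t / 2 < norm (commutator T b m g y)}"
      have Em: "?E g \<in> sets M" if "g \<in> Linf_c M" for g using cm[OF that] by measurable
      have "emeasure M {y\<in>space M. t < norm (commutator T b m f y)} \<le> emeasure M (?E ?f1 \<union> ?E ?f2)"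
      proof (rule emeasure_mono)
        show "{y\<in>space M. t < norm (commutator T b m f y)} \<subseteq> ?E ?f1 \<union> ?E ?f2"
        proof
          fix y assume "y \<in> {y\<in>space M. t < norm (commutator T b m f y)}"
          then show "y \<in> ?E ?f1 \<union> ?E ?f2" using sum[of y] by simp linarith
        qed
      qed (use Em fL in blast)
      also have "\<dots> \<le> emeasure M (?E ?f1) + emeasure M (?E ?f2)"
        by (rule emeasure_subadditive[OF Em[OF fL(1)] Em[OF fL(2)]])
      also have "\<dots> \<le> ennreal (A / t powr p1) * pmass M p1 ?f1 + ennreal (B / t powr q) * pmass M q ?f2"
      proof (rule add_mono)
        have "emeasure M (?E ?f1) \<le> ennreal (K1 / (t / 2) powr p1) * pmass M p1 ?f1"
        proof -
          have "\<forall>s>0. emeasure M {y. s < norm (commutator T b m ?f1 y)} \<le> ennreal (K1 / s powr p1) * pmass M p1 ?f1"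
            using K1(2) b fL(1) by (auto simp: commutator_weak_def)
          from spec[OF this, of "t / 2"] show ?thesis using t by (simp del: less_divide_eq_numeral1)
        qed
        also have "K1 / (t / 2) powr p1 = A / t powr p1" using t by (simp add: A_def powr_divide)
        finally show "emeasure M (?E ?f1) \<le> ennreal (A / t powr p1) * pmass M p1 ?f1" .
        show "emeasure M (?E ?f2) \<le> ennreal (B / t powr q) * pmass M q ?f2"
        proof (cases q\<^sub>0)
          case (real q')
          then have qq: "q = q'" by (simp add: q_def)
          have "emeasure M (?E ?f2) \<le> ennreal (KW / (t / 2) powr q) * pmass M q ?f2"
          proof -
            have "\<forall>s>0. emeasure M {y. s < norm (commutator T b m ?f2 y)} \<le> ennreal (KW / s powr q) * pmass M q ?f2"
              using wb fL(2) real qq by (auto simp: weak_bound_def)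
            from spec[OF this, of "t / 2"] show ?thesis using t by (simp del: less_divide_eq_numeral1)
          qed
          also have "KW / (t / 2) powr q = B / t powr q" using t real by (simp add: B_def powr_divide)
          finally show ?thesis .
        next
          case PInf
          have "AE y in M. norm (?f2 y) \<le> a * t"
            using a t by (intro AE_I2) (auto simp: restr_def U_def)
          then have "AE y in M. norm (commutator T b m ?f2 y) \<le> KW * (a * t)"
            using wb fL(2) PInf a t by (simp add: weak_bound_def)
          then have "AE y in M. \<not> (t / 2 < norm (commutator T b m ?f2 y))"
          proof eventually_elim
            case (elim y)
            have "KW * (a * t) \<le> t / 2" using KW t by (simp add: a_def field_simps)
            then show ?case using elim by simp
          qed
          then have "emeasure M (?E ?f2) = 0"
            using Em[OF fL(2)] by (subst (asm) AE_iff_measurable[OF _ refl]) (auto simp: Collect_conj_eq)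
          then show ?thesis by simp
        qed (use q0_pos in auto)
      qed
      finally show "emeasure M {y\<in>space M. t < norm (commutator T b m f y)} \<le>
        ennreal (A / t powr p1) * (\<integral>\<^sup>+y. ennreal (norm (f y) powr p1) * indicator {y. a * t < norm (f y)} y \<partial>M) +
        ennreal (B / t powr q) * (\<integral>\<^sup>+y. ennreal (norm (f y) powr q) * indicator {y. norm (f y) \<le> a * t} y \<partial>M)"
        using m1[OF p1(3)] m2[of q] q p1 by simp
    qed auto
  qed
qed

end

section \<open>Scaling in b and the strong-type bound\<close>

lemma eroot_mult:
  assumes "0 \<le> c" "0 < p" shows "eroot p (ennreal c * a) = ennreal (c powr (1 / p)) * eroot p a"
proof (cases "a = \<infinity>")
  case True
  then show ?thesis using assms by (cases "c = 0") (auto simp: eroot_def ennreal_mult_top)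
next
  case False
  then obtain a' where a': "a = ennreal a'" "0 \<le> a'" by (cases a) auto
  then show ?thesis using assms by (simp add: eroot_def ennreal_mult'[symmetric] powr_mult)
qed

lemma weak_bound_scale:
  assumes wb: "weak_bound M q\<^sub>0 X S (if q\<^sub>0 = \<infinity> then W * c else (W * c) powr real_of_ereal q\<^sub>0)"
    and c: "0 < c" and W: "0 \<le> W" and S': "\<And>f y. f \<in> X \<Longrightarrow> norm (S' f y) = norm (S f y) / c"
  shows "weak_bound M q\<^sub>0 X S' (if q\<^sub>0 = \<infinity> then W else W powr real_of_ereal q\<^sub>0)"
  unfolding weak_bound_def
proof (intro conjI allI impI ballI)
  fix q f and t :: real assume q: "q\<^sub>0 = ereal q" and f: "f \<in> X" and t: "0 < t"
  have "{y\<in>space M. t < norm (S' f y)} = {y\<in>space M. t * c < norm (S f y)}"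
    using c by (auto simp: S'[OF f] pos_less_divide_eq)
  moreover have "emeasure M {y\<in>space M. t * c < norm (S f y)} \<le> ennreal ((W * c) powr q / (t * c) powr q) * pmass M q f"
    using wb f q t c by (auto simp: weak_bound_def)
  moreover have "(W * c) powr q / (t * c) powr q = W powr q / t powr q" using W c t by (simp add: powr_mult)
  ultimately show "emeasure M {y\<in>space M. t < norm (S' f y)} \<le>
      ennreal ((if q\<^sub>0 = \<infinity> then W else W powr real_of_ereal q\<^sub>0) / t powr q) * pmass M q f"
    using q by simp
next
  fix f and B :: real assume q: "q\<^sub>0 = \<infinity>" and f: "f \<in> X" and B: "0 \<le> B" "AE y in M. norm (f y) \<le> B"
  have "AE y in M. norm (S f y) \<le> W * c * B" using wb f q B by (auto simp: weak_bound_def)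
  then show "AE y in M. norm (S' f y) \<le> (if q\<^sub>0 = \<infinity> then W else W powr real_of_ereal q\<^sub>0) * B"
    by eventually_elim (use c q in \<open>simp add: S'[OF f] pos_divide_le_eq mult_ac\<close>)
qed

lemma weak_type_bound_mono: "weak_type_bound M q X S K \<Longrightarrow> K \<le> L \<Longrightarrow> weak_type_bound M q X S L"
  unfolding weak_type_bound_def by (meson mult_right_mono order_trans zero_le)

context doubling_measure
begin

lemma BMO1_scale:
  fixes b :: "'a \<Rightarrow> 'k::{real_normed_field, banach, second_countable_topology}"
  assumes b: "b \<in> BMO M" and g: "0 < \<gamma>" and bg: "BMO_norm M b \<le> ennreal \<gamma>"
  shows "BMO1 (\<lambda>y. of_real (1 / \<gamma>) * b y)"
  unfolding BMO1_def
proof (intro conjI allI impI)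
  have bm[measurable]: "b \<in> borel_measurable M" using b by (simp add: BMO_def)
  show "(\<lambda>y. of_real (1 / \<gamma>) * b y) \<in> borel_measurable M" by measurable
  fix x :: 'a and r :: real assume r: "0 < r"
  let ?B = "ball x r" and ?c = "of_real (1 / \<gamma>) :: 'k"
  have mean: "mean M ?B (\<lambda>y. ?c * b y) = ?c * mean M ?B b" unfolding mean_def set_integral_mult_right by (simp only: mult_scaleR_right)
  have "(\<integral>\<^sup>+y\<in>?B. ennreal (norm (b y - mean M ?B b)) \<partial>M) / emeasure M ?B \<le> BMO_norm M b"
    unfolding BMO_norm_def using r by (intro SUP_upper2[of "(x, r)"]) auto
  also note bg
  finally have le: "(\<integral>\<^sup>+y\<in>?B. ennreal (norm (b y - mean M ?B b)) \<partial>M) \<le> ennreal \<gamma> * emeasure M ?B"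
    using ball_pos[OF r, of x] ball_finite[of x r]
    by (cases "emeasure M ?B") (auto simp: divide_le_posI_ennreal ennreal_divide_le_iff_real mult.commute)
  have "(\<integral>\<^sup>+y\<in>?B. ennreal (norm (?c * b y - mean M ?B (\<lambda>y. ?c * b y))) \<partial>M) =
    (\<integral>\<^sup>+y. ennreal (1 / \<gamma>) * (ennreal (norm (b y - mean M ?B b)) * indicator ?B y) \<partial>M)"
  proof (rule nn_integral_cong)
    fix y
    have "?c * b y - mean M ?B (\<lambda>y. ?c * b y) = ?c * (b y - mean M ?B b)" by (simp only: mean right_diff_distrib)
    then have "norm (?c * b y - mean M ?B (\<lambda>y. ?c * b y)) = 1 / \<gamma> * norm (b y - mean M ?B b)"
      using g by (simp add: norm_mult norm_divide)
    then show "ennreal (norm (?c * b y - mean M ?B (\<lambda>y. ?c * b y))) * indicator ?B y =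
      ennreal (1 / \<gamma>) * (ennreal (norm (b y - mean M ?B b)) * indicator ?B y)"
      using g by (simp only: ennreal_mult'[of "1 / \<gamma>"] mult.assoc) (simp add: ennreal_mult'[symmetric] mult.assoc[symmetric])
  qed
  also have "\<dots> = ennreal (1 / \<gamma>) * (\<integral>\<^sup>+y\<in>?B. ennreal (norm (b y - mean M ?B b)) \<partial>M)"
    by (rule nn_integral_cmult) measurable
  also have "\<dots> \<le> ennreal (1 / \<gamma>) * (ennreal \<gamma> * emeasure M ?B)" by (intro mult_left_mono le) simp
  also have "\<dots> = emeasure M ?B" using g by (simp add: mult.assoc[symmetric] ennreal_mult'[symmetric])
  finally show "(\<integral>\<^sup>+y\<in>?B. ennreal (norm (?c * b y - mean M ?B (\<lambda>y. ?c * b y))) \<partial>M) \<le> emeasure M ?B" .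
qed

end

context cz_operator
begin

lemma commutator_rescale:
  assumes b: "commutators_defined M \<D> b k" and g: "0 < \<gamma>" and m: "m \<le> k" and f: "f \<in> Linf_c M"
  shows "norm (commutator T (\<lambda>y. of_real (1 / \<gamma>) * b y) m f x) = norm (commutator T b m f x) / \<gamma> ^ m"
proof -
  let ?c = "of_real (1 / \<gamma>) :: 'k"
  have D: "(\<lambda>y. (b x - b y) ^ m * f y) \<in> \<D>" using b m f by (auto simp: commutators_defined_def)
  have "(?c * b x - ?c * b y) ^ m * f y = ?c ^ m * ((b x - b y) ^ m * f y)" for y
    by (simp add: right_diff_distrib[symmetric] power_mult_distrib mult.assoc del: of_real_divide)
  then have "commutator T (\<lambda>y. ?c * b y) m f x = T (\<lambda>y. ?c ^ m * ((b x - b y) ^ m * f y)) x"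
    unfolding commutator_def by (simp only:)
  then show ?thesis using g T_scale[OF D, of "?c ^ m" x]
    by (simp add: commutator_def norm_power norm_divide power_divide)
qed

lemma commutators_defined_rescale:
  assumes b: "commutators_defined M \<D> b k" and g: "0 < \<gamma>"
  shows "commutators_defined M \<D> (\<lambda>y. of_real (1 / \<gamma>) * b y) k"
  unfolding commutators_defined_def
proof (intro ballI allI impI)
  fix f :: "'a \<Rightarrow> 'k" and m and d :: 'k assume f: "f \<in> Linf_c M" and m: "m \<le> k"
  let ?c = "of_real (1 / \<gamma>) :: 'k"
  have "(\<lambda>y. ?c ^ m * ((d / ?c - b y) ^ m * f y)) \<in> \<D>"
    using b m f by (intro D_scale) (auto simp: commutators_defined_def)
  moreover have "?c ^ m * ((d / ?c - b y) ^ m * f y) = (d - ?c * b y) ^ m * f y" for y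
    using g by (simp add: mult.assoc[symmetric] power_mult_distrib[symmetric] right_diff_distrib)
  ultimately show "(\<lambda>y. (d - ?c * b y) ^ m * f y) \<in> \<D>" by (simp only:)
qed

lemma admissible_rescale:
  assumes b: "b \<in> BMO M" "commutators_defined M \<D> b k" and g: "0 < \<gamma>" and bg: "BMO_norm M b \<le> ennreal \<gamma>" and W: "0 \<le> W"
    and wt: "\<And>m. m \<in> {1..k} \<Longrightarrow> weak_type_bound M q\<^sub>0 (Linf_c M) (commutator T b m) (ennreal W * BMO_norm M b ^ m)"
  shows "admissible (if q\<^sub>0 = \<infinity> then W else W powr real_of_ereal q\<^sub>0) (\<lambda>y. of_real (1 / \<gamma>) * b y)"
  unfolding admissible_def
proof (intro conjI ballI)
  let ?b = "\<lambda>y. of_real (1 / \<gamma>) * b y"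
  show "BMO1 ?b" by (rule BMO1_scale[OF b(1) g bg])
  show "commutators_defined M \<D> ?b k" by (rule commutators_defined_rescale[OF b(2) g])
  fix m assume m: "m \<in> {1..k}"
  have mk: "m \<le> k" using m by simp
  note sc = commutator_rescale[OF b(2) g mk]
  have "ennreal W * BMO_norm M b ^ m \<le> ennreal W * ennreal \<gamma> ^ m" by (intro mult_left_mono power_mono bg) auto
  also have "\<dots> = ennreal (W * \<gamma> ^ m)" using W g by (simp add: ennreal_mult ennreal_power)
  finally have "weak_type_bound M q\<^sub>0 (Linf_c M) (commutator T b m) (ennreal (W * \<gamma> ^ m))"
    using wt[OF m] weak_type_bound_mono by blast
  from weak_boundI[OF this Linf_c_subset_Lspace[OF q0_pos] q0_pos] W g
  have "weak_bound M q\<^sub>0 (Linf_c M) (commutator T b m) (if q\<^sub>0 = \<infinity> then W * \<gamma> ^ m else (W * \<gamma> ^ m) powr real_of_ereal q\<^sub>0)" by simp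
  then show "weak_bound M q\<^sub>0 (Linf_c M) (commutator T ?b m) (if q\<^sub>0 = \<infinity> then W else W powr real_of_ereal q\<^sub>0)"
    by (rule weak_bound_scale) (use g W sc in auto)
  fix f :: "'a \<Rightarrow> 'k" assume f: "f \<in> Linf_c M"
  have [measurable]: "(\<lambda>x. norm (commutator T b m f x)) \<in> borel_measurable M" using wt[OF m] f by (simp add: weak_type_bound_def)
  show "(\<lambda>x. norm (commutator T ?b m f x)) \<in> borel_measurable M" unfolding sc[OF f] by measurable
qed

text \<open>Division by a number \<gamma> above the norm of \<open>b\<close> makes \<open>b\<close>
  admissible with a constant that depends on \<open>W\<close> and \<open>q\<^sub>0\<close> only. The
  uniform bound for admissible symbols is then scaled back, and homogeneity of degree
  \<open>k\<close> returns \<open>\<gamma> ^ k\<close>.\<close>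

theorem commutator_Lnorm_bound:
  assumes k: "1 \<le> k" and W: "0 \<le> W" and p: "p\<^sub>0 < p" "ereal p < q\<^sub>0"
  shows "\<exists>C. \<forall>b\<in>BMO M. commutators_defined M \<D> b k \<longrightarrow>
    (\<forall>m\<in>{1..k}. weak_type_bound M q\<^sub>0 (Linf_c M) (commutator T b m) (ennreal W * BMO_norm M b ^ m)) \<longrightarrow>
    (\<forall>f\<in>Linf_c M. Lnorm M (ereal p) (commutator T b k f) \<le> ennreal C * BMO_norm M b ^ k * Lnorm M (ereal p) f)"
proof -
  define KW where "KW = (if q\<^sub>0 = \<infinity> then W else W powr real_of_ereal q\<^sub>0)"
  have KW: "0 \<le> KW" using W by (simp add: KW_def)
  have pp: "0 < p" using p p0 by simp
  obtain C where C: "0 \<le> C" and strong: "\<And>b f. admissible KW b \<Longrightarrow> f \<in> Linf_c M \<Longrightarrow> pmass M p (commutator T b k f) \<le> ennreal C * pmass M p f"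
    using commutator_strong[OF KW k order_refl p] by blast
  have norm: "Lnorm M (ereal p) g = eroot p (pmass M p g)" for g :: "'a \<Rightarrow> 'k" by (simp add: Lnorm_def pmass_def)
  show ?thesis
  proof (intro exI[of _ "C powr (1 / p)"] ballI impI)
    fix b f :: "'a \<Rightarrow> 'k" assume b: "b \<in> BMO M" "commutators_defined M \<D> b k" and f: "f \<in> Linf_c M"
      and wt: "\<forall>m\<in>{1..k}. weak_type_bound M q\<^sub>0 (Linf_c M) (commutator T b m) (ennreal W * BMO_norm M b ^ m)"
    obtain B where B: "BMO_norm M b = ennreal B" "0 \<le> B" using b(1) by (cases "BMO_norm M b") (auto simp: BMO_def)
    obtain N where N: "Lnorm M (ereal p) f = ennreal N" "0 \<le> N"
      using pmass_Linf_c_finite[OF f pp] by (cases "Lnorm M (ereal p) f") (auto simp: norm eroot_def split: if_splits)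
    \<comment> \<open>\<open>\<gamma> > B\<close> instead of \<open>\<gamma> = B\<close>, since \<open>B\<close> may vanish\<close>
    have le: "Lnorm M (ereal p) (commutator T b k f) \<le> ennreal (C powr (1 / p) * \<gamma> ^ k * N)" if g: "B < \<gamma>" for \<gamma>
    proof -
      have g0: "0 < \<gamma>" using g B by simp
      let ?b = "\<lambda>y. of_real (1 / \<gamma>) * b y"
      have "admissible KW ?b"
        unfolding KW_def by (rule admissible_rescale[OF b g0 _ W]) (use wt g B in \<open>auto intro: ennreal_leI\<close>)
      then have le: "pmass M p (commutator T ?b k f) \<le> ennreal C * pmass M p f" by (rule strong[OF _ f])
      have mm: "(\<lambda>x. norm (commutator T ?b k f x)) \<in> borel_measurable M"
        by (rule commutator_measurable[OF \<open>admissible KW ?b\<close> order_refl f])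
      have "norm (commutator T b k f x) = \<gamma> ^ k * norm (commutator T ?b k f x)" for x
        using g0 by (simp add: commutator_rescale[OF b(2) g0 order_refl f] del: of_real_divide)
      then have "ennreal (norm (commutator T b k f x) powr p) = ennreal ((\<gamma> ^ k) powr p) * ennreal (norm (commutator T ?b k f x) powr p)" for x
        using g0 by (simp add: powr_mult ennreal_mult)
      then have "pmass M p (commutator T b k f) = ennreal ((\<gamma> ^ k) powr p) * pmass M p (commutator T ?b k f)"
        unfolding pmass_def using mm by (simp add: nn_integral_cmult)
      also have "\<dots> \<le> ennreal ((\<gamma> ^ k) powr p) * (ennreal C * pmass M p f)" by (intro mult_left_mono le) simp
      also have "\<dots> = ennreal ((\<gamma> ^ k) powr p * C) * pmass M p f" using C by (simp add: mult.assoc[symmetric] ennreal_mult)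
      finally have "eroot p (pmass M p (commutator T b k f)) \<le> eroot p (ennreal ((\<gamma> ^ k) powr p * C) * pmass M p f)"
        by (rule eroot_mono[OF _ pp])
      also have "\<dots> = ennreal (((\<gamma> ^ k) powr p * C) powr (1 / p)) * ennreal N"
        using C pp N(1) by (subst eroot_mult) (auto simp: norm)
      also have "((\<gamma> ^ k) powr p * C) powr (1 / p) = C powr (1 / p) * \<gamma> ^ k"
        using C pp g0 by (simp add: powr_mult powr_powr)
      finally show ?thesis using N g0 by (simp add: norm ennreal_mult)
    qed
    have "(\<lambda>n. ennreal (C powr (1 / p) * (B + 1 / real (Suc n)) ^ k * N)) \<longlonglongrightarrow> ennreal (C powr (1 / p) * (B + 0) ^ k * N)"
      by (intro tendsto_ennrealI tendsto_intros lim_1_over_n[THEN LIMSEQ_Suc])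
    then have "Lnorm M (ereal p) (commutator T b k f) \<le> ennreal (C powr (1 / p) * (B + 0) ^ k * N)"
      by (rule LIMSEQ_le_const) (intro exI[of _ 0] allI impI le, simp)
    then show "Lnorm M (ereal p) (commutator T b k f) \<le> ennreal (C powr (1 / p)) * BMO_norm M b ^ k * Lnorm M (ereal p) f"
      using B N by (simp add: ennreal_mult ennreal_power)
  qed
qed

end

text \<open>Doubling spreads a null ball over all its dyadic dilates and thus over the whole space;
  every norm in the claim is then 0.\<close>

lemma doubling_null_ball_imp_null:
  assumes dbl: "doubling M" and z: "emeasure M (ball x r) = 0" "0 < r"
  shows "AE y in M. False"
proof -
  obtain C where C: "\<And>x r. 0 < r \<Longrightarrow> emeasure M (ball x (2 * r)) \<le> ennreal C * emeasure M (ball x r)" and S: "sets M = sets borel"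
    using dbl by (auto simp: doubling_def)
  have sp: "space M = UNIV" using sets_eq_imp_space_eq[OF S] by simp
  have "emeasure M (ball x (2 ^ n * r)) = 0" for n
  proof (induction n)
    case (Suc n)
    have "emeasure M (ball x (2 * (2 ^ n * r))) \<le> ennreal C * emeasure M (ball x (2 ^ n * r))" by (rule C) (use z in simp)
    then show ?case using Suc by (simp add: mult.assoc)
  qed (use z in simp)
  then have "emeasure M (\<Union>n. ball x (2 ^ n * r)) = 0" by (subst emeasure_UN_eq_0) (auto simp: S)
  moreover have "(\<Union>n. ball x (2 ^ n * r)) = UNIV"
  proof (intro equalityI subsetI UNIV_I)
    fix y
    obtain n where "dist x y / r < 2 ^ n" using real_arch_pow[of 2 "dist x y / r"] by auto
    then show "y \<in> (\<Union>n. ball x (2 ^ n * r))" using z(2) by (auto simp: pos_divide_less_eq)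
  qed
  ultimately have "emeasure M (space M) = 0" by (simp add: sp)
  then show ?thesis by (intro AE_I[of _ _ "space M"]) auto
qed

lemma doubling_measure_intro:
  assumes dbl: "doubling M" and ord: "doubling_order M D" and pos: "\<And>x r. 0 < r \<Longrightarrow> emeasure M (ball x r) \<noteq> 0"
  shows "\<exists>Cd. doubling_measure M D Cd"
proof -
  obtain C where C: "\<And>x r l. 0 < r \<Longrightarrow> 1 \<le> l \<Longrightarrow> emeasure M (ball x (l * r)) \<le> ennreal (C * l powr D) * emeasure M (ball x r)" and D: "0 < D"
    using ord by (auto simp: doubling_order_def)
  have "doubling_measure M D (max C 1)"
  proof
    show "sets M = sets borel" using dbl by (simp add: doubling_def)
    show "emeasure M (ball x r) < \<infinity>" for x r
    proof (cases "0 < r")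
      case True
      then show ?thesis using dbl unfolding doubling_def by blast
    qed (simp add: ball_empty not_less)
    show "0 < emeasure M (ball x r)" if "0 < r" for x r using pos[OF that, of x] by (simp add: zero_less_iff_neq_zero)
    show "emeasure M (ball x (l * r)) \<le> ennreal (max C 1 * l powr D) * emeasure M (ball x r)" if "0 < r" "1 \<le> l" for x r l
      by (rule order_trans[OF C[OF that]]) (intro mult_right_mono ennreal_leI, auto)
  qed (use D in auto)
  then show ?thesis by blast
qed

text \<open>The perturbation makes the weights positive and adds exactly the geometric series
  \<open>(1 / 2) ^ j\<close>. Passing from \<open>real j ^ k\<close> to
  \<open>(1 + real j) ^ k\<close> costs \<open>2 ^ k\<close> for \<open>j \<ge> 1\<close>; the index
  0, where \<open>real j ^ k\<close> vanishes for \<open>k \<ge> 1\<close>, is a single term and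
  does not affect summability.\<close>

lemma summable_perturbed:
  fixes \<alpha> :: "nat \<Rightarrow> real"
  assumes \<alpha>: "\<And>j. 0 \<le> \<alpha> j" and s: "summable (\<lambda>j. \<alpha> j * 2 powr (D * real j) * real j ^ k)"
  shows "summable (\<lambda>j. (\<alpha> j + (1 / 2) ^ j / ((1 + real j) ^ k * 2 powr (D * real j))) * (1 + real j) ^ k * 2 powr (D * real j))"
proof -
  have s1: "summable (\<lambda>j. \<alpha> j * (1 + real j) ^ k * 2 powr (D * real j))"
  proof (rule summable_comparison_test[OF _ summable_mult[OF s, of "2 ^ k"]], intro exI[of _ 1] allI impI)
    fix j :: nat assume j: "1 \<le> j"
    have "(1 + real j) ^ k \<le> (2 * real j) ^ k" using j by (intro power_mono) auto
    then have "\<alpha> j * (1 + real j) ^ k * 2 powr (D * real j) \<le> \<alpha> j * (2 * real j) ^ k * 2 powr (D * real j)"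
      using \<alpha> by (intro mult_right_mono mult_left_mono) auto
    then show "norm (\<alpha> j * (1 + real j) ^ k * 2 powr (D * real j)) \<le> 2 ^ k * (\<alpha> j * 2 powr (D * real j) * real j ^ k)"
      using \<alpha>[of j] by (simp add: power_mult_distrib mult_ac)
  qed
  have "1 + real j \<noteq> 0" for j :: nat by linarith
  then have "(\<alpha> j + (1 / 2) ^ j / ((1 + real j) ^ k * 2 powr (D * real j))) * (1 + real j) ^ k * 2 powr (D * real j) =
    \<alpha> j * (1 + real j) ^ k * 2 powr (D * real j) + (1 / 2) ^ j" for j
    by (simp add: field_simps)
  then show ?thesis using summable_add[OF s1 summable_geometric[of "1 / 2 :: real"]] by simp
qed

theorem theorem8p2:
  fixes \<mu> :: "(real ^ 'n) measure"
    and T :: "(real ^ 'n \<Rightarrow> 'k::{real_normed_field, banach, second_countable_topology}) \<Rightarrow>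
              real ^ 'n \<Rightarrow> 'k"
    and \<D> :: "(real ^ 'n \<Rightarrow> 'k) set"
    and A :: "real \<Rightarrow> (real ^ 'n \<Rightarrow> 'k) \<Rightarrow> real ^ 'n \<Rightarrow> 'k"
    and \<alpha> :: "nat \<Rightarrow> real"
    and D p\<^sub>0 r p W :: real
    and q\<^sub>0 :: ereal
    and k :: nat
  assumes "doubling \<mu>" and "doubling_order \<mu> D"
    and "1 \<le> p\<^sub>0" and "ereal p\<^sub>0 < q\<^sub>0" and "1 \<le> k" and "1 < r"
    and "\<D> \<subseteq> borel_measurable \<mu>" and "Lspace \<mu> q\<^sub>0 \<subseteq> \<D>"
    and "\<And>f. f \<in> \<D> \<Longrightarrow> (\<lambda>x. norm (T f x)) \<in> borel_measurable \<mu>"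
    and "sublinear_on \<D> T"
    and "q\<^sub>0 = \<infinity> \<Longrightarrow> countably_sublinear_on \<mu> \<D> T"
    and "\<exists>K<\<infinity>. weak_type_bound \<mu> q\<^sub>0 (Lspace \<mu> q\<^sub>0) T K"
    and "\<And>t f. 0 < t \<Longrightarrow> f \<in> Linf_c \<mu> \<Longrightarrow> A t f \<in> Lspace \<mu> q\<^sub>0"
    and "\<And>j. 0 \<le> \<alpha> j"
    and "\<And>x t f j. 0 < t \<Longrightarrow> f \<in> Linf_c \<mu> \<Longrightarrow> (\<And>y. y \<notin> ball x t \<Longrightarrow> f y = 0) \<Longrightarrow> 1 \<le> j \<Longrightarrow>
           avg_norm \<mu> q\<^sub>0 (ball x (2 ^ (j + 1) * t)) (annulus x t j) (A t f)
             \<le> ennreal (\<alpha> j) * avg_norm \<mu> (ereal p\<^sub>0) (ball x t) (ball x t) f"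
    and "\<And>x t f j. 0 < t \<Longrightarrow> f \<in> Linf_c \<mu> \<Longrightarrow> (\<And>y. y \<notin> ball x t \<Longrightarrow> f y = 0) \<Longrightarrow> 2 \<le> j \<Longrightarrow>
           avg_norm \<mu> (ereal r) (ball x (2 ^ (j + 1) * t)) (annulus x t j)
               (T (\<lambda>y. f y - A t f y))
             \<le> ennreal (\<alpha> j) * avg_norm \<mu> (ereal p\<^sub>0) (ball x t) (ball x t) f"
    and "summable (\<lambda>j. \<alpha> j * 2 powr (D * real j) * real j ^ k)"
    and "p\<^sub>0 < p" and "ereal p < q\<^sub>0"
  shows "\<exists>C::real. \<forall>b\<in>BMO \<mu>.
           commutators_defined \<mu> \<D> b k \<longrightarrow>
           (\<forall>m\<in>{1..k}. weak_type_bound \<mu> q\<^sub>0 (Linf_c \<mu>) (commutator T b m)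
                         (ennreal W * BMO_norm \<mu> b ^ m)) \<longrightarrow>
           (\<forall>f\<in>Linf_c \<mu>. Lnorm \<mu> (ereal p) (commutator T b k f)
                             \<le> ennreal C * BMO_norm \<mu> b ^ k * Lnorm \<mu> (ereal p) f)"
proof (cases "\<exists>x r. 0 < r \<and> emeasure \<mu> (ball x r) = 0")
  case True
  then have null: "AE y in \<mu>. False" using doubling_null_ball_imp_null[OF assms(1)] by blast
  have "Lnorm \<mu> (ereal p) g = 0" for g :: "real ^ 'n \<Rightarrow> 'k"
  proof -
    have "(\<integral>\<^sup>+x. ennreal (norm (g x) powr p) \<partial>\<mu>) = (\<integral>\<^sup>+x. 0 \<partial>\<mu>)"
      using null by (intro nn_integral_cong_AE) auto
    then show ?thesis by (simp add: Lnorm_def eroot_def)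
  qed
  then show ?thesis by simp
next
  case False
  then obtain Cd where "doubling_measure \<mu> D Cd" using doubling_measure_intro[OF assms(1,2)] by blast
  then interpret doubling_measure \<mu> D Cd .
  \<comment> \<open>The weights in \<open>sum_powr_towers\<close> must not vanish.\<close>
  define \<alpha>' where "\<alpha>' j = \<alpha> j + (1 / 2) ^ j / ((1 + real j) ^ k * 2 powr (D * real j))" for j
  have \<alpha>': "\<alpha> j \<le> \<alpha>' j" "0 < \<alpha>' j" for j
  proof -
    have "0 < (1 / 2) ^ j / ((1 + real j) ^ k * 2 powr (D * real j))"
      by (intro divide_pos_pos mult_pos_pos zero_less_power) auto
    then show "\<alpha> j \<le> \<alpha>' j" "0 < \<alpha>' j" using assms(14)[of j] unfolding \<alpha>'_def by linarith+
  qed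
  have weaken: "u \<le> ennreal (\<alpha>' j) * v" if "u \<le> ennreal (\<alpha> j) * v" for u v j
    by (rule order_trans[OF that]) (intro mult_right_mono ennreal_leI \<alpha>', simp)
  have q0: "0 < q\<^sub>0" using assms(3,4) by (cases q\<^sub>0) auto
  obtain K where K: "K < \<infinity>" "weak_type_bound \<mu> q\<^sub>0 (Lspace \<mu> q\<^sub>0) T K" using assms(12) by blast
  then obtain K' where K': "K = ennreal K'" "0 \<le> K'" by (cases K) auto
  define KT where "KT = (if q\<^sub>0 = \<infinity> then K' else K' powr real_of_ereal q\<^sub>0)"
  have KT: "0 \<le> KT" "weak_bound \<mu> q\<^sub>0 (Lspace \<mu> q\<^sub>0) T KT"
    using weak_boundI[OF K(2)[unfolded K'(1)] order_refl q0 K'(2)] K'(2) by (auto simp: KT_def)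
  interpret cz_operator \<mu> D Cd T \<D> A \<alpha>' p\<^sub>0 r KT q\<^sub>0 k
  proof
    show "summable (\<lambda>j. \<alpha>' j * (1 + real j) ^ k * 2 powr (D * real j))"
      unfolding \<alpha>'_def by (rule summable_perturbed[OF assms(14,17)])
  qed (use assms KT \<alpha>' in \<open>auto intro!: weaken\<close>)
  \<comment> \<open>The sign of \<open>W\<close> is not prescribed; \<open>ennreal\<close> sends
    negative reals to 0.\<close>
  have "ennreal W = ennreal (max W 0)" by (simp add: max_def ennreal_neg)
  then show ?thesis using commutator_Lnorm_bound[OF assms(5) _ assms(18,19), of "max W 0"] by simp
qed

end
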